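(* Let $\Omega\subseteq\mathbb{R}^3$ be a bounded domain of class $C^1$, let $T>0$, $Q=(0,T)\times\Omega$, and let $H=L^2(\Omega)$, $V=H^1(\Omega)$, $W=\{u\in H^2(\Omega):\ \partial_N u=0 \text{ on }\partial\Omega\}$. Assume that - $\ell,\alpha,k,\nu,\gamma\in(0,+\infty)$, $f\in L^2(Q)$, $\Xi^*\in W$, $\Xi_0,\phi_0\in V$; - $\widehat{\chi}:\mathbb{R}\to[0,+\infty]$ is proper, lower semicontinuous and convex with $\widehat{\chi}(0)=0$, $\chi:=\partial\widehat{\chi}$ is its subdifferential, and $\widehat{\chi}(\phi_0)\in L^1(\Omega)$; - $\widehat{\pi}:\mathbb{R}\to\mathbb{R}$, $\widehat{\pi}\in C^1(\mathbb{R})$ and $\pi:=\widehat{\pi}'$ is Lipschitz continuous; - $A:H\to 2^H$ is a maximal monotone operator with $0\in A(0)$, and there is a constant $C_A>0$ such that $\|v\|_H\le C_A(1+\|x\|_H)$ for all $x\in H$ and all $v\in A x$. If $\alpha=\ell$, then the solution $(\Xi,\phi)$ of Problem $(P)$ (as defined in the context) is unique. Moreover, if $f_i\in L^2(Q)$, $\Xi^*_i\in W$, $\Xi_{0_i},\phi_{0_i}\in V$, $i=1,2$, are two sets of data and $(\Xi_i,\phi_i)$, $i=1,2$, are the corresponding solutions of Problem $(P)$, then the estimate $$\|\Xi_1-\Xi_2\|_{L^\infty(0,T;H)\cap L^2(0,T;V)}+\|\phi_1-\phi_2\|_{L^\infty(0,T;H)\cap L^2(0,T;V)}$$ $$\le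 C\big(\|f_1-f_2\|_{L^2(Q)}+\|\Xi^*_1-\Xi^*_2\|_W+\|\Xi_{0_1}-\Xi_{0_2}\|_H+\|\phi_{0_1}-\phi_{0_2}\|_H\big)$$ holds true for some constant $C$ that depends only on $\Omega$, $T$ and the parameters $\ell,\alpha,k,\nu,\gamma$.
   Context: $\partial_N$ denotes the outward normal derivative on $\Gamma=\partial\Omega$, and $\Sigma=(0,T)\times\Gamma$. $L^2(Q)$ is identified with $L^2(0,T;H)$. $W$ carries the $H^2(\Omega)$ norm; an intersection of normed spaces carries the sum of the norms. Monotone operators are multivalued (graphs). In the second part, the two solutions refer to the same operators $A$, $\chi$, $\pi$ and the same parameters $\ell,\alpha,k,\nu,\gamma$ (with $\alpha=\ell$). A solution of Problem $(P)$ with data $f,\Xi^*,\Xi_0,\phi_0$ is a pair $(\Xi,\phi)$ with $\Xi,\phi\in H^1(0,T;H)\cap L^\infty(0,T;V)\cap L^2(0,T;W)$ for which there exist functions $\zeta,\xi$ on $Q$ such that $$\partial_t(\Xi+(\ell-\alpha)\phi)-k\Delta\Xi+k\alpha\Delta\phi+\zeta=f-k\Delta\Xi^*\quad\text{a.e. in }Q,$$ $$\partial_t\phi-\nu\Delta\phi+\xi+\pi(\phi)=\gamma(\Xi-\alpha\phi+\Xi^* )\quad\text{a.e. in }Q,$$ $$\zeta(t)\in A(\Xi(t))\ \text{ for a.e. }t\in(0,T),\qquad \xi\in\chi(\phi)\ \text{ a.e. in }Q,$$ $$\partial_N\Xi=0,\quad \partial_N\phi=0\ \text{ on }\Sigma,\qquad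 \Xi(0)=\Xi_0,\quad \phi(0)=\phi_0\ \text{ in }\Omega.$$ (The boundary conditions are already encoded in the regularity $L^2(0,T;W)$.)
   Formalization: The constant C is also allowed to depend on the Lipschitz constant of π; independence of it is false, since for A=0, χ=0, π(s)=−Ls, zero f and Ξ*, the solution Ξ=0, φ=c·exp((L−γα)t) has unbounded ratio to its initial datum as L grows. *)

theory Defs
  imports "HOL-Probability.Essential_Supremum"
begin

text \<open>
  Elements of \<open>L\<^sup>2\<close> and of the Sobolev spaces are represented by functions on the whole
  Euclidean space, identified when they agree almost everywhere on the domain; values off the
  domain play no role. Partial derivatives are indexed by \<open>b \<in> Basis\<close>.
\<close>

section \<open>Classical derivatives and test functions\<close>

definition pd :: "'a \<Rightarrow> ('a::euclidean_space \<Rightarrow> real) \<Rightarrow> 'a \<Rightarrow> real" where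
  "pd b f x = frechet_derivative f (at x) b"

primrec Ck :: "nat \<Rightarrow> ('a::euclidean_space \<Rightarrow> real) \<Rightarrow> bool" where
  "Ck 0 f \<longleftrightarrow> continuous_on UNIV f"
| "Ck (Suc n) f \<longleftrightarrow> (\<forall>x. f differentiable (at x)) \<and> (\<forall>b\<in>Basis. Ck n (pd b f))"

definition test_functions :: "'a::euclidean_space set \<Rightarrow> ('a \<Rightarrow> real) set" where
  "test_functions S = {\<psi>. (\<forall>n. Ck n \<psi>) \<and> compact (closure {x. \<psi> x \<noteq> 0}) \<and>
      closure {x. \<psi> x \<noteq> 0} \<subseteq> S}"


section \<open>Lebesgue and Sobolev spaces\<close>

definition L2 :: "'a::euclidean_space set \<Rightarrow> ('a \<Rightarrow> real) set" where
  "L2 S = {u. u \<in> borel_measurable (lebesgue_on S) \<and>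
      integrable (lebesgue_on S) (\<lambda>x. (u x)\<^sup>2)}"

definition L2_inner :: "'a::euclidean_space set \<Rightarrow> ('a \<Rightarrow> real) \<Rightarrow> ('a \<Rightarrow> real) \<Rightarrow> real" where
  "L2_inner S u v = (LINT x|lebesgue_on S. u x * v x)"

definition L2_norm :: "'a::euclidean_space set \<Rightarrow> ('a \<Rightarrow> real) \<Rightarrow> real" where
  "L2_norm S u = sqrt (LINT x|lebesgue_on S. (u x)\<^sup>2)"

definition weak_pd_rel ::
    "'a::euclidean_space set \<Rightarrow> 'a \<Rightarrow> ('a \<Rightarrow> real) \<Rightarrow> ('a \<Rightarrow> real) \<Rightarrow> bool" where
  "weak_pd_rel \<Omega> b u v \<longleftrightarrow> (\<forall>\<psi>\<in>test_functions \<Omega>.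
      (LINT x|lebesgue_on \<Omega>. u x * pd b \<psi> x) = - (LINT x|lebesgue_on \<Omega>. v x * \<psi> x))"

definition H1 :: "'a::euclidean_space set \<Rightarrow> ('a \<Rightarrow> real) set" where
  "H1 \<Omega> = {u \<in> L2 \<Omega>. \<forall>b\<in>Basis. \<exists>v\<in>L2 \<Omega>. weak_pd_rel \<Omega> b u v}"

text \<open>The weak derivative is unique up to a.e. equality; \<open>wpd\<close> selects a representative.\<close>

definition wpd :: "'a::euclidean_space set \<Rightarrow> 'a \<Rightarrow> ('a \<Rightarrow> real) \<Rightarrow> 'a \<Rightarrow> real" where
  "wpd \<Omega> b u = (SOME v. v \<in> L2 \<Omega> \<and> weak_pd_rel \<Omega> b u v)"

definition H1_norm :: "'a::euclidean_space set \<Rightarrow> ('a \<Rightarrow> real) \<Rightarrow> real" where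
  "H1_norm \<Omega> u = sqrt ((L2_norm \<Omega> u)\<^sup>2 + (\<Sum>b\<in>Basis. (L2_norm \<Omega> (wpd \<Omega> b u))\<^sup>2))"

definition H2 :: "'a::euclidean_space set \<Rightarrow> ('a \<Rightarrow> real) set" where
  "H2 \<Omega> = {u \<in> H1 \<Omega>. \<forall>b\<in>Basis. wpd \<Omega> b u \<in> H1 \<Omega>}"

definition H2_norm :: "'a::euclidean_space set \<Rightarrow> ('a \<Rightarrow> real) \<Rightarrow> real" where
  "H2_norm \<Omega> u = sqrt ((H1_norm \<Omega> u)\<^sup>2 +
      (\<Sum>b\<in>Basis. \<Sum>c\<in>Basis. (L2_norm \<Omega> (wpd \<Omega> c (wpd \<Omega> b u)))\<^sup>2))"

definition laplacian :: "'a::euclidean_space set \<Rightarrow> ('a \<Rightarrow> real) \<Rightarrow> 'a \<Rightarrow> real" where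
  "laplacian \<Omega> u x = (\<Sum>b\<in>Basis. wpd \<Omega> b (wpd \<Omega> b u) x)"


section \<open>Domains of class \<open>C\<^sup>1\<close>, traces and the normal derivative\<close>

text \<open>
  \<open>boundary_chart \<Omega> p r R h\<close>: after the orthogonal change of coordinates \<open>R\<close>, inside the ball
  of radius \<open>r\<close> about the boundary point \<open>p\<close> the set \<open>\<Omega>\<close> is the part lying strictly above the
  graph of the \<open>C\<^sup>1\<close> function \<open>h\<close>. The boundary in the ball is then parametrised by
  \<open>chart_point R h\<close> on \<open>chart_dom p r R h\<close>, with area element \<open>area_elem h\<close>.
\<close>

definition boundary_chart ::
    "(real^3) set \<Rightarrow> real^3 \<Rightarrow> real \<Rightarrow> (real^3 \<Rightarrow> real^3) \<Rightarrow> (real^2 \<Rightarrow> real) \<Rightarrow> bool" where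
  "boundary_chart \<Omega> p r R h \<longleftrightarrow>
     p \<in> frontier \<Omega> \<and> 0 < r \<and> orthogonal_transformation R \<and> Ck 1 h \<and>
     \<Omega> \<inter> ball p r = {x \<in> ball p r. h (vector [R x $ 1, R x $ 2]) < R x $ 3}"

definition chart_point :: "(real^3 \<Rightarrow> real^3) \<Rightarrow> (real^2 \<Rightarrow> real) \<Rightarrow> real^2 \<Rightarrow> real^3" where
  "chart_point R h y = inv R (vector [y $ 1, y $ 2, h y])"

definition chart_dom ::
    "real^3 \<Rightarrow> real \<Rightarrow> (real^3 \<Rightarrow> real^3) \<Rightarrow> (real^2 \<Rightarrow> real) \<Rightarrow> (real^2) set" where
  "chart_dom p r R h = {y. chart_point R h y \<in> ball p r}"

definition area_elem :: "(real^2 \<Rightarrow> real) \<Rightarrow> real^2 \<Rightarrow> real" where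
  "area_elem h y = sqrt (1 + (pd (axis 1 1) h y)\<^sup>2 + (pd (axis 2 1) h y)\<^sup>2)"

text \<open>Since \<open>\<Omega>\<close> lies above the graph, the outward unit normal points downwards.\<close>

definition outward_normal :: "(real^3 \<Rightarrow> real^3) \<Rightarrow> (real^2 \<Rightarrow> real) \<Rightarrow> real^2 \<Rightarrow> real^3" where
  "outward_normal R h y =
     (1 / area_elem h y) *\<^sub>R inv R (vector [pd (axis 1 1) h y, pd (axis 2 1) h y, -1])"

definition bounded_C1_domain :: "(real^3) set \<Rightarrow> bool" where
  "bounded_C1_domain \<Omega> \<longleftrightarrow> open \<Omega> \<and> connected \<Omega> \<and> \<Omega> \<noteq> {} \<and> bounded \<Omega> \<and>
     (\<forall>p\<in>frontier \<Omega>. \<exists>r R h. boundary_chart \<Omega> p r R h)"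

text \<open>
  The trace operator is the closure of the restriction map \<open>w \<mapsto> w|\<Gamma>\<close>, defined for functions
  \<open>w\<close> of class \<open>C\<^sup>1\<close> up to the boundary, from \<open>H\<^sup>1(\<Omega>)\<close> to \<open>L\<^sup>2(\<Gamma>)\<close>. Convergence in \<open>L\<^sup>2(\<Gamma>)\<close>
  is expressed chart by chart; as \<open>\<Gamma>\<close> is compact, finitely many charts cover it.
\<close>

definition has_trace ::
    "(real^3) set \<Rightarrow> (real^3 \<Rightarrow> real) \<Rightarrow> (real^3 \<Rightarrow> real) \<Rightarrow> bool" where
  "has_trace \<Omega> u g \<longleftrightarrow> u \<in> H1 \<Omega> \<and>
     (\<exists>w :: nat \<Rightarrow> real^3 \<Rightarrow> real. (\<forall>n. Ck 1 (w n)) \<and>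
       (\<lambda>n. H1_norm \<Omega> (\<lambda>x. w n x - u x)) \<longlonglongrightarrow> 0 \<and>
       (\<forall>p r R h. boundary_chart \<Omega> p r R h \<longrightarrow>
          (\<lambda>y. g (chart_point R h y)) \<in> borel_measurable (lebesgue_on (chart_dom p r R h)) \<and>
          (\<lambda>n. \<integral>\<^sup>+ y. ennreal ((w n (chart_point R h y) - g (chart_point R h y))\<^sup>2 * area_elem h y)
                 \<partial>lebesgue_on (chart_dom p r R h)) \<longlonglongrightarrow> 0))"

definition has_normal_derivative ::
    "(real^3) set \<Rightarrow> (real^3 \<Rightarrow> real) \<Rightarrow> (real^3 \<Rightarrow> real) \<Rightarrow> bool" where
  "has_normal_derivative \<Omega> u d \<longleftrightarrow>
     (\<exists>g :: real^3 \<Rightarrow> real^3 \<Rightarrow> real. (\<forall>b\<in>Basis. has_trace \<Omega> (wpd \<Omega> b u) (g b)) \<and>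
       (\<forall>p r R h. boundary_chart \<Omega> p r R h \<longrightarrow>
          (AE y in lebesgue_on (chart_dom p r R h).
             d (chart_point R h y) =
               (\<Sum>b\<in>Basis. g b (chart_point R h y) * (outward_normal R h y \<bullet> b)))))"

definition W :: "(real^3) set \<Rightarrow> (real^3 \<Rightarrow> real) set" where
  "W \<Omega> = {u \<in> H2 \<Omega>. has_normal_derivative \<Omega> u (\<lambda>_. 0)}"


section \<open>Functions of time with values in a function space\<close>

text \<open>
  \<open>u t x\<close> is the value at \<open>x\<close> of \<open>u(t)\<close>. A normed function space is given by its carrier \<open>X\<close>
  and its norm \<open>N\<close>; \<open>strongly_measurable\<close> is measurability in the sense of Bochner.
\<close>

definition cyl :: "real \<Rightarrow> 'a set \<Rightarrow> (real \<times> 'a) set" where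
  "cyl T \<Omega> = {0<..<T} \<times> \<Omega>"

definition strongly_measurable ::
    "real \<Rightarrow> ('a \<Rightarrow> real) set \<Rightarrow> (('a \<Rightarrow> real) \<Rightarrow> real) \<Rightarrow> (real \<Rightarrow> 'a \<Rightarrow> real) \<Rightarrow> bool" where
  "strongly_measurable T X N u \<longleftrightarrow> (AE t in lebesgue_on {0<..<T}. u t \<in> X) \<and>
     (\<exists>s :: nat \<Rightarrow> real \<Rightarrow> 'a \<Rightarrow> real.
        (\<forall>n. simple_function (lebesgue_on {0<..<T}) (s n) \<and> (\<forall>t\<in>{0<..<T}. s n t \<in> X)) \<and>
        (AE t in lebesgue_on {0<..<T}. (\<lambda>n. N (\<lambda>x. s n t x - u t x)) \<longlonglongrightarrow> 0))"

definition L2_time ::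
    "real \<Rightarrow> ('a \<Rightarrow> real) set \<Rightarrow> (('a \<Rightarrow> real) \<Rightarrow> real) \<Rightarrow> (real \<Rightarrow> 'a \<Rightarrow> real) set" where
  "L2_time T X N = {u. strongly_measurable T X N u \<and>
      integrable (lebesgue_on {0<..<T}) (\<lambda>t. (N (u t))\<^sup>2)}"

definition L2_time_norm ::
    "real \<Rightarrow> (('a \<Rightarrow> real) \<Rightarrow> real) \<Rightarrow> (real \<Rightarrow> 'a \<Rightarrow> real) \<Rightarrow> real" where
  "L2_time_norm T N u = sqrt (LINT t|lebesgue_on {0<..<T}. (N (u t))\<^sup>2)"

definition Linf_time ::
    "real \<Rightarrow> ('a \<Rightarrow> real) set \<Rightarrow> (('a \<Rightarrow> real) \<Rightarrow> real) \<Rightarrow> (real \<Rightarrow> 'a \<Rightarrow> real) set" where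
  "Linf_time T X N = {u. strongly_measurable T X N u \<and>
      (\<exists>M. AE t in lebesgue_on {0<..<T}. N (u t) \<le> M)}"

definition Linf_time_norm ::
    "real \<Rightarrow> (('a \<Rightarrow> real) \<Rightarrow> real) \<Rightarrow> (real \<Rightarrow> 'a \<Rightarrow> real) \<Rightarrow> real" where
  "Linf_time_norm T N u = real_of_ereal (esssup (lebesgue_on {0<..<T}) (\<lambda>t. ereal (N (u t))))"

definition LinfH_L2V_norm ::
    "real \<Rightarrow> 'a::euclidean_space set \<Rightarrow> (real \<Rightarrow> 'a \<Rightarrow> real) \<Rightarrow> real" where
  "LinfH_L2V_norm T \<Omega> u = Linf_time_norm T (L2_norm \<Omega>) u + L2_time_norm T (H1_norm \<Omega>) u"

text \<open>
  \<open>L\<^sup>2(0,T;H)\<close> is identified with \<open>L\<^sup>2(Q)\<close>, so the \<open>H\<close>-valued Bochner integrals in the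
  definition of the weak time derivative are represented by integrals in \<open>t\<close> for a.e. fixed
  \<open>x\<close>; the exceptional null set may depend on the test function.
\<close>

definition has_time_derivative ::
    "real \<Rightarrow> 'a::euclidean_space set \<Rightarrow> (real \<Rightarrow> 'a \<Rightarrow> real) \<Rightarrow> (real \<Rightarrow> 'a \<Rightarrow> real) \<Rightarrow> bool" where
  "has_time_derivative T \<Omega> u v \<longleftrightarrow>
     case_prod u \<in> L2 (cyl T \<Omega>) \<and> case_prod v \<in> L2 (cyl T \<Omega>) \<and>
     (\<forall>\<psi>\<in>test_functions {0<..<T}. AE x in lebesgue_on \<Omega>.
        (LINT t|lebesgue_on {0<..<T}. u t x * deriv \<psi> t) =
        - (LINT t|lebesgue_on {0<..<T}. v t x * \<psi> t))"

definition H1_time :: "real \<Rightarrow> 'a::euclidean_space set \<Rightarrow> (real \<Rightarrow> 'a \<Rightarrow> real) set" where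
  "H1_time T \<Omega> = {u. \<exists>v. has_time_derivative T \<Omega> u v}"

text \<open>The initial value of \<open>u \<in> H\<^sup>1(0,T;H)\<close> is that of its representative in \<open>C([0,T];H)\<close>.\<close>

definition has_initial_value ::
    "real \<Rightarrow> 'a::euclidean_space set \<Rightarrow> (real \<Rightarrow> 'a \<Rightarrow> real) \<Rightarrow> ('a \<Rightarrow> real) \<Rightarrow> bool" where
  "has_initial_value T \<Omega> u u0 \<longleftrightarrow>
     (\<exists>w :: real \<Rightarrow> 'a \<Rightarrow> real. (\<forall>t\<in>{0..T}. w t \<in> L2 \<Omega>) \<and>
        (\<forall>t\<in>{0..T}. ((\<lambda>s. L2_norm \<Omega> (\<lambda>x. w s x - w t x)) \<longlongrightarrow> 0) (at t within {0..T})) \<and>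
        (AE t in lebesgue_on {0<..<T}. AE x in lebesgue_on \<Omega>. w t x = u t x) \<and>
        (AE x in lebesgue_on \<Omega>. w 0 x = u0 x))"

text \<open>\<open>v\<close> is an \<open>L\<^sup>2(Q)\<close> representative of the spatial Laplacian of \<open>u\<close>.\<close>

definition has_laplacian ::
    "real \<Rightarrow> 'a::euclidean_space set \<Rightarrow> (real \<Rightarrow> 'a \<Rightarrow> real) \<Rightarrow> (real \<Rightarrow> 'a \<Rightarrow> real) \<Rightarrow> bool" where
  "has_laplacian T \<Omega> u v \<longleftrightarrow> case_prod v \<in> L2 (cyl T \<Omega>) \<and>
     (AE t in lebesgue_on {0<..<T}. AE x in lebesgue_on \<Omega>. v t x = laplacian \<Omega> (u t) x)"


section \<open>Monotone operators and subdifferentials\<close>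

text \<open>
  Multivalued operators on \<open>L\<^sup>2(\<Omega>)\<close> act on representatives. Maximality forces the graph to be
  closed under a.e. equality, so no separate compatibility condition is needed.
\<close>

definition monotone_graph ::
    "'a::euclidean_space set \<Rightarrow> (('a \<Rightarrow> real) \<Rightarrow> ('a \<Rightarrow> real) set) \<Rightarrow> bool" where
  "monotone_graph \<Omega> A \<longleftrightarrow> (\<forall>x\<in>L2 \<Omega>. \<forall>y\<in>L2 \<Omega>. \<forall>v\<in>A x. \<forall>w\<in>A y.
      0 \<le> L2_inner \<Omega> (\<lambda>z. v z - w z) (\<lambda>z. x z - y z))"

definition maximal_monotone ::
    "'a::euclidean_space set \<Rightarrow> (('a \<Rightarrow> real) \<Rightarrow> ('a \<Rightarrow> real) set) \<Rightarrow> bool" where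
  "maximal_monotone \<Omega> A \<longleftrightarrow> (\<forall>x\<in>L2 \<Omega>. A x \<subseteq> L2 \<Omega>) \<and> monotone_graph \<Omega> A \<and>
     (\<forall>x\<in>L2 \<Omega>. \<forall>v\<in>L2 \<Omega>.
        (\<forall>y\<in>L2 \<Omega>. \<forall>w\<in>A y. 0 \<le> L2_inner \<Omega> (\<lambda>z. v z - w z) (\<lambda>z. x z - y z)) \<longrightarrow> v \<in> A x)"

definition proper_lsc_convex :: "(real \<Rightarrow> ereal) \<Rightarrow> bool" where
  "proper_lsc_convex F \<longleftrightarrow> (\<forall>r. F r \<noteq> -\<infinity>) \<and> (\<exists>r. F r \<noteq> \<infinity>) \<and>
     (\<forall>r. F r \<le> Liminf (at r) F) \<and>
     (\<forall>r s. \<forall>t\<in>{0<..<1}. F ((1 - t) * r + t * s) \<le> ereal (1 - t) * F r + ereal t * F s)"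

definition subdifferential :: "(real \<Rightarrow> ereal) \<Rightarrow> real \<Rightarrow> real set" where
  "subdifferential F r = {\<xi>. F r \<noteq> \<infinity> \<and> (\<forall>s. F r + ereal (\<xi> * (s - r)) \<le> F s)}"


section \<open>Problem (P)\<close>

text \<open>
  The Lipschitz constant \<open>L\<close> of \<open>\<pi> = \<pi>hat'\<close> is an explicit parameter because the constant in
  the continuous dependence estimate has to depend on it (solutions may grow like
  \<open>exp ((L - \<gamma> * \<alpha>) * t)\<close>); nothing else about the nonlinearities enters that constant.
\<close>

definition admissible_nonlinearities ::
    "(real^3) set \<Rightarrow> real \<Rightarrow> (real \<Rightarrow> ereal) \<Rightarrow> (real \<Rightarrow> real) \<Rightarrow>
     ((real^3 \<Rightarrow> real) \<Rightarrow> (real^3 \<Rightarrow> real) set) \<Rightarrow> bool" where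
  "admissible_nonlinearities \<Omega> L \<chi>hat \<pi>hat A \<longleftrightarrow>
     (\<forall>r. 0 \<le> \<chi>hat r) \<and> proper_lsc_convex \<chi>hat \<and> \<chi>hat 0 = 0 \<and>
     Ck 1 \<pi>hat \<and> L-lipschitz_on UNIV (deriv \<pi>hat) \<and>
     maximal_monotone \<Omega> A \<and> (\<lambda>_. 0) \<in> A (\<lambda>_. 0) \<and>
     (\<exists>C>0. \<forall>x\<in>L2 \<Omega>. \<forall>v\<in>A x. L2_norm \<Omega> v \<le> C * (1 + L2_norm \<Omega> x))"

definition admissible_data ::
    "(real^3) set \<Rightarrow> real \<Rightarrow> (real \<Rightarrow> real^3 \<Rightarrow> real) \<Rightarrow> (real^3 \<Rightarrow> real) \<Rightarrow>
     (real^3 \<Rightarrow> real) \<Rightarrow> (real^3 \<Rightarrow> real) \<Rightarrow> bool" where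
  "admissible_data \<Omega> T f \<Xi>s \<Xi>0 \<phi>0 \<longleftrightarrow>
     case_prod f \<in> L2 (cyl T \<Omega>) \<and> \<Xi>s \<in> W \<Omega> \<and> \<Xi>0 \<in> H1 \<Omega> \<and> \<phi>0 \<in> H1 \<Omega>"

definition solution_P ::
    "(real^3) set \<Rightarrow> real \<Rightarrow> real \<Rightarrow> real \<Rightarrow> real \<Rightarrow> real \<Rightarrow> real \<Rightarrow>
     (real \<Rightarrow> ereal) \<Rightarrow> (real \<Rightarrow> real) \<Rightarrow> ((real^3 \<Rightarrow> real) \<Rightarrow> (real^3 \<Rightarrow> real) set) \<Rightarrow>
     (real \<Rightarrow> real^3 \<Rightarrow> real) \<Rightarrow> (real^3 \<Rightarrow> real) \<Rightarrow> (real^3 \<Rightarrow> real) \<Rightarrow> (real^3 \<Rightarrow> real) \<Rightarrow>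
     (real \<Rightarrow> real^3 \<Rightarrow> real) \<Rightarrow> (real \<Rightarrow> real^3 \<Rightarrow> real) \<Rightarrow> bool" where
  "solution_P \<Omega> T l \<alpha> k \<nu> \<gamma> \<chi>hat \<pi>hat A f \<Xi>s \<Xi>0 \<phi>0 \<Xi> \<phi> \<longleftrightarrow>
     (\<forall>u\<in>{\<Xi>, \<phi>}. u \<in> H1_time T \<Omega> \<and> u \<in> Linf_time T (H1 \<Omega>) (H1_norm \<Omega>) \<and>
        u \<in> L2_time T (W \<Omega>) (H2_norm \<Omega>)) \<and>
     (\<exists>dU d\<phi> \<Delta>\<Xi> \<Delta>\<phi> \<zeta> \<xi>.
        has_time_derivative T \<Omega> (\<lambda>t x. \<Xi> t x + (l - \<alpha>) * \<phi> t x) dU \<and>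
        has_time_derivative T \<Omega> \<phi> d\<phi> \<and>
        has_laplacian T \<Omega> \<Xi> \<Delta>\<Xi> \<and> has_laplacian T \<Omega> \<phi> \<Delta>\<phi> \<and>
        (AE (t, x) in lebesgue_on (cyl T \<Omega>).
           dU t x - k * \<Delta>\<Xi> t x + k * \<alpha> * \<Delta>\<phi> t x + \<zeta> t x = f t x - k * laplacian \<Omega> \<Xi>s x) \<and>
        (AE (t, x) in lebesgue_on (cyl T \<Omega>).
           d\<phi> t x - \<nu> * \<Delta>\<phi> t x + \<xi> t x + deriv \<pi>hat (\<phi> t x)
             = \<gamma> * (\<Xi> t x - \<alpha> * \<phi> t x + \<Xi>s x)) \<and>
        (AE t in lebesgue_on {0<..<T}. \<zeta> t \<in> A (\<Xi> t)) \<and>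
        (AE (t, x) in lebesgue_on (cyl T \<Omega>). \<xi> t x \<in> subdifferential \<chi>hat (\<phi> t x))) \<and>
     has_initial_value T \<Omega> \<Xi> \<Xi>0 \<and> has_initial_value T \<Omega> \<phi> \<phi>0"

end

theory Submission
  imports Defs
begin

text \<open>
  Test the difference of the first equations with \<open>\<Xi>\<^sub>1 - \<Xi>\<^sub>2\<close> and that of the second ones with
  \<open>\<mu> (\<phi>\<^sub>1 - \<phi>\<^sub>2)\<close>, where \<open>\<mu> = k \<alpha>\<^sup>2 / \<nu>\<close>. The monotone terms have a sign, and this \<open>\<mu>\<close> makes half of
  the two Dirichlet integrals absorb the coupling term \<open>k \<alpha> \<integral> \<nabla>\<phi> \<cdot> \<nabla>\<Xi>\<close>; Gronwall's lemma concludes.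

  Green's formula needs neither a trace inequality nor density of smooth functions. Cut off the
  layer of depth \<open>\<delta>\<close> along the boundary; the error is \<open>1 / \<delta>\<close> times an integral over the layer
  of \<open>v\<close> times the normal component of \<open>\<nabla>u\<close>. That component has zero trace, so its \<open>L\<^sup>2\<close> norm on
  the layer is at most \<open>C \<delta>\<close>, and the error tends to zero with the \<open>L\<^sup>2\<close> norm of \<open>v\<close> on the layer.
\<close>

section \<open>Classical derivatives and mollification\<close>

text \<open>The equality of \<open>\<alpha>\<close> and \<open>l\<close> is what makes the testing
  work: the time derivative in the first equation then acts on \<Xi> alone, so each equation
  produces the derivative of one squared norm. Young's inequality splits the coupling term into
  \<open>k / 2\<close> and \<open>k * \<alpha>\<^sup>2 / 2\<close> times the two squared gradients;
  the choice \<open>\<mu> * \<nu> = k * \<alpha>\<^sup>2\<close> leaves as much again, which gives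
  the bound in V.

  Two weak notions obstruct the formal computation. A trace is only a limit of restrictions of C1
  functions, and the approximants of the gradient need not have zero normal component on the
  boundary. Hence the layer estimate is proved for the approximants with a boundary integral, which
  disappears in the limit; only afterwards does the layer become thin. The time derivative is weak,
  and the initial value belongs to a continuous representative. The squared norm of that
  representative is handled through |b|^2 - |a|^2 = (b - a, b + a) on short time intervals, so the
  fundamental theorem of calculus is needed for scalar functions only.\<close>

lemma pd_eqI: "(f has_derivative f') (at x) \<Longrightarrow> pd b f x = f' b"
  unfolding pd_def by (metis frechet_derivative_at)

lemma Ck_SucI:
  assumes "\<And>x. (f has_derivative f' x) (at x)" "\<And>b. b \<in> Basis \<Longrightarrow> Ck n (\<lambda>x. f' x b)"
  shows "Ck (Suc n) f"
proof -
  have "pd b f = (\<lambda>x. f' x b)" for b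
    using pd_eqI[OF assms(1)] by auto
  thus ?thesis using assms by (auto simp: differentiable_def)
qed

lemma C1I:
  assumes "\<And>x. (f has_derivative f' x) (at x)" "\<And>b. b \<in> Basis \<Longrightarrow> continuous_on UNIV (\<lambda>x. f' x b)"
  shows "Ck 1 f"
  using Ck_SucI[of f f' 0] assms by auto

lemma Ck_Suc_continuous: "Ck n f \<Longrightarrow> continuous_on UNIV f"
proof (cases n)
  case (Suc m)
  assume "Ck n f"
  hence "f differentiable (at x)" for x using Suc by simp
  thus ?thesis
    by (simp add: continuous_on_eq_continuous_within differentiable_imp_continuous_within)
qed simp

lemma Ck_SucD: "Ck (Suc n) f \<Longrightarrow> Ck n f"
proof (induction n arbitrary: f)
  case 0 from Ck_Suc_continuous[OF this] show ?case by simp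
next
  case (Suc n) thus ?case by simp
qed

lemma Ck_has_derivative:
  assumes "Ck (Suc n) f"
  shows "(f has_derivative (\<lambda>z. \<Sum>b\<in>Basis. (z \<bullet> b) * pd b f x)) (at x)"
proof -
  have d: "(f has_derivative frechet_derivative f (at x)) (at x)"
    using assms frechet_derivative_works by auto
  interpret linear "frechet_derivative f (at x)" using d has_derivative_linear by blast
  have "frechet_derivative f (at x) z = (\<Sum>b\<in>Basis. (z \<bullet> b) * pd b f x)" for z
  proof -
    have "frechet_derivative f (at x) z = frechet_derivative f (at x) (\<Sum>b\<in>Basis. (z \<bullet> b) *\<^sub>R b)"
      by (simp add: euclidean_representation)
    also have "\<dots> = (\<Sum>b\<in>Basis. (z \<bullet> b) * pd b f x)"
      by (simp add: sum scale pd_def)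
    finally show ?thesis .
  qed
  hence "frechet_derivative f (at x) = (\<lambda>z. \<Sum>b\<in>Basis. (z \<bullet> b) * pd b f x)" by auto
  thus ?thesis using d by simp
qed

lemma C1_has_derivative:
  "Ck 1 f \<Longrightarrow> (f has_derivative (\<lambda>z. \<Sum>b\<in>Basis. (z \<bullet> b) * pd b f x)) (at x)"
  using Ck_has_derivative[of 0] by auto

lemma C1_continuous: "Ck 1 f \<Longrightarrow> continuous_on S f"
  using Ck_Suc_continuous[of 1 f] continuous_on_subset by blast

lemma C1_continuous_pd: "Ck 1 f \<Longrightarrow> b \<in> Basis \<Longrightarrow> continuous_on S (pd b f)"
  using continuous_on_subset[of UNIV "pd b f" S] by auto

lemma Ck_const: "Ck n (\<lambda>x. c)"
proof (induction n arbitrary: c)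
  case (Suc n) show ?case by (rule Ck_SucI[where f'="\<lambda>x z. 0"]) (auto intro: Suc)
qed auto

lemma pd_mult:
  assumes "f differentiable (at x)" "g differentiable (at x)"
  shows "pd b (\<lambda>x. f x * g x) x = pd b f x * g x + f x * pd b g x"
  by (subst pd_eqI[OF has_derivative_mult[OF assms[unfolded frechet_derivative_works]]])
     (simp add: pd_def)

lemma pd_add:
  assumes "f differentiable (at x)" "g differentiable (at x)"
  shows "pd b (\<lambda>x. f x + g x) x = pd b f x + pd b g x"
  by (subst pd_eqI[OF has_derivative_add[OF assms[unfolded frechet_derivative_works]]])
     (simp add: pd_def)

lemma pd_diff:
  assumes "f differentiable (at x)" "g differentiable (at x)"
  shows "pd b (\<lambda>x. f x - g x) x = pd b f x - pd b g x"
  by (subst pd_eqI[OF has_derivative_diff[OF assms[unfolded frechet_derivative_works]]])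
     (simp add: pd_def)

lemma pd_const [simp]: "pd b (\<lambda>x. c) = (\<lambda>x. 0)"
  using pd_eqI[OF has_derivative_const] by blast

lemma Ck_add: "Ck n f \<Longrightarrow> Ck n g \<Longrightarrow> Ck n (\<lambda>x. f x + g x)"
proof (induction n arbitrary: f g)
  case (Suc n)
  have e: "pd b (\<lambda>x. f x + g x) = (\<lambda>x. pd b f x + pd b g x)" for b
    using Suc(2,3) by (auto intro!: pd_add)
  show ?case using Suc by (auto simp: e)
qed (auto intro: continuous_intros)

lemma Ck_mult: "Ck n f \<Longrightarrow> Ck n g \<Longrightarrow> Ck n (\<lambda>x. f x * g x)"
proof (induction n arbitrary: f g)
  case (Suc n)
  have e: "pd b (\<lambda>x. f x * g x) = (\<lambda>x. pd b f x * g x + f x * pd b g x)" for b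
    using Suc(2,3) by (auto intro!: pd_mult)
  show ?case using Suc Ck_SucD[OF Suc(2)] Ck_SucD[OF Suc(3)]
    by (auto simp: e intro!: Ck_add)
qed (auto intro: continuous_intros)

lemma Ck_diff: "Ck n f \<Longrightarrow> Ck n g \<Longrightarrow> Ck n (\<lambda>x. f x - g x)"
  using Ck_add[of n f "\<lambda>x. (-1) * g x"] Ck_mult[OF Ck_const[of n "-1"], of g] by simp

lemma Ck_inner: "Ck n (\<lambda>x. x \<bullet> c)"
proof (cases n)
  case (Suc n)
  show ?thesis unfolding Suc
    by (rule Ck_SucI[where f'="\<lambda>x z. z \<bullet> c"]) (auto intro!: derivative_eq_intros Ck_const)
qed (auto intro: continuous_intros)

section \<open>A smooth bump function\<close>

text \<open>The division by \<open>s ^ k\<close> makes the family closed under differentiation up to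
  linear combinations; smoothness of exp (- 1 / s) continued by zero then follows by an induction
  that treats all \<open>k\<close> at once.\<close>

definition flat_exp :: "nat \<Rightarrow> real \<Rightarrow> real" where
  "flat_exp k s = (if s > 0 then exp (- 1 / s) / s ^ k else 0)"

text \<open>Substituting \<open>1 / s\<close> reduces the limit to the decay of
  \<open>x ^ k / exp x\<close> at infinity.\<close>

lemma flat_exp_tendsto: "(flat_exp k \<longlongrightarrow> 0) (at_right 0)"
proof -
  have "((\<lambda>x. x ^ k / exp x) \<longlongrightarrow> (0::real)) at_top" by (rule tendsto_power_div_exp_0)
  hence "((\<lambda>s. (inverse s) ^ k / exp (inverse s)) \<longlongrightarrow> (0::real)) (at_right 0)"
    by (rule filterlim_compose[OF _ filterlim_inverse_at_top_right])
  moreover have "\<forall>\<^sub>F s in at_right 0. (inverse s) ^ k / exp (inverse s) = flat_exp k s"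
    unfolding eventually_at_right_field
    by (auto intro!: exI[of _ 1] simp: flat_exp_def exp_minus field_simps power_inverse inverse_eq_divide)
  ultimately show ?thesis by (rule Lim_transform_eventually)
qed

lemma flat_exp_has_derivative:
  "(flat_exp k has_field_derivative (flat_exp (k+2) s - k * flat_exp (k+1) s)) (at s)"
proof -
  consider "s > 0" | "s < 0" | "s = 0" by linarith
  then show ?thesis
  proof cases
    case 1
    have "((\<lambda>s. exp (- 1 / s) / s ^ k) has_field_derivative (flat_exp (k+2) s - k * flat_exp (k+1) s)) (at s)"
    proof -
      have i: "((\<lambda>s. - 1 / s) has_field_derivative 1 / s\<^sup>2) (at s)"
        using DERIV_inverse[of s UNIV] DERIV_minus[of inverse _ s UNIV] 1
        by (fastforce simp: divide_inverse power2_eq_square)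
      have d: "((\<lambda>s. exp (- 1 / s)) has_field_derivative exp (- 1 / s) * (1 / s\<^sup>2)) (at s)"
        by (rule DERIV_chain2[OF DERIV_exp i])
      have p: "((\<lambda>s. s ^ k) has_field_derivative k * s ^ (k - 1)) (at s)"
        using DERIV_pow[of k s] by simp
      have eq: "(exp (- 1 / s) * (1 / s\<^sup>2) * s ^ k - exp (- 1 / s) * (k * s ^ (k - 1))) / (s ^ k * s ^ k)
          = flat_exp (k+2) s - k * flat_exp (k+1) s"
        using 1 by (cases k) (simp_all add: flat_exp_def field_simps power2_eq_square)
      show ?thesis using DERIV_divide[OF d p] 1 unfolding eq by simp
    qed
    moreover have "\<forall>\<^sub>F x in nhds s. flat_exp k x = exp (- 1 / x) / x ^ k"
      using eventually_nhds_in_open[of "{0<..}" s] 1 by (auto simp: flat_exp_def elim!: eventually_mono)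
    ultimately show ?thesis by (subst DERIV_cong_ev[OF refl _ refl])
  next
    case 2
    have "\<forall>\<^sub>F x in nhds s. flat_exp k x = 0"
      using eventually_nhds_in_open[of "{..<0}" s] 2 by (auto simp: flat_exp_def elim!: eventually_mono)
    moreover have "((\<lambda>s. 0) has_field_derivative (flat_exp (k+2) s - k * flat_exp (k+1) s)) (at s)"
      using 2 by (auto simp: flat_exp_def)
    ultimately show ?thesis by (subst DERIV_cong_ev[OF refl _ refl])
  next
    case 3
    \<comment> \<open>At 0 the difference quotient is itself a member of the family: for
      \<open>h > 0\<close> it equals \<open>flat_exp (Suc k) h\<close>, whose limit is
      known.\<close>
    have "((\<lambda>h. flat_exp k h / h) \<longlongrightarrow> 0) (at 0)"
    proof (rule filterlim_split_at)
      have "\<forall>\<^sub>F x in at_left 0. 0 = flat_exp k x / x"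
        unfolding eventually_at_left_field by (auto simp: flat_exp_def intro!: exI[of _ "-1"])
      from Lim_transform_eventually[OF tendsto_const this]
      show "((\<lambda>h. flat_exp k h / h) \<longlongrightarrow> 0) (at_left 0)" by simp
      have "\<forall>\<^sub>F x in at_right 0. flat_exp (Suc k) x = flat_exp k x / x"
        unfolding eventually_at_right_field by (auto simp: flat_exp_def intro!: exI[of _ "1"])
      from Lim_transform_eventually[OF flat_exp_tendsto this]
      show "((\<lambda>h. flat_exp k h / h) \<longlongrightarrow> 0) (at_right 0)" by simp
    qed
    thus ?thesis using 3 by (simp add: DERIV_def flat_exp_def)
  qed
qed

text \<open>A derivative only raises the index \<open>k\<close> and brings in a factor that is
  linear in \<open>x\<close>, hence the induction with \<open>k\<close> arbitrary.\<close>

lemma Ck_flat_exp: "Ck n (\<lambda>x::'a::euclidean_space. flat_exp k (c - x \<bullet> x))"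
proof (induction n arbitrary: k)
  case 0
  have "isCont (flat_exp k) s" for s using DERIV_isCont[OF flat_exp_has_derivative] .
  hence "continuous_on UNIV (flat_exp k)" by (simp add: continuous_at_imp_continuous_on)
  from continuous_on_compose2[OF this, of UNIV "\<lambda>x::'a. c - x \<bullet> x"]
  show ?case by (simp add: continuous_intros)
next
  case (Suc n)
  let ?f' = "\<lambda>x z. (flat_exp (k+2) (c - x \<bullet> x) - k * flat_exp (k+1) (c - x \<bullet> x)) * (-2 * (x \<bullet> z))"
  show ?case
  proof (rule Ck_SucI[where f' = ?f'])
    fix x :: 'a
    have "((\<lambda>x. c - x \<bullet> x) has_derivative (\<lambda>z. -2 * (x \<bullet> z))) (at x)"
      by (auto intro!: derivative_eq_intros simp: inner_commute)
    from has_derivative_compose[OF this flat_exp_has_derivative[of k, THEN has_field_derivative_imp_has_derivative]]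
    show "((\<lambda>x. flat_exp k (c - x \<bullet> x)) has_derivative ?f' x) (at x)" .
  qed (intro Ck_mult Ck_diff Ck_const Ck_inner Suc)
qed

lemma flat_exp_nonneg: "0 \<le> flat_exp k s" by (simp add: flat_exp_def)

section \<open>Convolution and integrals of derivatives\<close>

text \<open>Reflection is an affine map with factor of absolute value one. If \<open>f\<close> is
  not measurable, neither is its reflection, and both integrals have the default value 0; this keeps
  \<open>conv_commute\<close> free of side conditions.\<close>

lemma lborel_integral_reflect:
  fixes f :: "'a::euclidean_space \<Rightarrow> real"
  shows "(\<integral>y. f (x - y) \<partial>lborel) = (\<integral>y. f y \<partial>lborel)"
proof (cases "f \<in> borel_measurable borel")
  case True
  have "(\<integral>y. f y \<partial>lborel) = (\<integral>y. f y \<partial>(density (distr lborel borel (\<lambda>y. x + (-1) *\<^sub>R y)) (\<lambda>_. ennreal (\<bar>-1\<bar> ^ DIM('a)))))"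
    by (subst lborel_affine[of "-1" x]) (auto simp: power_abs)
  also have "\<dots> = (\<integral>y. f (x - y) \<partial>lborel)"
    using True by (subst integral_density) (auto simp: integral_distr)
  finally show ?thesis by simp
next
  case False
  have "(\<lambda>y. f (x - y)) \<notin> borel_measurable borel"
  proof
    assume "(\<lambda>y. f (x - y)) \<in> borel_measurable borel"
    hence "(\<lambda>y. f (x - (x - y))) \<in> borel_measurable borel"
      by (rule measurable_compose[rotated]) simp
    thus False using False by simp
  qed
  hence "\<not> integrable lborel (\<lambda>y. f (x - y))" "\<not> integrable lborel f"
    using False by (auto dest: borel_measurable_integrable)
  thus ?thesis by (simp add: not_integrable_integral_eq)
qed

definition cont_csupp :: "('a::euclidean_space \<Rightarrow> real) \<Rightarrow> bool" where
  "cont_csupp f \<longleftrightarrow> continuous_on UNIV f \<and> bounded {x. f x \<noteq> 0}"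

lemma cont_csupp_cbox:
  assumes "cont_csupp f"
  obtains a where "{x. f x \<noteq> 0} \<subseteq> cbox (-a) a"
  using assms bounded_subset_cbox_symmetric unfolding cont_csupp_def by metis

lemma csupp_integral:
  fixes f g :: "'a::euclidean_space \<Rightarrow> real"
  assumes "continuous_on UNIV f" "{x. f x \<noteq> 0} \<subseteq> cbox a b"
  shows "integrable lborel f" "(\<integral>x. f x \<partial>lborel) = integral (cbox a b) f"
proof -
  have 1: "set_integrable lborel (cbox a b) f"
    unfolding set_integrable_def
    by (rule borel_integrable_compact) (use continuous_on_subset[OF assms(1)] in auto)
  have 2: "(\<lambda>x. indicator (cbox a b) x *\<^sub>R f x) = f" using assms(2) by (force simp: indicator_def)
  show "integrable lborel f" using 1 unfolding set_integrable_def 2 .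
  show "(\<integral>x. f x \<partial>lborel) = integral (cbox a b) f"
    using set_borel_integral_eq_integral(2)[OF 1] unfolding set_lebesgue_integral_def 2 .
qed

lemma cont_csupp_integrable: "cont_csupp f \<Longrightarrow> integrable lborel f"
  by (metis cont_csupp_cbox cont_csupp_def csupp_integral(1))

lemma cont_csupp_mult: "cont_csupp f \<Longrightarrow> continuous_on UNIV g \<Longrightarrow> cont_csupp (\<lambda>x. g x * f x)"
  unfolding cont_csupp_def by (auto intro!: continuous_intros elim: bounded_subset)

definition conv :: "('a::euclidean_space \<Rightarrow> real) \<Rightarrow> ('a \<Rightarrow> real) \<Rightarrow> 'a \<Rightarrow> real" where
  "conv \<rho> f x = (\<integral>y. \<rho> (x - y) * f y \<partial>lborel)"

text \<open>This allows a derivative to be put on either factor: on the mollifier to gain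
  smoothness, on \<open>f\<close> to see that derivatives of the mollification approximate those of
  \<open>f\<close>.\<close>

lemma conv_commute: "conv \<rho> f = conv f \<rho>"
proof
  fix x show "conv \<rho> f x = conv f \<rho> x"
    unfolding conv_def
    using lborel_integral_reflect[of "\<lambda>y. \<rho> (x - y) * f y" x] by (simp add: mult.commute)
qed

lemma conv_cbox:
  assumes "continuous_on UNIV \<rho>" "continuous_on UNIV f" "{x. f x \<noteq> 0} \<subseteq> cbox a b"
  shows "conv \<rho> f x = integral (cbox a b) (\<lambda>y. \<rho> (x - y) * f y)"
  unfolding conv_def
  by (rule csupp_integral(2)) (use assms in \<open>auto intro!: continuous_intros continuous_on_compose2[OF assms(1)]\<close>)

text \<open>Differentiation under the integral sign, over a fixed box that contains the support of
  \<open>f\<close>. The derivative is written as a bounded linear map because the Leibniz rule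
  expects that form.\<close>

lemma conv_Ck_aux:
  fixes f :: "'a::euclidean_space \<Rightarrow> real"
  assumes \<rho>: "Ck 1 \<rho>" and f: "cont_csupp f"
  shows "(conv \<rho> f has_derivative (\<lambda>z. \<Sum>b\<in>Basis. (z \<bullet> b) * conv (pd b \<rho>) f x)) (at x)"
proof -
  obtain a where a: "{x. f x \<noteq> 0} \<subseteq> cbox (-a) a" using cont_csupp_cbox[OF f] .
  have cf: "continuous_on UNIV f" using f by (simp add: cont_csupp_def)
  note c\<rho> = C1_continuous[OF \<rho>]
  have cpd: "\<And>b. b \<in> Basis \<Longrightarrow> continuous_on UNIV (pd b \<rho>)" using C1_continuous_pd[OF \<rho>] .
  let ?fx = "\<lambda>x y. \<Sum>b\<in>Basis. (pd b \<rho> (x - y) * f y) *\<^sub>R blinfun_inner_left b"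
  have ceq: "conv \<rho> f = (\<lambda>x. integral (cbox (-a) a) (\<lambda>y. \<rho> (x - y) * f y))"
    using conv_cbox[OF c\<rho> cf a] by auto
  have "((\<lambda>x. integral (cbox (-a) a) (\<lambda>y. \<rho> (x - y) * f y)) has_derivative
      blinfun_apply (integral (cbox (-a) a) (?fx x))) (at x within UNIV)"
  proof (rule leibniz_rule)
    fix x t :: 'a
    have "((\<lambda>x. \<rho> (x - t)) has_derivative (\<lambda>z. \<Sum>b\<in>Basis. (z \<bullet> b) * pd b \<rho> (x - t))) (at x)"
      by (rule has_derivative_compose[OF _ C1_has_derivative[OF \<rho>], of _ "\<lambda>z. z"])
         (auto intro!: derivative_eq_intros)
    hence "((\<lambda>x. \<rho> (x - t) * f t) has_derivative (\<lambda>z. (\<Sum>b\<in>Basis. (z \<bullet> b) * pd b \<rho> (x - t)) * f t)) (at x)"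
      by (rule has_derivative_mult_left)
    moreover have "(\<lambda>z. (\<Sum>b\<in>Basis. (z \<bullet> b) * pd b \<rho> (x - t)) * f t) = blinfun_apply (?fx x t)"
      by (auto simp: blinfun.sum_left blinfun.scaleR_left sum_distrib_right sum_distrib_left algebra_simps)
    ultimately show "((\<lambda>x. \<rho> (x - t) * f t) has_derivative blinfun_apply (?fx x t)) (at x within UNIV)"
      by simp
  next
    fix x
    show "(\<lambda>y. \<rho> (x - y) * f y) integrable_on cbox (-a) a"
      by (intro integrable_continuous continuous_intros continuous_on_compose2[OF c\<rho>] continuous_on_subset[OF cf]) auto
  next
    show "continuous_on (UNIV \<times> cbox (- a) a) (\<lambda>(x, t). ?fx x t)"
      unfolding split_beta
      by (intro continuous_intros continuous_on_compose2[OF cpd] continuous_on_compose2[OF cf]) auto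
  qed auto
  moreover have "integral (cbox (-a) a) (?fx x) = (\<Sum>b\<in>Basis. conv (pd b \<rho>) f x *\<^sub>R blinfun_inner_left b)"
  proof -
    have i: "(\<lambda>y. pd b \<rho> (x - y) * f y) integrable_on cbox (-a) a" if "b \<in> Basis" for b
      using that
      by (intro integrable_continuous continuous_intros continuous_on_compose2[OF cpd] continuous_on_subset[OF cf]) auto
    have "((\<lambda>y. (pd b \<rho> (x - y) * f y) *\<^sub>R blinfun_inner_left b) has_integral
        (conv (pd b \<rho>) f x *\<^sub>R blinfun_inner_left b)) (cbox (-a) a)" if "b \<in> Basis" for b
      unfolding conv_cbox[OF cpd[OF that] cf a]
      by (rule has_integral_scaleR_left) (use i[OF that] in auto)
    from has_integral_sum[OF finite_Basis, of "\<lambda>b y. (pd b \<rho> (x - y) * f y) *\<^sub>R blinfun_inner_left b", OF this]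
    show ?thesis by (rule integral_unique)
  qed
  moreover have "blinfun_apply (\<Sum>b\<in>Basis. conv (pd b \<rho>) f x *\<^sub>R blinfun_inner_left b)
      = (\<lambda>z. \<Sum>b\<in>Basis. (z \<bullet> b) * conv (pd b \<rho>) f x)"
    by (auto simp: blinfun.sum_left blinfun.scaleR_left ac_simps)
  ultimately show ?thesis unfolding ceq by simp
qed

lemma conv_continuous:
  assumes \<rho>: "continuous_on UNIV \<rho>" and f: "cont_csupp f"
  shows "continuous_on UNIV (conv \<rho> f)"
proof -
  obtain a where a: "{x. f x \<noteq> 0} \<subseteq> cbox (-a) a" using cont_csupp_cbox[OF f] .
  have cf: "continuous_on UNIV f" using f by (simp add: cont_csupp_def)
  have "continuous_on UNIV (\<lambda>x. integral (cbox (-a) a) (\<lambda>y. \<rho> (x - y) * f y))"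
    by (rule integral_continuous_on_param)
       (auto simp: split_beta intro!: continuous_intros continuous_on_compose2[OF \<rho>] continuous_on_compose2[OF cf])
  thus ?thesis using conv_cbox[OF \<rho> cf a] by simp
qed

lemma pd_conv:
  assumes "Ck 1 \<rho>" "cont_csupp f" "b \<in> Basis"
  shows "pd b (conv \<rho> f) = conv (pd b \<rho>) f"
proof
  fix x
  have "pd b (conv \<rho> f) x = (\<Sum>b'\<in>Basis. (if b' = b then conv (pd b' \<rho>) f x else 0))"
    unfolding pd_eqI[OF conv_Ck_aux[OF assms(1,2)], of b x]
    by (rule sum.cong) (use assms(3) in \<open>auto simp: inner_Basis\<close>)
  thus "pd b (conv \<rho> f) x = conv (pd b \<rho>) f x" using assms(3) by simp
qed

text \<open>Each induction step moves one derivative onto \<open>\<rho>\<close>, so continuity of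
  \<open>f\<close> suffices at every order.\<close>

lemma Ck_conv: "Ck n \<rho> \<Longrightarrow> cont_csupp f \<Longrightarrow> Ck n (conv \<rho> f)"
proof (induction n arbitrary: \<rho>)
  case 0 thus ?case using conv_continuous by auto
next
  case (Suc n)
  have 1: "Ck 1 \<rho>" using Suc(2) Ck_Suc_continuous by auto
  show ?case
    using Suc conv_Ck_aux[OF 1 Suc(3)] pd_conv[OF 1 Suc(3)] by (auto simp: differentiable_def)
qed

lemma pd_zero_outside_support:
  assumes "x \<notin> closure {x. f x \<noteq> 0}"
  shows "pd b f x = 0"
proof -
    let ?U = "- closure {x. f x \<noteq> 0}"
    have e: "0 = f y" if "y \<in> ?U" for y
      using that closure_subset[of "{x. f x \<noteq> 0}"] by (metis (mono_tags, lifting) ComplD mem_Collect_eq subsetD)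
    have U: "open ?U" "x \<in> ?U" using assms by auto
    have "((\<lambda>_. 0) has_derivative (\<lambda>_. 0)) (at x)" by (rule has_derivative_const)
    from has_derivative_transform_within_open[OF this U e]
    have "(f has_derivative (\<lambda>z. 0)) (at x)" .
    thus ?thesis by (simp add: pd_eqI)
qed

lemma cont_csupp_pd:
  assumes "Ck 1 f" "cont_csupp f" "b \<in> Basis"
  shows "cont_csupp (pd b f)"
proof -
  have "{x. pd b f x \<noteq> 0} \<subseteq> closure {x. f x \<noteq> 0}" using pd_zero_outside_support by auto
  hence "bounded {x. pd b f x \<noteq> 0}"
    using assms(2) unfolding cont_csupp_def by (meson bounded_closure bounded_subset)
  thus ?thesis using C1_continuous_pd[OF assms(1,3)] by (simp add: cont_csupp_def)
qed

text \<open>Convolving \<open>F\<close> with a cut-off \<open>r\<close> that is 1 on a large ball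
  gives, near the origin, the constant integral of \<open>F\<close>. Its derivative at 0 is
  therefore 0; by \<open>pd_conv\<close> it is also the integral of \<open>pd b F\<close>. No
  iterated integration along coordinate lines is involved.\<close>

lemma integral_pd_csupp_0:
  fixes F :: "'a::euclidean_space \<Rightarrow> real"
  assumes "Ck 1 F" "cont_csupp F" "b \<in> Basis"
  shows "(\<integral>x. pd b F x \<partial>lborel) = 0"
proof -
  obtain N where N: "\<And>x. F x \<noteq> 0 \<Longrightarrow> norm x \<le> N"
    using assms(2) unfolding cont_csupp_def bounded_iff by auto
  have c': "cont_csupp (pd b F)" using assms by (rule cont_csupp_pd)
  obtain N' where N': "\<And>x. pd b F x \<noteq> 0 \<Longrightarrow> norm x \<le> N'"
    using c' unfolding cont_csupp_def bounded_iff by auto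
  \<comment> \<open>The extra 1 lets \<open>x\<close> move in the unit ball while \<open>r\<close>
    stays equal to 1 wherever \<open>F (x - y)\<close> is nonzero.\<close>
  define M where "M = max N N' + 1"
  define r :: "'a \<Rightarrow> real" where "r y = max 0 (min 1 (M + 1 - norm y))" for y
  have "continuous_on UNIV r" unfolding r_def by (intro continuous_intros)
  moreover have "bounded {x. r x \<noteq> 0}"
    unfolding bounded_iff by (rule exI[of _ "M+1"]) (auto simp: r_def max_def min_def split: if_splits)
  ultimately have r: "cont_csupp r" by (simp add: cont_csupp_def)
  have *: "conv F r x = (\<integral>y. F y \<partial>lborel)" if "norm x < 1" for x
  proof -
    have eq: "F (x - y) * r y = F (x - y)" for y
    proof (cases "F (x - y) = 0")
      case False
      have "norm y \<le> norm (x - y) + norm x" using norm_triangle_sub[of y x] by (simp add: norm_minus_commute)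
      hence "norm y \<le> M" using N[OF False] that by (simp add: M_def)
      thus ?thesis by (simp add: r_def)
    qed simp
    show ?thesis unfolding conv_def eq using lborel_integral_reflect[of F x] by simp
  qed
  have "(conv F r has_derivative (\<lambda>_. 0)) (at 0)"
    by (rule has_derivative_transform_within_open[OF has_derivative_const[of "\<integral>y. F y \<partial>lborel" "at 0"] open_ball[of 0 1]])
       (use * in auto)
  hence "0 = conv (pd b F) r 0" using pd_conv[OF assms(1) r assms(3)] pd_eqI by metis
  also have "conv (pd b F) r 0 = (\<integral>y. pd b F (0 - y) \<partial>lborel)"
    unfolding conv_def
  proof (rule Bochner_Integration.integral_cong[OF refl])
    fix y show "pd b F (0 - y) * r y = pd b F (0 - y)"
      using N'[of "-y"] by (cases "pd b F (- y) = 0") (auto simp: r_def M_def)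
  qed
  also have "\<dots> = (\<integral>y. pd b F y \<partial>lborel)" by (rule lborel_integral_reflect)
  finally show ?thesis by simp
qed

section \<open>Mollifiers and approximation by test functions\<close>

text \<open>The bump is rebuilt for each radius and divided by its own integral, so no scaling
  argument enters.\<close>

definition mollifier :: "real \<Rightarrow> 'a::euclidean_space \<Rightarrow> real" where
  "mollifier \<epsilon> x = flat_exp 0 (\<epsilon>\<^sup>2 - x \<bullet> x) / (\<integral>y. flat_exp 0 (\<epsilon>\<^sup>2 - y \<bullet> (y::'a)) \<partial>lborel)"

lemma flat_exp_ball_zero:
  assumes "\<epsilon> > 0" "norm x \<ge> \<epsilon>"
  shows "flat_exp k (\<epsilon>\<^sup>2 - x \<bullet> x) = 0"
proof -
  have "\<epsilon>\<^sup>2 \<le> (norm x)\<^sup>2" using assms by (intro power_mono) auto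
  thus ?thesis by (simp add: flat_exp_def dot_square_norm)
qed

lemma mollifier_zero: "\<epsilon> > 0 \<Longrightarrow> norm x \<ge> \<epsilon> \<Longrightarrow> mollifier \<epsilon> x = 0"
  by (simp add: mollifier_def flat_exp_ball_zero)

lemma mollifier_nonneg: "mollifier \<epsilon> x \<ge> 0"
  by (auto simp: mollifier_def flat_exp_nonneg intro!: divide_nonneg_nonneg integral_nonneg)

lemma mollifier_Ck: "Ck n (mollifier \<epsilon>)"
  using Ck_mult[OF Ck_flat_exp Ck_const, of n 0 "\<epsilon>\<^sup>2"]
  unfolding mollifier_def[abs_def] divide_inverse by blast

lemma mollifier_csupp: "\<epsilon> > 0 \<Longrightarrow> cont_csupp (mollifier \<epsilon> :: 'a::euclidean_space \<Rightarrow> real)"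
proof -
  assume "\<epsilon> > 0"
  hence "{x. mollifier \<epsilon> (x::'a) \<noteq> 0} \<subseteq> ball 0 \<epsilon>" using mollifier_zero[of \<epsilon>] by force
  thus ?thesis unfolding cont_csupp_def
    using Ck_Suc_continuous[OF mollifier_Ck] bounded_subset[OF bounded_ball] by blast
qed

text \<open>The point is that the normalising integral is not zero: its integrand is positive on a
  nonempty open ball, which is not negligible.\<close>

lemma mollifier_integral:
  assumes "\<epsilon> > 0"
  shows "(\<integral>x. mollifier \<epsilon> (x::'a::euclidean_space) \<partial>lborel) = 1"
proof -
  let ?g = "\<lambda>y::'a. flat_exp 0 (\<epsilon>\<^sup>2 - y \<bullet> y)"
  have c: "continuous_on UNIV ?g" using Ck_Suc_continuous[OF Ck_flat_exp] .
  have "{x. ?g x \<noteq> 0} \<subseteq> ball 0 \<epsilon>" using flat_exp_ball_zero[OF assms] by force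
  hence "bounded {x. ?g x \<noteq> 0}" using bounded_subset[OF bounded_ball] by blast
  hence i: "integrable lborel ?g" using c by (intro cont_csupp_integrable) (simp add: cont_csupp_def)
  have "(\<integral>y. ?g y \<partial>lborel) \<noteq> 0"
  proof
    assume "(\<integral>y. ?g y \<partial>lborel) = 0"
    hence ae: "AE y in lborel. ?g y = 0"
      using integral_nonneg_eq_0_iff_AE[OF i] flat_exp_nonneg by auto
    have "?g y > 0" if "y \<in> ball 0 \<epsilon>" for y
      using that assms power_strict_mono[of "norm y" \<epsilon> 2] by (auto simp: flat_exp_def dot_square_norm)
    hence "?g y = 0 \<Longrightarrow> y \<notin> ball 0 \<epsilon>" for y by fastforce
    with ae have "AE y in lborel. y \<notin> ball (0::'a) \<epsilon>" by (rule eventually_mono)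
    hence "emeasure lborel (ball (0::'a) \<epsilon>) = 0"
      by (subst (asm) AE_iff_measurable[of "ball 0 \<epsilon>"]) auto
    moreover have "ball (0::'a) \<epsilon> \<noteq> {}" using assms by simp
    ultimately show False using open_not_negligible[of "ball (0::'a) \<epsilon>"]
      by (simp add: negligible_iff_null_sets null_sets_def)
  qed
  thus ?thesis unfolding mollifier_def by simp
qed

text \<open>Since the mollifier is nonnegative with mass one, the error is a weighted mean of
  \<open>f (x - y) - f x\<close> over \<open>norm y < \<epsilon>\<close>.\<close>

lemma conv_mollifier_close:
  fixes f :: "'a::euclidean_space \<Rightarrow> real"
  assumes "\<epsilon> > 0" "cont_csupp f" "\<And>y. dist y x < \<epsilon> \<Longrightarrow> \<bar>f y - f x\<bar> \<le> e"
  shows "\<bar>conv (mollifier \<epsilon>) f x - f x\<bar> \<le> (e::real)"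
proof -
  have m: "cont_csupp (mollifier \<epsilon>)" by (rule mollifier_csupp[OF assms(1)])
  have cf: "continuous_on UNIV f" "continuous_on UNIV (mollifier \<epsilon>)"
    using assms m by (auto simp: cont_csupp_def)
  have cf2: "continuous_on UNIV (\<lambda>y. f (x - y))"
    by (intro continuous_intros continuous_on_compose2[OF cf(1)]) auto
  have im: "integrable lborel (mollifier \<epsilon>)" by (rule cont_csupp_integrable[OF m])
  have i1: "integrable lborel (\<lambda>y. f (x - y) * mollifier \<epsilon> y)"
    by (rule cont_csupp_integrable[OF cont_csupp_mult[OF m cf2]])
  have "conv (mollifier \<epsilon>) f x - f x = (\<integral>y. f (x - y) * mollifier \<epsilon> y \<partial>lborel) - (\<integral>y. f x * mollifier \<epsilon> (y::'a) \<partial>lborel)"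
    unfolding conv_commute[of "mollifier \<epsilon>" f] by (simp add: conv_def mollifier_integral[OF assms(1)])
  also have "\<dots> = (\<integral>y. (f (x - y) - f x) * mollifier \<epsilon> y \<partial>lborel)"
    using i1 im by (subst Bochner_Integration.integral_diff[symmetric]) (auto simp: algebra_simps)
  also have "\<bar>\<dots>\<bar> \<le> (\<integral>y. e * mollifier \<epsilon> (y::'a) \<partial>lborel)"
  proof (rule order_trans[OF integral_abs_bound])
    show "(\<integral>y. \<bar>(f (x - y) - f x) * mollifier \<epsilon> y\<bar> \<partial>lborel) \<le> (\<integral>y. e * mollifier \<epsilon> (y::'a) \<partial>lborel)"
    proof (rule Bochner_Integration.integral_mono_AE')
      show "AE y in lborel. \<bar>(f (x - y) - f x) * mollifier \<epsilon> y\<bar> \<le> e * mollifier \<epsilon> y"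
      proof (rule AE_I2)
        fix y :: 'a
        show "\<bar>(f (x - y) - f x) * mollifier \<epsilon> y\<bar> \<le> e * mollifier \<epsilon> y"
        proof (cases "norm y < \<epsilon>")
          case True
          thus ?thesis using assms(3)[of "x - y"] mollifier_nonneg[of \<epsilon> y]
            by (auto simp: abs_mult dist_norm intro!: mult_right_mono)
        next
          case False
          thus ?thesis using mollifier_zero[OF assms(1), of y] by simp
        qed
      qed
    qed (use im assms(1) assms(3)[of x] in \<open>auto intro!: AE_I2 mult_nonneg_nonneg mollifier_nonneg\<close>)
  qed
  also have "\<dots> = e" using mollifier_integral[OF assms(1), where 'a='a] by simp
  finally show ?thesis .
qed

text \<open>Uniform continuity holds on the compact unit neighbourhood of the support; two points at
  distance below 1 either both lie in it or both have value 0.\<close>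

lemma cont_csupp_uniform:
  assumes "cont_csupp f" "e > 0"
  obtains d where "d > 0" "\<And>x y. dist x y < d \<Longrightarrow> \<bar>f x - f y\<bar> \<le> e"
proof -
  let ?K = "closure {x. f x \<noteq> 0}"
  have cf: "continuous_on UNIV f" and K: "compact ?K"
    using assms by (auto simp: cont_csupp_def)
  have "cball 0 1 + ?K = {x + y |x y. x \<in> cball 0 1 \<and> y \<in> ?K}" by (force simp: set_plus_def)
  hence K': "compact (cball 0 1 + ?K)" using compact_sums[OF compact_cball[of 0 1] K] by simp
  have "uniformly_continuous_on (cball 0 1 + ?K) f"
    using compact_uniformly_continuous[OF continuous_on_subset[OF cf] K'] by auto
  then obtain d where d: "d > 0" "\<And>x y. x \<in> cball 0 1 + ?K \<Longrightarrow> y \<in> cball 0 1 + ?K \<Longrightarrow> dist y x < d \<Longrightarrow> dist (f y) (f x) < e"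
    using assms(2) unfolding uniformly_continuous_on_def by metis
  show thesis
  proof (rule that[of "min d 1"])
    show "min d 1 > 0" using d by simp
    fix x y :: 'a assume xy: "dist x y < min d 1"
    show "\<bar>f x - f y\<bar> \<le> e"
    proof (cases "f x = 0 \<and> f y = 0")
      case True thus ?thesis using assms by simp
    next
      case False
      define z where "z = (if f x \<noteq> 0 then x else y)"
      have "z \<in> ?K" by (rule subsetD[OF closure_subset]) (use False in \<open>auto simp: z_def\<close>)
      moreover have "dist z x \<le> 1" "dist z y \<le> 1" using xy by (auto simp: z_def dist_commute)
      ultimately have z: "z \<in> ?K" "dist z x \<le> 1" "dist z y \<le> 1" by auto
      have "x - z \<in> cball 0 1" "y - z \<in> cball 0 1" using z by (auto simp: dist_norm norm_minus_commute)
      from set_plus_intro[OF this(1) z(1)] set_plus_intro[OF this(2) z(1)]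
      have "x \<in> cball 0 1 + ?K" "y \<in> cball 0 1 + ?K" by simp_all
      thus ?thesis using d(2)[of y x] xy by (auto simp: dist_real_def)
    qed
  qed
qed

text \<open>This is what permits cut-offs that are merely C1: they are uniform limits of test
  functions together with their first derivatives, with supports kept inside the domain.\<close>

lemma test_function_approx:
  fixes f :: "'a::euclidean_space \<Rightarrow> real"
  assumes "open \<Omega>" "compact K" "K \<subseteq> \<Omega>" "\<And>x. x \<notin> K \<Longrightarrow> f x = 0" "continuous_on UNIV f" "e > 0"
  obtains \<psi> where "\<psi> \<in> test_functions \<Omega>" "\<And>x. \<bar>\<psi> x - f x\<bar> \<le> e"
    "\<And>x b. Ck 1 f \<Longrightarrow> b \<in> Basis \<Longrightarrow> \<bar>pd b \<psi> x - pd b f x\<bar> \<le> e"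
proof -
  have cs: "cont_csupp f"
    using assms compact_imp_bounded[OF assms(2)] bounded_subset[of K "{x. f x \<noteq> 0}"] by (auto simp: cont_csupp_def)
  obtain d0 where d0: "d0 > 0" "\<And>x y. dist x y < d0 \<Longrightarrow> \<bar>f x - f y\<bar> \<le> e"
    using cont_csupp_uniform[OF cs assms(6)] by metis
  have "\<exists>d>0. \<forall>x y. Ck 1 f \<longrightarrow> dist x y < d \<longrightarrow> \<bar>pd b f x - pd b f y\<bar> \<le> e" if "b \<in> Basis" for b
  proof (cases "Ck 1 f")
    case True
    from cont_csupp_uniform[OF cont_csupp_pd[OF True cs that] assms(6)] show ?thesis by metis
  qed (auto intro: exI[of _ 1])
  then obtain db where db: "\<And>b. b \<in> Basis \<Longrightarrow> db b > 0"
    "\<And>b x y. b \<in> Basis \<Longrightarrow> Ck 1 f \<Longrightarrow> dist x y < db b \<Longrightarrow> \<bar>pd b f x - pd b f y\<bar> \<le> e" by metis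
  obtain r where r: "r > 0" "(\<Union>x\<in>K. cball x r) \<subseteq> \<Omega>"
    using compact_subset_open_imp_cball_epsilon_subset[OF assms(2,1,3)] by metis
  \<comment> \<open>Three demands on the radius: the enlarged support stays in \<Omega>, the
    function varies by at most \<open>e\<close>, and so does each of its partial
    derivatives.\<close>
  define \<epsilon> where "\<epsilon> = min r (min d0 (Min (db ` Basis)))"
  have e: "\<epsilon> > 0" using r d0 db by (simp add: \<epsilon>_def)
  have e_db: "\<epsilon> \<le> db b" if "b \<in> Basis" for b using that by (simp add: \<epsilon>_def min.coboundedI2)
  let ?\<psi> = "conv (mollifier \<epsilon>) f"
  have close: "\<bar>?\<psi> x - f x\<bar> \<le> e" for x
    by (rule conv_mollifier_close[OF e cs]) (use d0 in \<open>auto simp: \<epsilon>_def\<close>)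
  have pclose: "\<bar>pd b ?\<psi> x - pd b f x\<bar> \<le> e" if "Ck 1 f" "b \<in> Basis" for x b
  proof -
    have "pd b ?\<psi> = conv (mollifier \<epsilon>) (pd b f)"
      unfolding conv_commute[of "mollifier \<epsilon>"] by (rule pd_conv[OF that(1) mollifier_csupp[OF e] that(2)])
    thus ?thesis
      using conv_mollifier_close[OF e cont_csupp_pd[OF that(1) cs that(2)], of x e] db(2)[OF that(2,1)] e_db[OF that(2)]
      by force
  qed
  have smooth: "Ck n ?\<psi>" for n by (rule Ck_conv[OF mollifier_Ck cs])
  let ?K' = "{x + y |x y. x \<in> K \<and> y \<in> cball 0 \<epsilon>}"
  have K': "compact ?K'" using compact_sums[OF assms(2) compact_cball[of 0 \<epsilon>]] .
  have z: "?\<psi> x = 0" if "x \<notin> ?K'" for x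
  proof -
    have zz: "mollifier \<epsilon> (x - y) * f y = 0" for y
    proof (cases "y \<in> K")
      case True
      have "x - y \<notin> cball 0 \<epsilon>"
      proof
        assume "x - y \<in> cball 0 \<epsilon>"
        hence "x \<in> ?K'" using True by (intro CollectI exI[of _ y] exI[of _ "x - y"]) auto
        thus False using that by contradiction
      qed
      thus ?thesis using mollifier_zero[OF e, of "x - y"] by auto
    qed (simp add: assms)
    show ?thesis unfolding conv_def zz by simp
  qed
  have sub: "closure {x. ?\<psi> x \<noteq> 0} \<subseteq> ?K'"
  proof (rule closure_minimal)
    show "closed ?K'" by (rule compact_imp_closed[OF K'])
    show "{x. ?\<psi> x \<noteq> 0} \<subseteq> ?K'" using z by blast
  qed
  have "?K' \<subseteq> \<Omega>"
  proof clarify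
    fix x y :: 'a assume "x \<in> K" "y \<in> cball 0 \<epsilon>"
    hence "x + y \<in> cball x r" by (simp add: \<epsilon>_def dist_norm)
    thus "x + y \<in> \<Omega>" using r \<open>x \<in> K\<close> by blast
  qed
  moreover have "compact (closure {x. ?\<psi> x \<noteq> 0})"
    using sub bounded_subset[OF compact_imp_bounded[OF K']] by (simp add: compact_eq_bounded_closed)
  ultimately have "?\<psi> \<in> test_functions \<Omega>" using smooth sub by (auto simp: test_functions_def)
  thus thesis using that close pclose by blast
qed

section \<open>Lebesgue spaces and weak derivatives\<close>

lemma continuous_measurable_lebesgue_on:
  fixes g :: "'a::euclidean_space \<Rightarrow> real"
  assumes "continuous_on UNIV g" shows "g \<in> borel_measurable (lebesgue_on S)"
  by (rule measurable_restrict_space1, rule measurable_completion)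
     (use borel_measurable_continuous_onI[OF assms] in simp)

lemma abs_le_all_eps_0:
  fixes X I :: real
  assumes "\<And>e. e > 0 \<Longrightarrow> \<bar>X\<bar> \<le> e * I" "0 \<le> I"
  shows "X = 0"
proof (rule ccontr)
  assume X: "X \<noteq> 0"
  have "\<bar>X\<bar> \<le> \<bar>X\<bar> / (2 * (I + 1)) * I" by (rule assms(1)) (use X assms(2) in simp)
  also have "\<dots> \<le> \<bar>X\<bar> / 2" using assms(2) by (simp add: field_simps)
  finally show False using X by simp
qed

section \<open>Elementary facts about square integrable functions\<close>

lemma L2D: "u \<in> L2 S \<Longrightarrow> u \<in> borel_measurable (lebesgue_on S)"
  "u \<in> L2 S \<Longrightarrow> integrable (lebesgue_on S) (\<lambda>x. (u x)\<^sup>2)"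
  by (auto simp: L2_def)

lemma L2_mult_integrable:
  assumes "u \<in> L2 S" "v \<in> L2 S" shows "integrable (lebesgue_on S) (\<lambda>x. u x * v x)"
proof (rule Bochner_Integration.integrable_bound)
  show "integrable (lebesgue_on S) (\<lambda>x. (u x)\<^sup>2 + (v x)\<^sup>2)"
    using assms by (auto simp: L2_def)
  show "(\<lambda>x. u x * v x) \<in> borel_measurable (lebesgue_on S)" using assms by (auto simp: L2_def)
  have "\<bar>a * b\<bar> \<le> a\<^sup>2 + b\<^sup>2" for a b :: real
    using sum_squares_bound[of "\<bar>a\<bar>" "\<bar>b\<bar>"] abs_ge_zero[of "a * b"] unfolding abs_mult power2_abs by linarith
  thus "AE x in lebesgue_on S. norm (u x * v x) \<le> norm ((u x)\<^sup>2 + (v x)\<^sup>2)" by auto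
qed

lemma L2_bounded_mult:
  assumes "u \<in> L2 S" "g \<in> borel_measurable (lebesgue_on S)" "\<And>x. x \<in> S \<Longrightarrow> \<bar>g x\<bar> \<le> B"
  shows "(\<lambda>x. g x * u x) \<in> L2 S"
  unfolding L2_def
proof (intro CollectI conjI)
  show "(\<lambda>x. g x * u x) \<in> borel_measurable (lebesgue_on S)" using assms by (auto simp: L2_def)
  show "integrable (lebesgue_on S) (\<lambda>x. (g x * u x)\<^sup>2)"
  proof (rule Bochner_Integration.integrable_bound)
    show "integrable (lebesgue_on S) (\<lambda>x. B\<^sup>2 * (u x)\<^sup>2)" using assms by (auto simp: L2_def)
    show "(\<lambda>x. (g x * u x)\<^sup>2) \<in> borel_measurable (lebesgue_on S)" using assms by (auto simp: L2_def)
    have "(g x)\<^sup>2 \<le> B\<^sup>2" if "x \<in> S" for x using power_mono[OF assms(3)[OF that], of 2] by simp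
    thus "AE x in lebesgue_on S. norm ((g x * u x)\<^sup>2) \<le> norm (B\<^sup>2 * (u x)\<^sup>2)"
      by (intro AE_I2) (auto simp: power_mult_distrib intro!: mult_right_mono)
  qed
qed

lemma L2_cmult: "u \<in> L2 S \<Longrightarrow> (\<lambda>x. c * u x) \<in> L2 S"
  using L2_bounded_mult[of u S "\<lambda>_. c" "\<bar>c\<bar>"] by auto

lemma L2_add: "u \<in> L2 S \<Longrightarrow> v \<in> L2 S \<Longrightarrow> (\<lambda>x. u x + v x) \<in> L2 S"
  using L2_mult_integrable[of u S v] by (auto simp: L2_def power2_sum mult.assoc)

lemma L2_diff: "u \<in> L2 S \<Longrightarrow> v \<in> L2 S \<Longrightarrow> (\<lambda>x. u x - v x) \<in> L2 S"
  using L2_mult_integrable[of u S v] by (auto simp: L2_def power2_diff mult.assoc)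

lemma L2_sum: "finite I \<Longrightarrow> (\<And>i. i \<in> I \<Longrightarrow> u i \<in> L2 S) \<Longrightarrow> (\<lambda>x. \<Sum>i\<in>I. u i x) \<in> L2 S"
proof (induction I rule: finite_induct)
  case empty show ?case by (auto simp: L2_def)
qed (auto intro: L2_add)

lemma L2_cong_AE:
  assumes "u \<in> L2 S" "v \<in> borel_measurable (lebesgue_on S)" "AE x in lebesgue_on S. u x = v x"
  shows "v \<in> L2 S"
proof -
  have "integrable (lebesgue_on S) (\<lambda>x. (v x)\<^sup>2)"
    using assms by (subst integrable_cong_AE[where g="\<lambda>x. (u x)\<^sup>2"]) (auto simp: L2_def)
  thus ?thesis using assms by (auto simp: L2_def)
qed

lemma L2_norm_nonneg [simp]: "0 \<le> L2_norm S u"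
  by (auto simp: L2_norm_def)

lemma L2_norm_sq: "(L2_norm S u)\<^sup>2 = (LINT x|lebesgue_on S. (u x)\<^sup>2)"
  by (auto simp: L2_norm_def)

lemma L2_norm_cong_AE:
  assumes "u \<in> borel_measurable (lebesgue_on S)" "v \<in> borel_measurable (lebesgue_on S)"
    "AE x in lebesgue_on S. u x = v x"
  shows "L2_norm S u = L2_norm S v"
  unfolding L2_norm_def using assms by (subst integral_cong_AE[where g="\<lambda>x. (v x)\<^sup>2"]) auto

lemma quadratic_nonneg_discriminant:
  fixes A B C :: real
  assumes "\<And>t. 0 \<le> A * t\<^sup>2 - 2 * C * t + B"
  shows "C\<^sup>2 \<le> A * B"
proof (cases "A = 0")
  case True
  have "C = 0"
  proof (rule ccontr)
    assume "C \<noteq> 0"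
    thus False using assms[of "(B + 1) / (2 * C)"] True by (simp add: field_simps)
  qed
  thus ?thesis using True by simp
next
  case False
  have "A > 0"
  proof (rule ccontr)
    assume "\<not> A > 0"
    hence A: "A < 0" using False by simp
    \<comment> \<open>With this value \<open>A * t = A - (2 * \<bar>C\<bar> + \<bar>B\<bar>)\<close>
      and \<open>t \<ge> 1\<close>, so the quadratic term outweighs the other two and the polynomial
      is at most \<open>A * t < 0\<close>.\<close>
    define t where "t = 1 + (2 * \<bar>C\<bar> + \<bar>B\<bar>) / \<bar>A\<bar>"
    have t: "t \<ge> 1" by (simp add: t_def)
    have "A * t = A - (2 * \<bar>C\<bar> + \<bar>B\<bar>)" using A by (simp add: t_def field_simps)
    hence "A * t\<^sup>2 = (A - (2 * \<bar>C\<bar> + \<bar>B\<bar>)) * t" by (metis mult.assoc power2_eq_square)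
    moreover have "\<bar>B\<bar> \<le> \<bar>B\<bar> * t" using t by (simp add: mult_le_cancel_left1)
    moreover have "- 2 * C * t \<le> 2 * \<bar>C\<bar> * t" using t by (intro mult_right_mono) auto
    moreover have "A * t < 0" using A t by (simp add: mult_neg_pos)
    ultimately show False using assms[of t] by (simp add: algebra_simps)
  qed
  thus ?thesis using assms[of "C / A"] by (simp add: field_simps power2_eq_square)
qed

text \<open>The polynomial in \<open>t\<close> is the squared norm of \<open>u - t * v\<close>; its
  discriminant gives the inequality.\<close>

lemma L2_Cauchy_Schwarz:
  assumes "u \<in> L2 S" "v \<in> L2 S"
  shows "\<bar>LINT x|lebesgue_on S. u x * v x\<bar> \<le> L2_norm S u * L2_norm S v"
proof -
  let ?M = "lebesgue_on S"
  let ?C = "LINT x|?M. u x * v x" and ?A = "LINT x|?M. (v x)\<^sup>2" and ?B = "LINT x|?M. (u x)\<^sup>2"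
  note i = L2_mult_integrable[OF assms] L2D(2)[OF assms(1)] L2D(2)[OF assms(2)]
  have "0 \<le> ?A * t\<^sup>2 - 2 * ?C * t + ?B" for t
  proof -
    have "0 \<le> (LINT x|?M. (u x - t * v x)\<^sup>2)" by (rule Bochner_Integration.integral_nonneg) simp
    also have "(\<lambda>x. (u x - t * v x)\<^sup>2) = (\<lambda>x. (v x)\<^sup>2 * t\<^sup>2 - (u x * v x) * (2 * t) + (u x)\<^sup>2)"
      by (auto simp: power2_diff algebra_simps)
    also have "(LINT x|?M. (v x)\<^sup>2 * t\<^sup>2 - (u x * v x) * (2 * t) + (u x)\<^sup>2) = ?A * t\<^sup>2 - ?C * (2 * t) + ?B"
      using i by simp
    finally show ?thesis by (simp add: mult_ac)
  qed
  hence "?C\<^sup>2 \<le> ?A * ?B" by (rule quadratic_nonneg_discriminant)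
  hence "sqrt (?C\<^sup>2) \<le> sqrt (?A * ?B)" by (rule real_sqrt_le_mono)
  thus ?thesis by (simp add: L2_norm_def real_sqrt_mult mult.commute)
qed

lemma L2_norm_triangle:
  assumes "u \<in> L2 S" "v \<in> L2 S"
  shows "L2_norm S (\<lambda>x. u x + v x) \<le> L2_norm S u + L2_norm S v"
proof (rule power2_le_imp_le)
  note i = L2_mult_integrable[OF assms] L2D(2)[OF assms(1)] L2D(2)[OF assms(2)]
  have "(L2_norm S (\<lambda>x. u x + v x))\<^sup>2 = (L2_norm S u)\<^sup>2 + (L2_norm S v)\<^sup>2 + 2 * (LINT x|lebesgue_on S. u x * v x)"
    using i by (simp add: L2_norm_sq power2_sum mult.assoc)
  also have "\<dots> \<le> (L2_norm S u + L2_norm S v)\<^sup>2"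
    using L2_Cauchy_Schwarz[OF assms] by (simp add: power2_sum)
  finally show "(L2_norm S (\<lambda>x. u x + v x))\<^sup>2 \<le> (L2_norm S u + L2_norm S v)\<^sup>2" .
qed simp

lemma L2_norm_cmult: "L2_norm S (\<lambda>x. c * u x) = \<bar>c\<bar> * L2_norm S u"
  by (simp add: L2_norm_def power_mult_distrib real_sqrt_mult)

lemma L2_norm_minus_commute: "L2_norm S (\<lambda>x. u x - v x) = L2_norm S (\<lambda>x. v x - u x)"
  by (simp add: L2_norm_def power2_commute)

lemma L2_norm_triangle_diff:
  assumes "u \<in> L2 S" "v \<in> L2 S"
  shows "L2_norm S (\<lambda>x. u x - v x) \<le> L2_norm S u + L2_norm S v"
  using L2_norm_triangle[OF assms(1) L2_cmult[OF assms(2), of "-1"]]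
  by (simp add: L2_norm_def)

lemma L2_norm_sum:
  assumes "finite I" "\<And>i. i \<in> I \<Longrightarrow> u i \<in> L2 S"
  shows "L2_norm S (\<lambda>x. \<Sum>i\<in>I. u i x) \<le> (\<Sum>i\<in>I. L2_norm S (u i))"
  using assms
proof (induction I rule: finite_induct)
  case empty thus ?case by (simp add: L2_norm_def)
next
  case (insert i I)
  thus ?case using L2_norm_triangle[of "u i" S "\<lambda>x. \<Sum>i\<in>I. u i x"] L2_sum[of I u S] by force
qed

lemma L2_norm_0_AE: "u \<in> L2 S \<Longrightarrow> L2_norm S u = 0 \<Longrightarrow> AE x in lebesgue_on S. u x = 0"
  using integral_nonneg_eq_0_iff_AE[of "lebesgue_on S" "\<lambda>x. (u x)\<^sup>2"] by (auto simp: L2_norm_def L2_def)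

lemma finite_measure_lebesgue_on:
  assumes "bounded (S::'a::euclidean_space set)" "S \<in> sets lebesgue"
  shows "finite_measure (lebesgue_on S)"
proof
  have "emeasure lebesgue S < \<infinity>"
    using assms bounded_set_imp_lmeasurable fmeasurable_def by blast
  thus "emeasure (lebesgue_on S) (space (lebesgue_on S)) \<noteq> \<infinity>"
    using assms by (simp add: emeasure_restrict_space)
qed

lemma L2_integrable:
  assumes "u \<in> L2 S" "bounded (S::'a::euclidean_space set)" "S \<in> sets lebesgue"
  shows "integrable (lebesgue_on S) u"
proof (rule Bochner_Integration.integrable_bound)
  interpret finite_measure "lebesgue_on S" by (rule finite_measure_lebesgue_on[OF assms(2,3)])
  show "integrable (lebesgue_on S) (\<lambda>x. 1 + (u x)\<^sup>2)" using L2D[OF assms(1)] by auto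
  show "u \<in> borel_measurable (lebesgue_on S)" using L2D[OF assms(1)] by auto
  have "\<bar>a\<bar> \<le> 1 + a\<^sup>2" for a :: real using sum_squares_bound[of 1 "\<bar>a\<bar>"] abs_ge_zero[of a] by (simp del: abs_ge_zero)
  thus "AE x in lebesgue_on S. norm (u x) \<le> norm (1 + (u x)\<^sup>2)" by auto
qed

lemma bounded_in_L2:
  assumes "bounded (S::'a::euclidean_space set)" "S \<in> sets lebesgue"
    "g \<in> borel_measurable (lebesgue_on S)" "\<And>x. x \<in> S \<Longrightarrow> \<bar>g x\<bar> \<le> B"
  shows "g \<in> L2 S"
proof -
  interpret finite_measure "lebesgue_on S" by (rule finite_measure_lebesgue_on[OF assms(1,2)])
  have "(\<lambda>x. 1) \<in> L2 S" by (auto simp: L2_def)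
  from L2_bounded_mult[OF this assms(3,4)] show ?thesis by simp
qed

lemma continuous_bounded_on:
  fixes g :: "'a::euclidean_space \<Rightarrow> real"
  assumes "bounded S" "continuous_on UNIV g"
  obtains B where "\<And>x. x \<in> S \<Longrightarrow> \<bar>g x\<bar> \<le> B"
proof -
  have "compact (g ` closure S)"
    using assms by (intro compact_continuous_image continuous_on_subset[OF assms(2)]) auto
  then obtain B where "\<And>x. x \<in> closure S \<Longrightarrow> \<bar>g x\<bar> \<le> B"
    using compact_imp_bounded bounded_iff by (metis imageI real_norm_def)
  thus thesis using that closure_subset by blast
qed

lemma continuous_in_L2:
  assumes "bounded (S::'a::euclidean_space set)" "S \<in> sets lebesgue" "continuous_on UNIV g"
  shows "g \<in> L2 S"
proof -
  obtain B where "\<And>x. x \<in> S \<Longrightarrow> \<bar>g x\<bar> \<le> B" using continuous_bounded_on[OF assms(1,3)] by metis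
  thus ?thesis by (rule bounded_in_L2[OF assms(1,2) continuous_measurable_lebesgue_on[OF assms(3)]])
qed

lemma integral_small_mult:
  assumes "integrable M u" "g \<in> borel_measurable M" "\<And>x. \<bar>g x\<bar> \<le> e"
  shows "\<bar>LINT x|M. u x * g x\<bar> \<le> e * (LINT x|M. \<bar>u x\<bar>)" "integrable M (\<lambda>x. u x * (g x :: real))"
proof -
  have b: "\<bar>u x * g x\<bar> \<le> e * \<bar>u x\<bar>" for x
    using mult_left_mono[OF assms(3)[of x], of "\<bar>u x\<bar>"] by (simp add: abs_mult mult.commute)
  have e: "0 \<le> e" using assms(3)[of undefined] by (rule order_trans[OF abs_ge_zero])
  show i: "integrable M (\<lambda>x. u x * g x)"
    by (rule Bochner_Integration.integrable_bound[of _ "\<lambda>x. e * \<bar>u x\<bar>"]) (use assms b e in auto)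
  have "\<bar>LINT x|M. u x * g x\<bar> \<le> (LINT x|M. \<bar>u x * g x\<bar>)" by (rule integral_abs_bound)
  also have "\<dots> \<le> (LINT x|M. e * \<bar>u x\<bar>)"
    by (rule Bochner_Integration.integral_mono) (use i assms b in auto)
  finally show "\<bar>LINT x|M. u x * g x\<bar> \<le> e * (LINT x|M. \<bar>u x\<bar>)" by simp
qed

section \<open>Larger classes of test functions and the fundamental lemma\<close>

definition csupp_in :: "'a::euclidean_space set \<Rightarrow> ('a \<Rightarrow> real) \<Rightarrow> bool" where
  "csupp_in \<Omega> f \<longleftrightarrow> (\<exists>K. compact K \<and> K \<subseteq> \<Omega> \<and> (\<forall>x. x \<notin> K \<longrightarrow> f x = 0))"

lemma csupp_in_cont_csupp: "csupp_in \<Omega> f \<Longrightarrow> continuous_on UNIV f \<Longrightarrow> cont_csupp f"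
  unfolding csupp_in_def cont_csupp_def
  by (metis (mono_tags, lifting) bounded_subset compact_imp_bounded mem_Collect_eq subsetI)

lemma test_functions_csupp_in: "\<psi> \<in> test_functions \<Omega> \<Longrightarrow> csupp_in \<Omega> \<psi>"
proof -
  assume "\<psi> \<in> test_functions \<Omega>"
  hence "compact (closure {x. \<psi> x \<noteq> 0})" "closure {x. \<psi> x \<noteq> 0} \<subseteq> \<Omega>" by (auto simp: test_functions_def)
  moreover have "\<psi> x = 0" if "x \<notin> closure {x. \<psi> x \<noteq> 0}" for x
    using that closure_subset[of "{x. \<psi> x \<noteq> 0}"] by auto
  ultimately show ?thesis unfolding csupp_in_def by blast
qed

lemma test_functions_C1: "\<psi> \<in> test_functions \<Omega> \<Longrightarrow> Ck 1 \<psi>"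
  by (simp only: test_functions_def) blast

lemma csupp_in_mult_left: "csupp_in \<Omega> f \<Longrightarrow> csupp_in \<Omega> (\<lambda>x. g x * f x)"
  unfolding csupp_in_def by (metis mult_zero_right)

text \<open>Replacing \<open>f\<close> by a test function that is C1-close within \<open>e\<close>
  costs at most \<open>e\<close> times the L1 norms of \<open>u\<close> and \<open>v\<close>, which
  are finite because the domain is bounded.\<close>

lemma weak_pd_rel_C1:
  fixes \<Omega> :: "'a::euclidean_space set"
  assumes \<Omega>: "open \<Omega>" "bounded \<Omega>" and uv: "u \<in> L2 \<Omega>" "v \<in> L2 \<Omega>" "weak_pd_rel \<Omega> b u v"
    and b: "b \<in> Basis" and f: "Ck 1 f" "csupp_in \<Omega> f"
  shows "(LINT x|lebesgue_on \<Omega>. u x * pd b f x) = - (LINT x|lebesgue_on \<Omega>. v x * f x)"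
proof -
  let ?M = "lebesgue_on \<Omega>"
  have \<Omega>s: "\<Omega> \<in> sets lebesgue" using \<Omega> by auto
  note iu = L2_integrable[OF uv(1) \<Omega>(2) \<Omega>s] and iv = L2_integrable[OF uv(2) \<Omega>(2) \<Omega>s]
  note mf = C1_continuous[OF f(1)] C1_continuous_pd[OF f(1) b]
  note l2f = continuous_in_L2[OF \<Omega>(2) \<Omega>s mf(1)] continuous_in_L2[OF \<Omega>(2) \<Omega>s mf(2)]
  obtain K where K: "compact K" "K \<subseteq> \<Omega>" "\<And>x. x \<notin> K \<Longrightarrow> f x = 0" using f(2) by (auto simp: csupp_in_def)
  define X where "X = (LINT x|?M. u x * pd b f x) + (LINT x|?M. v x * f x)"
  have "\<bar>X\<bar> \<le> e * ((LINT x|?M. \<bar>u x\<bar>) + (LINT x|?M. \<bar>v x\<bar>))" if e: "e > 0" for e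
  proof -
    from test_function_approx[OF \<Omega>(1) K mf(1) e]
    obtain \<psi> where \<psi>: "\<psi> \<in> test_functions \<Omega>" "\<And>x. \<bar>\<psi> x - f x\<bar> \<le> e" "\<And>x. \<bar>pd b \<psi> x - pd b f x\<bar> \<le> e"
      using f(1) b by metis
    note C\<psi> = test_functions_C1[OF \<psi>(1)]
    note m\<psi> = C1_continuous[OF C\<psi>] C1_continuous_pd[OF C\<psi> b]
    note l2\<psi> = continuous_in_L2[OF \<Omega>(2) \<Omega>s m\<psi>(1)] continuous_in_L2[OF \<Omega>(2) \<Omega>s m\<psi>(2)]
    have r: "(LINT x|?M. u x * pd b \<psi> x) = - (LINT x|?M. v x * \<psi> x)"
      using uv(3) \<psi>(1) by (auto simp: weak_pd_rel_def)
    have "X = (LINT x|?M. u x * (pd b f x - pd b \<psi> x)) + (LINT x|?M. v x * (f x - \<psi> x))"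
      using r L2_mult_integrable[OF uv(1) l2f(2)] L2_mult_integrable[OF uv(2) l2f(1)]
        L2_mult_integrable[OF uv(1) l2\<psi>(2)] L2_mult_integrable[OF uv(2) l2\<psi>(1)]
      by (simp add: X_def right_diff_distrib)
    moreover have "\<bar>LINT x|?M. u x * (pd b f x - pd b \<psi> x)\<bar> \<le> e * (LINT x|?M. \<bar>u x\<bar>)"
      using \<psi>(3) by (intro integral_small_mult[OF iu] continuous_measurable_lebesgue_on continuous_intros mf m\<psi>)
        (simp add: abs_minus_commute)
    moreover have "\<bar>LINT x|?M. v x * (f x - \<psi> x)\<bar> \<le> e * (LINT x|?M. \<bar>v x\<bar>)"
      using \<psi>(2) by (intro integral_small_mult[OF iv] continuous_measurable_lebesgue_on continuous_intros mf m\<psi>)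
        (simp add: abs_minus_commute)
    ultimately show ?thesis by (simp add: distrib_left)
  qed
  note small = this
  have "X = 0"
    by (rule abs_le_all_eps_0[OF small]) (auto intro!: add_nonneg_nonneg Bochner_Integration.integral_nonneg)
  thus ?thesis by (simp add: X_def)
qed

text \<open>Here uniform closeness is enough, as no derivative of the test function occurs.\<close>

lemma weak_zero_continuous:
  fixes \<Omega> :: "'a::euclidean_space set"
  assumes \<Omega>: "open \<Omega>" and v: "integrable (lebesgue_on \<Omega>) v"
    and z: "\<And>\<psi>. \<psi> \<in> test_functions \<Omega> \<Longrightarrow> (LINT x|lebesgue_on \<Omega>. v x * \<psi> x) = 0"
    and f: "continuous_on UNIV f" "csupp_in \<Omega> f"
  shows "(LINT x|lebesgue_on \<Omega>. v x * f x) = 0"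
proof -
  let ?M = "lebesgue_on \<Omega>"
  obtain K where K: "compact K" "K \<subseteq> \<Omega>" "\<And>x. x \<notin> K \<Longrightarrow> f x = 0" using f(2) by (auto simp: csupp_in_def)
  let ?I = "LINT x|?M. \<bar>v x\<bar>"
  have "bounded (range f)"
  proof -
    have "compact (f ` K)" using K f by (intro compact_continuous_image continuous_on_subset[OF f(1)]) auto
    hence "bounded (insert 0 (f ` K))" using compact_imp_bounded by simp
    thus ?thesis by (rule bounded_subset) (use K(3) in force)
  qed
  then obtain B where B: "\<And>x. \<bar>f x\<bar> \<le> B" unfolding bounded_iff by auto
  have small: "\<bar>LINT x|?M. v x * f x\<bar> \<le> e * ?I" if e: "e > 0" for e
  proof -
    from test_function_approx[OF \<Omega>(1) K f(1) e]
    obtain \<psi> where \<psi>: "\<psi> \<in> test_functions \<Omega>" "\<And>x. \<bar>\<psi> x - f x\<bar> \<le> e" by metis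
    note m\<psi> = C1_continuous[OF test_functions_C1[OF \<psi>(1)], of UNIV]
    note md = continuous_on_diff[OF f(1) m\<psi>]
    note d = integral_small_mult[OF v continuous_measurable_lebesgue_on[OF md], of e]
    have ab: "\<bar>f x - \<psi> x\<bar> \<le> e" for x using \<psi>(2)[of x] by simp
    have "integrable ?M (\<lambda>x. v x * f x)"
      by (rule integral_small_mult(2)[OF v continuous_measurable_lebesgue_on[OF f(1)] B])
    moreover have "(LINT x|?M. v x * f x - v x * (f x - \<psi> x)) = 0"
      using z[OF \<psi>(1)] by (simp add: right_diff_distrib)
    ultimately have "(LINT x|?M. v x * f x) = (LINT x|?M. v x * (f x - \<psi> x))"
      using d(2)[OF ab] by simp
    thus ?thesis using d(1)[OF ab] by simp
  qed
  have I: "?I \<ge> 0" by (rule Bochner_Integration.integral_nonneg) auto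
  show ?thesis by (rule abs_le_all_eps_0[OF small I])
qed

text \<open>The indicator of a compact set is the pointwise limit of continuous tents of growing
  slope around it; dominated convergence with majorant \<open>\<bar>v\<bar>\<close> carries the
  identity over.\<close>

lemma weak_zero_compact:
  fixes \<Omega> :: "'a::euclidean_space set"
  assumes \<Omega>: "open \<Omega>" and v: "integrable (lebesgue_on \<Omega>) v"
    and z: "\<And>\<psi>. \<psi> \<in> test_functions \<Omega> \<Longrightarrow> (LINT x|lebesgue_on \<Omega>. v x * \<psi> x) = 0"
    and K: "compact K" "K \<subseteq> \<Omega>" "K \<noteq> {}"
  shows "(LINT x|lebesgue_on \<Omega>. v x * indicator K x) = 0"
proof -
  let ?M = "lebesgue_on \<Omega>"
  obtain r where r: "r > 0" "(\<Union>x\<in>K. cball x r) \<subseteq> \<Omega>"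
    using compact_subset_open_imp_cball_epsilon_subset[OF K(1) \<Omega> K(2)] by metis
  \<comment> \<open>The slope is at least \<open>1 / r\<close>, so every tent is already 0 at
    distance \<open>r\<close> from \<open>K\<close> and its support stays in \<Omega>.\<close>
  define f where "f m x = max 0 (1 - real (Suc m) / r * infdist x K)" for m x
  have cf: "continuous_on UNIV (f m)" for m unfolding f_def by (intro continuous_intros)
  let ?K' = "{x + y |x y. x \<in> K \<and> y \<in> cball 0 r}"
  have "csupp_in \<Omega> (f m)" for m
    unfolding csupp_in_def
  proof (intro exI conjI allI impI)
    show "compact ?K'" by (rule compact_sums[OF K(1) compact_cball])
    show "?K' \<subseteq> \<Omega>"
    proof clarify
      fix x y :: 'a assume "x \<in> K" "y \<in> cball 0 r"
      hence "x + y \<in> cball x r" by (simp add: dist_norm)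
      thus "x + y \<in> \<Omega>" using r \<open>x \<in> K\<close> by blast
    qed
    fix x assume x: "x \<notin> ?K'"
    obtain y where y: "y \<in> K" "infdist x K = dist x y"
      using infdist_attains_inf[OF compact_imp_closed[OF K(1)] K(3)] by metis
    have "\<not> dist x y \<le> r"
    proof
      assume "dist x y \<le> r"
      hence "x \<in> ?K'" using y by (intro CollectI exI[of _ y] exI[of _ "x - y"]) (auto simp: dist_norm norm_minus_commute)
      thus False using x by contradiction
    qed
    hence "1 \<le> infdist x K / r" using r y by simp
    also have "\<dots> \<le> real (Suc m) * (infdist x K / r)"
      using r infdist_nonneg[of x K] mult_right_mono[of 1 "real (Suc m)" "infdist x K / r"] by simp
    finally show "f m x = 0" by (simp add: f_def)
  qed
  hence zero: "(LINT x|?M. v x * f m x) = 0" for m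
    using weak_zero_continuous[OF \<Omega> v z cf] by blast
  have lim: "(\<lambda>m. f m x) \<longlonglongrightarrow> indicator K x" for x
  proof (cases "x \<in> K")
    case True
    thus ?thesis by (simp add: f_def)
  next
    case False
    hence d: "infdist x K > 0"
      using in_closed_iff_infdist_zero[OF compact_imp_closed[OF K(1)] K(3)] infdist_nonneg[of x K] by (metis less_eq_real_def)
    obtain N :: nat where N: "r / infdist x K \<le> N" using real_arch_simple by blast
    have "f m x = 0" if "m \<ge> N" for m
    proof -
      have "r / infdist x K \<le> real (Suc m)" using N that by linarith
      hence "1 \<le> real (Suc m) / r * infdist x K" using d r by (simp add: field_simps)
      thus ?thesis by (simp add: f_def)
    qed
    hence "\<forall>\<^sub>F m in sequentially. f m x = 0" using eventually_sequentially by blast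
    thus ?thesis using False by (simp add: tendsto_eventually)
  qed
  have "(\<lambda>m. LINT x|?M. v x * f m x) \<longlonglongrightarrow> (LINT x|?M. v x * indicator K x)"
  proof (rule integral_dominated_convergence[where w="\<lambda>x. \<bar>v x\<bar>"])
    have Kl: "K \<in> sets lebesgue" using K(1) by (simp add: borel_compact)
    show "(\<lambda>x. v x * indicator K x) \<in> borel_measurable ?M"
      using v Kl by (intro borel_measurable_times borel_measurable_indicator')
        (auto simp: sets_restrict_space space_restrict_space intro: measurable_restrict_space1)
    show "(\<lambda>x. v x * f m x) \<in> borel_measurable ?M" for m
      using v continuous_measurable_lebesgue_on[OF cf[of m]] by auto
    have "\<bar>f m x\<bar> \<le> 1" for m x using r infdist_nonneg[of x K] by (auto simp: f_def)
    thus "AE x in ?M. norm (v x * f m x) \<le> \<bar>v x\<bar>" for m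
      by (auto simp: abs_mult mult_left_le)
    show "AE x in ?M. (\<lambda>m. v x * f m x) \<longlonglongrightarrow> v x * indicator K x"
      by (intro AE_I2 tendsto_intros lim)
  qed (use v in auto)
  thus ?thesis using zero by (simp add: LIMSEQ_const_iff)
qed

text \<open>The set where \<open>v > 0\<close> is exhausted from inside, up to measure
  \<open>e\<close>, by closed sets. These are compact because the domain is bounded;
  \<open>v\<close> integrates to 0 over each although it is positive there, so each is null.\<close>

lemma weak_zero_nonpos:
  fixes \<Omega> :: "'a::euclidean_space set"
  assumes \<Omega>: "open \<Omega>" "bounded \<Omega>" and v: "integrable (lebesgue_on \<Omega>) v"
    and z: "\<And>\<psi>. \<psi> \<in> test_functions \<Omega> \<Longrightarrow> (LINT x|lebesgue_on \<Omega>. v x * \<psi> x) = 0"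
  shows "AE x in lebesgue_on \<Omega>. v x \<le> 0"
proof -
  let ?M = "lebesgue_on \<Omega>"
  have \<Omega>s: "\<Omega> \<in> sets lebesgue" using \<Omega> by auto
  define E where "E = {x \<in> \<Omega>. v x > 0}"
  have vm: "v \<in> borel_measurable ?M" using v by auto
  have "{x \<in> space ?M. v x > 0} \<in> sets ?M" using vm by measurable
  hence E: "E \<in> sets ?M" by (simp add: E_def)
  hence El: "E \<in> sets lebesgue" using \<Omega>s by (simp add: sets_restrict_space_iff)
  have le_e: "emeasure lebesgue E \<le> ennreal e" if e: "e > 0" for e
  proof -
    obtain T where T: "closed T" "T \<subseteq> E" "E - T \<in> lmeasurable" "emeasure lebesgue (E - T) < ennreal e"
      using sets_lebesgue_inner_closed[OF El e] by metis
    have T\<Omega>: "T \<subseteq> \<Omega>" using T(2) by (auto simp: E_def)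
    have cT: "compact T" using T(1) bounded_subset[OF \<Omega>(2) T\<Omega>] by (simp add: compact_eq_bounded_closed)
    have Tl: "T \<in> sets lebesgue" using T(1) by simp
    have "emeasure lebesgue T = 0"
    proof (cases "T = {}")
      case False
      have 0: "(LINT x|?M. v x * indicator T x) = 0" by (rule weak_zero_compact[OF \<Omega>(1) v z cT T\<Omega> False])
      have i: "integrable ?M (\<lambda>x. v x * indicator T x)"
        by (rule integral_small_mult(2)[OF v, of _ 1])
           (use Tl in \<open>auto intro!: borel_measurable_indicator' measurable_restrict_space1 simp: indicator_def\<close>)
      have nn: "AE x in ?M. 0 \<le> v x * indicator T x"
        using T(2) by (intro AE_I2) (force simp: E_def indicator_def)
      have "AE x in ?M. v x * indicator T x = 0"
        using integral_nonneg_eq_0_iff_AE[OF i nn] 0 by simp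
      hence "AE x in ?M. x \<notin> T"
      proof (rule eventually_mono)
        fix x assume "v x * indicator T x = 0"
        thus "x \<notin> T" using T(2) by (force simp: E_def)
      qed
      hence "AE x in lebesgue. x \<in> \<Omega> \<longrightarrow> x \<notin> T" using \<Omega>s by (subst (asm) AE_restrict_space_iff) auto
      hence "AE x in lebesgue. x \<notin> T" by (rule eventually_mono) (use T\<Omega> in auto)
      thus ?thesis using AE_iff_measurable[of T lebesgue "\<lambda>x. x \<notin> T"] Tl by auto
    qed simp
    moreover have "emeasure lebesgue E \<le> emeasure lebesgue T + emeasure lebesgue (E - T)"
      using T(2,3) Tl El emeasure_subadditive[of T lebesgue "E - T"] by (simp add: Un_absorb1)
    ultimately show ?thesis using T(4) by simp
  qed
  have "emeasure lebesgue E \<le> 0"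
  proof (rule ennreal_le_epsilon)
    fix e :: real assume "0 < e"
    thus "emeasure lebesgue E \<le> 0 + ennreal e" using le_e by simp
  qed
  hence "emeasure lebesgue E = 0" by simp
  hence "emeasure ?M E = 0" using \<Omega>s E by (subst emeasure_restrict_space) (auto simp: E_def)
  thus ?thesis using E
    by (intro AE_I[of _ _ E]) (auto simp: E_def)
qed

lemma fundamental_lemma:
  fixes \<Omega> :: "'a::euclidean_space set"
  assumes \<Omega>: "open \<Omega>" "bounded \<Omega>" and v: "integrable (lebesgue_on \<Omega>) v"
    and z: "\<And>\<psi>. \<psi> \<in> test_functions \<Omega> \<Longrightarrow> (LINT x|lebesgue_on \<Omega>. v x * \<psi> x) = 0"
  shows "AE x in lebesgue_on \<Omega>. v x = 0"
proof -
  have "AE x in lebesgue_on \<Omega>. - v x \<le> 0"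
    by (rule weak_zero_nonpos[OF \<Omega>]) (use v z in auto)
  moreover have "AE x in lebesgue_on \<Omega>. v x \<le> 0" by (rule weak_zero_nonpos[OF \<Omega> v z])
  ultimately show ?thesis by eventually_elim simp
qed

section \<open>First-order Sobolev functions\<close>

lemma wpdD:
  assumes "u \<in> H1 \<Omega>" "b \<in> Basis"
  shows "wpd \<Omega> b u \<in> L2 \<Omega>" "weak_pd_rel \<Omega> b u (wpd \<Omega> b u)"
proof -
  have "\<exists>v. v \<in> L2 \<Omega> \<and> weak_pd_rel \<Omega> b u v" using assms by (auto simp: H1_def)
  from someI_ex[OF this] show "wpd \<Omega> b u \<in> L2 \<Omega>" "weak_pd_rel \<Omega> b u (wpd \<Omega> b u)"
    unfolding wpd_def by auto
qed

lemma test_function_L2: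
  fixes \<Omega> :: "'a::euclidean_space set"
  assumes "open \<Omega>" "bounded \<Omega>" "\<psi> \<in> test_functions S"
  shows "\<psi> \<in> L2 \<Omega>" "b \<in> Basis \<Longrightarrow> pd b \<psi> \<in> L2 \<Omega>"
  using continuous_in_L2[OF assms(2)] assms(1) C1_continuous[OF test_functions_C1[OF assms(3)]]
    C1_continuous_pd[OF test_functions_C1[OF assms(3)]] by auto

lemma weak_pd_rel_diff:
  fixes \<Omega> :: "'a::euclidean_space set"
  assumes \<Omega>: "open \<Omega>" "bounded \<Omega>" and b: "b \<in> Basis"
    and 1: "u1 \<in> L2 \<Omega>" "v1 \<in> L2 \<Omega>" "weak_pd_rel \<Omega> b u1 v1"
    and 2: "u2 \<in> L2 \<Omega>" "v2 \<in> L2 \<Omega>" "weak_pd_rel \<Omega> b u2 v2"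
  shows "weak_pd_rel \<Omega> b (\<lambda>x. u1 x - u2 x) (\<lambda>x. v1 x - v2 x)"
  unfolding weak_pd_rel_def
proof
  fix \<psi> assume \<psi>: "\<psi> \<in> test_functions \<Omega>"
  note t = test_function_L2[OF \<Omega> \<psi>]
  note i = L2_mult_integrable[OF 1(1) t(2)[OF b]] L2_mult_integrable[OF 2(1) t(2)[OF b]]
    L2_mult_integrable[OF 1(2) t(1)] L2_mult_integrable[OF 2(2) t(1)]
  show "(LINT x|lebesgue_on \<Omega>. (u1 x - u2 x) * pd b \<psi> x) = - (LINT x|lebesgue_on \<Omega>. (v1 x - v2 x) * \<psi> x)"
    using i 1(3) 2(3) \<psi> by (simp add: left_diff_distrib weak_pd_rel_def)
qed

lemma wpd_unique:
  fixes \<Omega> :: "'a::euclidean_space set"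
  assumes \<Omega>: "open \<Omega>" "bounded \<Omega>" and b: "b \<in> Basis"
    and v: "u \<in> L2 \<Omega>" "v \<in> L2 \<Omega>" "weak_pd_rel \<Omega> b u v"
  shows "AE x in lebesgue_on \<Omega>. wpd \<Omega> b u x = v x"
proof -
  have "\<exists>v. v \<in> L2 \<Omega> \<and> weak_pd_rel \<Omega> b u v" using v by auto
  from someI_ex[OF this] have w: "wpd \<Omega> b u \<in> L2 \<Omega>" "weak_pd_rel \<Omega> b u (wpd \<Omega> b u)"
    unfolding wpd_def by auto
  have r: "weak_pd_rel \<Omega> b (\<lambda>x. u x - u x) (\<lambda>x. wpd \<Omega> b u x - v x)"
    by (rule weak_pd_rel_diff[OF \<Omega> b v(1) w v])
  have "AE x in lebesgue_on \<Omega>. wpd \<Omega> b u x - v x = 0"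
    by (rule fundamental_lemma[OF \<Omega> L2_integrable[OF L2_diff[OF w(1) v(2)] \<Omega>(2)]])
       (use r \<Omega> in \<open>auto simp: weak_pd_rel_def\<close>)
  thus ?thesis by eventually_elim simp
qed

lemma H1_diff:
  fixes \<Omega> :: "'a::euclidean_space set"
  assumes \<Omega>: "open \<Omega>" "bounded \<Omega>" and u: "u \<in> H1 \<Omega>" "v \<in> H1 \<Omega>"
  shows "(\<lambda>x. u x - v x) \<in> H1 \<Omega>"
    and "b \<in> Basis \<Longrightarrow> AE x in lebesgue_on \<Omega>. wpd \<Omega> b (\<lambda>x. u x - v x) x = wpd \<Omega> b u x - wpd \<Omega> b v x"
proof -
  have l2: "u \<in> L2 \<Omega>" "v \<in> L2 \<Omega>" using u by (auto simp: H1_def)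
  have r: "weak_pd_rel \<Omega> b (\<lambda>x. u x - v x) (\<lambda>x. wpd \<Omega> b u x - wpd \<Omega> b v x)" if "b \<in> Basis" for b
    using weak_pd_rel_diff[OF \<Omega> that l2(1) wpdD[OF u(1) that] l2(2) wpdD[OF u(2) that]] .
  have d: "(\<lambda>x. wpd \<Omega> b u x - wpd \<Omega> b v x) \<in> L2 \<Omega>" if "b \<in> Basis" for b
    using wpdD(1)[OF u(1) that] wpdD(1)[OF u(2) that] by (rule L2_diff)
  show "(\<lambda>x. u x - v x) \<in> H1 \<Omega>" using L2_diff[OF l2] r d by (force simp: H1_def)
  show "b \<in> Basis \<Longrightarrow> AE x in lebesgue_on \<Omega>. wpd \<Omega> b (\<lambda>x. u x - v x) x = wpd \<Omega> b u x - wpd \<Omega> b v x"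
    by (rule wpd_unique[OF \<Omega> _ L2_diff[OF l2] d r])
qed

text \<open>The equality is literal and not just almost everywhere: both sides apply the choice
  operator to the same predicate, since \<open>weak_pd_rel\<close> sees \<open>u\<close> only
  through integrals.\<close>

lemma wpd_cong_AE:
  fixes \<Omega> :: "'a::euclidean_space set"
  assumes \<Omega>: "open \<Omega>" "bounded \<Omega>" and b: "b \<in> Basis"
    and u: "u \<in> L2 \<Omega>" "v \<in> L2 \<Omega>" "AE x in lebesgue_on \<Omega>. u x = v x"
  shows "wpd \<Omega> b u = wpd \<Omega> b v"
proof -
  have "weak_pd_rel \<Omega> b u = weak_pd_rel \<Omega> b v"
    unfolding weak_pd_rel_def
  proof (intro ext ball_cong refl)
    fix w \<psi> assume \<psi>: "\<psi> \<in> test_functions \<Omega>"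
    have "(LINT x|lebesgue_on \<Omega>. u x * pd b \<psi> x) = (LINT x|lebesgue_on \<Omega>. v x * pd b \<psi> x)"
      using u(3) L2D(1)[OF u(1)] L2D(1)[OF u(2)] L2D(1)[OF test_function_L2(2)[OF \<Omega> \<psi> b]]
      by (intro integral_cong_AE) auto
    thus "((LINT x|lebesgue_on \<Omega>. u x * pd b \<psi> x) = - (LINT x|lebesgue_on \<Omega>. w x * \<psi> x)) =
        ((LINT x|lebesgue_on \<Omega>. v x * pd b \<psi> x) = - (LINT x|lebesgue_on \<Omega>. w x * \<psi> x))" by simp
  qed
  thus ?thesis by (simp add: wpd_def)
qed

lemma integral_lebesgue_on_csupp:
  fixes f :: "'a::euclidean_space \<Rightarrow> real"
  assumes "open \<Omega>" "continuous_on UNIV f" "\<And>x. x \<notin> \<Omega> \<Longrightarrow> f x = 0"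
  shows "(LINT x|lebesgue_on \<Omega>. f x) = (\<integral>x. f x \<partial>lborel)"
proof -
  have "(LINT x|lebesgue_on \<Omega>. f x) = (LINT x|lebesgue. indicator \<Omega> x *\<^sub>R f x)"
    using assms(1) by (subst integral_restrict_space) auto
  also have "(\<lambda>x. indicator \<Omega> x *\<^sub>R f x) = f" using assms(3) by (force simp: indicator_def)
  also have "(LINT x|lebesgue. f x) = (\<integral>x. f x \<partial>lborel)"
    using borel_measurable_continuous_onI[OF assms(2)] by (intro integral_completion) simp
  finally show ?thesis .
qed

text \<open>The product of \<open>w\<close> with a test function has compact support, so the
  integral of its derivative vanishes; the product rule then reads as the weak derivative
  relation.\<close>

lemma C1_H1:
  fixes \<Omega> :: "'a::euclidean_space set"
  assumes \<Omega>: "open \<Omega>" "bounded \<Omega>" and w: "Ck 1 w"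
  shows "w \<in> L2 \<Omega>" "b \<in> Basis \<Longrightarrow> pd b w \<in> L2 \<Omega>" "b \<in> Basis \<Longrightarrow> weak_pd_rel \<Omega> b w (pd b w)" "w \<in> H1 \<Omega>"
    "b \<in> Basis \<Longrightarrow> AE x in lebesgue_on \<Omega>. wpd \<Omega> b w x = pd b w x"
proof -
  note l2 = continuous_in_L2[OF \<Omega>(2), of w] continuous_in_L2[OF \<Omega>(2), of "pd b w" for b]
  show 1: "w \<in> L2 \<Omega>" using l2(1) \<Omega> C1_continuous[OF w] by auto
  show 2: "pd b w \<in> L2 \<Omega>" if "b \<in> Basis" for b using l2(2) \<Omega> C1_continuous_pd[OF w that] by auto
  show 3: "weak_pd_rel \<Omega> b w (pd b w)" if b: "b \<in> Basis" for b
    unfolding weak_pd_rel_def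
  proof
    fix \<psi> assume \<psi>: "\<psi> \<in> test_functions \<Omega>"
    note C\<psi> = test_functions_C1[OF \<psi>]
    have sup: "closure {x. \<psi> x \<noteq> 0} \<subseteq> \<Omega>" using \<psi> by (simp add: test_functions_def)
    have cs: "cont_csupp (\<lambda>x. w x * \<psi> x)"
      by (rule csupp_in_cont_csupp[OF csupp_in_mult_left[OF test_functions_csupp_in[OF \<psi>]]])
         (intro continuous_intros C1_continuous w C\<psi>)
    have Cm: "Ck 1 (\<lambda>x. w x * \<psi> x)" by (rule Ck_mult[OF w C\<psi>])
    have pdm: "pd b (\<lambda>x. w x * \<psi> x) x = pd b w x * \<psi> x + w x * pd b \<psi> x" for x
      using w C\<psi> by (intro pd_mult) auto
    have c1: "continuous_on UNIV (\<lambda>x. pd b w x * \<psi> x)" "continuous_on UNIV (\<lambda>x. w x * pd b \<psi> x)"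
      by (intro continuous_intros C1_continuous C1_continuous_pd w C\<psi> b)+
    have z: "\<psi> x = 0" "pd b \<psi> x = 0" if "x \<notin> \<Omega>" for x
      using sup that pd_zero_outside_support[of x \<psi> b] closure_subset[of "{x. \<psi> x \<noteq> 0}"] by auto
    have i: "integrable (lebesgue_on \<Omega>) (\<lambda>x. pd b w x * \<psi> x)" "integrable (lebesgue_on \<Omega>) (\<lambda>x. w x * pd b \<psi> x)"
      using L2_mult_integrable[OF 2[OF b] test_function_L2(1)[OF \<Omega> \<psi>]]
        L2_mult_integrable[OF 1 test_function_L2(2)[OF \<Omega> \<psi> b]] by auto
    have "0 = (\<integral>x. pd b (\<lambda>x. w x * \<psi> x) x \<partial>lborel)" using integral_pd_csupp_0[OF Cm cs b] by simp
    also have "\<dots> = (LINT x|lebesgue_on \<Omega>. pd b (\<lambda>x. w x * \<psi> x) x)"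
      unfolding pdm by (rule integral_lebesgue_on_csupp[symmetric]) (use \<Omega> z c1 in \<open>auto intro!: continuous_intros\<close>)
    also have "\<dots> = (LINT x|lebesgue_on \<Omega>. pd b w x * \<psi> x) + (LINT x|lebesgue_on \<Omega>. w x * pd b \<psi> x)"
      unfolding pdm using i by simp
    finally show "(LINT x|lebesgue_on \<Omega>. w x * pd b \<psi> x) = - (LINT x|lebesgue_on \<Omega>. pd b w x * \<psi> x)" by simp
  qed
  show "w \<in> H1 \<Omega>" using 1 2 3 by (auto simp: H1_def)
  show "AE x in lebesgue_on \<Omega>. wpd \<Omega> b w x = pd b w x" if "b \<in> Basis"
    by (rule wpd_unique[OF \<Omega> that 1 2[OF that] 3[OF that]])
qed

lemma H1_norm_ge:
  "L2_norm \<Omega> u \<le> H1_norm \<Omega> u" "b \<in> Basis \<Longrightarrow> L2_norm \<Omega> (wpd \<Omega> b u) \<le> H1_norm \<Omega> u"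
proof -
  have "(L2_norm \<Omega> u)\<^sup>2 \<le> (H1_norm \<Omega> u)\<^sup>2"
    by (auto simp: H1_norm_def sum_nonneg)
  thus "L2_norm \<Omega> u \<le> H1_norm \<Omega> u" by (rule power2_le_imp_le) (simp add: H1_norm_def sum_nonneg)
  assume b: "b \<in> Basis"
  have "(L2_norm \<Omega> (wpd \<Omega> b u))\<^sup>2 \<le> (H1_norm \<Omega> u)\<^sup>2"
    using b member_le_sum[of b Basis "\<lambda>b. (L2_norm \<Omega> (wpd \<Omega> b u))\<^sup>2"] 
    by (auto simp: H1_norm_def sum_nonneg intro: add_increasing)
  thus "L2_norm \<Omega> (wpd \<Omega> b u) \<le> H1_norm \<Omega> u" by (rule power2_le_imp_le) (simp add: H1_norm_def sum_nonneg)
qed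

lemma H2_norm_ge:
  "H1_norm \<Omega> u \<le> H2_norm \<Omega> u"
  "b \<in> Basis \<Longrightarrow> c \<in> Basis \<Longrightarrow> L2_norm \<Omega> (wpd \<Omega> c (wpd \<Omega> b u)) \<le> H2_norm \<Omega> u"
proof -
  have nn: "0 \<le> H2_norm \<Omega> u" by (simp add: H2_norm_def sum_nonneg)
  have sq: "(H2_norm \<Omega> u)\<^sup>2 = (H1_norm \<Omega> u)\<^sup>2 + (\<Sum>b\<in>Basis. \<Sum>c\<in>Basis. (L2_norm \<Omega> (wpd \<Omega> c (wpd \<Omega> b u)))\<^sup>2)"
    unfolding H2_norm_def by (rule real_sqrt_pow2) (intro add_nonneg_nonneg sum_nonneg zero_le_power2)
  have "(H1_norm \<Omega> u)\<^sup>2 \<le> (H2_norm \<Omega> u)\<^sup>2" unfolding sq by (simp add: sum_nonneg)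
  thus "H1_norm \<Omega> u \<le> H2_norm \<Omega> u" using nn by (rule power2_le_imp_le)
  assume b: "b \<in> Basis" and c: "c \<in> Basis"
  have "(L2_norm \<Omega> (wpd \<Omega> c (wpd \<Omega> b u)))\<^sup>2 \<le> (\<Sum>c\<in>Basis. (L2_norm \<Omega> (wpd \<Omega> c (wpd \<Omega> b u)))\<^sup>2)"
    using c member_le_sum[of c Basis "\<lambda>c. (L2_norm \<Omega> (wpd \<Omega> c (wpd \<Omega> b u)))\<^sup>2"] by simp
  also have "\<dots> \<le> (\<Sum>b\<in>Basis. \<Sum>c\<in>Basis. (L2_norm \<Omega> (wpd \<Omega> c (wpd \<Omega> b u)))\<^sup>2)"
    using b member_le_sum[of b Basis "\<lambda>b. \<Sum>c\<in>Basis. (L2_norm \<Omega> (wpd \<Omega> c (wpd \<Omega> b u)))\<^sup>2"] by (simp add: sum_nonneg)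
  also have "\<dots> \<le> (H2_norm \<Omega> u)\<^sup>2" unfolding sq by simp
  finally show "L2_norm \<Omega> (wpd \<Omega> c (wpd \<Omega> b u)) \<le> H2_norm \<Omega> u" using nn by (rule power2_le_imp_le)
qed

text \<open>The approximants of a trace converge in \<open>H1_norm\<close>, which speaks of chosen
  weak derivatives of differences. Later computations use the classical derivatives of the
  approximants, hence this translation.\<close>

lemma H1_approx_convergence:
  fixes \<Omega> :: "'a::euclidean_space set"
  assumes \<Omega>: "open \<Omega>" "bounded \<Omega>" and p: "p \<in> H1 \<Omega>" and w: "\<And>n::nat. Ck 1 (w n)"
    and lim: "(\<lambda>n. H1_norm \<Omega> (\<lambda>x. w n x - p x)) \<longlonglongrightarrow> 0"
  shows "(\<lambda>n. L2_norm \<Omega> (\<lambda>x. w n x - p x)) \<longlonglongrightarrow> 0"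
    "b \<in> Basis \<Longrightarrow> (\<lambda>n. L2_norm \<Omega> (\<lambda>x. pd b (w n) x - wpd \<Omega> b p x)) \<longlonglongrightarrow> 0"
proof -
  show "(\<lambda>n. L2_norm \<Omega> (\<lambda>x. w n x - p x)) \<longlonglongrightarrow> 0"
    by (rule tendsto_sandwich[OF _ _ tendsto_const lim]) (auto simp: H1_norm_ge)
  assume b: "b \<in> Basis"
  have "L2_norm \<Omega> (\<lambda>x. pd b (w n) x - wpd \<Omega> b p x) \<le> H1_norm \<Omega> (\<lambda>x. w n x - p x)" for n
  proof -
    note C = C1_H1[OF \<Omega> w[of n]]
    note d = H1_diff[OF \<Omega> C(4) p]
    have "AE x in lebesgue_on \<Omega>. pd b (w n) x - wpd \<Omega> b p x = wpd \<Omega> b (\<lambda>x. w n x - p x) x"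
      using d(2)[OF b] C(5)[OF b] by eventually_elim simp
    hence "L2_norm \<Omega> (\<lambda>x. pd b (w n) x - wpd \<Omega> b p x) = L2_norm \<Omega> (wpd \<Omega> b (\<lambda>x. w n x - p x))"
      by (intro L2_norm_cong_AE L2D(1)[OF L2_diff] L2D(1)[OF wpdD(1)] C(2) d(1) wpdD(1) p b)
    thus ?thesis using H1_norm_ge(2)[OF b] by simp
  qed
  thus "(\<lambda>n. L2_norm \<Omega> (\<lambda>x. pd b (w n) x - wpd \<Omega> b p x)) \<longlonglongrightarrow> 0"
    by (intro tendsto_sandwich[OF _ _ tendsto_const lim]) auto
qed

section \<open>Passing to the limit in products, and Green's identity away from the boundary\<close>

lemma L2_inner_tendsto:
  assumes "\<And>n. u n \<in> L2 S" "u' \<in> L2 S" "z \<in> L2 S"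
    and lim: "(\<lambda>n. L2_norm S (\<lambda>x. u n x - u' x)) \<longlonglongrightarrow> 0"
  shows "(\<lambda>n. LINT x|lebesgue_on S. u n x * z x) \<longlonglongrightarrow> (LINT x|lebesgue_on S. u' x * z x)"
proof (rule Lim_null[THEN iffD2], rule tendsto_rabs_zero_cancel, rule tendsto_sandwich[OF _ _ tendsto_const])
  show "(\<lambda>n. L2_norm S (\<lambda>x. u n x - u' x) * L2_norm S z) \<longlonglongrightarrow> 0"
    using tendsto_mult_left_zero[OF lim] by simp
  have "\<bar>(LINT x|lebesgue_on S. u n x * z x) - (LINT x|lebesgue_on S. u' x * z x)\<bar>
      \<le> L2_norm S (\<lambda>x. u n x - u' x) * L2_norm S z" for n
    using L2_Cauchy_Schwarz[OF L2_diff[OF assms(1)[of n] assms(2)] assms(3)]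
      L2_mult_integrable[OF assms(1)[of n] assms(3)] L2_mult_integrable[OF assms(2,3)]
    by (simp add: left_diff_distrib)
  thus "\<forall>\<^sub>F n in sequentially. \<bar>(LINT x|lebesgue_on S. u n x * z x) - (LINT x|lebesgue_on S. u' x * z x)\<bar>
      \<le> L2_norm S (\<lambda>x. u n x - u' x) * L2_norm S z" by simp
qed simp

lemma L2_norm_tendsto_sq:
  assumes "\<And>n. u n \<in> L2 S" "u' \<in> L2 S" 
    and lim: "(\<lambda>n. L2_norm S (\<lambda>x. u n x - u' x)) \<longlonglongrightarrow> 0"
  shows "(\<lambda>n. LINT x|lebesgue_on S. (u n x)\<^sup>2) \<longlonglongrightarrow> (LINT x|lebesgue_on S. (u' x)\<^sup>2)"
proof -
  have "(\<lambda>n. L2_norm S (u n)) \<longlonglongrightarrow> L2_norm S u'"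
  proof (rule Lim_null[THEN iffD2], rule tendsto_rabs_zero_cancel, rule tendsto_sandwich[OF _ _ tendsto_const lim])
    have "\<bar>L2_norm S (u n) - L2_norm S u'\<bar> \<le> L2_norm S (\<lambda>x. u n x - u' x)" for n
      using L2_norm_triangle[OF L2_diff[OF assms(1)[of n] assms(2)] assms(2)]
        L2_norm_triangle[OF L2_diff[OF assms(2) assms(1)[of n]] assms(1)[of n]]
      by (simp add: L2_norm_minus_commute[of S u'])
    thus "\<forall>\<^sub>F n in sequentially. \<bar>L2_norm S (u n) - L2_norm S u'\<bar> \<le> L2_norm S (\<lambda>x. u n x - u' x)" by simp
  qed simp
  from tendsto_power[OF this, of 2] show ?thesis by (simp add: L2_norm_sq)
qed

lemma L2_continuous_mult:
  assumes "u \<in> L2 S" "bounded (S::'a::euclidean_space set)" "continuous_on UNIV g"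
  shows "(\<lambda>x. g x * u x) \<in> L2 S"
proof -
  obtain B where "\<And>x. x \<in> S \<Longrightarrow> \<bar>g x\<bar> \<le> B"
    using continuous_bounded_on[OF assms(2,3)] by metis
  thus ?thesis
    by (rule L2_bounded_mult[OF assms(1) continuous_measurable_lebesgue_on[OF assms(3)]])
qed

lemma L2_limit_bounded_mult:
  assumes u: "\<And>n::nat. u n \<in> L2 S" "u' \<in> L2 S"
    and g: "g \<in> borel_measurable (lebesgue_on S)" "\<And>x. x \<in> S \<Longrightarrow> \<bar>g x\<bar> \<le> B"
    and lim: "(\<lambda>n. L2_norm S (\<lambda>x. u n x - u' x)) \<longlonglongrightarrow> 0"
  shows "(\<lambda>n. L2_norm S (\<lambda>x. g x * u n x - g x * u' x)) \<longlonglongrightarrow> 0"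
proof -
  have le: "L2_norm S (\<lambda>x. g x * u n x - g x * u' x) \<le> \<bar>B\<bar> * L2_norm S (\<lambda>x. u n x - u' x)" for n
  proof -
    note d = L2_diff[OF u(1)[of n] u(2)]
    have "L2_norm S (\<lambda>x. g x * (u n x - u' x)) \<le> L2_norm S (\<lambda>x. B * (u n x - u' x))"
      unfolding L2_norm_def
    proof (intro real_sqrt_le_mono Bochner_Integration.integral_mono)
      fix x assume "x \<in> space (lebesgue_on S)"
      hence "\<bar>g x\<bar> \<le> \<bar>B\<bar>" using g(2)[of x] by force
      thus "(g x * (u n x - u' x))\<^sup>2 \<le> (B * (u n x - u' x))\<^sup>2"
        by (simp add: power_mult_distrib mult_right_mono abs_le_square_iff)
    qed (use L2_bounded_mult[OF d g] L2_cmult[OF d, of B] in \<open>auto simp: L2_def\<close>)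
    thus ?thesis unfolding L2_norm_cmult by (simp add: right_diff_distrib)
  qed
  show ?thesis
    by (rule tendsto_sandwich[OF _ _ tendsto_const tendsto_mult_right_zero[OF lim, of "\<bar>B\<bar>"]]) (use le in auto)
qed

lemma L2_limit_continuous_mult:
  assumes "\<And>n::nat. u n \<in> L2 S" "u' \<in> L2 S" "bounded (S::'a::euclidean_space set)" "continuous_on UNIV g"
    and lim: "(\<lambda>n. L2_norm S (\<lambda>x. u n x - u' x)) \<longlonglongrightarrow> 0"
  shows "(\<lambda>n. L2_norm S (\<lambda>x. g x * u n x - g x * u' x)) \<longlonglongrightarrow> 0"
proof -
  obtain B where "\<And>x. x \<in> S \<Longrightarrow> \<bar>g x\<bar> \<le> B"
    using continuous_bounded_on[OF assms(3,4)] by metis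
  thus ?thesis
    by (rule L2_limit_bounded_mult[OF assms(1,2) continuous_measurable_lebesgue_on[OF assms(4)] _ lim])
qed

lemma L2_limit_add:
  assumes "\<And>n::nat. u n \<in> L2 S" "u' \<in> L2 S" "\<And>n. v n \<in> L2 S" "v' \<in> L2 S"
    and lim: "(\<lambda>n. L2_norm S (\<lambda>x. u n x - u' x)) \<longlonglongrightarrow> 0" "(\<lambda>n. L2_norm S (\<lambda>x. v n x - v' x)) \<longlonglongrightarrow> 0"
  shows "(\<lambda>n. L2_norm S (\<lambda>x. (u n x + v n x) - (u' x + v' x))) \<longlonglongrightarrow> 0"
proof (rule tendsto_sandwich[OF _ _ tendsto_const])
  show "(\<lambda>n. L2_norm S (\<lambda>x. u n x - u' x) + L2_norm S (\<lambda>x. v n x - v' x)) \<longlonglongrightarrow> 0"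
    using tendsto_add[OF lim] by simp
  have "L2_norm S (\<lambda>x. (u n x + v n x) - (u' x + v' x)) \<le> L2_norm S (\<lambda>x. u n x - u' x) + L2_norm S (\<lambda>x. v n x - v' x)" for n
    using L2_norm_triangle[OF L2_diff[OF assms(1)[of n] assms(2)] L2_diff[OF assms(3)[of n] assms(4)]]
    by (simp add: algebra_simps)
  thus "\<forall>\<^sub>F n in sequentially. L2_norm S (\<lambda>x. (u n x + v n x) - (u' x + v' x)) \<le> L2_norm S (\<lambda>x. u n x - u' x) + L2_norm S (\<lambda>x. v n x - v' x)"
    by simp
qed simp

lemma L2_limit_sum:
  assumes "finite I" "\<And>i n::nat. i \<in> I \<Longrightarrow> u i n \<in> L2 S" "\<And>i. i \<in> I \<Longrightarrow> u' i \<in> L2 S"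
    and lim: "\<And>i. i \<in> I \<Longrightarrow> (\<lambda>n. L2_norm S (\<lambda>x. u i n x - u' i x)) \<longlonglongrightarrow> 0"
  shows "(\<lambda>n. L2_norm S (\<lambda>x. (\<Sum>i\<in>I. u i n x) - (\<Sum>i\<in>I. u' i x))) \<longlonglongrightarrow> 0"
  using assms
proof (induction I rule: finite_induct)
  case empty thus ?case by (simp add: L2_norm_def)
next
  case (insert i I)
  have "(\<lambda>n. L2_norm S (\<lambda>x. (u i n x + (\<Sum>i\<in>I. u i n x)) - (u' i x + (\<Sum>i\<in>I. u' i x)))) \<longlonglongrightarrow> 0"
    by (intro L2_limit_add[where u="u i" and v="\<lambda>n x. \<Sum>i\<in>I. u i n x"] L2_sum insert) (use insert in auto)
  thus ?case using insert by simp
qed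

text \<open>For an approximant \<open>w n\<close> this is the weak derivative of \<open>v\<close>
  tested with the C1 function \<open>w n * \<eta>\<close>; both integrals are continuous under the
  two given limits. In effect, the \<open>b\<close>-derivative of \<open>p * v * \<eta>\<close> has
  integral 0.\<close>

lemma green_interior:
  fixes \<Omega> :: "'a::euclidean_space set"
  assumes \<Omega>: "open \<Omega>" "bounded \<Omega>" and b: "b \<in> Basis"
    and p: "p \<in> L2 \<Omega>" "q \<in> L2 \<Omega>" and w: "\<And>n::nat. Ck 1 (w n)"
    and lim: "(\<lambda>n. L2_norm \<Omega> (\<lambda>x. w n x - p x)) \<longlonglongrightarrow> 0" "(\<lambda>n. L2_norm \<Omega> (\<lambda>x. pd b (w n) x - q x)) \<longlonglongrightarrow> 0"
    and v: "v \<in> L2 \<Omega>" "vd \<in> L2 \<Omega>" "weak_pd_rel \<Omega> b v vd"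
    and \<eta>: "Ck 1 \<eta>" "csupp_in \<Omega> \<eta>"
  shows "(LINT x|lebesgue_on \<Omega>. p x * (pd b \<eta> x * v x + \<eta> x * vd x)) + (LINT x|lebesgue_on \<Omega>. q x * (\<eta> x * v x)) = 0"
proof -
  let ?z1 = "\<lambda>x. pd b \<eta> x * v x + \<eta> x * vd x" and ?z2 = "\<lambda>x. \<eta> x * v x"
  have z: "?z1 \<in> L2 \<Omega>" "?z2 \<in> L2 \<Omega>"
    using L2_add[OF L2_continuous_mult[OF v(1) \<Omega>(2) C1_continuous_pd[OF \<eta>(1) b]] L2_continuous_mult[OF v(2) \<Omega>(2) C1_continuous[OF \<eta>(1)]]]
      L2_continuous_mult[OF v(1) \<Omega>(2) C1_continuous[OF \<eta>(1)]] by auto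
  note C = C1_H1[OF \<Omega> w]
  have zero: "(LINT x|lebesgue_on \<Omega>. w n x * ?z1 x) + (LINT x|lebesgue_on \<Omega>. pd b (w n) x * ?z2 x) = 0" for n
  proof -
    have C1: "Ck 1 (\<lambda>x. w n x * \<eta> x)" by (rule Ck_mult[OF w \<eta>(1)])
    have e: "pd b (\<lambda>x. w n x * \<eta> x) x = pd b (w n) x * \<eta> x + w n x * pd b \<eta> x" for x
      using w[of n] \<eta>(1) by (intro pd_mult) auto
    have "(LINT x|lebesgue_on \<Omega>. v x * pd b (\<lambda>x. w n x * \<eta> x) x) = - (LINT x|lebesgue_on \<Omega>. vd x * (w n x * \<eta> x))"
      by (rule weak_pd_rel_C1[OF \<Omega> v b C1 csupp_in_mult_left[OF \<eta>(2)]])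
    moreover have "(LINT x|lebesgue_on \<Omega>. w n x * ?z1 x) + (LINT x|lebesgue_on \<Omega>. pd b (w n) x * ?z2 x)
       = (LINT x|lebesgue_on \<Omega>. v x * pd b (\<lambda>x. w n x * \<eta> x) x) + (LINT x|lebesgue_on \<Omega>. vd x * (w n x * \<eta> x))"
    proof -
      note i1 = L2_mult_integrable[OF C(1) z(1), of n] L2_mult_integrable[OF C(2)[OF b] z(2), of n]
      have l: "(\<lambda>x. w n x * \<eta> x) \<in> L2 \<Omega>" "pd b (\<lambda>x. w n x * \<eta> x) \<in> L2 \<Omega>" using C1_H1(1,2)[OF \<Omega> C1] b by auto
      note i2 = L2_mult_integrable[OF v(1) l(2)] L2_mult_integrable[OF v(2) l(1)]
      show ?thesis
        unfolding Bochner_Integration.integral_add[OF i1, symmetric] Bochner_Integration.integral_add[OF i2, symmetric]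
        unfolding e by (rule Bochner_Integration.integral_cong[OF refl]) (simp add: algebra_simps)
    qed
    ultimately show ?thesis by simp
  qed
  have "(\<lambda>n. (LINT x|lebesgue_on \<Omega>. w n x * ?z1 x) + (LINT x|lebesgue_on \<Omega>. pd b (w n) x * ?z2 x)) \<longlonglongrightarrow>
    (LINT x|lebesgue_on \<Omega>. p x * ?z1 x) + (LINT x|lebesgue_on \<Omega>. q x * ?z2 x)"
    by (intro tendsto_add L2_inner_tendsto C(1) C(2)[OF b] p z lim)
  thus ?thesis unfolding zero by (simp add: LIMSEQ_const_iff)
qed

section \<open>A cut-off profile and the one-dimensional layer inequality\<close>

text \<open>A C1 transition from 0 to 1 on the interval from 1 to 2. The weights 1, -2, 1 at the
  knots 1, 3/2, 2 cancel the quadratic and linear growth beyond 2, and the factor 2 makes the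
  remaining constant equal to 1; the derivative is a triangle of height 2.\<close>

definition step :: "real \<Rightarrow> real" where
  "step s = 2 * ((max 0 (s - 1))\<^sup>2 - 2 * (max 0 (s - 3/2))\<^sup>2 + (max 0 (s - 2))\<^sup>2)"

definition step' :: "real \<Rightarrow> real" where
  "step' s = 4 * (max 0 (s - 1) - 2 * max 0 (s - 3/2) + max 0 (s - 2))"

lemma max0_sq_deriv: "((\<lambda>t::real. (max 0 t)\<^sup>2) has_field_derivative 2 * max 0 t) (at t)"
proof -
  consider "t > 0" | "t < 0" | "t = 0" by linarith
  thus ?thesis
  proof cases
    case 1
    have "((\<lambda>t::real. t\<^sup>2) has_field_derivative 2 * max 0 t) (at t)"
      using 1 by (auto intro!: derivative_eq_intros)
    moreover have "\<forall>\<^sub>F x in nhds t. (max 0 x)\<^sup>2 = x\<^sup>2"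
      using eventually_nhds_in_open[of "{0<..}" t] 1 by (auto elim!: eventually_mono)
    ultimately show ?thesis by (subst DERIV_cong_ev[OF refl _ refl])
  next
    case 2
    have "((\<lambda>t::real. 0) has_field_derivative 2 * max 0 t) (at t)" using 2 by auto
    moreover have "\<forall>\<^sub>F x in nhds t. (max 0 x)\<^sup>2 = 0"
      using eventually_nhds_in_open[of "{..<0}" t] 2 by (auto elim!: eventually_mono)
    ultimately show ?thesis by (subst DERIV_cong_ev[OF refl _ refl])
  next
    case 3
    have "((\<lambda>h::real. (max 0 h)\<^sup>2 / h) \<longlongrightarrow> 0) (at 0)"
    proof (rule tendsto_rabs_zero_cancel, rule tendsto_sandwich[OF _ _ tendsto_const])
      show "((\<lambda>h::real. \<bar>h\<bar>) \<longlongrightarrow> 0) (at 0)" by (rule tendsto_rabs_zero) (rule tendsto_ident_at)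
      have "\<bar>(max 0 h)\<^sup>2 / h\<bar> \<le> \<bar>h\<bar>" for h :: real by (cases "h \<le> 0") (auto simp: max_def power2_eq_square)
      thus "\<forall>\<^sub>F h in at 0. \<bar>(max 0 h)\<^sup>2 / h\<bar> \<le> \<bar>h::real\<bar>" by simp
    qed simp
    thus ?thesis using 3 by (simp add: DERIV_def)
  qed
qed

lemma step_deriv: "(step has_field_derivative step' s) (at s)"
proof -
  have "((\<lambda>s::real. (max 0 (s - c))\<^sup>2) has_field_derivative 2 * max 0 (s - c)) (at s)" for c
  proof -
    have "((\<lambda>s. s - c) has_field_derivative 1) (at s)" by (auto intro!: derivative_eq_intros)
    from DERIV_chain2[OF max0_sq_deriv this] show ?thesis by simp
  qed
  note [derivative_intros] = this
  show ?thesis unfolding step_def[abs_def] step'_def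
    by (auto intro!: derivative_eq_intros simp: algebra_simps)
qed

lemma step_0: "s \<le> 1 \<Longrightarrow> step s = 0" by (simp add: step_def)
lemma step_1: "s \<ge> 2 \<Longrightarrow> step s = 1" by (simp add: step_def power2_eq_square algebra_simps)
lemma step'_0: "s \<le> 1 \<or> s \<ge> 2 \<Longrightarrow> step' s = 0" by (auto simp: step'_def)
lemma step'_bounds: "0 \<le> step' s" "step' s \<le> 2" by (auto simp: step'_def max_def)
lemma step'_abs: "\<bar>step' s\<bar> \<le> 2" using step'_bounds[of s] by simp
lemma step_bounds: "0 \<le> step s" "step s \<le> 1"
proof -
  have mono: "step a \<le> step b" if "a \<le> b" for a b
    using DERIV_nonneg_imp_nondecreasing[OF that] step_deriv step'_bounds by blast
  show "0 \<le> step s" using mono[of "min s 1" s] by (simp add: step_0)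
  show "step s \<le> 1" using mono[of s "max s 2"] by (simp add: step_1)
qed
lemma step_abs: "\<bar>step s\<bar> \<le> 1" using step_bounds[of s] by simp
lemma step'_continuous: "continuous_on S step'"
  unfolding step'_def[abs_def] by (intro continuous_intros)

lemma step_compose:
  assumes D: "Ck 1 D"
  shows "Ck 1 (\<lambda>x. step (c * D x))" "b \<in> Basis \<Longrightarrow> pd b (\<lambda>x. step (c * D x)) x = step' (c * D x) * (c * pd b D x)"
proof -
  have cD: "Ck 1 (\<lambda>x. c * D x)" by (rule Ck_mult[OF Ck_const D])
  have pcD: "pd b (\<lambda>x. c * D x) x = c * pd b D x" for b x
    using pd_mult[of "\<lambda>_. c" x D b] D by auto
  have d: "((\<lambda>x. step (c * D x)) has_derivative (\<lambda>z. step' (c * D x) * (\<Sum>b\<in>Basis. (z \<bullet> b) * pd b (\<lambda>x. c * D x) x))) (at x)" for x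
    using has_derivative_compose[OF C1_has_derivative[OF cD] step_deriv[THEN has_field_derivative_imp_has_derivative]] .
  have e: "(\<Sum>b'\<in>Basis. (b \<bullet> b') * pd b' (\<lambda>x. c * D x) x) = c * pd b D x" if "b \<in> Basis" for b x
  proof -
    have "(\<Sum>b'\<in>Basis. (b \<bullet> b') * pd b' (\<lambda>x. c * D x) x) = (\<Sum>b'\<in>Basis. if b' = b then c * pd b D x else 0)"
      by (rule sum.cong) (use that in \<open>auto simp: inner_Basis pcD\<close>)
    thus ?thesis using that by simp
  qed
  show "b \<in> Basis \<Longrightarrow> pd b (\<lambda>x. step (c * D x)) x = step' (c * D x) * (c * pd b D x)"
    unfolding pd_eqI[OF d] using e by simp
  show "Ck 1 (\<lambda>x. step (c * D x))"
  proof (rule C1I[OF d])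
    fix b :: 'a assume b: "b \<in> Basis"
    show "continuous_on UNIV (\<lambda>x. step' (c * D x) * (\<Sum>b'\<in>Basis. (b \<bullet> b') * pd b' (\<lambda>x. c * D x) x))"
      unfolding e[OF b]
      by (intro continuous_intros continuous_on_compose2[OF step'_continuous[of UNIV]] C1_continuous[OF D] C1_continuous_pd[OF D b]) auto
  qed
qed

text \<open>The increment \<open>q s - q 0\<close> is the integral of \<open>q'\<close>, so
  Cauchy-Schwarz bounds its square by \<open>d\<close> times the integral of the squared derivative;
  the factors 2 come from separating \<open>q 0\<close> from the increment.\<close>

lemma C1_square_bound:
  fixes q :: "real \<Rightarrow> real"
  assumes d: "\<And>s. (q has_field_derivative q' s) (at s)" and c: "continuous_on UNIV q'"
    and s: "0 \<le> s" "s \<le> d"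
  shows "(q s)\<^sup>2 \<le> 2 * (q 0)\<^sup>2 + 2 * d * integral {0..d} (\<lambda>s. (q' s)\<^sup>2)"
proof -
  have cs: "continuous_on S q'" for S using c continuous_on_subset by blast
  define I where "I = integral {0..s} (\<lambda>s. (q' s)\<^sup>2)"
  have i2: "(\<lambda>s. (q' s)\<^sup>2) integrable_on {a..b}" for a b
    by (intro integrable_continuous_interval continuous_intros cs)
  have ftc: "(q' has_integral (q s - q 0)) {0..s}"
    by (rule fundamental_theorem_of_calculus[OF s(1)])
       (use d in \<open>auto simp: has_real_derivative_iff_has_vector_derivative intro: has_vector_derivative_at_within\<close>)
  have "(q s - q 0)\<^sup>2 \<le> s * I"
  proof (cases "s = 0")
    case False
    \<comment> \<open>The mean slope. Expanding the integral of the square of \<open>q' - a\<close>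
      gives Cauchy-Schwarz for \<open>q'\<close> against the constant 1.\<close>
    define a where "a = (q s - q 0) / s"
    have "((\<lambda>t. (q' t)\<^sup>2 - 2 * a * q' t + a\<^sup>2) has_integral (I - 2 * a * (q s - q 0) + s * a\<^sup>2)) {0..s}"
    proof (intro has_integral_add has_integral_diff has_integral_mult_right)
      show "((\<lambda>t. (q' t)\<^sup>2) has_integral I) {0..s}" unfolding I_def using i2 by (rule integrable_integral)
      show "(q' has_integral (q s - q 0)) {0..s}" by (rule ftc)
      show "((\<lambda>_. a\<^sup>2) has_integral s * a\<^sup>2) {0..s}" using has_integral_const_real[of "a\<^sup>2" 0 s] s by simp
    qed
    moreover have "(q' t)\<^sup>2 - 2 * a * q' t + a\<^sup>2 \<ge> 0" for t
      using zero_le_power2[of "q' t - a"] by (simp add: power2_diff mult_ac)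
    ultimately have "0 \<le> I - 2 * a * (q s - q 0) + s * a\<^sup>2" by (rule has_integral_nonneg)
    hence "0 \<le> s * (I - 2 * a * (q s - q 0) + s * a\<^sup>2)" using s by simp
    also have "\<dots> = s * I - (q s - q 0)\<^sup>2" using False by (simp add: a_def field_simps power2_eq_square)
    finally show ?thesis by simp
  qed simp
  also have "s * I \<le> d * integral {0..d} (\<lambda>s. (q' s)\<^sup>2)"
  proof (rule mult_mono)
    show "I \<le> integral {0..d} (\<lambda>s. (q' s)\<^sup>2)" unfolding I_def
      by (rule integral_subset_le) (use i2 s in auto)
    show "0 \<le> I" unfolding I_def by (rule integral_nonneg[OF i2]) simp
  qed (use s in auto)
  finally have "(q s - q 0)\<^sup>2 \<le> d * integral {0..d} (\<lambda>s. (q' s)\<^sup>2)" .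
  moreover have "(q s)\<^sup>2 \<le> 2 * (q 0)\<^sup>2 + 2 * (q s - q 0)\<^sup>2"
    using zero_le_power2[of "q s - 2 * q 0"] by (simp add: power2_eq_square algebra_simps)
  ultimately show ?thesis by simp
qed

text \<open>Integration over the layer gains one more factor \<open>d\<close>. With nonnegative
  extended integrals the result can be integrated over the base points with measurability as the
  only concern.\<close>

lemma C1_square_bound_nn:
  fixes q :: "real \<Rightarrow> real"
  assumes d: "\<And>s. (q has_field_derivative q' s) (at s)" and c: "continuous_on UNIV q'" and d0: "0 \<le> d"
  shows "(\<integral>\<^sup>+s. indicator {0<..<d} s * ennreal ((q s)\<^sup>2) \<partial>lborel)
    \<le> ennreal (2 * d) * ennreal ((q 0)\<^sup>2) + ennreal (2 * d\<^sup>2) * (\<integral>\<^sup>+s. indicator {0<..<d} s * ennreal ((q' s)\<^sup>2) \<partial>lborel)"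
proof -
  let ?I = "integral {0..d} (\<lambda>s. (q' s)\<^sup>2)"
  let ?B = "2 * (q 0)\<^sup>2 + 2 * d * ?I"
  have i: "(\<lambda>s. (q' s)\<^sup>2) integrable_on {0..d}"
    by (intro integrable_continuous_interval continuous_intros continuous_on_subset[OF c]) auto
  have I0: "0 \<le> ?I" by (rule integral_nonneg[OF i]) simp
  have m: "q' \<in> borel_measurable borel" using borel_measurable_continuous_onI[OF c] .
  have "(\<integral>\<^sup>+s. indicator {0<..<d} s * ennreal ((q s)\<^sup>2) \<partial>lborel) \<le> (\<integral>\<^sup>+s. ennreal ?B * indicator {0<..<d} s \<partial>lborel)"
  proof (rule nn_integral_mono)
    fix s show "indicator {0<..<d} s * ennreal ((q s)\<^sup>2) \<le> ennreal ?B * indicator {0<..<d} s"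
      using C1_square_bound[OF d c, of s d] by (auto simp: indicator_def intro!: ennreal_leI)
  qed
  also have "\<dots> = ennreal ?B * ennreal d" using d0 by (simp add: nn_integral_cmult_indicator)
  also have "\<dots> = ennreal (2 * d) * ennreal ((q 0)\<^sup>2) + ennreal (2 * d\<^sup>2) * ennreal ?I"
    using d0 I0 by (simp add: ennreal_mult'[symmetric] ennreal_plus[symmetric] power2_eq_square algebra_simps del: ennreal_plus)
  also have "ennreal ?I = (\<integral>\<^sup>+s. indicator {0..d} s * ennreal ((q' s)\<^sup>2) \<partial>lborel)"
  proof -
    have "(\<integral>\<^sup>+s. indicator {0..d} s * ennreal ((q' s)\<^sup>2) \<partial>lborel) = (\<integral>\<^sup>+s. ennreal (indicator {0..d} s * (q' s)\<^sup>2) \<partial>lborel)"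
      by (intro nn_integral_cong) (auto simp: indicator_def)
    also have "\<dots> = ennreal ?I"
    proof -
      have si: "set_integrable lborel {0..d} (\<lambda>s. (q' s)\<^sup>2)"
        unfolding set_integrable_def
        by (rule borel_integrable_compact) (auto intro!: continuous_intros continuous_on_subset[OF c])
      from set_borel_integral_eq_integral(2)[OF si] si show ?thesis
        by (subst nn_integral_eq_integral) (auto simp: set_integrable_def set_lebesgue_integral_def)
    qed
    finally show ?thesis by simp
  qed
  also have "\<dots> = (\<integral>\<^sup>+s. indicator {0<..<d} s * ennreal ((q' s)\<^sup>2) \<partial>lborel)"
  proof (rule nn_integral_cong_AE)
    show "AE s in lborel. indicator {0..d} s * ennreal ((q' s)\<^sup>2) = indicator {0<..<d} s * ennreal ((q' s)\<^sup>2)"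
      using AE_lborel_singleton[of 0] AE_lborel_singleton[of d]
      by eventually_elim (auto simp: indicator_def)
  qed
  finally show ?thesis .
qed

section \<open>Three-space as a product of a plane and a line\<close>

lemma Basis_real2: "(Basis::(real^2) set) = {axis 1 1, axis 2 1}"
  by (auto simp: Basis_vec_def exhaust_2) (metis exhaust_2)

lemma Basis_real3: "(Basis::(real^3) set) = {axis 1 1, axis 2 1, axis 3 1}"
  by (auto simp: Basis_vec_def exhaust_3) (metis exhaust_3)

lemma sum_Basis_real2: "(\<Sum>b\<in>(Basis::(real^2) set). f b) = f (axis 1 1) + f (axis 2 1)"
  unfolding Basis_real2 by (subst sum.insert) (auto simp: axis_eq_axis)

lemma prod_Basis_real2:
  fixes f :: "real^2 \<Rightarrow> 'c::comm_monoid_mult"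
  shows "(\<Prod>b\<in>(Basis::(real^2) set). f b) = f (axis 1 1) * f (axis 2 1)"
  unfolding Basis_real2 by (subst prod.insert) (auto simp: axis_eq_axis)

lemma prod_Basis_real3:
  fixes f :: "real^3 \<Rightarrow> 'c::comm_monoid_mult"
  shows "(\<Prod>b\<in>(Basis::(real^3) set). f b) = f (axis 1 1) * (f (axis 2 1) * f (axis 3 1))"
  unfolding Basis_real3 by (subst prod.insert, simp, simp add: axis_eq_axis)+ simp

text \<open>The identification of a plane times a line with three-space, through which product
  measure and Fubini's theorem become available for integrals along the third coordinate.\<close>

definition glue :: "(real^2) \<times> real \<Rightarrow> real^3" where
  "glue = (\<lambda>(y, s). vector [y $ 1, y $ 2, s])"

lemma glue_nth [simp]: "glue (y, s) $ 1 = y $ 1" "glue (y, s) $ 2 = y $ 2" "glue (y, s) $ 3 = s"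
  by (auto simp: glue_def)

lemma glue_continuous: "continuous_on S glue"
proof -
  have "linear glue"
    by (rule linearI) (auto simp: vec_eq_iff forall_3 split: prod.splits)
  thus ?thesis by (simp add: linear_continuous_on linear_conv_bounded_linear)
qed

text \<open>It suffices to compare boxes, and the preimage of a box is the product of a planar box
  and an interval.\<close>

lemma lborel_glue: "distr lborel borel glue = (lborel :: (real^3) measure)"
proof (rule lborel_eqI[symmetric])
  have gm: "glue \<in> borel_measurable borel" by (rule borel_measurable_continuous_onI[OF glue_continuous])
  fix l u :: "real^3" assume le: "\<And>b. b \<in> Basis \<Longrightarrow> l \<bullet> b \<le> u \<bullet> b"
  have le': "l $ i \<le> u $ i" for i using le[of "axis i 1"] by (simp add: axis_in_Basis_iff inner_axis)
  let ?l = "vector [l $ 1, l $ 2] :: real^2" and ?u = "vector [u $ 1, u $ 2] :: real^2"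
  have pre: "glue -` box l u = box ?l ?u \<times> {l $ 3 <..< u $ 3}"
    by (auto simp: mem_box_cart forall_3 forall_2)
  have "emeasure (distr lborel borel glue) (box l u) = emeasure (lborel \<Otimes>\<^sub>M lborel) (box ?l ?u \<times> {l $ 3 <..< u $ 3})"
    using gm by (subst emeasure_distr) (auto simp: pre lborel_prod)
  also have "\<dots> = emeasure lborel (box ?l ?u) * emeasure lborel {l $ 3 <..< u $ 3}"
    by (subst lborel.emeasure_pair_measure_Times) auto
  also have "emeasure lborel (box ?l ?u) = ennreal ((u $ 1 - l $ 1) * (u $ 2 - l $ 2))"
  proof -
    have "(\<Prod>b\<in>(Basis::(real^2) set). (?u - ?l) \<bullet> b) = (u $ 1 - l $ 1) * (u $ 2 - l $ 2)"
      unfolding prod_Basis_real2 by (simp add: inner_axis)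
    moreover have "\<forall>b\<in>Basis. ?l \<bullet> b \<le> ?u \<bullet> b"
      unfolding Basis_real2 using le' by (simp add: inner_axis)
    ultimately show ?thesis by (simp add: emeasure_lborel_box_eq)
  qed
  also have "emeasure lborel {l $ 3 <..< u $ 3} = ennreal (u $ 3 - l $ 3)" using le' by simp
  also have "ennreal ((u $ 1 - l $ 1) * (u $ 2 - l $ 2)) * ennreal (u $ 3 - l $ 3) = ennreal (\<Prod>b\<in>Basis. (u - l) \<bullet> b)"
    using le' by (simp add: prod_Basis_real3 inner_axis ennreal_mult[symmetric])
  finally show "emeasure (distr lborel borel glue) (box l u) = ennreal (\<Prod>b\<in>Basis. (u - l) \<bullet> b)" .
qed simp

text \<open>Boxes again suffice: the preimage of a box is its image under the inverse rotation,
  which preserves Lebesgue measure.\<close>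

lemma lborel_orthogonal:
  fixes R :: "real^3 \<Rightarrow> real^3"
  assumes R: "orthogonal_transformation R"
  shows "distr lborel borel R = lborel"
proof (rule lborel_eqI[symmetric])
  have cR: "continuous_on UNIV R" using R orthogonal_transformation_linear linear_continuous_on linear_conv_bounded_linear by blast
  have gm: "R \<in> borel_measurable borel" by (rule borel_measurable_continuous_onI[OF cR])
  have iR: "orthogonal_transformation (inv R)" by (rule orthogonal_transformation_inv[OF R])
  have bij: "bij R" by (rule orthogonal_transformation_bij[OF R])
  fix l u :: "real^3" assume le: "\<And>b. b \<in> Basis \<Longrightarrow> l \<bullet> b \<le> u \<bullet> b"
  have pre: "R -` box l u = inv R ` box l u" using bij by (simp add: bij_vimage_eq_inv_image)
  have meas: "inv R ` box l u \<in> lmeasurable" "measure lebesgue (inv R ` box l u) = measure lebesgue (box l u)"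
    using measurable_orthogonal_image[OF iR] measure_orthogonal_image[OF iR] by auto
  have op: "open (R -` box l u)" by (rule open_vimage[OF open_box cR])
  have "emeasure (distr lborel borel R) (box l u) = emeasure lborel (R -` box l u)"
    using gm by (subst emeasure_distr) auto
  also have "\<dots> = emeasure lebesgue (R -` box l u)" using op by simp
  also have "\<dots> = ennreal (measure lebesgue (box l u))"
    using meas unfolding pre by (simp add: emeasure_eq_measure2 fmeasurableD2)
  also have "\<dots> = ennreal (\<Prod>b\<in>Basis. (u - l) \<bullet> b)"
    using le by (simp add: measure_lborel_box_eq)
  finally show "emeasure (distr lborel borel R) (box l u) = ennreal (\<Prod>b\<in>Basis. (u - l) \<bullet> b)" .
qed simp

section \<open>Boundary charts\<close>

context
  fixes \<Omega> :: "(real^3) set" and p :: "real^3" and r :: real and R :: "real^3 \<Rightarrow> real^3" and h :: "real^2 \<Rightarrow> real"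
  assumes chart: "boundary_chart \<Omega> p r R h"
begin

definition base :: "real^3 \<Rightarrow> real^2" where "base x = vector [R x $ 1, R x $ 2]"

text \<open>Height above the graph in the rotated coordinates, not the distance to the boundary: it
  is as smooth as \<open>h\<close>, and it grows at unit speed along \<open>up\<close>.\<close>

definition depth :: "real^3 \<Rightarrow> real" where "depth x = R x $ 3 - h (base x)"

text \<open>The derivative of \<open>depth\<close> in direction \<open>b\<close>, as a function of
  the base point. It is the inward normal component of \<open>b\<close> before
  normalisation.\<close>

definition conormal :: "real^3 \<Rightarrow> real^2 \<Rightarrow> real" where
  "conormal b y = R b $ 3 - (R b $ 1 * pd (axis 1 1) h y + R b $ 2 * pd (axis 2 1) h y)"

definition up :: "real^3" where "up = inv R (axis 3 1)"

lemma chartD: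
  "0 < r" "orthogonal_transformation R" "Ck 1 h" "linear R" "linear (inv R)" "bij R"
  "orthogonal_transformation (inv R)" "R (inv R x) = x" "inv R (R x) = x"
proof -
  show "0 < r" and R: "orthogonal_transformation R" and "Ck 1 h"
    using chart unfolding boundary_chart_def by blast+
  show "linear R" by (rule orthogonal_transformation_linear[OF R])
  show i: "orthogonal_transformation (inv R)" by (rule orthogonal_transformation_inv[OF R])
  show "linear (inv R)" by (rule orthogonal_transformation_linear[OF i])
  show b: "bij R" by (rule orthogonal_transformation_bij[OF R])
  show "R (inv R x) = x" by (rule surj_f_inv_f[OF bij_is_surj[OF b]])
  show "inv R (R x) = x" by (rule inv_f_f[OF bij_is_inj[OF b]])
qed

lemma bounded_linear_base: "bounded_linear base"
proof -
  have "linear base"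
  proof (rule linearI)
    fix x y :: "real^3" and c :: real
    show "base (x + y) = base x + base y"
      using linear_add[OF chartD(4)] by (simp add: base_def vec_eq_iff forall_2)
    show "base (c *\<^sub>R x) = c *\<^sub>R base x"
      using linear_scale[OF chartD(4)] by (simp add: base_def vec_eq_iff forall_2)
  qed
  thus ?thesis by (simp add: linear_conv_bounded_linear)
qed

lemma rotation_cont: "continuous_on S R" "continuous_on S (inv R)"
  using chartD(4,5) linear_continuous_on linear_conv_bounded_linear by blast+

lemma base_cont: "continuous_on S base"
  using bounded_linear_base by (rule linear_continuous_on)

lemma profile_cont: "continuous_on S h"
  using chartD(3) by (rule C1_continuous)

lemma depth_cont: "continuous_on S depth"
  unfolding depth_def
  by (intro continuous_intros rotation_cont continuous_on_compose2[OF profile_cont[of UNIV]] base_cont) auto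

lemma conormal_cont: "continuous_on S (conormal b)"
  unfolding conormal_def by (intro continuous_intros C1_continuous_pd chartD) (simp_all add: axis_in_Basis_iff)

lemma depth_deriv: "(depth has_derivative (\<lambda>z. conormal z (base x))) (at x)"
proof -
  note lb = bounded_linear_base
  have lR: "bounded_linear (\<lambda>x. R x $ 3)"
    using chartD(4) by (simp add: bounded_linear_compose[OF bounded_linear_vec_nth] linear_conv_bounded_linear)
  have "((\<lambda>x. h (base x)) has_derivative (\<lambda>z. \<Sum>b\<in>Basis. (base z \<bullet> b) * pd b h (base x))) (at x)"
    by (rule has_derivative_compose[OF bounded_linear_imp_has_derivative[OF lb] C1_has_derivative[OF chartD(3)]])
  from has_derivative_diff[OF bounded_linear_imp_has_derivative[OF lR] this]
  show ?thesis
    unfolding depth_def[abs_def] conormal_def[abs_def] sum_Basis_real2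
    by (simp add: base_def inner_axis)
qed

lemma depth_C1: "Ck 1 depth" and pd_depth: "pd b depth x = conormal b (base x)"
proof -
  show "Ck 1 depth"
    by (rule C1I[OF depth_deriv]) (intro continuous_on_compose2[OF conormal_cont[of UNIV]] base_cont, auto)
  show "pd b depth x = conormal b (base x)" using pd_eqI[OF depth_deriv] .
qed

lemma chart_point_up: "chart_point R h y + s *\<^sub>R up = inv R (glue (y, h y + s))"
proof -
  have "glue (y, h y + s) = vector [y $ 1, y $ 2, h y] + s *\<^sub>R axis 3 1"
    by (auto simp: vec_eq_iff forall_3 axis_def)
  thus ?thesis
    by (simp add: chart_point_def up_def linear_add[OF chartD(5)] linear_scale[OF chartD(5)])
qed

lemma base_chart [simp]: "base (chart_point R h y + s *\<^sub>R up) = y"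
  and depth_chart [simp]: "depth (chart_point R h y + s *\<^sub>R up) = s"
proof -
  show 1: "base (chart_point R h y + s *\<^sub>R up) = y"
    by (simp add: chart_point_up base_def chartD vec_eq_iff forall_2)
  show "depth (chart_point R h y + s *\<^sub>R up) = s"
    unfolding depth_def 1 by (simp add: chart_point_up chartD)
qed

lemma chart_point_cont: "continuous_on S (chart_point R h)"
proof -
  have e: "chart_point R h = (\<lambda>y. inv R (glue (y, h y)))" using chart_point_up[of _ 0] by auto
  show ?thesis unfolding e
    by (intro continuous_on_compose2[OF rotation_cont(2)[of UNIV]] continuous_on_compose2[OF glue_continuous[of UNIV]]
        continuous_intros profile_cont) auto
qed

text \<open>The coordinates are a rotation followed, for each \<open>y\<close>, by a translation of
  the last variable by \<open>h y\<close>. Both preserve measure, so no Jacobian appears.\<close>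

lemma nn_integral_chart:
  assumes F: "F \<in> borel_measurable borel"
  shows "(\<integral>\<^sup>+x. F x \<partial>lborel) = (\<integral>\<^sup>+y. \<integral>\<^sup>+s. F (chart_point R h y + s *\<^sub>R up) \<partial>lborel \<partial>lborel)"
proof -
  note [measurable] = F borel_measurable_continuous_onI[OF rotation_cont(2)] borel_measurable_continuous_onI[OF glue_continuous]
    borel_measurable_continuous_onI[OF profile_cont]
  have [measurable]: "inv R \<in> measurable lborel borel" "glue \<in> measurable lborel borel" 
    by (simp_all)
  have "(\<integral>\<^sup>+x. F x \<partial>lborel) = (\<integral>\<^sup>+x. F x \<partial>distr lborel borel (inv R))"
    using lborel_orthogonal[OF chartD(7)] by simp
  also have "\<dots> = (\<integral>\<^sup>+x. F (inv R x) \<partial>lborel)" by (subst nn_integral_distr) auto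
  also have "\<dots> = (\<integral>\<^sup>+x. F (inv R x) \<partial>distr lborel borel glue)" using lborel_glue by simp
  also have "\<dots> = (\<integral>\<^sup>+z. F (inv R (glue z)) \<partial>lborel)" by (subst nn_integral_distr) auto
  also have "\<dots> = (\<integral>\<^sup>+z. F (inv R (glue z)) \<partial>(lborel \<Otimes>\<^sub>M lborel))" by (simp add: lborel_prod)
  also have "\<dots> = (\<integral>\<^sup>+y. \<integral>\<^sup>+s. F (inv R (glue (y, s))) \<partial>lborel \<partial>lborel)"
    by (subst lborel.nn_integral_fst[symmetric]) (simp_all add: lborel_prod)
  also have "\<dots> = (\<integral>\<^sup>+y. \<integral>\<^sup>+s. F (inv R (glue (y, h y + s))) \<partial>lborel \<partial>lborel)"
  proof (rule nn_integral_cong)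
    fix y :: "real^2"
    have 1: "glue \<circ> Pair y \<in> borel_measurable borel"
      by (rule borel_measurable_continuous_onI) (unfold o_def, intro continuous_on_compose2[OF glue_continuous[of UNIV]] continuous_intros, auto)
    have "(\<lambda>s. F (inv R (glue (y, s)))) \<in> borel_measurable borel"
      using measurable_compose[OF measurable_compose[OF 1, of "inv R" borel] F] by (simp add: o_def)
    from nn_integral_real_affine[OF this, of 1 "h y"]
    show "(\<integral>\<^sup>+s. F (inv R (glue (y, s))) \<partial>lborel) = (\<integral>\<^sup>+s. F (inv R (glue (y, h y + s))) \<partial>lborel)"
      by (simp add: one_ennreal_def[symmetric])
  qed
  finally show ?thesis by (simp add: chart_point_up)
qed

lemma in_domain_iff: "x \<in> ball p r \<Longrightarrow> x \<in> \<Omega> \<longleftrightarrow> 0 < depth x"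
  using chart unfolding boundary_chart_def depth_def base_def by fastforce

text \<open>The coefficients \<open>a\<close> are frozen and stand for the conormal at a fixed base
  point. This matters because \<open>h\<close> is only C1: the conormal is merely continuous and
  could not be differentiated in other directions.\<close>

lemma line_deriv:
  assumes \<eta>: "\<And>b. b \<in> Basis \<Longrightarrow> Ck 1 (u b)"
  shows "((\<lambda>s. \<Sum>b\<in>Basis. u b (x + s *\<^sub>R up) * a b) has_field_derivative
      (\<Sum>b\<in>Basis. (\<Sum>c\<in>Basis. (up \<bullet> c) * pd c (u b) (x + s *\<^sub>R up)) * a b)) (at s)"
proof -
  have "((\<lambda>s. u b (x + s *\<^sub>R up)) has_derivative (\<lambda>z. \<Sum>c\<in>Basis. ((z *\<^sub>R up) \<bullet> c) * pd c (u b) (x + s *\<^sub>R up))) (at s)"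
    if "b \<in> Basis" for b
    by (rule has_derivative_compose[OF _ C1_has_derivative[OF \<eta>[OF that]]]) (auto intro!: derivative_eq_intros)
  hence "((\<lambda>s. u b (x + s *\<^sub>R up)) has_field_derivative (\<Sum>c\<in>Basis. (up \<bullet> c) * pd c (u b) (x + s *\<^sub>R up))) (at s)"
    if "b \<in> Basis" for b
    unfolding has_field_derivative_def
    by (rule has_derivative_eq_rhs[OF _ ext]) (use that in \<open>auto simp: sum_distrib_left mult_ac intro!: sum.cong\<close>)
  note D = this
  show ?thesis by (intro DERIV_sum DERIV_cmult_right D)
qed

text \<open>The conormal is constant along \<open>up\<close>, so it suffices to integrate in that direction, starting
  from the boundary.\<close>

lemma layer_estimate:
  assumes u: "\<And>b. b \<in> Basis \<Longrightarrow> Ck 1 (u b)" and d: "0 \<le> d"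
  defines "f \<equiv> \<lambda>x. \<Sum>b\<in>Basis. u b x * conormal b (base x)"
    and "g \<equiv> \<lambda>x. \<Sum>b\<in>Basis. (\<Sum>c\<in>Basis. (up \<bullet> c) * pd c (u b) x) * conormal b (base x)"
  shows "(\<integral>\<^sup>+x. indicator {x. 0 < depth x \<and> depth x < d} x * ennreal ((f x)\<^sup>2) \<partial>lborel)
    \<le> ennreal (2 * d) * (\<integral>\<^sup>+y. ennreal ((f (chart_point R h y))\<^sup>2) \<partial>lborel)
      + ennreal (2 * d\<^sup>2) * (\<integral>\<^sup>+x. indicator {x. 0 < depth x \<and> depth x < d} x * ennreal ((g x)\<^sup>2) \<partial>lborel)"
proof -
  let ?A = "{x. 0 < depth x \<and> depth x < d}"
  let ?P = "\<lambda>y s. chart_point R h y + s *\<^sub>R up"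
  have cn: "continuous_on UNIV (\<lambda>x. conormal b (base x))" for b
    by (rule continuous_on_compose2[OF conormal_cont[of UNIV] base_cont]) auto
  have cf: "continuous_on UNIV f" unfolding f_def
    by (intro continuous_intros cn C1_continuous u)
  have cg: "continuous_on UNIV g" unfolding g_def
    by (intro continuous_intros cn C1_continuous_pd u)
  note [measurable] = borel_measurable_continuous_onI[OF cf] borel_measurable_continuous_onI[OF cg]
    borel_measurable_continuous_onI[OF depth_cont] borel_measurable_continuous_onI[OF chart_point_cont]
  have Am[measurable]: "?A \<in> sets borel" by measurable
  have F: "(\<lambda>x. indicator ?A x * ennreal ((f x)\<^sup>2)) \<in> borel_measurable borel"
    and G: "(\<lambda>x. indicator ?A x * ennreal ((g x)\<^sup>2)) \<in> borel_measurable borel" by measurable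
  have ind: "indicator ?A (?P y s) = (indicator {0<..<d} s :: ennreal)" for y s by (simp add: indicator_def)
  have cP: "continuous_on UNIV (\<lambda>z. ?P (fst z) (snd z))"
    by (intro continuous_intros continuous_on_compose2[OF chart_point_cont[of UNIV]]) auto
  have Gm: "(\<lambda>y. \<integral>\<^sup>+s. indicator {0<..<d} s * ennreal ((g (?P y s))\<^sup>2) \<partial>lborel) \<in> borel_measurable lborel"
  proof -
    have "(\<lambda>z. g (?P (fst z) (snd z))) \<in> borel_measurable borel"
      by (rule borel_measurable_continuous_onI[OF continuous_on_compose2[OF cg cP]]) auto
    hence [measurable]: "(\<lambda>z. g (?P (fst z) (snd z))) \<in> borel_measurable (lborel \<Otimes>\<^sub>M lborel)"
      by (simp add: lborel_prod)
    have "(\<lambda>z. indicator {0<..<d} (snd z) * ennreal ((g (?P (fst z) (snd z)))\<^sup>2)) \<in> borel_measurable (lborel \<Otimes>\<^sub>M lborel)"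
      by measurable
    from lborel.borel_measurable_nn_integral_fst[OF this] show ?thesis by simp
  qed
  have Fm: "(\<lambda>y. ennreal ((f (chart_point R h y))\<^sup>2)) \<in> borel_measurable lborel"
    by measurable
  have "(\<integral>\<^sup>+x. indicator ?A x * ennreal ((f x)\<^sup>2) \<partial>lborel)
      = (\<integral>\<^sup>+y. \<integral>\<^sup>+s. indicator {0<..<d} s * ennreal ((f (?P y s))\<^sup>2) \<partial>lborel \<partial>lborel)"
    unfolding nn_integral_chart[OF F] ind ..
  also have "\<dots> \<le> (\<integral>\<^sup>+y. ennreal (2 * d) * ennreal ((f (chart_point R h y))\<^sup>2)
      + ennreal (2 * d\<^sup>2) * (\<integral>\<^sup>+s. indicator {0<..<d} s * ennreal ((g (?P y s))\<^sup>2) \<partial>lborel) \<partial>lborel)"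
  proof (rule nn_integral_mono)
    fix y
    have "((\<lambda>s. f (?P y s)) has_field_derivative g (?P y s)) (at s)" for s
      unfolding f_def g_def base_chart by (rule line_deriv[OF u])
    moreover have "continuous_on UNIV (\<lambda>s. g (?P y s))"
      by (intro continuous_on_compose2[OF cg] continuous_intros) auto
    ultimately show "(\<integral>\<^sup>+s. indicator {0<..<d} s * ennreal ((f (?P y s))\<^sup>2) \<partial>lborel)
        \<le> ennreal (2 * d) * ennreal ((f (chart_point R h y))\<^sup>2)
      + ennreal (2 * d\<^sup>2) * (\<integral>\<^sup>+s. indicator {0<..<d} s * ennreal ((g (?P y s))\<^sup>2) \<partial>lborel)"
      using C1_square_bound_nn[of "\<lambda>s. f (?P y s)" "\<lambda>s. g (?P y s)" d] d by simp
  qed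
  also have "\<dots> = ennreal (2 * d) * (\<integral>\<^sup>+y. ennreal ((f (chart_point R h y))\<^sup>2) \<partial>lborel)
      + ennreal (2 * d\<^sup>2) * (\<integral>\<^sup>+y. \<integral>\<^sup>+s. indicator {0<..<d} s * ennreal ((g (?P y s))\<^sup>2) \<partial>lborel \<partial>lborel)"
    using Gm Fm by (simp add: nn_integral_add nn_integral_cmult)
  also have "(\<integral>\<^sup>+y. \<integral>\<^sup>+s. indicator {0<..<d} s * ennreal ((g (?P y s))\<^sup>2) \<partial>lborel \<partial>lborel)
      = (\<integral>\<^sup>+x. indicator ?A x * ennreal ((g x)\<^sup>2) \<partial>lborel)"
    unfolding nn_integral_chart[OF G] ind ..
  finally show ?thesis .
qed

lemma area_elem_ge_1: "area_elem h y \<ge> 1"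
  unfolding area_elem_def by (simp add: real_le_rsqrt)

text \<open>\<open>inv R\<close> is an isometry and passes to the other side of the inner product as
  \<open>R\<close>. A vanishing normal component can thus be stated with the conormal, since the two
  differ by a nonzero factor.\<close>

lemma outward_normal_conormal:
  "outward_normal R h y \<bullet> b = - conormal b y / area_elem h y"
proof -
  let ?v = "vector [pd (axis 1 1) h y, pd (axis 2 1) h y, -1] :: real^3"
  have "inv R ?v \<bullet> b = ?v \<bullet> R b"
    using chartD(2,8) unfolding orthogonal_transformation_def by metis
  also have "\<dots> = - conormal b y" by (simp add: inner_vec_def sum_3 conormal_def)
  finally show ?thesis by (simp add: outward_normal_def)
qed

text \<open>The limit traces \<open>g\<close> have zero conormal component, so they may be
  subtracted from the approximants for free. What is left is controlled by the trace convergence: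
  \<open>\<eta>\<close> makes the coefficients bounded and confines the integral to the chart, and
  \<open>area_elem\<close> is at least 1.\<close>

lemma boundary_term_tendsto:
  fixes w :: "real^3 \<Rightarrow> nat \<Rightarrow> real^3 \<Rightarrow> real"
  assumes w: "\<And>b n. b \<in> Basis \<Longrightarrow> Ck 1 (w b n)"
    and gm: "\<And>b. b \<in> Basis \<Longrightarrow> (\<lambda>y. g b (chart_point R h y)) \<in> borel_measurable (lebesgue_on (chart_dom p r R h))"
    and lim: "\<And>b. b \<in> Basis \<Longrightarrow> (\<lambda>n. \<integral>\<^sup>+ y. ennreal ((w b n (chart_point R h y) - g b (chart_point R h y))\<^sup>2 * area_elem h y)
                 \<partial>lebesgue_on (chart_dom p r R h)) \<longlonglongrightarrow> 0"
    and N0: "AE y in lebesgue_on (chart_dom p r R h).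
             0 = (\<Sum>b\<in>Basis. g b (chart_point R h y) * (outward_normal R h y \<bullet> b))"
    and \<eta>: "continuous_on UNIV \<eta>" and K: "compact K" "K \<subseteq> ball p r" "\<And>x. x \<notin> K \<Longrightarrow> \<eta> x = 0"
  shows "(\<lambda>n. \<integral>\<^sup>+y. ennreal ((\<Sum>b\<in>Basis. \<eta> (chart_point R h y) * w b n (chart_point R h y) * conormal b y)\<^sup>2) \<partial>lborel) \<longlonglongrightarrow> 0"
proof -
  let ?U = "chart_dom p r R h" and ?cp = "chart_point R h"
  have Uo: "open ?U"
  proof -
    have "?U = ?cp -` ball p r" by (auto simp: chart_dom_def)
    thus ?thesis using chart_point_cont[of UNIV] by (simp add: open_vimage)
  qed
  have Us: "?U \<in> sets lebesgue" using Uo by auto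
  have cn: "continuous_on S (\<lambda>x. \<eta> x * conormal b (base x))" for b S
    by (intro continuous_on_mult continuous_on_compose2[OF conormal_cont[of UNIV] base_cont] continuous_on_subset[OF \<eta>]) auto
  have "\<exists>B. \<forall>x. \<bar>\<eta> x * conormal b (base x)\<bar> \<le> B" for b
  proof -
    have "compact ((\<lambda>x. \<eta> x * conormal b (base x)) ` K)" by (intro compact_continuous_image cn K)
    from compact_imp_bounded[OF this]
    obtain B where "\<forall>x\<in>K. \<bar>\<eta> x * conormal b (base x)\<bar> \<le> B"
      unfolding bounded_iff by auto
    hence "\<forall>x. \<bar>\<eta> x * conormal b (base x)\<bar> \<le> max B 0" using K(3) by (metis abs_zero max.cobounded2 max.coboundedI1 mult_zero_left)
    thus ?thesis by blast
  qed
  then obtain B where B: "\<And>b x. \<bar>\<eta> x * conormal b (base x)\<bar> \<le> B b" by metis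
  define M where "M = (\<Sum>b\<in>(Basis::(real^3) set). (B b)\<^sup>2)"
  let ?t = "\<lambda>n b y. (w b n (?cp y) - g b (?cp y))\<^sup>2 * area_elem h y"
  have area_m: "area_elem h \<in> borel_measurable (lebesgue_on ?U)"
    unfolding area_elem_def
    by (intro continuous_measurable_lebesgue_on continuous_intros C1_continuous_pd chartD) (simp_all add: axis_in_Basis_iff)
  have wm: "(\<lambda>y. w b n (?cp y)) \<in> borel_measurable (lebesgue_on ?U)" if "b \<in> Basis" for b n
    by (intro continuous_measurable_lebesgue_on continuous_on_compose2[OF C1_continuous[OF w[OF that], of UNIV]] chart_point_cont) auto
  have le: "(\<integral>\<^sup>+y. ennreal ((\<Sum>b\<in>Basis. \<eta> (?cp y) * w b n (?cp y) * conormal b y)\<^sup>2) \<partial>lborel)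
      \<le> ennreal M * (\<Sum>b\<in>Basis. \<integral>\<^sup>+ y. ennreal (?t n b y) \<partial>lebesgue_on ?U)" for n
  proof -
    have "(\<integral>\<^sup>+y. ennreal ((\<Sum>b\<in>Basis. \<eta> (?cp y) * w b n (?cp y) * conormal b y)\<^sup>2) \<partial>lborel)
        = (\<integral>\<^sup>+y. ennreal ((\<Sum>b\<in>Basis. \<eta> (?cp y) * w b n (?cp y) * conormal b y)\<^sup>2) \<partial>lebesgue)"
      by (simp add: nn_integral_completion)
    also have "\<dots> = (\<integral>\<^sup>+y. ennreal ((\<Sum>b\<in>Basis. \<eta> (?cp y) * w b n (?cp y) * conormal b y)\<^sup>2) * indicator ?U y \<partial>lebesgue)"
    proof (rule nn_integral_cong)
      fix y
      have "\<eta> (?cp y) = 0" if "y \<notin> ?U" using that K(2) by (intro K(3)) (auto simp: chart_dom_def)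
      thus "ennreal ((\<Sum>b\<in>Basis. \<eta> (?cp y) * w b n (?cp y) * conormal b y)\<^sup>2)
        = ennreal ((\<Sum>b\<in>Basis. \<eta> (?cp y) * w b n (?cp y) * conormal b y)\<^sup>2) * indicator ?U y"
        by (cases "y \<in> ?U") auto
    qed
    also have "\<dots> = (\<integral>\<^sup>+y. ennreal ((\<Sum>b\<in>Basis. \<eta> (?cp y) * w b n (?cp y) * conormal b y)\<^sup>2) \<partial>lebesgue_on ?U)"
      using Us by (subst nn_integral_restrict_space) auto
    also have "\<dots> \<le> (\<integral>\<^sup>+y. ennreal M * (\<Sum>b\<in>Basis. ennreal (?t n b y)) \<partial>lebesgue_on ?U)"
    proof (rule nn_integral_mono_AE)
      show "AE y in lebesgue_on ?U. ennreal ((\<Sum>b\<in>Basis. \<eta> (?cp y) * w b n (?cp y) * conormal b y)\<^sup>2)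
          \<le> ennreal M * (\<Sum>b\<in>Basis. ennreal (?t n b y))"
        using N0
      proof eventually_elim
        case (elim y)
        have a: "area_elem h y \<ge> 1" by (rule area_elem_ge_1)
        have "0 = - (\<Sum>b\<in>Basis. g b (?cp y) * conormal b y) / area_elem h y"
          using elim by (simp add: outward_normal_conormal sum_negf[symmetric] sum_divide_distrib)
        hence z: "(\<Sum>b\<in>Basis. g b (?cp y) * conormal b y) = 0" using a by simp
        have b': "base (?cp y) = y" using base_chart[of y 0] by simp
        \<comment> \<open>The subtracted sum is \<open>\<eta>\<close> times the conormal component
          of \<open>g\<close>, which is 0 by \<open>z\<close>.\<close>
        have "(\<Sum>b\<in>Basis. \<eta> (?cp y) * w b n (?cp y) * conormal b y)
            = (\<Sum>b\<in>Basis. (\<eta> (?cp y) * conormal b y) * (w b n (?cp y) - g b (?cp y)))"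
        proof -
          have "(\<Sum>b\<in>Basis. (\<eta> (?cp y) * conormal b y) * (w b n (?cp y) - g b (?cp y)))
            = (\<Sum>b\<in>Basis. \<eta> (?cp y) * w b n (?cp y) * conormal b y) - \<eta> (?cp y) * (\<Sum>b\<in>Basis. g b (?cp y) * conormal b y)"
            by (simp add: sum_subtractf right_diff_distrib sum_distrib_left mult_ac)
          thus ?thesis using z by simp
        qed
        hence "(\<Sum>b\<in>Basis. \<eta> (?cp y) * w b n (?cp y) * conormal b y)\<^sup>2
            \<le> (\<Sum>b\<in>Basis. (\<eta> (?cp y) * conormal b y)\<^sup>2) * (\<Sum>b\<in>Basis. (w b n (?cp y) - g b (?cp y))\<^sup>2)"
          using Cauchy_Schwarz_ineq_sum[of "\<lambda>b. \<eta> (?cp y) * conormal b y" "\<lambda>b. w b n (?cp y) - g b (?cp y)" Basis] by simp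
        also have "\<dots> \<le> M * (\<Sum>b\<in>Basis. ?t n b y)"
        proof (rule mult_mono)
          have "(\<eta> (?cp y) * conormal b y)\<^sup>2 \<le> (B b)\<^sup>2" for b
            using power_mono[OF B[of "?cp y" b], of 2] b' by simp
          thus "(\<Sum>b\<in>Basis. (\<eta> (?cp y) * conormal b y)\<^sup>2) \<le> M" unfolding M_def by (intro sum_mono)
          show "(\<Sum>b\<in>Basis. (w b n (?cp y) - g b (?cp y))\<^sup>2) \<le> (\<Sum>b\<in>Basis. ?t n b y)"
            by (intro sum_mono mult_left_le_one_le[of _ 1, THEN order_trans] order_trans[OF _ mult_left_mono[OF a]]) simp_all
        qed (auto simp: M_def intro!: sum_nonneg)
        finally have *: "(\<Sum>b\<in>Basis. \<eta> (?cp y) * w b n (?cp y) * conormal b y)\<^sup>2 \<le> M * (\<Sum>b\<in>Basis. ?t n b y)" .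
        have "ennreal (M * (\<Sum>b\<in>Basis. ?t n b y)) = ennreal M * (\<Sum>b\<in>Basis. ennreal (?t n b y))"
          using a by (subst sum_ennreal) (auto simp: M_def ennreal_mult sum_nonneg)
        thus ?case using ennreal_leI[OF *] by simp
      qed
    qed
    also have "\<dots> = ennreal M * (\<Sum>b\<in>Basis. \<integral>\<^sup>+ y. ennreal (?t n b y) \<partial>lebesgue_on ?U)"
    proof -
      have [measurable]: "(\<lambda>y. ennreal (?t n b y)) \<in> borel_measurable (lebesgue_on ?U)" if "b \<in> Basis" for b
        using wm[OF that, of n] gm[OF that] area_m by measurable
      show ?thesis
        by (subst nn_integral_cmult) (auto simp: nn_integral_sum)
    qed
    finally show ?thesis .
  qed
  have "(\<lambda>n. ennreal M * (\<Sum>b\<in>Basis. \<integral>\<^sup>+ y. ennreal (?t n b y) \<partial>lebesgue_on ?U)) \<longlonglongrightarrow> ennreal M * (\<Sum>b\<in>(Basis::(real^3) set). 0)"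
    by (intro ennreal_tendsto_cmult tendsto_sum lim) auto
  hence L: "(\<lambda>n. ennreal M * (\<Sum>b\<in>Basis. \<integral>\<^sup>+ y. ennreal (?t n b y) \<partial>lebesgue_on ?U)) \<longlonglongrightarrow> 0" by simp
  show ?thesis by (rule tendsto_sandwich[OF _ _ tendsto_const L]) (use le in auto)
qed

end

section \<open>The boundary layer in one chart, with \<open>P\<close> as the gradient,
  \<open>Q\<close> as its derivatives and \<open>\<eta>\<close> as localisation\<close>

context
  fixes \<Omega> :: "(real^3) set" and p :: "real^3" and r :: real and R :: "real^3 \<Rightarrow> real^3" and h :: "real^2 \<Rightarrow> real"
    and w :: "real^3 \<Rightarrow> nat \<Rightarrow> real^3 \<Rightarrow> real" and P :: "real^3 \<Rightarrow> real^3 \<Rightarrow> real"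
    and Q :: "real^3 \<Rightarrow> real^3 \<Rightarrow> real^3 \<Rightarrow> real" and g :: "real^3 \<Rightarrow> real^3 \<Rightarrow> real"
    and \<eta> :: "real^3 \<Rightarrow> real" and K :: "(real^3) set"
  assumes chart: "boundary_chart \<Omega> p r R h"
    and \<Omega>: "open \<Omega>" "bounded \<Omega>"
    and P: "\<And>b. b \<in> Basis \<Longrightarrow> P b \<in> L2 \<Omega>" and Q: "\<And>b c. b \<in> Basis \<Longrightarrow> c \<in> Basis \<Longrightarrow> Q b c \<in> L2 \<Omega>"
    and w: "\<And>b n. b \<in> Basis \<Longrightarrow> Ck 1 (w b n)"
    and w_lim: "\<And>b. b \<in> Basis \<Longrightarrow> (\<lambda>n. L2_norm \<Omega> (\<lambda>x. w b n x - P b x)) \<longlonglongrightarrow> 0"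
    and pdw_lim: "\<And>b c. b \<in> Basis \<Longrightarrow> c \<in> Basis \<Longrightarrow> (\<lambda>n. L2_norm \<Omega> (\<lambda>x. pd c (w b n) x - Q b c x)) \<longlonglongrightarrow> 0"
    and gm: "\<And>b. b \<in> Basis \<Longrightarrow> (\<lambda>y. g b (chart_point R h y)) \<in> borel_measurable (lebesgue_on (chart_dom p r R h))"
    and g_lim: "\<And>b. b \<in> Basis \<Longrightarrow> (\<lambda>n. \<integral>\<^sup>+ y. ennreal ((w b n (chart_point R h y) - g b (chart_point R h y))\<^sup>2 * area_elem h y)
                 \<partial>lebesgue_on (chart_dom p r R h)) \<longlonglongrightarrow> 0"
    and N0: "AE y in lebesgue_on (chart_dom p r R h).
             0 = (\<Sum>b\<in>Basis. g b (chart_point R h y) * (outward_normal R h y \<bullet> b))"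
    and \<eta>: "Ck 1 \<eta>" and K: "compact K" "K \<subseteq> ball p r" "\<And>x. x \<notin> K \<Longrightarrow> \<eta> x = 0"
begin

text \<open>The localised conormal component of \<open>P\<close>, continued from the boundary into
  the domain by keeping the conormal constant along \<open>up\<close>.\<close>

definition flux :: "real^3 \<Rightarrow> real" where
  "flux x = (\<Sum>b\<in>Basis. (\<eta> x * conormal R h b (base R x)) * P b x)"

text \<open>The weak derivative of \<open>flux\<close> in direction \<open>up\<close>, written out
  by the product rule; the conormal contributes no term.\<close>

definition flux_up :: "real^3 \<Rightarrow> real" where
  "flux_up x = (\<Sum>b\<in>Basis. \<Sum>c\<in>Basis. (up R \<bullet> c * conormal R h b (base R x) * pd c \<eta> x) * P b x
     + (up R \<bullet> c * conormal R h b (base R x) * \<eta> x) * Q b c x)"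

definition layer :: "real \<Rightarrow> (real^3) set" where
  "layer d = {x \<in> ball p r. 0 < depth R h x \<and> depth R h x < d}"

lemma normal_cont: "continuous_on S (\<lambda>x. conormal R h b (base R x))"
  by (rule continuous_on_compose2[OF conormal_cont[OF chart, of UNIV] base_cont[OF chart]]) auto

lemma layer_sets: "layer d \<in> sets borel" "layer d \<subseteq> \<Omega>"
proof -
  note [measurable] = borel_measurable_continuous_onI[OF depth_cont[OF chart]]
  have "layer d = ball p r \<inter> {x. 0 < depth R h x \<and> depth R h x < d}" by (auto simp: layer_def)
  moreover have "{x. 0 < depth R h x \<and> depth R h x < d} \<in> sets borel" by measurable
  ultimately show "layer d \<in> sets borel" by auto
  show "layer d \<subseteq> \<Omega>" using in_domain_iff[OF chart] by (auto simp: layer_def)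
qed

lemma indicator_layer_measurable: "(indicator (layer d) :: real^3 \<Rightarrow> real) \<in> borel_measurable (lebesgue_on \<Omega>)"
proof -
  have "(indicator (layer d) :: real^3 \<Rightarrow> real) \<in> borel_measurable lborel" using layer_sets(1) by simp
  thus ?thesis by (intro measurable_restrict_space1 measurable_completion)
qed

lemma pd_\<eta>_zero: "x \<notin> K \<Longrightarrow> pd b \<eta> x = 0"
proof (rule pd_zero_outside_support)
  have "closure {x. \<eta> x \<noteq> 0} \<subseteq> K" by (rule closure_minimal) (use K compact_imp_closed in auto)
  thus "x \<notin> K \<Longrightarrow> x \<notin> closure {x. \<eta> x \<noteq> 0}" by auto
qed

lemma flux_L2: "flux \<in> L2 \<Omega>"
  unfolding flux_def
  by (intro L2_sum L2_continuous_mult P \<Omega> continuous_intros C1_continuous \<eta> normal_cont) auto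

lemma flux_up_L2: "flux_up \<in> L2 \<Omega>"
  unfolding flux_up_def
  by (intro L2_sum L2_add L2_continuous_mult P Q \<Omega> continuous_intros C1_continuous C1_continuous_pd \<eta> normal_cont) auto

lemma nn_integral_domain:
  fixes f :: "real^3 \<Rightarrow> real"
  assumes "continuous_on UNIV f"
  shows "(\<integral>\<^sup>+x. ennreal ((f x)\<^sup>2) \<partial>lebesgue_on \<Omega>) = (\<integral>\<^sup>+x. ennreal ((f x)\<^sup>2) * indicator \<Omega> x \<partial>lborel)"
    "A \<in> sets borel \<Longrightarrow> A \<subseteq> \<Omega> \<Longrightarrow> (\<integral>\<^sup>+x. ennreal ((indicator A x * f x)\<^sup>2) \<partial>lebesgue_on \<Omega>) = (\<integral>\<^sup>+x. ennreal ((f x)\<^sup>2) * indicator A x \<partial>lborel)"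
proof -
  have s: "\<Omega> \<in> sets lebesgue" "\<Omega> \<in> sets borel" using \<Omega> by auto
  note [measurable] = borel_measurable_continuous_onI[OF assms] s(2)
  have "(\<integral>\<^sup>+x. ennreal ((f x)\<^sup>2) \<partial>lebesgue_on \<Omega>) = (\<integral>\<^sup>+x. ennreal ((f x)\<^sup>2) * indicator \<Omega> x \<partial>lebesgue)"
    using s by (subst nn_integral_restrict_space) auto
  thus "(\<integral>\<^sup>+x. ennreal ((f x)\<^sup>2) \<partial>lebesgue_on \<Omega>) = (\<integral>\<^sup>+x. ennreal ((f x)\<^sup>2) * indicator \<Omega> x \<partial>lborel)"
    by (simp add: nn_integral_completion)
  assume A: "A \<in> sets borel" "A \<subseteq> \<Omega>"
  note [measurable] = A(1)
  have "(\<integral>\<^sup>+x. ennreal ((indicator A x * f x)\<^sup>2) \<partial>lebesgue_on \<Omega>) = (\<integral>\<^sup>+x. ennreal ((indicator A x * f x)\<^sup>2) * indicator \<Omega> x \<partial>lebesgue)"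
    using s by (subst nn_integral_restrict_space) auto
  also have "\<dots> = (\<integral>\<^sup>+x. ennreal ((f x)\<^sup>2) * indicator A x \<partial>lebesgue)"
    using A(2) by (intro nn_integral_cong) (auto simp: indicator_def)
  finally show "(\<integral>\<^sup>+x. ennreal ((indicator A x * f x)\<^sup>2) \<partial>lebesgue_on \<Omega>) = (\<integral>\<^sup>+x. ennreal ((f x)\<^sup>2) * indicator A x \<partial>lborel)"
    by (simp add: nn_integral_completion)
qed

lemma L2_nn_integral:
  assumes "u \<in> L2 \<Omega>"
  shows "(\<integral>\<^sup>+x. ennreal ((u x)\<^sup>2) \<partial>lebesgue_on \<Omega>) = ennreal ((L2_norm \<Omega> u)\<^sup>2)"
  unfolding L2_norm_sq using L2D(2)[OF assms] by (intro nn_integral_eq_integral) auto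

lemma layer_L2: "u \<in> L2 \<Omega> \<Longrightarrow> (\<lambda>x. indicator (layer d) x * u x) \<in> L2 \<Omega>"
  by (rule L2_bounded_mult[OF _ indicator_layer_measurable, of _ _ 1]) (auto simp: indicator_def)

text \<open>For the approximants \<open>layer_estimate\<close> carries a boundary term of order
  \<open>d\<close>. It tends to 0 by \<open>boundary_term_tendsto\<close> as \<open>n\<close> grows
  with \<open>d\<close> fixed, so only the term of order \<open>d\<^sup>2\<close> survives; this
  extra order is what makes thin cut-offs harmless.\<close>

lemma flux_layer_estimate:
  assumes d: "0 \<le> d"
  shows "(L2_norm \<Omega> (\<lambda>x. indicator (layer d) x * flux x))\<^sup>2 \<le> 2 * d\<^sup>2 * (L2_norm \<Omega> flux_up)\<^sup>2"
proof -
  define fn where "fn n x = (\<Sum>b\<in>Basis. (\<eta> x * conormal R h b (base R x)) * w b n x)" for n x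
  define gn where "gn n x = (\<Sum>b\<in>Basis. \<Sum>c\<in>Basis. (up R \<bullet> c * conormal R h b (base R x) * pd c \<eta> x) * w b n x
     + (up R \<bullet> c * conormal R h b (base R x) * \<eta> x) * pd c (w b n) x)" for n x
  have cfn: "continuous_on UNIV (fn n)" for n
    unfolding fn_def by (intro continuous_intros C1_continuous \<eta> normal_cont w)
  have cgn: "continuous_on UNIV (gn n)" for n
    unfolding gn_def by (intro continuous_intros C1_continuous C1_continuous_pd \<eta> normal_cont w)
  have wL: "w b n \<in> L2 \<Omega>" "c \<in> Basis \<Longrightarrow> pd c (w b n) \<in> L2 \<Omega>" if "b \<in> Basis" for b c n
    using C1_H1[OF \<Omega> w[OF that]] by auto
  have fnL: "fn n \<in> L2 \<Omega>" for n unfolding fn_def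
    by (intro L2_sum L2_continuous_mult wL \<Omega> continuous_intros C1_continuous \<eta> normal_cont) auto
  have gnL: "gn n \<in> L2 \<Omega>" for n unfolding gn_def
    by (intro L2_sum L2_add L2_continuous_mult wL \<Omega> continuous_intros C1_continuous C1_continuous_pd \<eta> normal_cont) auto
  have fn_lim: "(\<lambda>n. L2_norm \<Omega> (\<lambda>x. fn n x - flux x)) \<longlonglongrightarrow> 0"
    unfolding fn_def flux_def
    by (intro L2_limit_sum L2_limit_continuous_mult L2_continuous_mult wL P \<Omega> w_lim continuous_intros C1_continuous \<eta> normal_cont) auto
  have gn_lim: "(\<lambda>n. L2_norm \<Omega> (\<lambda>x. gn n x - flux_up x)) \<longlonglongrightarrow> 0"
  proof -
    let ?k1 = "\<lambda>b c x. up R \<bullet> c * conormal R h b (base R x) * pd c \<eta> x"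
    let ?k2 = "\<lambda>b c x. up R \<bullet> c * conormal R h b (base R x) * \<eta> x"
    have k: "continuous_on UNIV (?k1 b c)" "continuous_on UNIV (?k2 b c)" if "c \<in> Basis" for b c
      by (intro continuous_intros C1_continuous C1_continuous_pd \<eta> normal_cont that)+
    have l: "(\<lambda>n. L2_norm \<Omega> (\<lambda>x. (?k1 b c x * w b n x + ?k2 b c x * pd c (w b n) x)
        - (?k1 b c x * P b x + ?k2 b c x * Q b c x))) \<longlonglongrightarrow> 0"
      if bc: "b \<in> Basis" "c \<in> Basis" for b c
      by (rule L2_limit_add[where u="\<lambda>n x. ?k1 b c x * w b n x" and v="\<lambda>n x. ?k2 b c x * pd c (w b n) x"])
        (intro L2_continuous_mult L2_limit_continuous_mult wL P Q \<Omega> w_lim pdw_lim k bc)+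
    have m: "(\<lambda>x. ?k1 b c x * w b n x + ?k2 b c x * pd c (w b n) x) \<in> L2 \<Omega>"
      "(\<lambda>x. ?k1 b c x * P b x + ?k2 b c x * Q b c x) \<in> L2 \<Omega>" if bc: "b \<in> Basis" "c \<in> Basis" for b c n
      by (intro L2_add L2_continuous_mult wL P Q \<Omega> k bc)+
    show ?thesis unfolding gn_def flux_up_def
      by (rule L2_limit_sum, simp, rule L2_sum, simp, rule m(1), assumption+, rule L2_sum, simp, rule m(2), assumption+,
          rule L2_limit_sum, simp, rule m(1), assumption+, rule m(2), assumption+, rule l)
  qed
  let ?F = "\<lambda>n. L2_norm \<Omega> (\<lambda>x. indicator (layer d) x * fn n x)"
  let ?\<beta> = "\<lambda>n. \<integral>\<^sup>+y. ennreal ((fn n (chart_point R h y))\<^sup>2) \<partial>lborel"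
  have est: "ennreal ((?F n)\<^sup>2) \<le> ennreal (2 * d) * ?\<beta> n + ennreal (2 * d\<^sup>2) * ennreal ((L2_norm \<Omega> (gn n))\<^sup>2)" for n
  proof -
    let ?S = "{x. 0 < depth R h x \<and> depth R h x < d}"
    have u: "Ck 1 (\<lambda>x. \<eta> x * w b n x)" if "b \<in> Basis" for b
      using Ck_mult[OF \<eta> w[OF that]] .
    have fe: "(\<Sum>b\<in>Basis. (\<eta> x * w b n x) * conormal R h b (base R x)) = fn n x" for x
      by (simp add: fn_def mult_ac)
    have pdm: "pd c (\<lambda>x. \<eta> x * w b n x) x = pd c \<eta> x * w b n x + \<eta> x * pd c (w b n) x" if "b \<in> Basis" for b c x
      using \<eta> w[OF that] by (intro pd_mult) auto
    have ge: "(\<Sum>b\<in>Basis. (\<Sum>c\<in>Basis. (up R \<bullet> c) * pd c (\<lambda>x. \<eta> x * w b n x) x) * conormal R h b (base R x)) = gn n x" for x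
      unfolding gn_def by (intro sum.cong refl) (simp add: pdm sum_distrib_left sum_distrib_right algebra_simps)
    have fz: "fn n x = 0" and gz: "gn n x = 0" if "x \<notin> K" for x
      using K(3)[OF that] pd_\<eta>_zero[OF that] by (auto simp: fn_def gn_def)
    have "ennreal ((?F n)\<^sup>2) = (\<integral>\<^sup>+x. ennreal ((indicator (layer d) x * fn n x)\<^sup>2) \<partial>lebesgue_on \<Omega>)"
      by (rule L2_nn_integral[OF layer_L2[OF fnL], symmetric])
    also have "\<dots> = (\<integral>\<^sup>+x. ennreal ((fn n x)\<^sup>2) * indicator (layer d) x \<partial>lborel)"
      by (rule nn_integral_domain(2)[OF cfn layer_sets])
    also have "\<dots> \<le> (\<integral>\<^sup>+x. indicator ?S x * ennreal ((fn n x)\<^sup>2) \<partial>lborel)"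
      by (intro nn_integral_mono) (auto simp: indicator_def layer_def)
    also have "\<dots> \<le> ennreal (2 * d) * ?\<beta> n + ennreal (2 * d\<^sup>2) * (\<integral>\<^sup>+x. indicator ?S x * ennreal ((gn n x)\<^sup>2) \<partial>lborel)"
      using layer_estimate[OF chart, where u="\<lambda>b x. \<eta> x * w b n x", OF u d] unfolding fe ge .
    \<comment> \<open>The slab \<open>?S\<close> may leave \<Omega>, but \<open>gn\<close> vanishes
      off \<open>K\<close>, and inside the ball positive depth means membership in \<Omega>.\<close>
    also have "(\<integral>\<^sup>+x. indicator ?S x * ennreal ((gn n x)\<^sup>2) \<partial>lborel) \<le> (\<integral>\<^sup>+x. ennreal ((gn n x)\<^sup>2) * indicator \<Omega> x \<partial>lborel)"
    proof (rule nn_integral_mono)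
      fix x
      show "indicator ?S x * ennreal ((gn n x)\<^sup>2) \<le> ennreal ((gn n x)\<^sup>2) * indicator \<Omega> x"
        using gz[of x] in_domain_iff[OF chart, of x] K(2) by (cases "x \<in> K") (auto simp: indicator_def)
    qed
    also have "\<dots> = ennreal ((L2_norm \<Omega> (gn n))\<^sup>2)"
      unfolding nn_integral_domain(1)[OF cgn, symmetric] by (rule L2_nn_integral[OF gnL])
    finally show ?thesis by (simp add: mult_left_mono add_left_mono)
  qed
  have "?\<beta> \<longlonglongrightarrow> 0"
  proof -
    have "fn n (chart_point R h y) = (\<Sum>b\<in>Basis. \<eta> (chart_point R h y) * w b n (chart_point R h y) * conormal R h b y)" for n y
      using base_chart[OF chart, of y 0] by (simp add: fn_def mult_ac)
    thus ?thesis
      using boundary_term_tendsto[OF chart w gm g_lim N0 C1_continuous[OF \<eta>] K] by simp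
  qed
  moreover have "(\<lambda>n. (?F n)\<^sup>2) \<longlonglongrightarrow> (L2_norm \<Omega> (\<lambda>x. indicator (layer d) x * flux x))\<^sup>2"
    unfolding L2_norm_sq
    by (intro L2_norm_tendsto_sq L2_limit_bounded_mult[OF fnL flux_L2 indicator_layer_measurable _ fn_lim, of _ 1] layer_L2 fnL flux_L2)
       (auto simp: indicator_def)
  moreover have "(\<lambda>n. (L2_norm \<Omega> (gn n))\<^sup>2) \<longlonglongrightarrow> (L2_norm \<Omega> flux_up)\<^sup>2"
    unfolding L2_norm_sq by (rule L2_norm_tendsto_sq[OF gnL flux_up_L2 gn_lim])
  ultimately have "ennreal ((L2_norm \<Omega> (\<lambda>x. indicator (layer d) x * flux x))\<^sup>2)
      \<le> ennreal (2 * d) * 0 + ennreal (2 * d\<^sup>2) * ennreal ((L2_norm \<Omega> flux_up)\<^sup>2)"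
    using est by (intro LIMSEQ_le[OF tendsto_ennrealI tendsto_add[OF ennreal_tendsto_cmult ennreal_tendsto_cmult[OF _ tendsto_ennrealI]]])
      (auto simp: less_top[symmetric])
  thus ?thesis by (simp add: ennreal_mult[symmetric] del: ennreal_mult)
qed

text \<open>After multiplying \<open>\<eta>\<close> by a cut-off in \<open>depth\<close>,
  \<open>green_interior\<close> applies. The gradient of the cut-off is a multiple of the conormal,
  so it meets \<open>P\<close> only through \<open>flux\<close>. The extra term is bounded by the
  slope of the cut-off times the norms of \<open>flux\<close> and \<open>v\<close> on the layer; the
  slope and the bound for \<open>flux\<close> compensate each other, and the norm of
  \<open>v\<close> tends to 0.\<close>

lemma green_chart:
  assumes v: "v \<in> L2 \<Omega>" "\<And>b. b \<in> Basis \<Longrightarrow> vd b \<in> L2 \<Omega>" "\<And>b. b \<in> Basis \<Longrightarrow> weak_pd_rel \<Omega> b v (vd b)"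
  shows "(\<Sum>b\<in>Basis. (LINT x|lebesgue_on \<Omega>. P b x * (pd b \<eta> x * v x + \<eta> x * vd b x))
    + (LINT x|lebesgue_on \<Omega>. Q b b x * (\<eta> x * v x))) = 0"
proof -
  let ?M = "lebesgue_on \<Omega>"
  let ?D = "depth R h"
  define Y where "Y x = (\<Sum>b\<in>Basis. P b x * (pd b \<eta> x * v x + \<eta> x * vd b x) + Q b b x * (\<eta> x * v x))" for x
  have z1: "(\<lambda>x. pd b \<eta> x * v x + \<eta> x * vd b x) \<in> L2 \<Omega>" "(\<lambda>x. \<eta> x * v x) \<in> L2 \<Omega>" if "b \<in> Basis" for b
    by (intro L2_add L2_continuous_mult v that \<Omega> C1_continuous C1_continuous_pd \<eta>)+
  have iY1: "integrable ?M (\<lambda>x. P b x * (pd b \<eta> x * v x + \<eta> x * vd b x))" "integrable ?M (\<lambda>x. Q b b x * (\<eta> x * v x))"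
    if "b \<in> Basis" for b
    using L2_mult_integrable[OF P[OF that] z1(1)[OF that]] L2_mult_integrable[OF Q[OF that that] z1(2)[OF that]] by auto
  have iY: "integrable ?M Y" unfolding Y_def
    by (intro Bochner_Integration.integrable_sum Bochner_Integration.integrable_add iY1)
  have intY: "(\<Sum>b\<in>Basis. (LINT x|?M. P b x * (pd b \<eta> x * v x + \<eta> x * vd b x)) + (LINT x|?M. Q b b x * (\<eta> x * v x)))
      = (LINT x|?M. Y x)"
    unfolding Y_def using iY1 by (simp add: Bochner_Integration.integral_sum)
  \<comment> \<open>The reciprocal thickness: the cut-off \<open>st m\<close> vanishes up to depth
    \<open>1 / c m\<close> and equals 1 from depth \<open>2 / c m\<close> on.\<close>
  define c where "c m = real (Suc m)" for m
  have c0: "c m > 0" for m by (simp add: c_def)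
  define st where "st m x = step (c m * ?D x)" for m x
  define dst where "dst m x = step' (c m * ?D x) * c m" for m x
  note D = depth_C1[OF chart]
  have stC: "Ck 1 (st m)" for m unfolding st_def[abs_def] by (rule step_compose(1)[OF D])
  have pst: "pd b (st m) x = dst m x * conormal R h b (base R x)" if "b \<in> Basis" for b m x
    unfolding st_def[abs_def] dst_def step_compose(2)[OF D that] pd_depth[OF chart] by simp
  have dst_c: "continuous_on S (dst m)" for m S unfolding dst_def[abs_def]
    by (intro continuous_intros continuous_on_compose2[OF step'_continuous[of UNIV]] depth_cont[OF chart]) auto
  have split0: "(LINT x|?M. Y x * st m x) + (LINT x|?M. flux x * (dst m x * v x)) = 0" for m
  proof -
    have C: "Ck 1 (\<lambda>x. \<eta> x * st m x)" by (rule Ck_mult[OF \<eta> stC])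
    have cs: "csupp_in \<Omega> (\<lambda>x. \<eta> x * st m x)"
      unfolding csupp_in_def
    proof (intro exI conjI allI impI)
      let ?K = "K \<inter> {x. 1 / c m \<le> ?D x}"
      have "closed {x. 1 / c m \<le> ?D x}"
        by (intro closed_Collect_le continuous_on_const depth_cont[OF chart])
      thus "compact ?K" using K(1) by (simp add: compact_Int_closed)
      show "?K \<subseteq> \<Omega>"
      proof
        fix x assume x: "x \<in> ?K"
        have "0 < 1 / c m" using c0 by simp
        moreover have "1 / c m \<le> ?D x" using x by blast
        ultimately have "0 < ?D x" by (rule less_le_trans)
        thus "x \<in> \<Omega>" using x K(2) in_domain_iff[OF chart, of x] by blast
      qed
      fix x assume "x \<notin> ?K"
      hence "x \<notin> K \<or> c m * ?D x \<le> 1" using c0[of m] by (auto simp: field_simps)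
      thus "\<eta> x * st m x = 0" using K(3) step_0 by (auto simp: st_def)
    qed
    have pde: "pd b (\<lambda>x. \<eta> x * st m x) x = pd b \<eta> x * st m x + \<eta> x * (dst m x * conormal R h b (base R x))"
      if "b \<in> Basis" for b x
      using pd_mult[of \<eta> x "st m" b] \<eta> stC[of m] pst[OF that] by auto
    let ?a = "\<lambda>b x. P b x * (pd b (\<lambda>x. \<eta> x * st m x) x * v x + (\<eta> x * st m x) * vd b x)"
    let ?b = "\<lambda>b x. Q b b x * ((\<eta> x * st m x) * v x)"
    have z: "(\<lambda>x. pd b (\<lambda>x. \<eta> x * st m x) x * v x + (\<eta> x * st m x) * vd b x) \<in> L2 \<Omega>" "(\<lambda>x. (\<eta> x * st m x) * v x) \<in> L2 \<Omega>"
      if "b \<in> Basis" for b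
      by (intro L2_add L2_continuous_mult v that \<Omega> C1_continuous C1_continuous_pd C)+
    have i: "integrable ?M (?a b)" "integrable ?M (?b b)" if "b \<in> Basis" for b
      using L2_mult_integrable[OF P[OF that] z(1)[OF that]] L2_mult_integrable[OF Q[OF that that] z(2)[OF that]] by auto
    have "0 = (\<Sum>b\<in>Basis. (LINT x|?M. ?a b x) + (LINT x|?M. ?b b x))"
      by (rule sym, intro sum.neutral ballI)
         (rule green_interior[OF \<Omega> _ P Q w w_lim pdw_lim v(1) v(2) v(3) C cs]; assumption)
    also have "\<dots> = (LINT x|?M. (\<Sum>b\<in>Basis. ?a b x + ?b b x))"
      using i by (simp add: Bochner_Integration.integral_sum)
    \<comment> \<open>All terms without a derivative of the cut-off collect in \<open>Y\<close>, the
      others combine to \<open>flux\<close>.\<close>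
    also have "\<dots> = (LINT x|?M. Y x * st m x + flux x * (dst m x * v x))"
    proof (rule Bochner_Integration.integral_cong[OF refl])
      fix x
      have "?a b x + ?b b x = (P b x * (pd b \<eta> x * v x + \<eta> x * vd b x) + Q b b x * (\<eta> x * v x)) * st m x
          + ((\<eta> x * conormal R h b (base R x)) * P b x) * (dst m x * v x)" if "b \<in> Basis" for b
        unfolding pde[OF that] by (simp add: algebra_simps)
      thus "(\<Sum>b\<in>Basis. ?a b x + ?b b x) = Y x * st m x + flux x * (dst m x * v x)"
        unfolding Y_def flux_def sum_distrib_right sum.distrib[symmetric] by (intro sum.cong refl)
    qed
    also have "\<dots> = (LINT x|?M. Y x * st m x) + (LINT x|?M. flux x * (dst m x * v x))"
    proof (rule Bochner_Integration.integral_add)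
      show "integrable ?M (\<lambda>x. Y x * st m x)"
        by (rule integral_small_mult(2)[OF iY continuous_measurable_lebesgue_on[OF C1_continuous[OF stC]], of _ 1])
           (simp add: st_def step_abs)
      show "integrable ?M (\<lambda>x. flux x * (dst m x * v x))"
        by (intro L2_mult_integrable flux_L2 L2_continuous_mult v \<Omega> dst_c)
    qed
    finally show ?thesis by simp
  qed
  have lim1: "(\<lambda>m. LINT x|?M. Y x * st m x) \<longlonglongrightarrow> (LINT x|?M. Y x)"
  proof (rule integral_dominated_convergence[where w="\<lambda>x. \<bar>Y x\<bar>"])
    show "(\<lambda>x. Y x * st m x) \<in> borel_measurable ?M" for m
      using iY continuous_measurable_lebesgue_on[OF C1_continuous[OF stC]] by auto
    show "AE x in ?M. norm (Y x * st m x) \<le> \<bar>Y x\<bar>" for m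
      by (auto simp: abs_mult st_def step_abs mult_left_le)
    show "AE x in ?M. (\<lambda>m. Y x * st m x) \<longlonglongrightarrow> Y x"
    proof (rule AE_I2)
      fix x assume "x \<in> space ?M"
      hence x: "x \<in> \<Omega>" by simp
      show "(\<lambda>m. Y x * st m x) \<longlonglongrightarrow> Y x"
      proof (cases "x \<in> K")
        case True
        hence d: "?D x > 0" using K(2) x in_domain_iff[OF chart, of x] by auto
        obtain N :: nat where N: "2 / ?D x \<le> N" using real_arch_simple by blast
        have "st m x = 1" if "m \<ge> N" for m
        proof -
          have "2 / ?D x \<le> c m" using N that by (simp add: c_def)
          thus ?thesis unfolding st_def by (intro step_1) (use d in \<open>simp add: field_simps\<close>)
        qed
        hence "\<forall>\<^sub>F m in sequentially. Y x * st m x = Y x"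
          unfolding eventually_sequentially by auto
        thus ?thesis by (rule tendsto_eventually)
      next
        case False
        hence "Y x = 0" using K(3) pd_\<eta>_zero by (simp add: Y_def)
        thus ?thesis by simp
      qed
    qed
  qed (use iY in auto)
  have lim2: "(\<lambda>m. LINT x|?M. flux x * (dst m x * v x)) \<longlonglongrightarrow> 0"
  proof -
    let ?V = "\<lambda>m. L2_norm \<Omega> (\<lambda>x. indicator (layer (2 / c m)) x * v x)"
    have bound: "\<bar>LINT x|?M. flux x * (dst m x * v x)\<bar> \<le> (8 * L2_norm \<Omega> flux_up) * ?V m" for m
    proof -
      let ?A = "layer (2 / c m)"
      \<comment> \<open>On \<open>K\<close> the derivative of the cut-off lives in the layer, and
        off \<open>K\<close> the flux is 0; hence the indicator may be attached to both factors
        before Cauchy-Schwarz.\<close>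
      have eq: "flux x * (dst m x * v x) = (indicator ?A x * flux x) * (dst m x * (indicator ?A x * v x))" for x
      proof (cases "x \<in> ?A")
        case False
        have "flux x = 0 \<or> dst m x = 0"
        proof (cases "x \<in> K")
          case True
          hence "\<not> (0 < ?D x \<and> ?D x < 2 / c m)" using False K(2) by (auto simp: layer_def)
          hence "c m * ?D x \<le> 1 \<or> c m * ?D x \<ge> 2"
            using c0[of m] by (auto simp: not_less field_simps intro: order_trans[OF mult_nonneg_nonpos])
          thus ?thesis using step'_0 by (auto simp: dst_def)
        qed (use K(3) in \<open>simp add: flux_def\<close>)
        thus ?thesis using False by auto
      qed (simp add: indicator_def)
      have db: "\<bar>dst m x\<bar> \<le> 2 * c m" for x
        using mult_right_mono[OF step'_abs, of "c m"] c0[of m] by (auto simp: dst_def abs_mult)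
      note dm = continuous_measurable_lebesgue_on[OF dst_c]
      have "\<bar>LINT x|?M. flux x * (dst m x * v x)\<bar>
          \<le> L2_norm \<Omega> (\<lambda>x. indicator ?A x * flux x) * L2_norm \<Omega> (\<lambda>x. dst m x * (indicator ?A x * v x))"
        unfolding eq by (intro L2_Cauchy_Schwarz layer_L2 flux_L2 L2_bounded_mult[OF layer_L2 dm db] v)
      \<comment> \<open>The powers of \<open>c m\<close> cancel in this product, which leaves the
        factor 8.\<close>
      also have "\<dots> \<le> (2 * (2 / c m) * L2_norm \<Omega> flux_up) * (2 * c m * ?V m)"
      proof (rule mult_mono)
        have "(L2_norm \<Omega> (\<lambda>x. indicator ?A x * flux x))\<^sup>2 \<le> 2 * (2 / c m)\<^sup>2 * (L2_norm \<Omega> flux_up)\<^sup>2"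
          by (rule flux_layer_estimate) (use c0[of m] in simp)
        \<comment> \<open>The constant 2 is enlarged to 4 only to obtain a perfect square.\<close>
        also have "\<dots> \<le> 4 * ((2 / c m)\<^sup>2 * (L2_norm \<Omega> flux_up)\<^sup>2)"
          unfolding mult.assoc by (intro mult_right_mono) auto
        also have "\<dots> = (2 * (2 / c m) * L2_norm \<Omega> flux_up)\<^sup>2" unfolding power_mult_distrib by simp
        finally show "L2_norm \<Omega> (\<lambda>x. indicator ?A x * flux x) \<le> 2 * (2 / c m) * L2_norm \<Omega> flux_up"
          by (rule power2_le_imp_le) (use c0[of m] in simp)
        have "L2_norm \<Omega> (\<lambda>x. dst m x * (indicator ?A x * v x)) \<le> L2_norm \<Omega> (\<lambda>x. (2 * c m) * (indicator ?A x * v x))"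
          unfolding L2_norm_def
        proof (intro real_sqrt_le_mono Bochner_Integration.integral_mono)
          fix x
          have "(dst m x)\<^sup>2 \<le> (2 * c m)\<^sup>2" using power_mono[OF db[of x], of 2] by simp
          thus "(dst m x * (indicator ?A x * v x))\<^sup>2 \<le> ((2 * c m) * (indicator ?A x * v x))\<^sup>2"
            unfolding power_mult_distrib[of "dst m x"] power_mult_distrib[of "2 * c m"]
            by (rule mult_right_mono) simp
        qed (use L2D(2)[OF L2_bounded_mult[OF layer_L2[OF v(1)] dm db]] L2D(2)[OF L2_cmult[OF layer_L2[OF v(1)]]] in auto)
        also have "\<dots> = 2 * c m * ?V m" unfolding L2_norm_cmult using c0[of m] by simp
        finally show "L2_norm \<Omega> (\<lambda>x. dst m x * (indicator ?A x * v x)) \<le> 2 * c m * ?V m" .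
      qed (use c0[of m] in auto)
      also have "\<dots> = (8 * L2_norm \<Omega> flux_up) * ?V m" using c0[of m] by simp
      finally show ?thesis .
    qed
    have "?V \<longlonglongrightarrow> 0"
    proof -
      have "(\<lambda>m. LINT x|?M. (indicator (layer (2 / c m)) x * v x)\<^sup>2) \<longlonglongrightarrow> (LINT x|?M. 0)"
      proof (rule integral_dominated_convergence[where w="\<lambda>x. (v x)\<^sup>2"])
        show "(\<lambda>x. (indicator (layer (2 / c m)) x * v x)\<^sup>2) \<in> borel_measurable ?M" for m
          using L2D(2)[OF layer_L2[OF v(1)]] by auto
        show "AE x in ?M. norm ((indicator (layer (2 / c m)) x * v x)\<^sup>2) \<le> (v x)\<^sup>2" for m
          by (auto simp: indicator_def)
        show "AE x in ?M. (\<lambda>m. (indicator (layer (2 / c m)) x * v x)\<^sup>2) \<longlonglongrightarrow> 0"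
        proof (rule AE_I2)
          fix x
          show "(\<lambda>m. (indicator (layer (2 / c m)) x * v x)\<^sup>2) \<longlonglongrightarrow> 0"
          proof (cases "?D x > 0")
            case True
            obtain N :: nat where N: "2 / ?D x \<le> N" using real_arch_simple by blast
            have "x \<notin> layer (2 / c m)" if "m \<ge> N" for m
            proof -
              have "2 / ?D x \<le> c m" using N that by (simp add: c_def)
              hence "2 / c m \<le> ?D x" using True c0[of m] by (simp add: field_simps)
              thus ?thesis by (simp add: layer_def)
            qed
            hence "\<forall>\<^sub>F m in sequentially. (indicator (layer (2 / c m)) x * v x)\<^sup>2 = 0"
              unfolding eventually_sequentially by (intro exI[of _ N] allI impI) simp
            thus ?thesis by (rule tendsto_eventually)
          qed (simp add: layer_def)
        qed
      qed (use L2D(2)[OF v(1)] in auto)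
      from tendsto_real_sqrt[OF this] show ?thesis by (simp add: L2_norm_def)
    qed
    from tendsto_mult_right_zero[OF this, of "8 * L2_norm \<Omega> flux_up"]
    have L: "(\<lambda>m. (8 * L2_norm \<Omega> flux_up) * ?V m) \<longlonglongrightarrow> 0" .
    show ?thesis
      by (rule tendsto_rabs_zero_cancel, rule tendsto_sandwich[OF _ _ tendsto_const L]) (use bound in auto)
  qed
  have "(\<lambda>m. (LINT x|?M. Y x * st m x) + (LINT x|?M. flux x * (dst m x * v x))) \<longlonglongrightarrow> (LINT x|?M. Y x) + 0"
    by (rule tendsto_add[OF lim1 lim2])
  hence "(LINT x|?M. Y x) = 0" unfolding split0 by (simp add: LIMSEQ_const_iff)
  thus ?thesis unfolding intY .
qed

end

section \<open>Green's formula\<close>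

lemma cutoff_exists:
  fixes p :: "'a::euclidean_space"
  assumes "r > 0"
  obtains \<kappa> where "Ck 1 \<kappa>" "\<And>x. x \<in> ball p (r / 2) \<Longrightarrow> \<kappa> x = 0" "\<And>x. x \<notin> cball p (3 * r / 4) \<Longrightarrow> \<kappa> x = (1::real)"
proof -
  let ?D = "\<lambda>x. (x - p) \<bullet> (x - p)"
  \<comment> \<open>With this scaling the argument of \<open>step\<close> is at most 1 for distance
    up to \<open>r / 2\<close> and at least 9/4, hence above 2, from distance
    \<open>3 * r / 4\<close> on.\<close>
  let ?c = "4 / r\<^sup>2"
  have D: "Ck 1 ?D"
    by (rule C1I[where f'="\<lambda>x z. 2 * ((x - p) \<bullet> z)"])
       (auto intro!: derivative_eq_intros continuous_intros simp: inner_commute)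
  have nz: "?D x = (dist p x)\<^sup>2" for x by (simp add: dist_norm dot_square_norm norm_minus_commute)
  show thesis
  proof (rule that[of "\<lambda>x. step (?c * ?D x)"])
    show "Ck 1 (\<lambda>x. step (?c * ?D x))" by (rule step_compose(1)[OF D])
    fix x
    {
      assume "x \<in> ball p (r / 2)"
      hence "(dist p x)\<^sup>2 \<le> (r / 2)\<^sup>2" by (intro power_mono) auto
      thus "step (?c * ?D x) = 0" unfolding nz
        by (intro step_0) (use assms in \<open>simp add: field_simps power2_eq_square\<close>)
    }
    {
      assume "x \<notin> cball p (3 * r / 4)"
      hence "(3 * r / 4)\<^sup>2 \<le> (dist p x)\<^sup>2" using assms by (intro power_mono) auto
      hence "9 * r\<^sup>2 \<le> 16 * (dist p x)\<^sup>2" by (simp add: field_simps power2_eq_square)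
      hence "2 * r\<^sup>2 \<le> 4 * (dist p x)\<^sup>2" using zero_le_power2[of r] by linarith
      thus "step (?c * ?D x) = 1" unfolding nz
        by (intro step_1) (use assms in \<open>simp add: field_simps\<close>)
    }
  qed
qed

text \<open>In place of a partition of unity, one cutoff function is split off at a time.\<close>

lemma local_functional_zero:
  fixes \<Omega> :: "'a::euclidean_space set" and \<Lambda> :: "('a \<Rightarrow> real) \<Rightarrow> real"
  assumes bdd: "bounded \<Omega>"
    and add: "\<And>f g. Ck 1 f \<Longrightarrow> Ck 1 g \<Longrightarrow> \<Lambda> (\<lambda>x. f x + g x) = \<Lambda> f + \<Lambda> g"
    and zero: "\<And>f. Ck 1 f \<Longrightarrow> (\<And>x. x \<in> \<Omega> \<Longrightarrow> f x = 0) \<Longrightarrow> \<Lambda> f = 0"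
    and loc: "\<And>p. p \<in> closure \<Omega> \<Longrightarrow> \<exists>r>0. \<forall>f. Ck 1 f \<longrightarrow> (\<forall>x. x \<notin> cball p (3 * r / 4) \<longrightarrow> f x = 0) \<longrightarrow> \<Lambda> f = 0"
  shows "\<Lambda> (\<lambda>_. 1) = 0"
proof -
  obtain r where r: "\<And>p. p \<in> closure \<Omega> \<Longrightarrow> r p > 0"
    "\<And>p f. p \<in> closure \<Omega> \<Longrightarrow> Ck 1 f \<Longrightarrow> (\<And>x. x \<notin> cball p (3 * r p / 4) \<Longrightarrow> f x = 0) \<Longrightarrow> \<Lambda> f = 0"
    using loc by metis
  have "compact (closure \<Omega>)" using bdd by simp
  moreover have "closure \<Omega> \<subseteq> (\<Union>p\<in>closure \<Omega>. ball p (r p / 2))" using r(1) by force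
  ultimately obtain C where C: "C \<subseteq> closure \<Omega>" "finite C" "closure \<Omega> \<subseteq> (\<Union>p\<in>C. ball p (r p / 2))"
    using compactE_image[of "closure \<Omega>" "closure \<Omega>" "\<lambda>p. ball p (r p / 2)"] by (metis open_ball)
  \<comment> \<open>The invariant of the induction over the cover: \<open>f\<close> vanishes on the
    balls treated so far, while the value of the functional is still that at the constant 1.\<close>
  have "\<exists>f. Ck 1 f \<and> \<Lambda> f = \<Lambda> (\<lambda>_. 1) \<and> (\<forall>x\<in>(\<Union>p\<in>C. ball p (r p / 2)). f x = 0)"
    using C(2,1)
  proof (induction C rule: finite_induct)
    case empty
    show ?case by (intro exI[of _ "\<lambda>_. 1"] conjI, rule Ck_const, simp_all)
  next
    case (insert p C)
    from insert.prems have "C \<subseteq> closure \<Omega>" by blast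
    from insert.IH[OF this]
    obtain f where f: "Ck 1 f" "\<Lambda> f = \<Lambda> (\<lambda>_. 1)" "\<And>x. x \<in> (\<Union>p\<in>C. ball p (r p / 2)) \<Longrightarrow> f x = 0" by blast
    have p: "p \<in> closure \<Omega>" using insert by auto
    obtain \<kappa> where \<kappa>: "Ck 1 \<kappa>" "\<And>x. x \<in> ball p (r p / 2) \<Longrightarrow> \<kappa> x = 0" "\<And>x. x \<notin> cball p (3 * r p / 4) \<Longrightarrow> \<kappa> x = 1"
      using cutoff_exists[OF r(1)[OF p]] by metis
    have C1: "Ck 1 (\<lambda>x. f x * \<kappa> x)" "Ck 1 (\<lambda>x. f x * (1 - \<kappa> x))"
      by (intro Ck_mult Ck_diff Ck_const f \<kappa>)+
    have "\<Lambda> f = \<Lambda> (\<lambda>x. f x * \<kappa> x + f x * (1 - \<kappa> x))" by (simp add: algebra_simps)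
    also have "\<dots> = \<Lambda> (\<lambda>x. f x * \<kappa> x) + \<Lambda> (\<lambda>x. f x * (1 - \<kappa> x))" by (rule add[OF C1])
    also have "\<Lambda> (\<lambda>x. f x * (1 - \<kappa> x)) = 0" by (rule r(2)[OF p C1(2)]) (simp add: \<kappa>(3))
    finally have "\<Lambda> (\<lambda>x. f x * \<kappa> x) = \<Lambda> (\<lambda>_. 1)" using f(2) by simp
    moreover have "\<forall>x\<in>(\<Union>p\<in>insert p C. ball p (r p / 2)). f x * \<kappa> x = 0"
    proof
      fix x assume "x \<in> (\<Union>p\<in>insert p C. ball p (r p / 2))"
      hence "x \<in> ball p (r p / 2) \<or> x \<in> (\<Union>p\<in>C. ball p (r p / 2))" by blast
      thus "f x * \<kappa> x = 0" using f(3) \<kappa>(2) by (metis mult_eq_0_iff)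
    qed
    ultimately show ?case using C1(1) by blast
  qed
  then obtain f where f: "Ck 1 f" "\<Lambda> f = \<Lambda> (\<lambda>_. 1)" "\<And>x. x \<in> (\<Union>p\<in>C. ball p (r p / 2)) \<Longrightarrow> f x = 0" by blast
  have "\<Lambda> f = 0"
    by (rule zero[OF f(1)]) (use f(3) C(3) closure_subset in blast)
  thus ?thesis using f(2) by simp
qed

lemma H2D: "u \<in> H2 \<Omega> \<Longrightarrow> u \<in> H1 \<Omega>" "u \<in> H2 \<Omega> \<Longrightarrow> b \<in> Basis \<Longrightarrow> wpd \<Omega> b u \<in> H1 \<Omega>"
  "u \<in> H2 \<Omega> \<Longrightarrow> b \<in> Basis \<Longrightarrow> wpd \<Omega> b u \<in> L2 \<Omega>"
  "u \<in> H2 \<Omega> \<Longrightarrow> b \<in> Basis \<Longrightarrow> c \<in> Basis \<Longrightarrow> wpd \<Omega> c (wpd \<Omega> b u) \<in> L2 \<Omega>"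
  using wpdD(1) by (auto simp: H2_def)

lemma laplacian_L2: "u \<in> H2 \<Omega> \<Longrightarrow> laplacian \<Omega> u \<in> L2 \<Omega>"
  unfolding laplacian_def[abs_def] by (intro L2_sum H2D) auto

text \<open>The vector field \<open>v\<close> times the gradient of \<open>u\<close> has divergence
  with integral 0. By \<open>local_functional_zero\<close> this may be checked against functions
  supported near one point: \<open>green_interior\<close> covers interior points and
  \<open>green_chart\<close> boundary points.\<close>

theorem green_formula:
  fixes \<Omega> :: "(real^3) set"
  assumes dom: "bounded_C1_domain \<Omega>" and u: "u \<in> W \<Omega>" and v: "v \<in> H1 \<Omega>"
  shows "(LINT x|lebesgue_on \<Omega>. laplacian \<Omega> u x * v x)
    = - (\<Sum>b\<in>Basis. LINT x|lebesgue_on \<Omega>. wpd \<Omega> b u x * wpd \<Omega> b v x)"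
proof -
  let ?M = "lebesgue_on \<Omega>"
  have \<Omega>: "open \<Omega>" "bounded \<Omega>" using dom by (auto simp: bounded_C1_domain_def)
  define P where "P b = wpd \<Omega> b u" for b
  define Q where "Q b c = wpd \<Omega> c (P b)" for b c
  define vd where "vd b = wpd \<Omega> b v" for b
  have u2: "u \<in> H2 \<Omega>" using u by (simp add: W_def)
  have P1: "P b \<in> H1 \<Omega>" and PL: "P b \<in> L2 \<Omega>" if "b \<in> Basis" for b
    using H2D[OF u2] that by (auto simp: P_def)
  have QL: "Q b c \<in> L2 \<Omega>" if "b \<in> Basis" "c \<in> Basis" for b c using wpdD(1)[OF P1] that by (simp add: Q_def)
  have vL: "v \<in> L2 \<Omega>" using v by (simp add: H1_def)
  have vdL: "vd b \<in> L2 \<Omega>" "weak_pd_rel \<Omega> b v (vd b)" if "b \<in> Basis" for b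
    using wpdD[OF v that] by (simp_all add: vd_def)
  obtain g where g: "\<And>b. b \<in> Basis \<Longrightarrow> has_trace \<Omega> (P b) (g b)"
    "\<And>p r R h. boundary_chart \<Omega> p r R h \<Longrightarrow> AE y in lebesgue_on (chart_dom p r R h).
             0 = (\<Sum>b\<in>Basis. g b (chart_point R h y) * (outward_normal R h y \<bullet> b))"
    using u unfolding W_def has_normal_derivative_def P_def by blast
  \<comment> \<open>In \<open>has_trace\<close> the sequence is chosen before the chart, so one
    sequence for each derivative serves all charts simultaneously.\<close>
  define approx where "approx b w \<longleftrightarrow> (\<forall>n. Ck 1 (w n)) \<and>
       (\<lambda>n. H1_norm \<Omega> (\<lambda>x. w n x - P b x)) \<longlonglongrightarrow> 0 \<and>
       (\<forall>p r R h. boundary_chart \<Omega> p r R h \<longrightarrow>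
          (\<lambda>y. g b (chart_point R h y)) \<in> borel_measurable (lebesgue_on (chart_dom p r R h)) \<and>
          (\<lambda>n. \<integral>\<^sup>+ y. ennreal ((w n (chart_point R h y) - g b (chart_point R h y))\<^sup>2 * area_elem h y)
                 \<partial>lebesgue_on (chart_dom p r R h)) \<longlonglongrightarrow> 0)" for b and w :: "nat \<Rightarrow> real^3 \<Rightarrow> real"
  have "\<forall>b\<in>Basis. \<exists>w. approx b w"
    using g(1) unfolding has_trace_def approx_def by blast
  from bchoice[OF this] obtain w where ap: "\<And>b. b \<in> Basis \<Longrightarrow> approx b (w b)" by blast
  have w: "Ck 1 (w b n)" and wH: "(\<lambda>n. H1_norm \<Omega> (\<lambda>x. w b n x - P b x)) \<longlonglongrightarrow> 0" if "b \<in> Basis" for b n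
    using ap[OF that] unfolding approx_def by blast+
  have wT: "(\<lambda>y. g b (chart_point R h y)) \<in> borel_measurable (lebesgue_on (chart_dom p r R h))"
      "(\<lambda>n. \<integral>\<^sup>+ y. ennreal ((w b n (chart_point R h y) - g b (chart_point R h y))\<^sup>2 * area_elem h y)
                 \<partial>lebesgue_on (chart_dom p r R h)) \<longlonglongrightarrow> 0"
    if "b \<in> Basis" "boundary_chart \<Omega> p r R h" for b p r R h
    using ap[OF that(1)] that(2) unfolding approx_def by blast+
  have wl: "(\<lambda>n. L2_norm \<Omega> (\<lambda>x. w b n x - P b x)) \<longlonglongrightarrow> 0"
    "c \<in> Basis \<Longrightarrow> (\<lambda>n. L2_norm \<Omega> (\<lambda>x. pd c (w b n) x - Q b c x)) \<longlonglongrightarrow> 0" if "b \<in> Basis" for b c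
    using H1_approx_convergence[OF \<Omega> P1[OF that] w[OF that] wH[OF that]] by (simp_all add: Q_def)
  \<comment> \<open>The integral of the divergence of \<open>\<eta> * v\<close> times the gradient
    of \<open>u\<close>, expanded by the product rule; at \<open>\<eta> = 1\<close> it is the
    difference of the two sides of Green's formula.\<close>
  define \<Lambda> where "\<Lambda> \<eta> = (\<Sum>b\<in>Basis. (LINT x|?M. P b x * (pd b \<eta> x * v x + \<eta> x * vd b x))
    + (LINT x|?M. Q b b x * (\<eta> x * v x)))" for \<eta>
  have "\<Lambda> (\<lambda>_. 1) = 0"
  proof (rule local_functional_zero[OF \<Omega>(2)])
    fix f1 f2 :: "real^3 \<Rightarrow> real" assume f: "Ck 1 f1" "Ck 1 f2"
    have z: "(\<lambda>x. pd b f x * v x + f x * vd b x) \<in> L2 \<Omega>" "(\<lambda>x. f x * v x) \<in> L2 \<Omega>" if "b \<in> Basis" "Ck 1 f" for b f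
      by (intro L2_add L2_continuous_mult vL vdL that \<Omega> C1_continuous C1_continuous_pd)+
    have i: "integrable ?M (\<lambda>x. P b x * (pd b f x * v x + f x * vd b x))" "integrable ?M (\<lambda>x. Q b b x * (f x * v x))"
      if "b \<in> Basis" "Ck 1 f" for b f
      using L2_mult_integrable[OF PL[OF that(1)] z(1)[OF that]] L2_mult_integrable[OF QL[OF that(1,1)] z(2)[OF that]] by auto
    have e: "pd b (\<lambda>x. f1 x + f2 x) x = pd b f1 x + pd b f2 x" for b x
      using f by (intro pd_add) auto
    have "(LINT x|?M. P b x * (pd b (\<lambda>x. f1 x + f2 x) x * v x + (f1 x + f2 x) * vd b x)) =
        (LINT x|?M. P b x * (pd b f1 x * v x + f1 x * vd b x)) + (LINT x|?M. P b x * (pd b f2 x * v x + f2 x * vd b x))"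
      "(LINT x|?M. Q b b x * ((f1 x + f2 x) * v x)) = (LINT x|?M. Q b b x * (f1 x * v x)) + (LINT x|?M. Q b b x * (f2 x * v x))"
      if "b \<in> Basis" for b
      unfolding Bochner_Integration.integral_add[OF i(1)[OF that f(1)] i(1)[OF that f(2)], symmetric]
        Bochner_Integration.integral_add[OF i(2)[OF that f(1)] i(2)[OF that f(2)], symmetric]
      by (rule Bochner_Integration.integral_cong[OF refl], simp add: e algebra_simps)+
    thus "\<Lambda> (\<lambda>x. f1 x + f2 x) = \<Lambda> f1 + \<Lambda> f2"
      unfolding \<Lambda>_def sum.distrib[symmetric] by (intro sum.cong refl) simp
  next
    fix f :: "real^3 \<Rightarrow> real" assume f: "Ck 1 f" "\<And>x. x \<in> \<Omega> \<Longrightarrow> f x = 0"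
    have "pd b f x = 0" if "x \<in> \<Omega>" for b x
    proof (rule pd_zero_outside_support)
      have "\<Omega> \<inter> {x. f x \<noteq> 0} = {}" using f(2) by auto
      thus "x \<notin> closure {x. f x \<noteq> 0}" using open_Int_closure_eq_empty[OF \<Omega>(1)] that by blast
    qed
    note pd0 = this
    have "(LINT x|?M. P b x * (pd b f x * v x + f x * vd b x)) = (LINT x|?M. 0)"
      "(LINT x|?M. Q b b x * (f x * v x)) = (LINT x|?M. 0)" for b
      by (rule Bochner_Integration.integral_cong[OF refl], simp add: pd0 f(2))+
    thus "\<Lambda> f = 0" by (simp add: \<Lambda>_def)
  next
    fix p assume "p \<in> closure \<Omega>"
    then consider "p \<in> \<Omega>" | "p \<in> frontier \<Omega>"
      using \<Omega>(1) by (auto simp: frontier_def interior_open)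
    thus "\<exists>r>0. \<forall>f. Ck 1 f \<longrightarrow> (\<forall>x. x \<notin> cball p (3 * r / 4) \<longrightarrow> f x = 0) \<longrightarrow> \<Lambda> f = 0"
    proof cases
      case 1
      then obtain r where r: "r > 0" "ball p r \<subseteq> \<Omega>" using \<Omega>(1) open_contains_ball by blast
      show ?thesis
      proof (intro exI[of _ r] conjI allI impI)
        fix f assume f: "Ck 1 f" "\<forall>x. x \<notin> cball p (3 * r / 4) \<longrightarrow> f x = 0"
        have "cball p (3 * r / 4) \<subseteq> \<Omega>" using r by force
        hence cs: "csupp_in \<Omega> f" unfolding csupp_in_def using f(2) by (intro exI[of _ "cball p (3 * r / 4)"]) auto
        show "\<Lambda> f = 0" unfolding \<Lambda>_def
          by (intro sum.neutral ballI)
             (rule green_interior[OF \<Omega> _ PL QL w wl vL vdL f(1) cs]; assumption)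
      qed (use r in simp)
    next
      case 2
      then obtain r R h where chart: "boundary_chart \<Omega> p r R h"
        using dom unfolding bounded_C1_domain_def by blast
      have r: "r > 0" using chart by (simp add: boundary_chart_def)
      show ?thesis
      proof (intro exI[of _ r] conjI allI impI)
        fix f assume f: "Ck 1 f" "\<forall>x. x \<notin> cball p (3 * r / 4) \<longrightarrow> f x = 0"
        have "cball p (3 * r / 4) \<subseteq> ball p r" using r by force
        thus "\<Lambda> f = 0" unfolding \<Lambda>_def
          using green_chart[OF chart \<Omega> PL QL w wl(1) wl(2) wT(1)[OF _ chart] wT(2)[OF _ chart] g(2)[OF chart] f(1) compact_cball _ _ vL vdL(1) vdL(2)]
            f(2) by blast
      qed (use r in simp)
    qed
  qed
  hence "(\<Sum>b\<in>Basis. (LINT x|?M. P b x * vd b x) + (LINT x|?M. Q b b x * v x)) = 0"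
    by (simp add: \<Lambda>_def)
  moreover have "(LINT x|?M. laplacian \<Omega> u x * v x) = (\<Sum>b\<in>Basis. LINT x|?M. Q b b x * v x)"
    using L2_mult_integrable[OF QL vL]
    by (simp add: laplacian_def sum_distrib_right Q_def P_def Bochner_Integration.integral_sum)
  ultimately show ?thesis by (simp add: sum.distrib P_def vd_def)
qed

section \<open>Time derivatives\<close>

text \<open>Lebesgue measure on a product is the completion of the product measure, to which
  Fubini's theorem does not apply directly. \<open>F\<close> is replaced by a Borel function equal
  to it almost everywhere; on almost every section the two still agree almost everywhere.\<close>

lemma lebesgue_fubini_UNIV:
  fixes F :: "'a::euclidean_space \<times> 'b::euclidean_space \<Rightarrow> real"
  assumes F: "integrable lebesgue F"
  shows "AE a in lebesgue. integrable lebesgue (\<lambda>b. F (a, b))"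
    "integrable lebesgue (\<lambda>a. LINT b|lebesgue. F (a, b))"
    "(LINT a|lebesgue. LINT b|lebesgue. F (a, b)) = (LINT z|lebesgue. F z)"
proof -
  obtain g where g: "g \<in> borel_measurable lborel" and ae: "AE z in lborel. F z = g z"
    using completion_ex_borel_measurable_real[OF borel_measurable_integrable[OF F]] by auto
  have ae': "AE z in lebesgue. F z = g z" by (rule AE_completion[OF ae])
  have gl: "g \<in> borel_measurable lebesgue" using g by (rule measurable_completion)
  have "integrable lebesgue g"
    using integrable_cong_AE_imp[OF F gl] ae' by (auto elim: eventually_mono)
  hence gi: "integrable (lborel \<Otimes>\<^sub>M lborel) g" using integrable_completion[OF g] by (simp add: lborel_prod)
  have "AE z in lborel \<Otimes>\<^sub>M lborel. F z = g z" unfolding lborel_prod by (rule ae)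
  from lborel_pair.AE_pair[OF this]
  have A: "AE a in lborel. AE b in lborel. F (a, b) = g (a, b)" .
  have B: "AE a in lborel. integrable lborel (\<lambda>b. g (a, b))"
    using lborel_pair.AE_integrable_fst'[OF gi] .
  have C: "AE a in lborel. integrable lebesgue (\<lambda>b. F (a, b)) \<and> (LINT b|lebesgue. F (a, b)) = (\<integral>b. g (a, b) \<partial>lborel)"
    using A B
  proof eventually_elim
    case (elim a)
    have m: "(\<lambda>b. g (a, b)) \<in> borel_measurable lborel" using elim(2) by auto
    have i: "integrable lebesgue (\<lambda>b. g (a, b))" using integrable_completion[OF m] elim(2) by simp
    have e: "AE b in lebesgue. g (a, b) = F (a, b)" using AE_completion[OF elim(1)] by (auto elim: eventually_mono)
    have mF: "(\<lambda>b. F (a, b)) \<in> borel_measurable lebesgue"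
      by (rule borel_measurable_AE[OF borel_measurable_integrable[OF i] e])
    have "integrable lebesgue (\<lambda>b. F (a, b))" by (rule integrable_cong_AE_imp[OF i mF e])
    moreover have "(LINT b|lebesgue. F (a, b)) = (LINT b|lebesgue. g (a, b))"
      by (rule integral_cong_AE[OF mF borel_measurable_integrable[OF i]]) (use e in \<open>auto elim: eventually_mono\<close>)
    ultimately show ?case using integral_completion[OF m] by simp
  qed
  show "AE a in lebesgue. integrable lebesgue (\<lambda>b. F (a, b))"
    by (rule AE_completion) (use C in \<open>auto elim: eventually_mono\<close>)
  have gf: "integrable lborel (\<lambda>a. \<integral>b. g (a, b) \<partial>lborel)" by (rule lborel_pair.integrable_fst'[OF gi])
  have gf': "integrable lebesgue (\<lambda>a. \<integral>b. g (a, b) \<partial>lborel)"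
    using integrable_completion[OF borel_measurable_integrable[OF gf]] gf by simp
  have e: "AE a in lebesgue. (\<integral>b. g (a, b) \<partial>lborel) = (LINT b|lebesgue. F (a, b))"
    by (rule AE_completion) (use C in \<open>auto elim: eventually_mono\<close>)
  have mF: "(\<lambda>a. LINT b|lebesgue. F (a, b)) \<in> borel_measurable lebesgue"
    by (rule borel_measurable_AE[OF borel_measurable_integrable[OF gf'] e])
  show "integrable lebesgue (\<lambda>a. LINT b|lebesgue. F (a, b))" by (rule integrable_cong_AE_imp[OF gf' mF e])
  have "(LINT a|lebesgue. LINT b|lebesgue. F (a, b)) = (LINT a|lebesgue. \<integral>b. g (a, b) \<partial>lborel)"
    by (rule integral_cong_AE[OF mF borel_measurable_integrable[OF gf']]) (use e in \<open>auto elim: eventually_mono\<close>)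
  also have "\<dots> = (\<integral>a. \<integral>b. g (a, b) \<partial>lborel \<partial>lborel)"
    by (rule integral_completion[OF borel_measurable_integrable[OF gf]])
  also have "\<dots> = (\<integral>z. g z \<partial>(lborel \<Otimes>\<^sub>M lborel))" by (rule lborel_pair.integral_fst'[OF gi])
  also have "\<dots> = (LINT z|lebesgue. g z)" using integral_completion[OF g] by (simp add: lborel_prod)
  also have "\<dots> = (LINT z|lebesgue. F z)"
    by (rule integral_cong_AE[OF gl borel_measurable_integrable[OF F]]) (use ae' in \<open>auto elim: eventually_mono\<close>)
  finally show "(LINT a|lebesgue. LINT b|lebesgue. F (a, b)) = (LINT z|lebesgue. F z)" .
qed

lemma lborel_swap: "distr lborel borel prod.swap = (lborel :: ('a::euclidean_space \<times> 'b::euclidean_space) measure)"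
proof -
  have "(lborel :: ('a \<times> 'b) measure) = distr (lborel \<Otimes>\<^sub>M lborel) (lborel \<Otimes>\<^sub>M lborel) (\<lambda>(x, y). (y, x))"
    using lborel_pair.distr_pair_swap by (metis lborel_prod)
  also have "\<dots> = distr lborel borel prod.swap"
  proof (rule distr_cong)
    show "lborel \<Otimes>\<^sub>M lborel = (lborel :: ('b \<times> 'a) measure)" by (rule lborel_prod)
    show "sets (lborel \<Otimes>\<^sub>M lborel) = sets (borel :: ('a \<times> 'b) measure)" unfolding lborel_prod by simp
  qed auto
  finally show ?thesis by simp
qed

text \<open>Again by a Borel representative: the exceptional set lies in a Borel null set, and the
  preimage of that set under the swap is a null set too.\<close>

lemma lebesgue_swap:
  fixes F :: "'a::euclidean_space \<times> 'b::euclidean_space \<Rightarrow> real"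
  assumes F: "integrable lebesgue F"
  shows "integrable lebesgue (\<lambda>z. F (prod.swap z))" "(LINT z|lebesgue. F (prod.swap z)) = (LINT z|lebesgue. F z)"
proof -
  obtain g where g: "g \<in> borel_measurable lborel" and ae: "AE z in lborel. F z = g z"
    using completion_ex_borel_measurable_real[OF borel_measurable_integrable[OF F]] by auto
  have ae': "AE z in lebesgue. F z = g z" by (rule AE_completion[OF ae])
  have gl: "g \<in> borel_measurable lebesgue" using g by (rule measurable_completion)
  have "integrable lebesgue g"
    using integrable_cong_AE_imp[OF F gl] ae' by (auto elim: eventually_mono)
  hence gi: "integrable lborel g" using integrable_completion[OF g] by simp
  have sm: "prod.swap \<in> measurable (lborel :: ('b \<times> 'a) measure) (borel :: ('a \<times> 'b) measure)"
    by (simp add: borel_measurable_continuous_onI continuous_on_swap)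
  obtain N where N: "{z \<in> space lborel. F z \<noteq> g z} \<subseteq> N" "emeasure lborel N = 0" "N \<in> sets lborel"
    using AE_E[OF ae] .
  have "emeasure lborel (prod.swap -` N) = 0"
  proof -
    have "emeasure (lborel :: ('a \<times> 'b) measure) N = emeasure (distr (lborel :: ('b \<times> 'a) measure) borel prod.swap) N"
      by (simp add: lborel_swap)
    thus ?thesis using N sm by (simp add: emeasure_distr)
  qed
  moreover have "prod.swap -` N \<in> sets lborel" using measurable_sets[OF sm, of N] N by simp
  ultimately have aes: "AE z in lborel. g (prod.swap z) = F (prod.swap z)"
  proof (intro AE_I[where N="prod.swap -` N"])
    have "F z = g z" if "z \<notin> N" for z using N(1) that by auto
    thus "{z \<in> space lborel. g (prod.swap z) \<noteq> F (prod.swap z)} \<subseteq> prod.swap -` N" by fastforce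
  qed
  have gsm: "(\<lambda>z. g (prod.swap z)) \<in> borel_measurable lborel" using measurable_compose[OF sm] g by simp
  have gi': "integrable (distr lborel borel prod.swap) g" using gi by (simp add: lborel_swap)
  have gsi: "integrable lborel (\<lambda>z. g (prod.swap z))"
    using integrable_distr[OF _ gi'] sm by simp
  have gsl: "integrable lebesgue (\<lambda>z. g (prod.swap z))" using integrable_completion[OF gsm] gsi by simp
  have e: "AE z in lebesgue. g (prod.swap z) = F (prod.swap z)" by (rule AE_completion[OF aes])
  have mF: "(\<lambda>z. F (prod.swap z)) \<in> borel_measurable lebesgue"
    by (rule borel_measurable_AE[OF borel_measurable_integrable[OF gsl] e])
  show "integrable lebesgue (\<lambda>z. F (prod.swap z))" by (rule integrable_cong_AE_imp[OF gsl mF e])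
  have "(LINT z|lebesgue. F (prod.swap z)) = (LINT z|lebesgue. g (prod.swap z))"
    by (rule integral_cong_AE[OF mF borel_measurable_integrable[OF gsl]]) (use e in \<open>auto elim: eventually_mono\<close>)
  also have "\<dots> = (\<integral>z. g (prod.swap z) \<partial>lborel)" by (rule integral_completion[OF gsm])
  also have "\<dots> = (\<integral>z. g z \<partial>distr lborel borel prod.swap)" using sm g by (subst integral_distr) auto
  also have "\<dots> = (LINT z|lebesgue. g z)" by (simp add: lborel_swap integral_completion[OF g])
  also have "\<dots> = (LINT z|lebesgue. F z)"
    by (rule integral_cong_AE[OF gl borel_measurable_integrable[OF F]]) (use ae' in \<open>auto elim: eventually_mono\<close>)
  finally show "(LINT z|lebesgue. F (prod.swap z)) = (LINT z|lebesgue. F z)" .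
qed

lemma lebesgue_on_fubini:
  fixes F :: "'a::euclidean_space \<times> 'b::euclidean_space \<Rightarrow> real"
  assumes AB: "open A" "open B" and F: "integrable (lebesgue_on (A \<times> B)) F"
  shows "AE a in lebesgue_on A. integrable (lebesgue_on B) (\<lambda>b. F (a, b))"
    "integrable (lebesgue_on A) (\<lambda>a. LINT b|lebesgue_on B. F (a, b))"
    "(LINT a|lebesgue_on A. LINT b|lebesgue_on B. F (a, b)) = (LINT z|lebesgue_on (A \<times> B). F z)"
proof -
  have s: "A \<in> sets lebesgue" "B \<in> sets lebesgue" "A \<times> B \<in> sets lebesgue" using AB by (auto simp: open_Times)
  define G where "G = (\<lambda>z. indicator (A \<times> B) z *\<^sub>R F z)"
  have Gi: "integrable lebesgue G"
    using F s integrable_restrict_space[of "A \<times> B" lebesgue F] by (simp add: G_def)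
  have Gab: "G (a, b) = indicator A a *\<^sub>R (indicator B b *\<^sub>R F (a, b))" for a b
    by (simp add: G_def indicator_times)
  note f = lebesgue_fubini_UNIV[OF Gi, unfolded Gab]
  have "AE a in lebesgue. a \<in> A \<longrightarrow> integrable (lebesgue_on B) (\<lambda>b. F (a, b))"
    using f(1)
  proof eventually_elim
    case (elim a)
    show ?case
    proof
      assume "a \<in> A"
      thus "integrable (lebesgue_on B) (\<lambda>b. F (a, b))"
        using elim s integrable_restrict_space[of B lebesgue "\<lambda>b. F (a, b)"] by simp
    qed
  qed
  thus "AE a in lebesgue_on A. integrable (lebesgue_on B) (\<lambda>b. F (a, b))"
    using s by (subst AE_restrict_space_iff) auto
  have inner: "(LINT b|lebesgue. indicator A a *\<^sub>R (indicator B b *\<^sub>R F (a, b))) = indicator A a *\<^sub>R (LINT b|lebesgue_on B. F (a, b))" for a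
    using s by (subst integral_restrict_space) auto
  show "integrable (lebesgue_on A) (\<lambda>a. LINT b|lebesgue_on B. F (a, b))"
    using f(2) s integrable_restrict_space[of A lebesgue "\<lambda>a. LINT b|lebesgue_on B. F (a, b)"] unfolding inner by simp
  have "(LINT a|lebesgue_on A. LINT b|lebesgue_on B. F (a, b)) = (LINT a|lebesgue. indicator A a *\<^sub>R (LINT b|lebesgue_on B. F (a, b)))"
    using s by (subst integral_restrict_space) auto
  also have "\<dots> = (LINT z|lebesgue. G z)" using f(3) unfolding inner .
  also have "\<dots> = (LINT z|lebesgue_on (A \<times> B). F z)"
    using s by (subst integral_restrict_space) (auto simp: G_def)
  finally show "(LINT a|lebesgue_on A. LINT b|lebesgue_on B. F (a, b)) = (LINT z|lebesgue_on (A \<times> B). F z)" .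
qed

lemma lebesgue_on_fubini_swap:
  fixes F :: "'a::euclidean_space \<times> 'b::euclidean_space \<Rightarrow> real"
  assumes AB: "open A" "open B" and F: "integrable (lebesgue_on (A \<times> B)) F"
  shows "integrable (lebesgue_on B) (\<lambda>b. LINT a|lebesgue_on A. F (a, b))"
    "(LINT b|lebesgue_on B. LINT a|lebesgue_on A. F (a, b)) = (LINT z|lebesgue_on (A \<times> B). F z)"
proof -
  have s: "A \<times> B \<in> sets lebesgue" "B \<times> A \<in> sets lebesgue" using AB by (auto simp: open_Times)
  define G where "G = (\<lambda>z. indicator (A \<times> B) z *\<^sub>R F z)"
  have Gi: "integrable lebesgue G"
    using F s integrable_restrict_space[of "A \<times> B" lebesgue F] by (simp add: G_def)
  note sw = lebesgue_swap[OF Gi]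
  have Gs: "G (prod.swap z) = indicator (B \<times> A) z *\<^sub>R F (prod.swap z)" for z
    by (cases z) (auto simp: G_def indicator_def)
  have i: "integrable (lebesgue_on (B \<times> A)) (\<lambda>z. F (prod.swap z))"
    using sw(1) s integrable_restrict_space[of "B \<times> A" lebesgue "\<lambda>z. F (prod.swap z)"] unfolding Gs by simp
  show "integrable (lebesgue_on B) (\<lambda>b. LINT a|lebesgue_on A. F (a, b))"
    using lebesgue_on_fubini(2)[OF AB(2,1) i] by simp
  from lebesgue_on_fubini(3)[OF AB(2,1) i]
  have "(LINT b|lebesgue_on B. LINT a|lebesgue_on A. F (a, b)) = (LINT z|lebesgue_on (B \<times> A). F (prod.swap z))" by simp
  also have "\<dots> = (LINT z|lebesgue. G (prod.swap z))"
    using s by (subst integral_restrict_space) (auto simp: Gs)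
  also have "\<dots> = (LINT z|lebesgue. G z)" by (rule sw(2))
  also have "\<dots> = (LINT z|lebesgue_on (A \<times> B). F z)"
    using s by (subst integral_restrict_space) (auto simp: G_def)
  finally show "(LINT b|lebesgue_on B. LINT a|lebesgue_on A. F (a, b)) = (LINT z|lebesgue_on (A \<times> B). F z)" .
qed

lemma lebesgue_on_AE_sections:
  fixes A :: "'a::euclidean_space set" and B :: "'b::euclidean_space set"
  assumes AB: "open A" "open B" and P: "AE z in lebesgue_on (A \<times> B). P z"
  shows "AE a in lebesgue_on A. AE b in lebesgue_on B. P (a, b)"
proof -
  have s: "A \<in> sets lebesgue" "B \<in> sets lebesgue" "A \<times> B \<in> sets lebesgue" using AB by (auto simp: open_Times)
  have "AE z in lebesgue. z \<in> A \<times> B \<longrightarrow> P z" using P s by (subst (asm) AE_restrict_space_iff) auto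
  hence "AE z in lborel \<Otimes>\<^sub>M lborel. z \<in> A \<times> B \<longrightarrow> P z" unfolding AE_completion_iff lborel_prod .
  from lborel_pair.AE_pair[OF this]
  have "AE a in lborel. AE b in lborel. (a, b) \<in> A \<times> B \<longrightarrow> P (a, b)" .
  hence "AE a in lborel. a \<in> A \<longrightarrow> (AE b in lebesgue_on B. P (a, b))"
  proof eventually_elim
    case (elim a)
    show ?case
    proof
      assume "a \<in> A"
      hence "AE b in lborel. b \<in> B \<longrightarrow> P (a, b)" using elim by (auto elim: eventually_mono)
      from AE_completion[OF this] show "AE b in lebesgue_on B. P (a, b)" using s by (subst AE_restrict_space_iff) auto
    qed
  qed
  from AE_completion[OF this] show ?thesis using s by (subst AE_restrict_space_iff) auto
qed

section \<open>Functions on the space-time cylinder\<close>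

text \<open>Fubini is applied twice: to \<open>u\<close> itself, which gives measurability of almost
  every section, and to its square, which gives the norms.\<close>

lemma cyl_L2_sections:
  fixes \<Omega> :: "'a::euclidean_space set"
  assumes \<Omega>: "open \<Omega>" "bounded \<Omega>" and u: "case_prod u \<in> L2 (cyl T \<Omega>)"
  shows "AE t in lebesgue_on {0<..<T}. u t \<in> L2 \<Omega>"
    "integrable (lebesgue_on {0<..<T}) (\<lambda>t. (L2_norm \<Omega> (u t))\<^sup>2)"
    "(LINT t|lebesgue_on {0<..<T}. (L2_norm \<Omega> (u t))\<^sup>2) = (L2_norm (cyl T \<Omega>) (case_prod u))\<^sup>2"
proof -
  have bd: "bounded ({0<..<T} \<times> \<Omega>)" "{0<..<T} \<times> \<Omega> \<in> sets lebesgue"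
    using \<Omega> by (auto intro: bounded_Times simp: open_Times)
  have i1: "integrable (lebesgue_on ({0<..<T} \<times> \<Omega>)) (case_prod u)"
    using L2_integrable[OF u[unfolded cyl_def] bd] .
  have i2: "integrable (lebesgue_on ({0<..<T} \<times> \<Omega>)) (\<lambda>z. (case_prod u z)\<^sup>2)"
    using L2D(2)[OF u] by (simp add: cyl_def)
  note f1 = lebesgue_on_fubini[OF open_greaterThanLessThan \<Omega>(1) i1] and f2 = lebesgue_on_fubini[OF open_greaterThanLessThan \<Omega>(1) i2]
  show "AE t in lebesgue_on {0<..<T}. u t \<in> L2 \<Omega>"
    using f1(1) f2(1) by eventually_elim (auto simp: L2_def)
  show "integrable (lebesgue_on {0<..<T}) (\<lambda>t. (L2_norm \<Omega> (u t))\<^sup>2)"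
    using f2(2) by (simp add: L2_norm_sq)
  show "(LINT t|lebesgue_on {0<..<T}. (L2_norm \<Omega> (u t))\<^sup>2) = (L2_norm (cyl T \<Omega>) (case_prod u))\<^sup>2"
    using f2(3) by (simp add: L2_norm_sq cyl_def)
qed

lemma cyl_inner_integrable:
  fixes \<Omega> :: "'a::euclidean_space set"
  assumes \<Omega>: "open \<Omega>" and u: "case_prod u \<in> L2 (cyl T \<Omega>)" "case_prod v \<in> L2 (cyl T \<Omega>)"
  shows "integrable (lebesgue_on {0<..<T}) (\<lambda>t. LINT x|lebesgue_on \<Omega>. u t x * v t x)"
proof -
  have "integrable (lebesgue_on ({0<..<T} \<times> \<Omega>)) (\<lambda>z. case_prod u z * case_prod v z)"
    using L2_mult_integrable[OF u] by (simp add: cyl_def)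
  from lebesgue_on_fubini(2)[OF open_greaterThanLessThan \<Omega> this] show ?thesis by simp
qed

lemma lebesgue_on_measurable_AE:
  fixes f g :: "'a::euclidean_space \<Rightarrow> real"
  assumes f: "f \<in> borel_measurable (lebesgue_on S)" and S: "S \<in> sets lebesgue"
    and e: "AE x in lebesgue_on S. f x = g x"
  shows "g \<in> borel_measurable (lebesgue_on S)"
proof -
  have "(\<lambda>x. indicator S x *\<^sub>R f x) \<in> borel_measurable lebesgue"
    using f S borel_measurable_restrict_space_iff[of S lebesgue f] by simp
  moreover have "AE x in lebesgue. indicator S x *\<^sub>R f x = indicator S x *\<^sub>R g x"
  proof -
    have "AE x in lebesgue. x \<in> S \<longrightarrow> f x = g x" using e S by (subst (asm) AE_restrict_space_iff) auto
    thus ?thesis by eventually_elim (auto simp: indicator_def)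
  qed
  ultimately have "(\<lambda>x. indicator S x *\<^sub>R g x) \<in> borel_measurable lebesgue" by (rule borel_measurable_AE)
  thus ?thesis using S borel_measurable_restrict_space_iff[of S lebesgue g] by simp
qed

text \<open>Measurability of \<open>\<eta>\<close> refers to the completed measure and does not pass
  at once to functions on the product. A Borel representative \<open>k\<close> has a Borel extension
  that is constant in time.\<close>

lemma cyl_product_L2:
  fixes \<Omega> :: "'a::euclidean_space set"
  assumes \<Omega>: "open \<Omega>" "bounded \<Omega>" and \<eta>: "\<eta> \<in> L2 \<Omega>"
  obtains k where "k \<in> L2 \<Omega>" "AE x in lebesgue_on \<Omega>. \<eta> x = k x"
    "\<And>\<psi>. continuous_on UNIV \<psi> \<Longrightarrow> (\<lambda>(t, x). \<psi> t * k x) \<in> L2 (cyl T \<Omega>)"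
proof -
  have s: "\<Omega> \<in> sets lebesgue" "{0<..<T} \<times> \<Omega> \<in> sets lebesgue" using \<Omega> by (auto simp: open_Times)
  have "(\<lambda>x. indicator \<Omega> x *\<^sub>R \<eta> x) \<in> borel_measurable lebesgue"
    using L2D(1)[OF \<eta>] s borel_measurable_restrict_space_iff[of \<Omega> lebesgue \<eta>] by simp
  then obtain k where k: "k \<in> borel_measurable lborel" and ae: "AE x in lborel. indicator \<Omega> x *\<^sub>R \<eta> x = k x"
    using completion_ex_borel_measurable_real by blast
  have "AE x in lebesgue. x \<in> \<Omega> \<longrightarrow> \<eta> x = k x"
    using AE_completion[OF ae] by eventually_elim auto
  hence e: "AE x in lebesgue_on \<Omega>. \<eta> x = k x" using s by (subst AE_restrict_space_iff) auto
  have kL: "k \<in> L2 \<Omega>"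
    by (rule L2_cong_AE[OF \<eta> _ e]) (intro measurable_restrict_space1 measurable_completion k)
  have m: "(\<lambda>(t, x). k x) \<in> borel_measurable (lebesgue_on (cyl T \<Omega>))"
    by (intro measurable_restrict_space1 measurable_completion) (use k in \<open>simp add: lborel_prod[symmetric]\<close>)
  have "(\<lambda>(t, x). k x) \<in> L2 (cyl T \<Omega>)"
    unfolding L2_def
  proof (intro CollectI conjI m)
    have km[measurable]: "k \<in> borel_measurable lborel" by (rule k)
    have om[measurable]: "{0<..<T} \<in> sets lborel" "\<Omega> \<in> sets lborel" using \<Omega> by auto
    have nn: "(\<integral>\<^sup>+x. ennreal ((k x)\<^sup>2) * indicator \<Omega> x \<partial>lborel) < \<infinity>"
    proof -
      have "(\<integral>\<^sup>+x. ennreal ((k x)\<^sup>2) \<partial>lebesgue_on \<Omega>) < \<infinity>"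
        using L2D(2)[OF kL] by (subst nn_integral_eq_integral) auto
      also have "(\<integral>\<^sup>+x. ennreal ((k x)\<^sup>2) \<partial>lebesgue_on \<Omega>) = (\<integral>\<^sup>+x. ennreal ((k x)\<^sup>2) * indicator \<Omega> x \<partial>lebesgue)"
        using s by (subst nn_integral_restrict_space) auto
      finally show ?thesis by (simp add: nn_integral_completion)
    qed
    have "(\<integral>\<^sup>+z. ennreal ((case z of (t, x) \<Rightarrow> k x)\<^sup>2) \<partial>lebesgue_on (cyl T \<Omega>))
       = (\<integral>\<^sup>+z. ennreal ((k (snd z))\<^sup>2) * indicator ({0<..<T} \<times> \<Omega>) z \<partial>lebesgue)"
      using s by (subst nn_integral_restrict_space) (auto simp: cyl_def split_beta)
    also have "\<dots> = (\<integral>\<^sup>+z. ennreal ((k (snd z))\<^sup>2) * indicator ({0<..<T} \<times> \<Omega>) z \<partial>(lborel \<Otimes>\<^sub>M lborel))"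
      by (simp add: nn_integral_completion lborel_prod)
    also have "\<dots> = (\<integral>\<^sup>+t. \<integral>\<^sup>+x. (ennreal ((k x)\<^sup>2) * indicator \<Omega> x) * indicator {0<..<T} t \<partial>lborel \<partial>lborel)"
      by (subst lborel.nn_integral_fst[symmetric]) (auto simp: indicator_times mult_ac)
    also have "\<dots> = (\<integral>\<^sup>+x. ennreal ((k x)\<^sup>2) * indicator \<Omega> x \<partial>lborel) * emeasure lborel {0<..<T}"
      by (simp add: nn_integral_multc nn_integral_cmult)
    also have "\<dots> < \<infinity>" using nn by (cases "0 \<le> T") (simp_all add: ennreal_mult_less_top)
    finally show "integrable (lebesgue_on (cyl T \<Omega>)) (\<lambda>z. (case z of (t, x) \<Rightarrow> k x)\<^sup>2)"
      using m by (intro integrableI_nonneg) auto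
  qed
  note kc = this
  have bc: "bounded (cyl T \<Omega>)" using \<Omega> by (auto simp: cyl_def intro: bounded_Times)
  have "(\<lambda>(t, x). \<psi> t * k x) \<in> L2 (cyl T \<Omega>)" if \<psi>: "continuous_on UNIV \<psi>" for \<psi> :: "real \<Rightarrow> real"
  proof -
    have "continuous_on UNIV (\<lambda>z::real \<times> 'a. \<psi> (fst z))"
      by (intro continuous_on_compose2[OF \<psi>] continuous_intros) auto
    from L2_continuous_mult[OF kc bc this] show ?thesis by (simp add: case_prod_unfold)
  qed
  thus thesis using that kL e by blast
qed

lemma cyl_time_integral_measurable:
  fixes \<Omega> :: "'a::euclidean_space set"
  assumes \<Omega>: "open \<Omega>" "bounded \<Omega>" and w: "case_prod w \<in> L2 (cyl T \<Omega>)" and \<theta>: "continuous_on UNIV \<theta>"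
  shows "(\<lambda>x. LINT t|lebesgue_on {0<..<T}. w t x * \<theta> t) \<in> borel_measurable (lebesgue_on \<Omega>)"
proof -
  have bd: "bounded ({0<..<T} \<times> \<Omega>)" "{0<..<T} \<times> \<Omega> \<in> sets lebesgue"
    using \<Omega> by (auto intro: bounded_Times simp: open_Times)
  have "continuous_on UNIV (\<lambda>z::real \<times> 'a. \<theta> (fst z))"
    by (intro continuous_on_compose2[OF \<theta>] continuous_intros) auto
  from L2_continuous_mult[OF w[unfolded cyl_def] bd(1) this]
  have "integrable (lebesgue_on ({0<..<T} \<times> \<Omega>)) (\<lambda>z. \<theta> (fst z) * case_prod w z)"
    by (rule L2_integrable[OF _ bd])
  from lebesgue_on_fubini_swap(1)[OF open_greaterThanLessThan \<Omega>(1) this] show ?thesis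
    by (auto simp: mult.commute)
qed

text \<open>Pairing with a fixed \<open>\<eta>\<close> turns an H-valued function of time into a
  scalar one. The exchange of integrals connects this with \<open>has_time_derivative\<close>, which
  integrates in time for fixed \<open>x\<close>.\<close>

lemma cyl_inner_L2:
  fixes \<Omega> :: "'a::euclidean_space set"
  assumes \<Omega>: "open \<Omega>" "bounded \<Omega>" and w: "case_prod w \<in> L2 (cyl T \<Omega>)" and \<eta>: "\<eta> \<in> L2 \<Omega>"
  shows "(\<lambda>t. LINT x|lebesgue_on \<Omega>. w t x * \<eta> x) \<in> L2 {0<..<T}" (is ?L2)
    and "continuous_on UNIV \<theta> \<Longrightarrow> (LINT t|lebesgue_on {0<..<T}. (LINT x|lebesgue_on \<Omega>. w t x * \<eta> x) * \<theta> t)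
      = (LINT x|lebesgue_on \<Omega>. (LINT t|lebesgue_on {0<..<T}. w t x * \<theta> t) * \<eta> x)"
      (is "_ \<Longrightarrow> ?swap")
proof -
  let ?I = "lebesgue_on {0<..<T}" and ?M = "lebesgue_on \<Omega>"
  obtain k where k: "k \<in> L2 \<Omega>" "AE x in ?M. \<eta> x = k x"
    "\<And>\<psi>. continuous_on UNIV \<psi> \<Longrightarrow> (\<lambda>(t, x). \<psi> t * k x) \<in> L2 (cyl T \<Omega>)"
    by (rule cyl_product_L2[OF \<Omega> \<eta>, where T=T]) blast
  note sec = cyl_L2_sections[OF \<Omega> w]
  have eqk: "AE t in ?I. (LINT x|?M. w t x * k x) = (LINT x|?M. w t x * \<eta> x)"
    using sec(1)
  proof eventually_elim
    case (elim t)
    show ?case using k(2) L2D(1)[OF elim] L2D(1)[OF k(1)] L2D(1)[OF \<eta>]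
      by (intro integral_cong_AE) (auto elim: eventually_mono)
  qed
  have k1: "(\<lambda>(t::real, x). k x) \<in> L2 (cyl T \<Omega>)" using k(3)[of "\<lambda>_. 1"] by simp
  have mk: "(\<lambda>t. LINT x|?M. w t x * k x) \<in> borel_measurable ?I"
    using cyl_inner_integrable[OF \<Omega>(1) w, of "\<lambda>t. k"] k1 by auto
  have "(\<lambda>t. LINT x|?M. w t x * k x) \<in> L2 {0<..<T}"
    unfolding L2_def
  proof (intro CollectI conjI mk)
    show "integrable ?I (\<lambda>t. (LINT x|?M. w t x * k x)\<^sup>2)"
    proof (rule Bochner_Integration.integrable_bound)
      show "integrable ?I (\<lambda>t. (L2_norm \<Omega> (w t))\<^sup>2 * (L2_norm \<Omega> k)\<^sup>2)" using sec(2) by simp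
      show "AE t in ?I. norm ((LINT x|?M. w t x * k x)\<^sup>2) \<le> norm ((L2_norm \<Omega> (w t))\<^sup>2 * (L2_norm \<Omega> k)\<^sup>2)"
        using sec(1)
      proof eventually_elim
        case (elim t)
        show ?case using power_mono[OF L2_Cauchy_Schwarz[OF elim k(1)], of 2] by (simp add: power_mult_distrib)
      qed
    qed (use mk in auto)
  qed
  thus L2: ?L2
    by (rule L2_cong_AE[OF _ lebesgue_on_measurable_AE[OF mk _ eqk] eqk]) auto
  assume \<theta>: "continuous_on UNIV \<theta>"
  have \<theta>m: "\<theta> \<in> borel_measurable ?I" by (rule continuous_measurable_lebesgue_on[OF \<theta>])
  have F: "integrable (lebesgue_on ({0<..<T} \<times> \<Omega>)) (\<lambda>z. case_prod w z * (case z of (t, x) \<Rightarrow> \<theta> t * k x))"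
    using L2_mult_integrable[OF w k(3)[OF \<theta>]] by (simp add: cyl_def)
  have "(LINT t|?I. (LINT x|?M. w t x * \<eta> x) * \<theta> t) = (LINT t|?I. (LINT x|?M. w t x * k x) * \<theta> t)"
    using L2D(1)[OF L2] mk \<theta>m eqk by (intro integral_cong_AE) (auto elim: eventually_mono)
  also have "\<dots> = (LINT t|?I. LINT x|?M. w t x * (\<theta> t * k x))"
    unfolding Bochner_Integration.integral_mult_left_zero[symmetric]
    by (intro Bochner_Integration.integral_cong refl) (simp add: mult_ac)
  also have "\<dots> = (LINT x|?M. LINT t|?I. w t x * (\<theta> t * k x))"
    using lebesgue_on_fubini(3)[OF open_greaterThanLessThan \<Omega>(1) F] lebesgue_on_fubini_swap(2)[OF open_greaterThanLessThan \<Omega>(1) F]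
    by simp
  also have "\<dots> = (LINT x|?M. (LINT t|?I. w t x * \<theta> t) * k x)"
    by (simp add: mult.assoc[symmetric])
  also have "\<dots> = (LINT x|?M. (LINT t|?I. w t x * \<theta> t) * \<eta> x)"
    using cyl_time_integral_measurable[OF \<Omega> w \<theta>] L2D(1)[OF k(1)] L2D(1)[OF \<eta>] k(2)
    by (intro integral_cong_AE) (auto elim: eventually_mono)
  finally show ?swap .
qed

text \<open>The null set of points \<open>x\<close> may depend on the test function; integrating
  against \<open>\<eta>\<close> removes it and leaves a scalar weak derivative.\<close>

lemma has_time_derivative_inner:
  fixes \<Omega> :: "'a::euclidean_space set"
  assumes \<Omega>: "open \<Omega>" "bounded \<Omega>" and u: "has_time_derivative T \<Omega> u v" and \<eta>: "\<eta> \<in> L2 \<Omega>"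
  shows "weak_pd_rel {0<..<T} 1 (\<lambda>t. LINT x|lebesgue_on \<Omega>. u t x * \<eta> x) (\<lambda>t. LINT x|lebesgue_on \<Omega>. v t x * \<eta> x)"
  unfolding weak_pd_rel_def
proof
  fix \<psi> assume \<psi>: "\<psi> \<in> test_functions {0<..<T}"
  let ?I = "lebesgue_on {0<..<T}" and ?M = "lebesgue_on \<Omega>"
  have uv: "case_prod u \<in> L2 (cyl T \<Omega>)" "case_prod v \<in> L2 (cyl T \<Omega>)" using u by (auto simp: has_time_derivative_def)
  note C\<psi> = test_functions_C1[OF \<psi>]
  have pd_deriv: "pd 1 \<psi> t = deriv \<psi> t" for t
  proof -
    have "(\<psi> has_derivative (\<lambda>z. z * pd 1 \<psi> t)) (at t)" using C1_has_derivative[OF C\<psi>, of t] by simp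
    hence "(\<psi> has_field_derivative pd 1 \<psi> t) (at t)" by (simp add: has_field_derivative_def mult_commute_abs)
    thus ?thesis by (simp add: DERIV_imp_deriv)
  qed
  note c = C1_continuous[OF C\<psi>, of UNIV] C1_continuous_pd[OF C\<psi>, of 1 UNIV]
  have e: "AE x in ?M. (LINT t|?I. u t x * pd 1 \<psi> t) = - (LINT t|?I. v t x * \<psi> t)"
    using u \<psi> unfolding has_time_derivative_def pd_deriv by blast
  show "(LINT t|?I. (LINT x|?M. u t x * \<eta> x) * pd 1 \<psi> t) = - (LINT t|?I. (LINT x|?M. v t x * \<eta> x) * \<psi> t)"
    unfolding cyl_inner_L2(2)[OF \<Omega> uv(1) \<eta> c(2)[simplified]] cyl_inner_L2(2)[OF \<Omega> uv(2) \<eta> c(1)]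
      Bochner_Integration.integral_minus[symmetric]
    using cyl_time_integral_measurable[OF \<Omega> uv(1) c(2)[simplified]] cyl_time_integral_measurable[OF \<Omega> uv(2) c(1)]
      L2D(1)[OF \<eta>] e
    by (intro integral_cong_AE) (auto elim: eventually_mono)
qed

section \<open>The fundamental theorem for scalar weak derivatives\<close>

lemma pd_real: "Ck 1 \<psi> \<Longrightarrow> (\<psi> has_field_derivative pd 1 \<psi> t) (at t)"
  using C1_has_derivative[of \<psi> t] by (simp add: has_field_derivative_def mult_commute_abs)

lemma lebesgue_on_open_interval_integral:
  assumes "integrable (lebesgue_on {a<..<b::real}) f"
  shows "f integrable_on {a..b}" "(LINT t|lebesgue_on {a<..<b}. f t) = integral {a..b} (f :: real \<Rightarrow> real)"
proof -
  have "f integrable_on {a<..<b}" by (rule integrable_on_lebesgue_on[OF assms]) auto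
  thus "f integrable_on {a..b}" by (simp add: integrable_on_open_interval_real)
  have "(LINT t|lebesgue_on {a<..<b}. f t) = integral {a<..<b} f" by (rule lebesgue_integral_eq_integral[OF assms]) auto
  thus "(LINT t|lebesgue_on {a<..<b}. f t) = integral {a..b} f" by (simp add: integral_open_interval_real)
qed

lemma step_shift:
  "Ck 1 (\<lambda>t::real. step (c * (t - a)))" "pd 1 (\<lambda>t::real. step (c * (t - a))) t = step' (c * (t - a)) * c"
proof -
  have D: "Ck 1 (\<lambda>t::real. t - a)" by (rule C1I[where f'="\<lambda>x z. z"]) (auto intro!: derivative_eq_intros)
  have "pd 1 (\<lambda>t::real. t - a) t = 1"
    by (rule pd_eqI[where f'="\<lambda>z. z", simplified]) (auto intro!: derivative_eq_intros)
  thus "Ck 1 (\<lambda>t::real. step (c * (t - a)))" "pd 1 (\<lambda>t::real. step (c * (t - a))) t = step' (c * (t - a)) * c"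
    using step_compose(1)[OF D, of c] step_compose(2)[OF D, of 1 c t] by (simp_all del: Ck.simps One_nat_def)
qed

lemma step'_mass:
  assumes "0 < a" "a < T" "c * (T - a) \<ge> 2" "c > 0"
  shows "(LINT t|lebesgue_on {0<..<T}. step' (c * (t - a)) * c) = 1"
proof -
  have hi: "((\<lambda>t. step' (c * (t - a)) * c) has_integral (step (c * (T - a)) - step (c * (0 - a)))) {0..T}"
  proof (rule fundamental_theorem_of_calculus)
    fix t assume "t \<in> {0..T}"
    have "((\<lambda>t. step (c * (t - a))) has_field_derivative step' (c * (t - a)) * c) (at t)"
      using pd_real[OF step_shift(1)] by (simp add: step_shift(2))
    thus "((\<lambda>t. step (c * (t - a))) has_vector_derivative step' (c * (t - a)) * c) (at t within {0..T})"
      by (simp add: has_real_derivative_iff_has_vector_derivative has_vector_derivative_at_within)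
  qed (use assms in simp)
  have "step (c * (T - a)) = 1" "step (c * (0 - a)) = 0"
    using assms by (auto intro!: step_1 step_0 order_trans[OF _ mult_nonneg_nonneg])
  hence "integral {0..T} (\<lambda>t. step' (c * (t - a)) * c) = 1" unfolding integral_unique[OF hi] by simp
  moreover have "integrable (lebesgue_on {0<..<T}) (\<lambda>t. step' (c * (t - a)) * c)"
    by (rule L2_integrable[OF continuous_in_L2])
       (auto intro!: continuous_intros continuous_on_compose2[OF step'_continuous[of UNIV]])
  ultimately show ?thesis using lebesgue_on_open_interval_integral(2) by metis
qed

text \<open>The kernel is nonnegative, has mass one, and lives between \<open>a + 1 / c\<close> and
  \<open>a + 2 / c\<close> with \<open>c = real (Suc n)\<close>; it is a one-sided approximate
  identity.\<close>

lemma step'_concentrates: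
  fixes y :: "real \<Rightarrow> real"
  assumes y: "continuous_on {0..T} y" "y \<in> borel_measurable (lebesgue_on {0<..<T})" and a: "0 < a" "a < T"
  shows "(\<lambda>n. LINT t|lebesgue_on {0<..<T}. y t * (step' (real (Suc n) * (t - a)) * real (Suc n))) \<longlonglongrightarrow> y a"
proof (rule LIMSEQ_I)
  fix r :: real assume "r > 0"
  let ?I = "lebesgue_on {0<..<T}"
  obtain d where d: "d > 0" "\<And>t. t \<in> {0..T} \<Longrightarrow> dist t a < d \<Longrightarrow> dist (y t) (y a) < r / 2"
    using y(1) a \<open>r > 0\<close> unfolding continuous_on_iff by (metis atLeastAtMost_iff half_gt_zero less_eq_real_def)
  obtain B where B: "\<And>t. t \<in> {0..T} \<Longrightarrow> \<bar>y t\<bar> \<le> B"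
    using compact_imp_bounded[OF compact_continuous_image[OF y(1) compact_Icc]] unfolding bounded_iff by (metis imageI real_norm_def)
  obtain N :: nat where N: "max (2 / (T - a)) (4 / d) \<le> real N" using real_arch_simple by blast
  show "\<exists>no. \<forall>n\<ge>no. norm ((LINT t|?I. y t * (step' (real (Suc n) * (t - a)) * real (Suc n))) - y a) < r"
  proof (intro exI allI impI)
    fix n assume n: "N \<le> n"
    define c where "c = real (Suc n)"
    have c: "c > 0" "2 / (T - a) \<le> c" "4 / d \<le> c" using N n by (auto simp: c_def)
    \<comment> \<open>The first bound puts the whole kernel inside the interval, the second makes it
      vanish at distance \<open>d\<close> or more from \<open>a\<close>.\<close>
    have c2: "c * (T - a) \<ge> 2" "c * d \<ge> 4" using c a d by (auto simp: field_simps)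
    define k where "k t = step' (c * (t - a)) * c" for t
    have k0: "k t \<ge> 0" for t using c step'_bounds by (simp add: k_def)
    have kc: "continuous_on UNIV k" unfolding k_def[abs_def]
      by (intro continuous_intros continuous_on_compose2[OF step'_continuous[of UNIV]]) auto
    have kL: "k \<in> L2 {0<..<T}" by (rule continuous_in_L2[OF _ _ kc]) auto
    have yL: "y \<in> L2 {0<..<T}" by (rule bounded_in_L2[OF _ _ y(2), of B]) (use B in auto)
    have ki: "integrable ?I k" by (rule L2_integrable[OF kL]) auto
    have yk: "integrable ?I (\<lambda>t. y t * k t)" by (rule L2_mult_integrable[OF yL kL])
    have mass: "(LINT t|?I. k t) = 1" unfolding k_def by (rule step'_mass[OF a c2(1) c(1)])
    have yk2: "integrable ?I (\<lambda>t. (y t - y a) * k t)" using yk ki by (simp add: left_diff_distrib)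
    have "(LINT t|?I. y t * k t) - y a = (LINT t|?I. (y t - y a) * k t)"
      using yk ki mass by (simp add: left_diff_distrib)
    also have "\<bar>\<dots>\<bar> \<le> (LINT t|?I. \<bar>(y t - y a) * k t\<bar>)" by (rule integral_abs_bound)
    also have "\<dots> \<le> (LINT t|?I. r / 2 * k t)"
    proof (rule Bochner_Integration.integral_mono)
      fix t assume "t \<in> space ?I"
      hence t: "t \<in> {0..T}" by simp
      show "\<bar>(y t - y a) * k t\<bar> \<le> r / 2 * k t"
      proof (cases "dist t a < d")
        case True
        hence "\<bar>y t - y a\<bar> \<le> r / 2" using d(2)[OF t] by (simp add: dist_real_def)
        from mult_right_mono[OF this k0[of t]] show ?thesis using k0[of t] by (simp only: abs_mult abs_of_nonneg)
      next
        case False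
        hence "t - a \<le> -d \<or> t - a \<ge> d" by (auto simp: dist_real_def)
        moreover have "c * (t - a) \<ge> c * d" if "t - a \<ge> d" using that c by (intro mult_left_mono) auto
        moreover have "c * (t - a) \<le> 0" if "t - a \<le> -d" using that c d by (intro mult_nonneg_nonpos) auto
        ultimately have "k t = 0" using c2 step'_0[of "c * (t - a)"] unfolding k_def by force
        thus ?thesis by simp
      qed
    qed (use ki yk2 in auto)
    also have "\<dots> = r / 2" using mass by simp
    also have "\<dots> < r" using \<open>r > 0\<close> by simp
    finally show "norm ((LINT t|?I. y t * (step' (real (Suc n) * (t - a)) * real (Suc n))) - y a) < r"
      by (simp add: k_def c_def)
  qed
qed

text \<open>Testing with the difference of two shifted steps compares mean values of
  \<open>Y\<close> just to the right of \<open>a\<close> and of \<open>b\<close> with an integral of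
  \<open>z\<close>. Since \<open>y\<close> is continuous, the means converge to its values, and the
  test functions converge to the indicator of the interval between.\<close>

lemma weak_derivative_FTC:
  fixes y Y z :: "real \<Rightarrow> real"
  assumes T: "0 < T" and y: "continuous_on {0..T} y" and Y: "Y \<in> L2 {0<..<T}" "z \<in> L2 {0<..<T}"
    and e: "AE t in lebesgue_on {0<..<T}. Y t = y t" and weak: "weak_pd_rel {0<..<T} 1 Y z"
    and ab: "0 \<le> a" "a \<le> b" "b \<le> T"
  shows "y b - y a = integral {a..b} z" "z integrable_on {a..b}"
proof -
  let ?I = "lebesgue_on {0<..<T}"
  have zi: "integrable ?I z" by (rule L2_integrable[OF Y(2)]) auto
  have zT: "z integrable_on {0..T}" by (rule lebesgue_on_open_interval_integral(1)[OF zi])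
  have zab: "z integrable_on {a..b}" if "0 \<le> a" "b \<le> T" for a b
    by (rule integrable_on_subinterval[OF zT]) (use that in auto)
  show "z integrable_on {a..b}" using zab ab by simp
  have ym: "y \<in> borel_measurable ?I" by (rule lebesgue_on_measurable_AE[OF L2D(1)[OF Y(1)] _ e]) auto
  \<comment> \<open>The interior case: each step rises to the right of its base point, so
    \<open>b < T\<close> leaves room for the second rise once \<open>n\<close> is large, and the
    test function has compact support.\<close>
  have inner: "y b - y a = integral {a..b} z" if ab: "0 < a" "a \<le> b" "b < T" for a b
  proof -
    define st where "st n x t = step (real (Suc n) * (t - x))" for n and x t :: real
    define k where "k n x t = step' (real (Suc n) * (t - x)) * real (Suc n)" for n and x t :: real
    have kc: "continuous_on UNIV (k n x)" for n x unfolding k_def[abs_def]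
      by (intro continuous_intros continuous_on_compose2[OF step'_continuous[of UNIV]]) auto
    have kL: "k n x \<in> L2 {0<..<T}" for n x by (rule continuous_in_L2[OF _ _ kc]) auto
    have stc: "continuous_on UNIV (st n x)" for n x unfolding st_def[abs_def] by (rule C1_continuous[OF step_shift(1)])
    obtain N :: nat where N: "2 / (T - b) < real N" using reals_Archimedean2 by blast
    have id: "(LINT t|?I. y t * k n a t) - (LINT t|?I. y t * k n b t) = - (LINT t|?I. z t * (st n a t - st n b t))"
      if n: "n \<ge> N" for n
    proof -
      let ?c = "real (Suc n)"
      have C: "Ck 1 (\<lambda>t. st n a t - st n b t)" unfolding st_def by (intro Ck_diff step_shift)
      have pde: "pd 1 (\<lambda>t. st n a t - st n b t) t = k n a t - k n b t" for t
      proof -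
        have "Ck 1 (st n a)" "Ck 1 (st n b)" unfolding st_def by (rule step_shift)+
        hence "pd 1 (\<lambda>t. st n a t - st n b t) t = pd 1 (st n a) t - pd 1 (st n b) t" by (intro pd_diff) auto
        thus ?thesis unfolding st_def step_shift(2) k_def .
      qed
      have cs: "csupp_in {0<..<T} (\<lambda>t. st n a t - st n b t)"
        unfolding csupp_in_def
      proof (intro exI conjI allI impI)
        have "2 / (T - b) < ?c" using N n by simp
        hence "2 / ?c < T - b" using ab by (simp add: field_simps)
        thus "{a..b + 2 / ?c} \<subseteq> {0<..<T}" using ab by auto
        fix t assume "t \<notin> {a..b + 2 / ?c}"
        then consider "t < a" | "t > b + 2 / ?c" by fastforce
        thus "st n a t - st n b t = 0"
        proof cases
          case 1
          hence "?c * (t - a) \<le> 0" "?c * (t - b) \<le> 0" using ab by (intro mult_nonneg_nonpos; simp)+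
          thus ?thesis by (simp add: st_def step_0)
        next
          case 2
          hence "2 / ?c \<le> t - b" by simp
          hence "2 \<le> ?c * (t - b)" by (simp add: field_simps)
          moreover have "?c * (t - b) \<le> ?c * (t - a)" using ab by (intro mult_left_mono) auto
          ultimately show ?thesis
            unfolding st_def using step_1[of "?c * (t - a)"] step_1[of "?c * (t - b)"] by linarith
        qed
      qed simp
      have yk: "integrable ?I (\<lambda>t. Y t * k n x t)" for x by (rule L2_mult_integrable[OF Y(1) kL])
      have "(LINT t|?I. Y t * pd 1 (\<lambda>t. st n a t - st n b t) t) = - (LINT t|?I. z t * (st n a t - st n b t))"
        by (rule weak_pd_rel_C1[OF _ _ Y weak _ C cs]) auto
      moreover have "(LINT t|?I. Y t * pd 1 (\<lambda>t. st n a t - st n b t) t) = (LINT t|?I. Y t * k n a t) - (LINT t|?I. Y t * k n b t)"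
        unfolding pde using yk by (simp add: right_diff_distrib)
      moreover have "(LINT t|?I. Y t * k n x t) = (LINT t|?I. y t * k n x t)" for x
        using e ym L2D(1)[OF Y(1)] L2D(1)[OF kL[of n x]] by (intro integral_cong_AE) (auto elim: eventually_mono)
      ultimately show ?thesis by simp
    qed
    have L: "(\<lambda>n. (LINT t|?I. y t * k n a t) - (LINT t|?I. y t * k n b t)) \<longlonglongrightarrow> y a - y b"
      unfolding k_def by (intro tendsto_diff step'_concentrates y ym) (use ab in auto)
    have st_lim: "(\<lambda>n. st n x t) \<longlonglongrightarrow> indicator {x<..} t" for x t
    proof (cases "x < t")
      case True
      obtain M :: nat where M: "2 / (t - x) \<le> real M" using real_arch_simple by blast
      have "st n x t = 1" if "n \<ge> M" for n
      proof -
        have "2 / (t - x) \<le> real (Suc n)" using M that by simp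
        thus ?thesis unfolding st_def by (intro step_1) (use True in \<open>simp add: field_simps\<close>)
      qed
      hence "\<forall>\<^sub>F n in sequentially. st n x t = 1" unfolding eventually_sequentially by blast
      thus ?thesis using True by (simp add: tendsto_eventually)
    next
      case False
      have "real (Suc n) * (t - x) \<le> 0" for n using False by (intro mult_nonneg_nonpos) auto
      hence "st n x t = 0" for n unfolding st_def using step_0[of "real (Suc n) * (t - x)"] by (meson order_trans zero_le_one)
      thus ?thesis using False by simp
    qed
    have R: "(\<lambda>n. - (LINT t|?I. z t * (st n a t - st n b t))) \<longlonglongrightarrow> - (LINT t|?I. z t * (indicator {a<..} t - indicator {b<..} t))"
    proof (rule tendsto_minus, rule integral_dominated_convergence[where w="\<lambda>t. \<bar>z t\<bar>"])
      show "(\<lambda>t. z t * (indicator {a<..} t - indicator {b<..} t)) \<in> borel_measurable ?I"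
      proof -
        have "(\<lambda>t. indicator {a<..} t - indicator {b<..} t :: real) \<in> borel_measurable lborel" by simp
        hence "(\<lambda>t. indicator {a<..} t - indicator {b<..} t :: real) \<in> borel_measurable ?I"
          by (intro measurable_restrict_space1 measurable_completion)
        thus ?thesis using zi by auto
      qed
      show "(\<lambda>t. z t * (st n a t - st n b t)) \<in> borel_measurable ?I" for n
        using zi continuous_measurable_lebesgue_on[OF stc] by auto
      show "AE t in ?I. norm (z t * (st n a t - st n b t)) \<le> \<bar>z t\<bar>" for n
      proof (rule AE_I2)
        fix t
        have "\<bar>st n a t - st n b t\<bar> \<le> 1"
          using step_bounds[of "real (Suc n) * (t - a)"] step_bounds[of "real (Suc n) * (t - b)"] by (simp add: st_def abs_le_iff)
        thus "norm (z t * (st n a t - st n b t)) \<le> \<bar>z t\<bar>" by (simp add: abs_mult mult_left_le)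
      qed
      show "AE t in ?I. (\<lambda>n. z t * (st n a t - st n b t)) \<longlonglongrightarrow> z t * (indicator {a<..} t - indicator {b<..} t)"
        by (intro AE_I2 tendsto_intros st_lim)
    qed (use zi in auto)
    have "(\<lambda>n. (LINT t|?I. y t * k n a t) - (LINT t|?I. y t * k n b t)) \<longlonglongrightarrow> - (LINT t|?I. z t * (indicator {a<..} t - indicator {b<..} t))"
      by (rule Lim_transform_eventually[OF R]) (use id in \<open>auto simp: eventually_sequentially intro!: exI[of _ N]\<close>)
    hence "y a - y b = - (LINT t|?I. z t * (indicator {a<..} t - indicator {b<..} t))"
      by (rule LIMSEQ_unique[OF L])
    also have "(LINT t|?I. z t * (indicator {a<..} t - indicator {b<..} t)) = (LINT t|?I. indicator {a<..b} t *\<^sub>R z t)"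
      using ab by (intro Bochner_Integration.integral_cong refl) (auto simp: indicator_def)
    also have "\<dots> = integral {0..T} (\<lambda>t. if t \<in> {a<..b} then z t else 0)"
    proof -
      have "integrable ?I (\<lambda>t. indicator {a<..b} t *\<^sub>R z t)"
        using zi ab by (intro integrable_mult_indicator) (auto simp: sets_restrict_space_iff)
      moreover have "(\<lambda>t. indicator {a<..b} t *\<^sub>R z t) = (\<lambda>t. if t \<in> {a<..b} then z t else 0)"
        by (auto simp: indicator_def)
      ultimately show ?thesis using lebesgue_on_open_interval_integral(2) by metis
    qed
    also have "\<dots> = integral ({0..T} \<inter> {a<..b}) z" by (simp only: integral_restrict_Int Int_commute)
    also have "\<dots> = integral {a..b} z"
    proof (rule integral_spike_set)
      show "negligible {x \<in> {0..T} \<inter> {a<..b} - {a..b}. z x \<noteq> 0}"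
        by (rule negligible_subset[of "{a}"]) auto
      show "negligible {x \<in> {a..b} - {0..T} \<inter> {a<..b}. z x \<noteq> 0}"
        by (rule negligible_subset[of "{a}"]) (use ab in auto)
    qed
    finally show ?thesis by simp
  qed
  \<comment> \<open>\<open>G\<close> is constant on the open interval by \<open>inner\<close> and
    continuous on the closed one, which brings in the endpoints 0 and \<open>T\<close>.\<close>
  define G where "G t = y t - integral {0..t} z" for t
  have G: "G b = G a" if "0 < a" "a \<le> b" "b < T" for a b
    using inner[OF that] Henstock_Kurzweil_Integration.integral_combine[of 0 a b z] that zab[of 0 b] by (simp add: G_def)
  have cG: "continuous_on {0..T} G" unfolding G_def
    by (intro continuous_intros y indefinite_integral_continuous_1 zT)
  have const: "G t = G (T / 2)" if "t \<in> {0..T}" for t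
  proof -
    have cl: "closure {0<..<T} = {0..T}" using T by simp
    show ?thesis
    proof (rule continuous_constant_on_closure[of "{0<..<T}" G])
      show "continuous_on (closure {0<..<T}) G" using cG cl by simp
      show "\<And>x. x \<in> {0<..<T} \<Longrightarrow> G x = G (T / 2)"
      proof -
        fix x assume "x \<in> {0<..<T}"
        thus "G x = G (T / 2)" using G[of x "T/2"] G[of "T/2" x] T by (cases "x \<le> T / 2") auto
      qed
      show "t \<in> closure {0<..<T}" using that cl by simp
    qed
  qed
  have "G b = G (T / 2)" "G a = G (T / 2)" using ab by (intro const; simp)+
  hence "G b = G a" by simp
  thus "y b - y a = integral {a..b} z"
    using Henstock_Kurzweil_Integration.integral_combine[of 0 a b z] ab zab[of 0 b] by (simp add: G_def)
qed

section \<open>The energy identity for paths in H\<close>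

text \<open>Cut the interval into equal pieces shorter than \<open>d\<close> and telescope: the
  total change of \<open>P\<close> is at most \<open>e\<close> times that of \<open>m\<close>. No
  differentiability of \<open>P\<close> is involved.\<close>

lemma small_increments_constant:
  fixes P m :: "real \<Rightarrow> real"
  assumes t: "0 \<le> t"
    and inc: "\<And>e. e > 0 \<Longrightarrow> \<exists>d>0. \<forall>a b. 0 \<le> a \<and> a \<le> b \<and> b \<le> t \<and> b - a < d \<longrightarrow> \<bar>P b - P a\<bar> \<le> e * (m b - m a)"
  shows "P t = P 0"
proof -
  have "\<bar>P t - P 0\<bar> \<le> e * \<bar>m t - m 0\<bar>" if e: "e > 0" for e
  proof -
    obtain d where d: "d > 0" "\<And>a b. 0 \<le> a \<Longrightarrow> a \<le> b \<Longrightarrow> b \<le> t \<Longrightarrow> b - a < d \<Longrightarrow> \<bar>P b - P a\<bar> \<le> e * (m b - m a)"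
      using inc[OF e] by blast
    obtain n :: nat where n: "t / d < real n" using reals_Archimedean2 by blast
    have n0: "n > 0" using n t d by (cases n) (auto simp: field_simps)
    define s where "s i = t * real i / real n" for i
    have s: "0 \<le> s i" "s i \<le> s (Suc i)" "i < n \<Longrightarrow> s (Suc i) \<le> t" "s (Suc i) - s i < d" for i
    proof -
      show "0 \<le> s i" using t by (simp add: s_def)
      show "s i \<le> s (Suc i)" unfolding s_def using t n0 by (intro divide_right_mono mult_left_mono) auto
      show "s (Suc i) - s i < d" using n n0 d by (simp add: s_def field_simps)
      assume "i < n"
      hence "t * real (Suc i) \<le> t * real n" using t by (intro mult_left_mono) auto
      thus "s (Suc i) \<le> t" using n0 by (simp add: s_def field_simps)
    qed
    have ends: "s 0 = 0" "s n = t" using n0 by (auto simp: s_def)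
    have "\<bar>P t - P 0\<bar> = \<bar>\<Sum>i<n. P (s (Suc i)) - P (s i)\<bar>"
      using sum_lessThan_telescope[of "\<lambda>i. P (s i)" n] ends by simp
    also have "\<dots> \<le> (\<Sum>i<n. \<bar>P (s (Suc i)) - P (s i)\<bar>)" by (rule sum_abs)
    also have "\<dots> \<le> (\<Sum>i<n. e * (m (s (Suc i)) - m (s i)))"
      by (rule sum_mono) (use s d in auto)
    also have "\<dots> = e * (m t - m 0)"
      using sum_lessThan_telescope[of "\<lambda>i. m (s i)" n] ends by (simp add: sum_distrib_left[symmetric])
    also have "\<dots> \<le> e * \<bar>m t - m 0\<bar>" using e by (intro mult_left_mono) auto
    finally show ?thesis .
  qed
  from abs_le_all_eps_0[OF this] show ?thesis by simp
qed

text \<open>Heine-Cantor for a path in H. On representatives \<open>L2_norm\<close> is only a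
  seminorm, so the argument is run directly with a Lebesgue number of a cover of the time
  interval.\<close>

lemma L2_path_uniform:
  fixes w :: "real \<Rightarrow> 'a::euclidean_space \<Rightarrow> real" and T e :: real
  assumes wL: "\<And>t. t \<in> {0..T} \<Longrightarrow> w t \<in> L2 \<Omega>"
    and wc: "\<And>t. t \<in> {0..T} \<Longrightarrow> ((\<lambda>s. L2_norm \<Omega> (\<lambda>x. w s x - w t x)) \<longlongrightarrow> 0) (at t within {0..T})"
    and e: "e > 0"
  obtains d where "d > 0" "\<And>s t. s \<in> {0..T} \<Longrightarrow> t \<in> {0..T} \<Longrightarrow> dist s t < d \<Longrightarrow> L2_norm \<Omega> (\<lambda>x. w s x - w t x) < e"
proof -
  have "\<exists>d>0. \<forall>s\<in>{0..T}. dist s t < d \<longrightarrow> L2_norm \<Omega> (\<lambda>x. w s x - w t x) < e / 2" if t: "t \<in> {0..T}" for t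
  proof -
    have "\<forall>\<^sub>F s in at t within {0..T}. L2_norm \<Omega> (\<lambda>x. w s x - w t x) < e / 2"
      using order_tendstoD(2)[OF wc[OF t], of "e / 2"] e by simp
    then obtain d where d: "d > 0" "\<forall>s\<in>{0..T}. s \<noteq> t \<and> dist s t < d \<longrightarrow> L2_norm \<Omega> (\<lambda>x. w s x - w t x) < e / 2"
      unfolding eventually_at by blast
    moreover have "L2_norm \<Omega> (\<lambda>x. w t x - w t x) < e / 2" using e by (simp add: L2_norm_def)
    ultimately show ?thesis by metis
  qed
  then obtain \<delta> where \<delta>: "\<And>t. t \<in> {0..T} \<Longrightarrow> \<delta> t > 0"
    "\<And>s t. t \<in> {0..T} \<Longrightarrow> s \<in> {0..T} \<Longrightarrow> dist s t < \<delta> t \<Longrightarrow> L2_norm \<Omega> (\<lambda>x. w s x - w t x) < e / 2"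
    by metis
  obtain d where d: "d > 0" "\<And>x. x \<in> {0..T} \<Longrightarrow> \<exists>G\<in>(\<lambda>t. ball t (\<delta> t)) ` {0..T}. ball x d \<subseteq> G"
  proof (rule Heine_Borel_lemma[OF compact_Icc[of 0 T], of "(\<lambda>t. ball t (\<delta> t)) ` {0..T}"])
    show "{0..T} \<subseteq> \<Union> ((\<lambda>t. ball t (\<delta> t)) ` {0..T})" using \<delta>(1) by force
  qed auto
  show thesis
  proof (rule that[OF d(1)])
    fix s t assume st: "s \<in> {0..T}" "t \<in> {0..T}" "dist s t < d"
    obtain r where r: "r \<in> {0..T}" "ball t d \<subseteq> ball r (\<delta> r)" using d(2)[OF st(2)] by blast
    have "s \<in> ball t d" "t \<in> ball t d" using st(3) d(1) by (auto simp: dist_commute)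
    hence "s \<in> ball r (\<delta> r)" "t \<in> ball r (\<delta> r)" using r(2) by blast+
    hence "L2_norm \<Omega> (\<lambda>x. w s x - w r x) < e / 2" "L2_norm \<Omega> (\<lambda>x. w t x - w r x) < e / 2"
      using \<delta>(2)[OF r(1)] st by (auto simp: dist_commute)
    moreover have "L2_norm \<Omega> (\<lambda>x. w s x - w t x) \<le> L2_norm \<Omega> (\<lambda>x. w s x - w r x) + L2_norm \<Omega> (\<lambda>x. w t x - w r x)"
      using L2_norm_triangle_diff[OF L2_diff[OF wL[OF st(1)] wL[OF r(1)]] L2_diff[OF wL[OF st(2)] wL[OF r(1)]]]
      by simp
    ultimately show "L2_norm \<Omega> (\<lambda>x. w s x - w t x) < e" by simp
  qed
qed

text \<open>The continuous representative of a function in \<open>H\<^sup>1(0,T;H)\<close>, with its weak derivative.\<close>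

definition h1_path :: "real \<Rightarrow> 'a::euclidean_space set \<Rightarrow> (real \<Rightarrow> 'a \<Rightarrow> real) \<Rightarrow> (real \<Rightarrow> 'a \<Rightarrow> real) \<Rightarrow> (real \<Rightarrow> 'a \<Rightarrow> real) \<Rightarrow> bool" where
  "h1_path T \<Omega> u v w \<longleftrightarrow> case_prod u \<in> L2 (cyl T \<Omega>) \<and> case_prod v \<in> L2 (cyl T \<Omega>) \<and>
     (\<forall>t\<in>{0..T}. w t \<in> L2 \<Omega>) \<and>
     (\<forall>t\<in>{0..T}. ((\<lambda>s. L2_norm \<Omega> (\<lambda>x. w s x - w t x)) \<longlongrightarrow> 0) (at t within {0..T})) \<and>
     (AE t in lebesgue_on {0<..<T}. AE x in lebesgue_on \<Omega>. w t x = u t x) \<and>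
     (\<forall>\<eta>\<in>L2 \<Omega>. \<forall>a b. 0 \<le> a \<longrightarrow> a \<le> b \<longrightarrow> b \<le> T \<longrightarrow>
        ((\<lambda>s. LINT x|lebesgue_on \<Omega>. v s x * \<eta> x) has_integral
          ((LINT x|lebesgue_on \<Omega>. w b x * \<eta> x) - (LINT x|lebesgue_on \<Omega>. w a x * \<eta> x))) {a..b})"

text \<open>The continuous representative comes from the initial condition. Paired with
  \<open>\<eta>\<close> it is a continuous version of a scalar function with a weak derivative, so
  \<open>weak_derivative_FTC\<close> applies.\<close>

lemma h1_path_exists:
  fixes \<Omega> :: "'a::euclidean_space set"
  assumes \<Omega>: "open \<Omega>" "bounded \<Omega>" and T: "0 < T"
    and u: "has_time_derivative T \<Omega> u v" and u0: "has_initial_value T \<Omega> u u0"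
  obtains w where "h1_path T \<Omega> u v w" "AE x in lebesgue_on \<Omega>. w 0 x = u0 x"
proof -
  let ?M = "lebesgue_on \<Omega>"
  obtain w where w: "\<And>t. t \<in> {0..T} \<Longrightarrow> w t \<in> L2 \<Omega>"
    "\<And>t. t \<in> {0..T} \<Longrightarrow> ((\<lambda>s. L2_norm \<Omega> (\<lambda>x. w s x - w t x)) \<longlongrightarrow> 0) (at t within {0..T})"
    "AE t in lebesgue_on {0<..<T}. AE x in ?M. w t x = u t x" "AE x in ?M. w 0 x = u0 x"
    using u0 unfolding has_initial_value_def by blast
  have uv: "case_prod u \<in> L2 (cyl T \<Omega>)" "case_prod v \<in> L2 (cyl T \<Omega>)" using u by (auto simp: has_time_derivative_def)
  have "((\<lambda>s. LINT x|?M. v s x * \<eta> x) has_integral ((LINT x|?M. w b x * \<eta> x) - (LINT x|?M. w a x * \<eta> x))) {a..b}"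
    if \<eta>: "\<eta> \<in> L2 \<Omega>" and ab: "0 \<le> a" "a \<le> b" "b \<le> T" for \<eta> a b
  proof -
    let ?y = "\<lambda>t. LINT x|?M. w t x * \<eta> x"
    have c: "continuous_on {0..T} ?y"
      unfolding continuous_on
    proof
      fix t assume t: "t \<in> {0..T}"
      have bnd: "\<bar>?y s - ?y t\<bar> \<le> L2_norm \<Omega> (\<lambda>x. w s x - w t x) * L2_norm \<Omega> \<eta>" if s: "s \<in> {0..T}" for s
        using L2_Cauchy_Schwarz[OF L2_diff[OF w(1)[OF s] w(1)[OF t]] \<eta>]
          L2_mult_integrable[OF w(1)[OF s] \<eta>] L2_mult_integrable[OF w(1)[OF t] \<eta>] by (simp add: left_diff_distrib)
      have l: "((\<lambda>s. L2_norm \<Omega> (\<lambda>x. w s x - w t x) * L2_norm \<Omega> \<eta>) \<longlongrightarrow> 0) (at t within {0..T})"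
        using tendsto_mult_left_zero[OF w(2)[OF t]] by simp
      show "(?y \<longlongrightarrow> ?y t) (at t within {0..T})"
      proof (rule Lim_null[THEN iffD2], rule tendsto_rabs_zero_cancel, rule tendsto_sandwich[OF _ _ tendsto_const l])
        show "\<forall>\<^sub>F s in at t within {0..T}. \<bar>?y s - ?y t\<bar> \<le> L2_norm \<Omega> (\<lambda>x. w s x - w t x) * L2_norm \<Omega> \<eta>"
          using bnd by (auto simp: eventually_at_filter)
      qed simp
    qed
    have e: "AE t in lebesgue_on {0<..<T}. (LINT x|?M. u t x * \<eta> x) = ?y t"
      using w(3) cyl_L2_sections(1)[OF \<Omega> uv(1)] AE_space
    proof eventually_elim
      case (elim t)
      have "w t \<in> L2 \<Omega>" using elim(3) by (intro w(1)) auto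
      thus ?case using elim L2D(1)[OF elim(2)] L2D(1)[OF \<eta>] L2D(1)[of "w t" \<Omega>]
        by (intro integral_cong_AE) (auto elim: eventually_mono)
    qed
    note f = weak_derivative_FTC[OF T c cyl_inner_L2(1)[OF \<Omega> uv(1) \<eta>] cyl_inner_L2(1)[OF \<Omega> uv(2) \<eta>] e
        has_time_derivative_inner[OF \<Omega> u \<eta>] ab]
    show ?thesis using integrable_integral[OF f(2)] by (simp add: f(1))
  qed
  hence "h1_path T \<Omega> u v w" using uv w by (simp add: h1_path_def)
  thus thesis using that w(4) by blast
qed

lemma h1_path_diff:
  fixes \<Omega> :: "'a::euclidean_space set"
  assumes \<Omega>: "open \<Omega>" "bounded \<Omega>" and 1: "h1_path T \<Omega> u1 v1 w1" and 2: "h1_path T \<Omega> u2 v2 w2"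
  shows "h1_path T \<Omega> (\<lambda>t x. u1 t x - u2 t x) (\<lambda>t x. v1 t x - v2 t x) (\<lambda>t x. w1 t x - w2 t x)"
  unfolding h1_path_def
proof (intro conjI ballI allI impI)
  let ?M = "lebesgue_on \<Omega>"
  note D1 = 1[unfolded h1_path_def] and D2 = 2[unfolded h1_path_def]
  show "(\<lambda>(t, x). u1 t x - u2 t x) \<in> L2 (cyl T \<Omega>)" "(\<lambda>(t, x). v1 t x - v2 t x) \<in> L2 (cyl T \<Omega>)"
    using L2_diff[of "case_prod u1" "cyl T \<Omega>" "case_prod u2"] L2_diff[of "case_prod v1" "cyl T \<Omega>" "case_prod v2"] D1 D2
    by (simp_all add: case_prod_unfold)
  show wL: "(\<lambda>x. w1 t x - w2 t x) \<in> L2 \<Omega>" if "t \<in> {0..T}" for t using D1 D2 that by (blast intro: L2_diff)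
  show "AE t in lebesgue_on {0<..<T}. AE x in ?M. w1 t x - w2 t x = u1 t x - u2 t x"
  proof -
    have "AE t in lebesgue_on {0<..<T}. AE x in ?M. w1 t x = u1 t x" "AE t in lebesgue_on {0<..<T}. AE x in ?M. w2 t x = u2 t x"
      using D1 D2 by blast+
    thus ?thesis
    proof eventually_elim
      case (elim t)
      thus ?case by eventually_elim simp
    qed
  qed
  {
    fix t assume t: "t \<in> {0..T}"
    show "((\<lambda>s. L2_norm \<Omega> (\<lambda>x. w1 s x - w2 s x - (w1 t x - w2 t x))) \<longlongrightarrow> 0) (at t within {0..T})"
    proof (rule tendsto_sandwich[OF _ _ tendsto_const])
      show "((\<lambda>s. L2_norm \<Omega> (\<lambda>x. w1 s x - w1 t x) + L2_norm \<Omega> (\<lambda>x. w2 s x - w2 t x)) \<longlongrightarrow> 0) (at t within {0..T})"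
        using D1 D2 t tendsto_add_zero by blast
      have "L2_norm \<Omega> (\<lambda>x. w1 s x - w2 s x - (w1 t x - w2 t x)) \<le> L2_norm \<Omega> (\<lambda>x. w1 s x - w1 t x) + L2_norm \<Omega> (\<lambda>x. w2 s x - w2 t x)"
        if s: "s \<in> {0..T}" for s
        using L2_norm_triangle_diff[of "\<lambda>x. w1 s x - w1 t x" \<Omega> "\<lambda>x. w2 s x - w2 t x"] L2_diff[of "w1 s" \<Omega> "w1 t"] L2_diff[of "w2 s" \<Omega> "w2 t"]
          D1 D2 s t by (simp add: algebra_simps)
      thus "\<forall>\<^sub>F s in at t within {0..T}. L2_norm \<Omega> (\<lambda>x. w1 s x - w2 s x - (w1 t x - w2 t x)) \<le> L2_norm \<Omega> (\<lambda>x. w1 s x - w1 t x) + L2_norm \<Omega> (\<lambda>x. w2 s x - w2 t x)"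
        by (auto simp: eventually_at_filter)
    qed simp
  next
    fix \<eta> a b assume \<eta>: "\<eta> \<in> L2 \<Omega>" and ab: "0 \<le> a" "a \<le> b" "b \<le> T"
    have h1: "((\<lambda>s. LINT x|?M. v1 s x * \<eta> x) has_integral ((LINT x|?M. w1 b x * \<eta> x) - (LINT x|?M. w1 a x * \<eta> x))) {a..b}"
      and h2: "((\<lambda>s. LINT x|?M. v2 s x * \<eta> x) has_integral ((LINT x|?M. w2 b x * \<eta> x) - (LINT x|?M. w2 a x * \<eta> x))) {a..b}"
      using D1 D2 \<eta> ab by blast+
    have h: "((\<lambda>s. (LINT x|?M. v1 s x * \<eta> x) - (LINT x|?M. v2 s x * \<eta> x)) has_integral
      ((LINT x|?M. (w1 b x - w2 b x) * \<eta> x) - (LINT x|?M. (w1 a x - w2 a x) * \<eta> x))) {a..b}"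
    proof -
      have E: "(LINT x|?M. (w1 t x - w2 t x) * \<eta> x) = (LINT x|?M. w1 t x * \<eta> x) - (LINT x|?M. w2 t x * \<eta> x)" if "t \<in> {0..T}" for t
        using L2_mult_integrable[of "w1 t" \<Omega> \<eta>] L2_mult_integrable[of "w2 t" \<Omega> \<eta>] D1 D2 that \<eta> by (simp add: left_diff_distrib)
      have mem: "a \<in> {0..T}" "b \<in> {0..T}" using ab by auto
      show ?thesis unfolding E[OF mem(1)] E[OF mem(2)]
        by (rule has_integral_eq_rhs[OF has_integral_diff[OF h1 h2]]) simp
    qed
    \<comment> \<open>The integral of the difference splits only where both sections are square
      integrable; the exceptional times are absorbed as a negligible set.\<close>
    have "AE s in lebesgue_on {0<..<T}. v1 s \<in> L2 \<Omega>" "AE s in lebesgue_on {0<..<T}. v2 s \<in> L2 \<Omega>"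
      using cyl_L2_sections(1)[OF \<Omega>] D1 D2 by blast+
    hence "AE s in lebesgue_on {0<..<T}. (LINT x|?M. (v1 s x - v2 s x) * \<eta> x) = (LINT x|?M. v1 s x * \<eta> x) - (LINT x|?M. v2 s x * \<eta> x)"
    proof eventually_elim
      case (elim s)
      thus ?case using L2_mult_integrable[of "v1 s" \<Omega> \<eta>] L2_mult_integrable[of "v2 s" \<Omega> \<eta>] \<eta> by (simp add: left_diff_distrib)
    qed
    hence "AE s in lebesgue. s \<in> {0<..<T} \<longrightarrow> (LINT x|?M. (v1 s x - v2 s x) * \<eta> x) = (LINT x|?M. v1 s x * \<eta> x) - (LINT x|?M. v2 s x * \<eta> x)"
      by (subst (asm) AE_restrict_space_iff) auto
    then obtain N where N: "N \<in> null_sets lebesgue" "\<And>s. s \<in> {0<..<T} - N \<Longrightarrow> (LINT x|?M. (v1 s x - v2 s x) * \<eta> x) = (LINT x|?M. v1 s x * \<eta> x) - (LINT x|?M. v2 s x * \<eta> x)"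
      by (auto simp: eventually_ae_filter)
    show "((\<lambda>s. LINT x|?M. (v1 s x - v2 s x) * \<eta> x) has_integral
      ((LINT x|?M. (w1 b x - w2 b x) * \<eta> x) - (LINT x|?M. (w1 a x - w2 a x) * \<eta> x))) {a..b}"
    proof (rule has_integral_spike[OF _ _ h])
      show "negligible (N \<union> {0, T})" using N(1) by (simp add: negligible_iff_null_sets negligible_Un)
      fix s assume "s \<in> {a..b} - (N \<union> {0, T})"
      thus "(LINT x|?M. (v1 s x - v2 s x) * \<eta> x) = (LINT x|?M. v1 s x * \<eta> x) - (LINT x|?M. v2 s x * \<eta> x)"
        using ab by (intro N(2)) auto
    qed
  }
qed

text \<open>The difference of the squared norms at \<open>a\<close> and \<open>b\<close> is the
  pairing of \<open>w b - w a\<close> with \<open>w b + w a\<close>. With the second factor held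
  fixed, the scalar fundamental theorem gives an integral of \<open>v\<close>. On a short interval
  replacing that factor by \<open>2 * w s\<close> costs at most \<open>e\<close> times the norm of
  \<open>v s\<close>, so \<open>small_increments_constant\<close> applies with \<open>m\<close> the
  integral of that norm.\<close>

lemma energy_identity:
  fixes \<Omega> :: "'a::euclidean_space set"
  assumes \<Omega>: "open \<Omega>" "bounded \<Omega>" and p: "h1_path T \<Omega> u v w" and t: "t \<in> {0..T}"
  shows "(L2_norm \<Omega> (w t))\<^sup>2 = (L2_norm \<Omega> (w 0))\<^sup>2 + 2 * integral {0..t} (\<lambda>s. LINT x|lebesgue_on \<Omega>. v s x * u s x)"
proof -
  let ?M = "lebesgue_on \<Omega>" and ?I = "lebesgue_on {0<..<T}"
  have uL: "case_prod u \<in> L2 (cyl T \<Omega>)" and vL: "case_prod v \<in> L2 (cyl T \<Omega>)"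
    and wL: "\<And>t. t \<in> {0..T} \<Longrightarrow> w t \<in> L2 \<Omega>"
    and wc: "\<And>t. t \<in> {0..T} \<Longrightarrow> ((\<lambda>s. L2_norm \<Omega> (\<lambda>x. w s x - w t x)) \<longlongrightarrow> 0) (at t within {0..T})"
    and wu: "AE t in ?I. AE x in ?M. w t x = u t x"
    and ftc: "\<And>\<eta> a b. \<eta> \<in> L2 \<Omega> \<Longrightarrow> 0 \<le> a \<Longrightarrow> a \<le> b \<Longrightarrow> b \<le> T \<Longrightarrow> ((\<lambda>s. LINT x|?M. v s x * \<eta> x) has_integral
          ((LINT x|?M. w b x * \<eta> x) - (LINT x|?M. w a x * \<eta> x))) {a..b}"
    using p unfolding h1_path_def by blast+
  define S where "S s = (LINT x|?M. v s x * u s x)" for s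
  define V where "V s = L2_norm \<Omega> (v s)" for s
  have Si: "S integrable_on {0..T}"
    using lebesgue_on_open_interval_integral(1)[OF cyl_inner_integrable[OF \<Omega>(1) vL uL]] unfolding S_def .
  have V2: "integrable ?I (\<lambda>s. (V s)\<^sup>2)" using cyl_L2_sections(2)[OF \<Omega> vL] by (simp add: V_def)
  have Vm: "V \<in> borel_measurable ?I"
  proof -
    have "(\<lambda>s. sqrt ((V s)\<^sup>2)) \<in> borel_measurable ?I" 
      by (rule measurable_compose[OF borel_measurable_integrable[OF V2] borel_measurable_continuous_onI])
         (intro continuous_intros)
    moreover have "sqrt ((V s)\<^sup>2) = V s" for s unfolding V_def by simp
    ultimately show ?thesis by simp
  qed
  have "V \<in> L2 {0<..<T}" using Vm V2 by (simp add: L2_def)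
  hence "integrable ?I V" by (rule L2_integrable) auto
  hence Vi: "V integrable_on {0..T}" by (rule lebesgue_on_open_interval_integral(1))
  define P where "P t = (L2_norm \<Omega> (w t))\<^sup>2 - 2 * integral {0..t} S" for t
  define m where "m t = integral {0..t} V" for t
  have sub: "f integrable_on {a..b}" if "f integrable_on {0..T}" "0 \<le> a" "b \<le> T" for f :: "real \<Rightarrow> real" and a b
    by (rule integrable_on_subinterval[OF that(1)]) (use that in auto)
  have "AE s in ?I. v s \<in> L2 \<Omega> \<and> S s = (LINT x|?M. v s x * w s x)"
    using wu cyl_L2_sections(1)[OF \<Omega> vL] cyl_L2_sections(1)[OF \<Omega> uL] AE_space
  proof eventually_elim
    case (elim s)
    have ws: "w s \<in> L2 \<Omega>" using elim(4) by (intro wL) auto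
    have "S s = (LINT x|?M. v s x * w s x)" unfolding S_def
      using L2D(1)[OF elim(2)] L2D(1)[OF elim(3)] L2D(1)[OF ws] elim(1) by (intro integral_cong_AE) (auto elim: eventually_mono)
    thus ?case using elim by simp
  qed
  hence "AE s in lebesgue. s \<in> {0<..<T} \<longrightarrow> v s \<in> L2 \<Omega> \<and> S s = (LINT x|?M. v s x * w s x)"
    by (subst (asm) AE_restrict_space_iff) auto
  then obtain N where N: "N \<in> null_sets lebesgue" "\<And>s. s \<in> {0<..<T} - N \<Longrightarrow> v s \<in> L2 \<Omega> \<and> S s = (LINT x|?M. v s x * w s x)"
    by (auto simp: eventually_ae_filter)
  have "P t = P 0"
  proof (rule small_increments_constant[where m=m])
    show "0 \<le> t" using t by simp
    fix e :: real assume e: "e > 0"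
    hence e2: "e / 2 > 0" by simp
    obtain d where d: "d > 0" "\<And>s t. s \<in> {0..T} \<Longrightarrow> t \<in> {0..T} \<Longrightarrow> dist s t < d \<Longrightarrow> L2_norm \<Omega> (\<lambda>x. w s x - w t x) < e / 2"
      using L2_path_uniform[OF wL wc e2] by blast
    show "\<exists>d>0. \<forall>a b. 0 \<le> a \<and> a \<le> b \<and> b \<le> t \<and> b - a < d \<longrightarrow> \<bar>P b - P a\<bar> \<le> e * (m b - m a)"
    proof (intro exI conjI allI impI)
      fix a b assume "0 \<le> a \<and> a \<le> b \<and> b \<le> t \<and> b - a < d"
      hence ab: "0 \<le> a" "a \<le> b" "b \<le> T" "b - a < d" "a \<in> {0..T}" "b \<in> {0..T}" using t by auto
      \<comment> \<open>A test element that does not vary on the interval from \<open>a\<close> to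
        \<open>b\<close>, as the scalar fundamental theorem requires.\<close>
      define \<eta> where "\<eta> x = w b x + w a x" for x
      have \<eta>: "\<eta> \<in> L2 \<Omega>" unfolding \<eta>_def by (intro L2_add wL ab)
      have N1: "(L2_norm \<Omega> (w b))\<^sup>2 - (L2_norm \<Omega> (w a))\<^sup>2 = (LINT x|?M. w b x * \<eta> x) - (LINT x|?M. w a x * \<eta> x)"
      proof -
        have "(LINT x|?M. w b x * \<eta> x) = (LINT x|?M. (w b x)\<^sup>2) + (LINT x|?M. w b x * w a x)"
          using L2D(2)[OF wL[OF ab(6)]] L2_mult_integrable[OF wL[OF ab(6)] wL[OF ab(5)]]
          by (simp add: \<eta>_def distrib_left flip: power2_eq_square)
        moreover have "(LINT x|?M. w a x * \<eta> x) = (LINT x|?M. w b x * w a x) + (LINT x|?M. (w a x)\<^sup>2)"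
          using L2D(2)[OF wL[OF ab(5)]] L2_mult_integrable[OF wL[OF ab(6)] wL[OF ab(5)]]
          by (simp add: \<eta>_def distrib_left mult.commute[of "w a _" "w b _"] flip: power2_eq_square)
        ultimately show ?thesis by (simp add: L2_norm_sq)
      qed
      have hS: "(S has_integral integral {a..b} S) {a..b}" using sub[OF Si] ab by (intro integrable_integral) auto
      have hV: "((\<lambda>s. e * V s) has_integral e * integral {a..b} V) {a..b}"
        using sub[OF Vi] ab by (intro has_integral_mult_right integrable_integral) auto
      have "((\<lambda>s. (LINT x|?M. v s x * \<eta> x) - 2 * S s) has_integral
          (((L2_norm \<Omega> (w b))\<^sup>2 - (L2_norm \<Omega> (w a))\<^sup>2) - 2 * integral {a..b} S)) {a..b}"
        unfolding N1 by (intro has_integral_diff has_integral_mult_right ftc \<eta> ab hS)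
      moreover have "((L2_norm \<Omega> (w b))\<^sup>2 - (L2_norm \<Omega> (w a))\<^sup>2) - 2 * integral {a..b} S = P b - P a"
        using Henstock_Kurzweil_Integration.integral_combine[OF ab(1,2) sub[OF Si]] ab by (simp add: P_def)
      ultimately have hP: "((\<lambda>s. (LINT x|?M. v s x * \<eta> x) - 2 * S s) has_integral (P b - P a)) {a..b}" by simp
      have pw: "\<bar>(LINT x|?M. v s x * \<eta> x) - 2 * S s\<bar> \<le> e * V s" if s: "s \<in> {a..b} - (N \<union> {0, T})" for s
      proof -
        have sT: "s \<in> {0..T}" "s \<in> {0<..<T} - N" using s ab by auto
        note vs = N(2)[OF sT(2)]
        let ?z = "\<lambda>x. (w b x - w s x) + (w a x - w s x)"
        have z: "?z \<in> L2 \<Omega>" by (intro L2_add L2_diff wL ab sT)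
        have "(LINT x|?M. v s x * \<eta> x) - 2 * S s = (LINT x|?M. v s x * ?z x)"
        proof -
          have "(LINT x|?M. v s x * \<eta> x) - 2 * (LINT x|?M. v s x * w s x) = (LINT x|?M. v s x * \<eta> x - 2 * (v s x * w s x))"
            using L2_mult_integrable[of "v s" \<Omega> \<eta>] L2_mult_integrable[of "v s" \<Omega> "w s"] vs \<eta> wL[OF sT(1)] by simp
          also have "\<dots> = (LINT x|?M. v s x * ?z x)"
            by (rule Bochner_Integration.integral_cong[OF refl]) (simp add: \<eta>_def algebra_simps)
          finally show ?thesis using vs by simp
        qed
        hence "\<bar>(LINT x|?M. v s x * \<eta> x) - 2 * S s\<bar> \<le> V s * L2_norm \<Omega> ?z"
          using L2_Cauchy_Schwarz[of "v s" \<Omega> ?z] vs z by (simp add: V_def)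
        also have "\<dots> \<le> V s * e"
        proof (rule mult_left_mono)
          have "L2_norm \<Omega> ?z \<le> L2_norm \<Omega> (\<lambda>x. w b x - w s x) + L2_norm \<Omega> (\<lambda>x. w a x - w s x)"
            by (rule L2_norm_triangle; intro L2_diff wL ab sT)
          also have "\<dots> \<le> e / 2 + e / 2"
            using d(2)[of b s] d(2)[of a s] ab sT s by (intro add_mono less_imp_le) (auto simp: dist_real_def)
          finally show "L2_norm \<Omega> ?z \<le> e" by simp
        qed (simp add: V_def)
        finally show ?thesis by (simp add: mult.commute)
      qed
      have neg: "negligible (N \<union> {0, T})" using N(1) by (simp add: negligible_iff_null_sets negligible_Un)
      let ?f = "\<lambda>s. if s \<in> N \<union> {0, T} then 0 else (LINT x|?M. v s x * \<eta> x) - 2 * S s"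
      have hf: "(?f has_integral (P b - P a)) {a..b}" by (rule has_integral_spike[OF neg _ hP]) auto
      have "norm (P b - P a) \<le> e * integral {a..b} V"
      proof -
        have "norm (integral {a..b} ?f) \<le> integral {a..b} (\<lambda>s. e * V s)"
        proof (rule integral_norm_bound_integral)
          show "?f integrable_on {a..b}" "(\<lambda>s. e * V s) integrable_on {a..b}" using hf hV by auto
          fix s assume "s \<in> {a..b}"
          thus "norm (?f s) \<le> e * V s" using pw[of s] e by (auto simp: V_def)
        qed
        thus ?thesis using integral_unique[OF hf] integral_unique[OF hV] by simp
      qed
      moreover have "integral {a..b} V = m b - m a"
        using Henstock_Kurzweil_Integration.integral_combine[OF ab(1,2) sub[OF Vi]] ab by (simp add: m_def)
      ultimately show "\<bar>P b - P a\<bar> \<le> e * (m b - m a)" by simp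
    qed (rule d(1))
  qed
  thus ?thesis by (simp add: P_def S_def[abs_def])
qed

lemma gronwall:
  fixes y :: "real \<Rightarrow> real"
  assumes y: "continuous_on {0..T} y" and K: "0 \<le> K" and t: "t \<in> {0..T}"
    and le: "\<And>t. t \<in> {0..T} \<Longrightarrow> y t \<le> B + K * integral {0..t} y"
  shows "y t \<le> B * exp (K * t)"
proof -
  \<comment> \<open>The right-hand side of the hypothesis is differentiable even though
    \<open>y\<close> need not be; multiplied by the integrating factor exp (- K * s) it does not
    increase.\<close>
  define Y where "Y t = B + K * integral {0..t} y" for t
  have dY: "(Y has_real_derivative K * y s) (at s within {0..T})" if "s \<in> {0..T}" for s
    unfolding Y_def using integral_has_real_derivative[OF y that] by (auto intro!: derivative_eq_intros)
  have dZ: "((\<lambda>s. Y s * exp (- K * s)) has_real_derivative (K * y s - K * Y s) * exp (- K * s)) (at s within {0..T})"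
    if "s \<in> {0..T}" for s
    using dY[OF that] by (auto intro!: derivative_eq_intros simp: algebra_simps)
  have "Y t * exp (- K * t) \<le> Y 0 * exp (- K * 0)"
  proof (cases "t = 0")
    case False
    have "(\<lambda>s. Y s * exp (- K * s)) t \<le> (\<lambda>s. Y s * exp (- K * s)) 0"
    proof (rule DERIV_nonpos_imp_decreasing_open[where f="\<lambda>s. Y s * exp (- K * s)" and a=0 and b=t])
      show "0 \<le> t" using t by simp
      show "continuous_on {0..t} (\<lambda>s. Y s * exp (- K * s))"
        by (rule continuous_on_subset[of "{0..T}"], rule DERIV_continuous_on[OF dZ]) (use t in auto)
      fix s assume s: "0 < s" "s < t"
      have "at s within {0..T} = at s" using s t by (intro at_within_Icc_at) auto
      moreover have "(K * y s - K * Y s) * exp (- K * s) \<le> 0"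
        using mult_left_mono[OF le[of s] K] s t by (intro mult_nonpos_nonneg) (auto simp: Y_def)
      ultimately show "\<exists>d. ((\<lambda>s. Y s * exp (- K * s)) has_real_derivative d) (at s) \<and> d \<le> 0"
        using dZ[of s] s t by auto
    qed
    thus ?thesis by simp
  qed simp
  hence "Y t \<le> B * exp (K * t)" by (simp add: Y_def exp_minus field_simps)
  thus ?thesis using le[OF t] by (simp add: Y_def)
qed

section \<open>The energy estimate\<close>

text \<open>The factor 3 counts the second derivatives in the Laplacian, each bounded by
  \<open>H2_norm\<close>. The work lies in commuting \<open>wpd\<close> with differences, which
  holds only almost everywhere.\<close>

lemma laplacian_diff:
  fixes \<Omega> :: "(real^3) set"
  assumes \<Omega>: "open \<Omega>" "bounded \<Omega>" and u: "u \<in> H2 \<Omega>" "v \<in> H2 \<Omega>"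
  shows "L2_norm \<Omega> (\<lambda>x. laplacian \<Omega> u x - laplacian \<Omega> v x) \<le> 3 * H2_norm \<Omega> (\<lambda>x. u x - v x)"
proof -
  let ?d = "\<lambda>x. u x - v x"
  have ae: "AE x in lebesgue_on \<Omega>. wpd \<Omega> b (wpd \<Omega> b ?d) x = wpd \<Omega> b (wpd \<Omega> b u) x - wpd \<Omega> b (wpd \<Omega> b v) x"
    and d2: "wpd \<Omega> b (wpd \<Omega> b ?d) \<in> L2 \<Omega>" if b: "b \<in> Basis" for b
  proof -
    note d1 = H1_diff[OF \<Omega> H2D(1)[OF u(1)] H2D(1)[OF u(2)]]
    have "wpd \<Omega> b (wpd \<Omega> b ?d) = wpd \<Omega> b (\<lambda>x. wpd \<Omega> b u x - wpd \<Omega> b v x)"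
      by (rule wpd_cong_AE[OF \<Omega> b wpdD(1)[OF d1(1) b] L2_diff[OF H2D(3)[OF u(1) b] H2D(3)[OF u(2) b]] d1(2)[OF b]])
    moreover note d = H1_diff[OF \<Omega> H2D(2)[OF u(1) b] H2D(2)[OF u(2) b]]
    ultimately show "AE x in lebesgue_on \<Omega>. wpd \<Omega> b (wpd \<Omega> b ?d) x = wpd \<Omega> b (wpd \<Omega> b u) x - wpd \<Omega> b (wpd \<Omega> b v) x"
      "wpd \<Omega> b (wpd \<Omega> b ?d) \<in> L2 \<Omega>"
      using d(2)[OF b] wpdD(1)[OF d(1) b] by simp_all
  qed
  have "L2_norm \<Omega> (\<lambda>x. laplacian \<Omega> u x - laplacian \<Omega> v x) = L2_norm \<Omega> (\<lambda>x. \<Sum>b\<in>Basis. wpd \<Omega> b (wpd \<Omega> b ?d) x)"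
  proof (rule L2_norm_cong_AE)
    show "(\<lambda>x. laplacian \<Omega> u x - laplacian \<Omega> v x) \<in> borel_measurable (lebesgue_on \<Omega>)"
      by (intro L2D(1) L2_diff laplacian_L2 u)
    show "(\<lambda>x. \<Sum>b\<in>Basis. wpd \<Omega> b (wpd \<Omega> b ?d) x) \<in> borel_measurable (lebesgue_on \<Omega>)"
      by (intro L2D(1) L2_sum d2) auto
    have "AE x in lebesgue_on \<Omega>. \<forall>b\<in>Basis. wpd \<Omega> b (wpd \<Omega> b ?d) x = wpd \<Omega> b (wpd \<Omega> b u) x - wpd \<Omega> b (wpd \<Omega> b v) x"
      using ae by (intro AE_finite_allI) auto
    thus "AE x in lebesgue_on \<Omega>. laplacian \<Omega> u x - laplacian \<Omega> v x = (\<Sum>b\<in>Basis. wpd \<Omega> b (wpd \<Omega> b ?d) x)"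
      by eventually_elim (simp add: laplacian_def sum_subtractf)
  qed
  also have "\<dots> \<le> (\<Sum>b\<in>Basis. L2_norm \<Omega> (wpd \<Omega> b (wpd \<Omega> b ?d)))" by (rule L2_norm_sum[OF finite_Basis d2])
  also have "\<dots> \<le> (\<Sum>b\<in>(Basis::(real^3) set). H2_norm \<Omega> ?d)" by (intro sum_mono H2_norm_ge(2))
  also have "\<dots> = 3 * H2_norm \<Omega> ?d" by simp
  finally show ?thesis .
qed

text \<open>\<open>wpd\<close> returns some representative of the zero derivative, not literally
  zero. The result makes the data distance vanish when the data coincide, as uniqueness
  requires.\<close>

lemma H2_norm_zero:
  fixes \<Omega> :: "(real^3) set"
  assumes \<Omega>: "open \<Omega>" "bounded \<Omega>"
  shows "H2_norm \<Omega> (\<lambda>x. 0) = 0"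
proof -
  let ?z = "\<lambda>x::real^3. 0::real"
  have C: "Ck 1 ?z" by (rule Ck_const)
  have z: "wpd \<Omega> b ?z \<in> L2 \<Omega>" "AE x in lebesgue_on \<Omega>. wpd \<Omega> b ?z x = 0" "L2_norm \<Omega> (wpd \<Omega> b ?z) = 0" if "b \<in> Basis" for b
  proof -
    show 1: "wpd \<Omega> b ?z \<in> L2 \<Omega>" using wpdD(1)[OF C1_H1(4)[OF \<Omega> C] that] .
    show 2: "AE x in lebesgue_on \<Omega>. wpd \<Omega> b ?z x = 0" using C1_H1(5)[OF \<Omega> C that] by simp
    show "L2_norm \<Omega> (wpd \<Omega> b ?z) = 0" using L2_norm_cong_AE[OF L2D(1)[OF 1] _ 2] by (simp add: L2_norm_def)
  qed
  have "wpd \<Omega> c (wpd \<Omega> b ?z) = wpd \<Omega> c ?z" if "b \<in> Basis" "c \<in> Basis" for b c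
    by (rule wpd_cong_AE[OF \<Omega> that(2) z(1)[OF that(1)] C1_H1(1)[OF \<Omega> C] z(2)[OF that(1)]])
  hence "L2_norm \<Omega> (wpd \<Omega> c (wpd \<Omega> b ?z)) = 0" if "b \<in> Basis" "c \<in> Basis" for b c using z(3) that by simp
  thus ?thesis using z(3) by (simp add: H2_norm_def H1_norm_def) (simp add: L2_norm_def)
qed

section \<open>The energy inequality at a fixed time\<close>

lemma subdifferential_monotone:
  assumes "\<And>r. 0 \<le> F r" "\<xi> \<in> subdifferential F r" "\<zeta> \<in> subdifferential F s"
  shows "0 \<le> (\<xi> - \<zeta>) * (r - s)"
proof -
  have fin: "F r \<noteq> \<infinity>" "F s \<noteq> \<infinity>" and le: "F r + ereal (\<xi> * (s - r)) \<le> F s" "F s + ereal (\<zeta> * (r - s)) \<le> F r"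
    using assms(2,3) by (auto simp: subdifferential_def)
  \<comment> \<open>Finiteness from above is part of \<open>subdifferential\<close>, and
    nonnegativity of \<open>F\<close> excludes minus infinity; in real arithmetic the two
    subgradient inequalities can be added.\<close>
  obtain a b where ab: "F r = ereal a" "F s = ereal b"
    using fin assms(1)[of r] assms(1)[of s] by (cases "F r"; cases "F s") auto
  have "a + \<xi> * (s - r) \<le> b" "b + \<zeta> * (r - s) \<le> a" using le unfolding ab by simp_all
  thus ?thesis by (simp add: algebra_simps)
qed

lemma inner_young:
  assumes "u \<in> L2 S" "v \<in> L2 S"
  shows "\<bar>LINT x|lebesgue_on S. u x * v x\<bar> \<le> (L2_norm S u)\<^sup>2 / 2 + (L2_norm S v)\<^sup>2 / 2"
  using L2_Cauchy_Schwarz[OF assms] sum_squares_bound[of "L2_norm S u" "L2_norm S v"] by linarith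

definition grad_sq :: "(real^3) set \<Rightarrow> (real^3 \<Rightarrow> real) \<Rightarrow> real" where
  "grad_sq \<Omega> u = (\<Sum>b\<in>Basis. (L2_norm \<Omega> (wpd \<Omega> b u))\<^sup>2)"

lemma grad_sq_nonneg: "0 \<le> grad_sq \<Omega> u" by (simp add: grad_sq_def sum_nonneg)

lemma H1_norm_sq: "(H1_norm \<Omega> u)\<^sup>2 = (L2_norm \<Omega> u)\<^sup>2 + grad_sq \<Omega> u"
  unfolding H1_norm_def grad_sq_def by (rule real_sqrt_pow2) (intro add_nonneg_nonneg sum_nonneg zero_le_power2)

lemma green_difference:
  fixes \<Omega> :: "(real^3) set"
  assumes dom: "bounded_C1_domain \<Omega>" and u: "u1 \<in> W \<Omega>" "u2 \<in> W \<Omega>" and v: "v \<in> H1 \<Omega>"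
  shows "(LINT x|lebesgue_on \<Omega>. (laplacian \<Omega> u1 x - laplacian \<Omega> u2 x) * v x)
    = - (\<Sum>b\<in>Basis. LINT x|lebesgue_on \<Omega>. wpd \<Omega> b (\<lambda>x. u1 x - u2 x) x * wpd \<Omega> b v x)"
proof -
  let ?M = "lebesgue_on \<Omega>"
  have \<Omega>: "open \<Omega>" "bounded \<Omega>" using dom by (auto simp: bounded_C1_domain_def)
  have u2: "u1 \<in> H2 \<Omega>" "u2 \<in> H2 \<Omega>" using u by (auto simp: W_def)
  have vL: "v \<in> L2 \<Omega>" using v by (simp add: H1_def)
  have "(LINT x|?M. wpd \<Omega> b (\<lambda>x. u1 x - u2 x) x * wpd \<Omega> b v x)
      = (LINT x|?M. wpd \<Omega> b u1 x * wpd \<Omega> b v x) - (LINT x|?M. wpd \<Omega> b u2 x * wpd \<Omega> b v x)" if b: "b \<in> Basis" for b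
  proof -
    note d = H1_diff[OF \<Omega> H2D(1)[OF u2(1)] H2D(1)[OF u2(2)]]
    note m = L2D(1)[OF wpdD(1)[OF d(1) b]] L2D(1)[OF wpdD(1)[OF v b]] L2D(1)[OF H2D(3)[OF u2(1) b]] L2D(1)[OF H2D(3)[OF u2(2) b]]
    have "(LINT x|?M. wpd \<Omega> b (\<lambda>x. u1 x - u2 x) x * wpd \<Omega> b v x) = (LINT x|?M. (wpd \<Omega> b u1 x - wpd \<Omega> b u2 x) * wpd \<Omega> b v x)"
      using m d(2)[OF b] by (intro integral_cong_AE) (auto elim: eventually_mono)
    thus ?thesis
      using L2_mult_integrable[OF H2D(3)[OF u2(1) b] wpdD(1)[OF v b]] L2_mult_integrable[OF H2D(3)[OF u2(2) b] wpdD(1)[OF v b]]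
      by (simp add: left_diff_distrib)
  qed
  thus ?thesis
    using green_formula[OF dom u(1) v] green_formula[OF dom u(2) v]
      L2_mult_integrable[OF laplacian_L2[OF u2(1)] vL] L2_mult_integrable[OF laplacian_L2[OF u2(2)] vL]
    by (simp add: left_diff_distrib sum_subtractf)
qed

text \<open>The hypothesis \<open>eq2\<close> is the second equation after multiplication by the
  difference, with the nonlinear terms already estimated pointwise. The gradient balance is exact:
  the coupling costs \<open>k / 2\<close> and \<open>k * \<alpha>\<^sup>2 / 2\<close>, while
  \<open>k\<close> and \<open>\<mu> * \<nu> = k * \<alpha>\<^sup>2\<close> are available.\<close>

lemma static_energy:
  fixes \<Omega> :: "(real^3) set"
  assumes dom: "bounded_C1_domain \<Omega>"
    and par: "0 < \<alpha>" "0 < k" "0 < \<nu>" "0 < \<gamma>" "0 \<le> L"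
    and W: "x1 \<in> W \<Omega>" "x2 \<in> W \<Omega>" "\<phi>1 \<in> W \<Omega>" "\<phi>2 \<in> W \<Omega>"
    and L2: "dX \<in> L2 \<Omega>" "dF \<in> L2 \<Omega>" "f \<in> L2 \<Omega>" "Ls \<in> L2 \<Omega>" "\<sigma> \<in> L2 \<Omega>" "\<zeta> \<in> L2 \<Omega>"
    and eq1: "AE x in lebesgue_on \<Omega>. dX x - k * (laplacian \<Omega> x1 x - laplacian \<Omega> x2 x)
        + k * \<alpha> * (laplacian \<Omega> \<phi>1 x - laplacian \<Omega> \<phi>2 x) + \<zeta> x = f x - k * Ls x"
    and mono: "0 \<le> (LINT x|lebesgue_on \<Omega>. \<zeta> x * (x1 x - x2 x))"
    and eq2: "AE x in lebesgue_on \<Omega>. dF x * (\<phi>1 x - \<phi>2 x) \<le> \<nu> * ((laplacian \<Omega> \<phi>1 x - laplacian \<Omega> \<phi>2 x) * (\<phi>1 x - \<phi>2 x))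
        + L * (\<phi>1 x - \<phi>2 x)\<^sup>2 + \<gamma> * ((x1 x - x2 x) * (\<phi>1 x - \<phi>2 x)) + \<gamma> * (\<sigma> x * (\<phi>1 x - \<phi>2 x))"
  defines "\<mu> \<equiv> k * \<alpha>\<^sup>2 / \<nu>" and "X \<equiv> \<lambda>x. x1 x - x2 x" and "F \<equiv> \<lambda>x. \<phi>1 x - \<phi>2 x"
  shows "(LINT x|lebesgue_on \<Omega>. dX x * X x) + \<mu> * (LINT x|lebesgue_on \<Omega>. dF x * F x)
      + k / 2 * grad_sq \<Omega> X + k * \<alpha>\<^sup>2 / 2 * grad_sq \<Omega> F
    \<le> (L2_norm \<Omega> f)\<^sup>2 / 2 + k\<^sup>2 / 2 * (L2_norm \<Omega> Ls)\<^sup>2 + \<mu> * \<gamma> / 2 * (L2_norm \<Omega> \<sigma>)\<^sup>2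
      + (1 + \<mu> * \<gamma> / 2) * (L2_norm \<Omega> X)\<^sup>2 + \<mu> * (L + \<gamma>) * (L2_norm \<Omega> F)\<^sup>2"
proof -
  let ?M = "lebesgue_on \<Omega>"
  let ?in = "\<lambda>u v. LINT x|?M. u x * v x"
  have \<Omega>: "open \<Omega>" "bounded \<Omega>" using dom by (auto simp: bounded_C1_domain_def)
  have h2: "x1 \<in> H2 \<Omega>" "x2 \<in> H2 \<Omega>" "\<phi>1 \<in> H2 \<Omega>" "\<phi>2 \<in> H2 \<Omega>" using W by (auto simp: W_def)
  have XH: "X \<in> H1 \<Omega>" and FH: "F \<in> H1 \<Omega>"
    unfolding X_def F_def by (intro H1_diff(1) \<Omega> H2D(1) h2)+
  have XL: "X \<in> L2 \<Omega>" and FL: "F \<in> L2 \<Omega>" using XH FH by (auto simp: H1_def)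
  define lX where "lX x = laplacian \<Omega> x1 x - laplacian \<Omega> x2 x" for x
  define lF where "lF x = laplacian \<Omega> \<phi>1 x - laplacian \<Omega> \<phi>2 x" for x
  have lL: "lX \<in> L2 \<Omega>" "lF \<in> L2 \<Omega>" unfolding lX_def[abs_def] lF_def[abs_def] by (intro L2_diff laplacian_L2 h2)+
  have g1: "?in lX X = - grad_sq \<Omega> X"
    using green_difference[OF dom W(1,2) XH] unfolding lX_def X_def[symmetric]
    by (simp add: grad_sq_def L2_norm_sq flip: power2_eq_square)
  have g2: "?in lF F = - grad_sq \<Omega> F"
    using green_difference[OF dom W(3,4) FH] unfolding lF_def F_def[symmetric]
    by (simp add: grad_sq_def L2_norm_sq flip: power2_eq_square)
  \<comment> \<open>Young's inequality with weight \<alpha>, chosen so that multiplication by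
    \<open>k * \<alpha>\<close> leaves \<open>k / 2\<close> in front of
    \<open>grad_sq \<Omega> X\<close>.\<close>
  have g3: "- ?in lF X \<le> 1 / (2 * \<alpha>) * grad_sq \<Omega> X + \<alpha> / 2 * grad_sq \<Omega> F"
  proof -
    have "- ?in lF X = (\<Sum>b\<in>Basis. LINT x|?M. wpd \<Omega> b F x * wpd \<Omega> b X x)"
      using green_difference[OF dom W(3,4) XH] unfolding lF_def F_def[symmetric] by simp
    also have "\<dots> \<le> (\<Sum>b\<in>Basis. 1 / (2 * \<alpha>) * (L2_norm \<Omega> (wpd \<Omega> b X))\<^sup>2 + \<alpha> / 2 * (L2_norm \<Omega> (wpd \<Omega> b F))\<^sup>2)"
    proof (rule sum_mono)
      fix b :: "real^3" assume b: "b \<in> Basis"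
      let ?a = "L2_norm \<Omega> (wpd \<Omega> b F)" and ?b = "L2_norm \<Omega> (wpd \<Omega> b X)"
      have "(LINT x|?M. wpd \<Omega> b F x * wpd \<Omega> b X x) \<le> ?a * ?b"
        using L2_Cauchy_Schwarz[OF wpdD(1)[OF FH b] wpdD(1)[OF XH b]] by linarith
      also have "?a * ?b \<le> 1 / (2 * \<alpha>) * ?b\<^sup>2 + \<alpha> / 2 * ?a\<^sup>2"
      proof -
        have "0 \<le> (?b - \<alpha> * ?a)\<^sup>2 / (2 * \<alpha>)" using par by simp
        also have "\<dots> = 1 / (2 * \<alpha>) * ?b\<^sup>2 + \<alpha> / 2 * ?a\<^sup>2 - ?a * ?b"
          using par by (simp add: field_simps power2_eq_square)
        finally show ?thesis by simp
      qed
      finally show "(LINT x|?M. wpd \<Omega> b F x * wpd \<Omega> b X x) \<le> 1 / (2 * \<alpha>) * ?b\<^sup>2 + \<alpha> / 2 * ?a\<^sup>2" .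
    qed
    also have "\<dots> = 1 / (2 * \<alpha>) * grad_sq \<Omega> X + \<alpha> / 2 * grad_sq \<Omega> F"
      by (simp add: sum.distrib grad_sq_def sum_distrib_left)
    finally show ?thesis .
  qed
  note I = L2_mult_integrable
  have e1: "?in dX X = k * ?in lX X - k * \<alpha> * ?in lF X - ?in \<zeta> X + ?in f X - k * ?in Ls X"
  proof -
    have "?in dX X = (LINT x|?M. k * (lX x * X x) - k * \<alpha> * (lF x * X x) - \<zeta> x * X x + f x * X x - k * (Ls x * X x))"
    proof (rule integral_cong_AE)
      show "AE x in ?M. dX x * X x = k * (lX x * X x) - k * \<alpha> * (lF x * X x) - \<zeta> x * X x + f x * X x - k * (Ls x * X x)"
        using eq1
      proof eventually_elim
        case (elim x)
        hence e: "dX x = k * lX x - k * \<alpha> * lF x - \<zeta> x + f x - k * Ls x" by (simp add: lX_def lF_def)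
        show ?case unfolding e by (simp add: algebra_simps)
      qed
    qed (use I[OF L2(1) XL] I[OF lL(1) XL] I[OF lL(2) XL] I[OF L2(6) XL] I[OF L2(3) XL] I[OF L2(4) XL] in auto)
    thus ?thesis using I[OF lL(1) XL] I[OF lL(2) XL] I[OF L2(6) XL] I[OF L2(3) XL] I[OF L2(4) XL] by simp
  qed
  have e2: "?in dF F \<le> \<nu> * ?in lF F + L * (L2_norm \<Omega> F)\<^sup>2 + \<gamma> * ?in X F + \<gamma> * ?in \<sigma> F"
  proof -
    have "?in dF F \<le> (LINT x|?M. \<nu> * (lF x * F x) + L * (F x)\<^sup>2 + \<gamma> * (X x * F x) + \<gamma> * (\<sigma> x * F x))"
    proof (rule integral_mono_AE)
      show "AE x in ?M. dF x * F x \<le> \<nu> * (lF x * F x) + L * (F x)\<^sup>2 + \<gamma> * (X x * F x) + \<gamma> * (\<sigma> x * F x)"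
        using eq2 unfolding lF_def X_def F_def .
    qed (use I[OF L2(2) FL] I[OF lL(2) FL] I[OF XL FL] I[OF L2(5) FL] L2D(2)[OF FL] in auto)
    thus ?thesis using I[OF lL(2) FL] I[OF XL FL] I[OF L2(5) FL] L2D(2)[OF FL] by (simp add: L2_norm_sq)
  qed
  have mono': "0 \<le> ?in \<zeta> X" using mono by (simp add: X_def)
  have b1: "?in f X \<le> (L2_norm \<Omega> f)\<^sup>2 / 2 + (L2_norm \<Omega> X)\<^sup>2 / 2" using inner_young[OF L2(3) XL] by linarith
  have b2: "- (k * ?in Ls X) \<le> k\<^sup>2 / 2 * (L2_norm \<Omega> Ls)\<^sup>2 + (L2_norm \<Omega> X)\<^sup>2 / 2"
    using inner_young[OF L2_cmult[OF L2(4), of k] XL] unfolding L2_norm_cmult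
    by (simp add: mult.assoc power_mult_distrib abs_le_iff)
  have b3: "?in X F \<le> (L2_norm \<Omega> X)\<^sup>2 / 2 + (L2_norm \<Omega> F)\<^sup>2 / 2" using inner_young[OF XL FL] by linarith
  have b4: "?in \<sigma> F \<le> (L2_norm \<Omega> \<sigma>)\<^sup>2 / 2 + (L2_norm \<Omega> F)\<^sup>2 / 2" using inner_young[OF L2(5) FL] by linarith
  have \<mu>: "0 < \<mu>" using par by (simp add: \<mu>_def)
  have c1: "?in dX X \<le> - (k / 2) * grad_sq \<Omega> X + k * \<alpha>\<^sup>2 / 2 * grad_sq \<Omega> F
      + (L2_norm \<Omega> f)\<^sup>2 / 2 + k\<^sup>2 / 2 * (L2_norm \<Omega> Ls)\<^sup>2 + (L2_norm \<Omega> X)\<^sup>2"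
  proof -
    have "k * \<alpha> * (- ?in lF X) \<le> k * \<alpha> * (1 / (2 * \<alpha>) * grad_sq \<Omega> X + \<alpha> / 2 * grad_sq \<Omega> F)"
      using g3 par by (intro mult_left_mono) auto
    also have "\<dots> = k / 2 * grad_sq \<Omega> X + k * \<alpha>\<^sup>2 / 2 * grad_sq \<Omega> F"
      using par by (simp add: field_simps power2_eq_square)
    finally show ?thesis using e1 mono' b1 b2 unfolding g1 by simp
  qed
  have c2: "?in dF F \<le> - \<nu> * grad_sq \<Omega> F + \<gamma> / 2 * (L2_norm \<Omega> \<sigma>)\<^sup>2 + \<gamma> / 2 * (L2_norm \<Omega> X)\<^sup>2 + (L + \<gamma>) * (L2_norm \<Omega> F)\<^sup>2"
  proof -
    have "\<gamma> * ?in X F \<le> \<gamma> * ((L2_norm \<Omega> X)\<^sup>2 / 2 + (L2_norm \<Omega> F)\<^sup>2 / 2)"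
      "\<gamma> * ?in \<sigma> F \<le> \<gamma> * ((L2_norm \<Omega> \<sigma>)\<^sup>2 / 2 + (L2_norm \<Omega> F)\<^sup>2 / 2)"
      using b3 b4 par by (auto intro!: mult_left_mono)
    thus ?thesis using e2 unfolding g2 by (simp add: algebra_simps)
  qed
  have "\<mu> * ?in dF F \<le> \<mu> * (- \<nu> * grad_sq \<Omega> F + \<gamma> / 2 * (L2_norm \<Omega> \<sigma>)\<^sup>2 + \<gamma> / 2 * (L2_norm \<Omega> X)\<^sup>2 + (L + \<gamma>) * (L2_norm \<Omega> F)\<^sup>2)"
    using c2 \<mu> by (intro mult_left_mono) auto
  also have "\<dots> = - (\<mu> * \<nu>) * grad_sq \<Omega> F + \<mu> * \<gamma> / 2 * (L2_norm \<Omega> \<sigma>)\<^sup>2 + \<mu> * \<gamma> / 2 * (L2_norm \<Omega> X)\<^sup>2 + \<mu> * (L + \<gamma>) * (L2_norm \<Omega> F)\<^sup>2"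
    by (simp add: algebra_simps)
  also have "\<mu> * \<nu> = k * \<alpha>\<^sup>2" using par by (simp add: \<mu>_def)
  finally have c3: "\<mu> * ?in dF F \<le> - (k * \<alpha>\<^sup>2) * grad_sq \<Omega> F + \<mu> * \<gamma> / 2 * (L2_norm \<Omega> \<sigma>)\<^sup>2 + \<mu> * \<gamma> / 2 * (L2_norm \<Omega> X)\<^sup>2 + \<mu> * (L + \<gamma>) * (L2_norm \<Omega> F)\<^sup>2" .
  show ?thesis using c1 c3 by (simp add: algebra_simps)
qed

section \<open>From the differential inequality to bounds in time\<close>

lemma integral_mono_AE_interval:
  fixes f g :: "real \<Rightarrow> real"
  assumes "f integrable_on {a..b}" "g integrable_on {a..b}" "{a..b} \<subseteq> {0..T}"
    and le: "AE t in lebesgue_on {0<..<T}. f t \<le> g t"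
  shows "integral {a..b} f \<le> integral {a..b} g"
proof -
  have "AE t in lebesgue. t \<in> {0<..<T} \<longrightarrow> f t \<le> g t" using le by (subst (asm) AE_restrict_space_iff) auto
  then obtain N where N: "N \<in> null_sets lebesgue" "\<And>s. s \<in> {0<..<T} - N \<Longrightarrow> f s \<le> g s"
    by (auto simp: eventually_ae_filter)
  have neg: "negligible (N \<union> {0, T})" using N(1) by (simp add: negligible_iff_null_sets negligible_Un)
  let ?f = "\<lambda>s. if s \<in> N \<union> {0, T} then g s else f s"
  have h: "(?f has_integral integral {a..b} f) {a..b}"
    by (rule has_integral_spike[OF neg _ integrable_integral[OF assms(1)]]) auto
  have "integral {a..b} ?f \<le> integral {a..b} g"
  proof (rule integral_le)
    fix s assume "s \<in> {a..b}"
    hence "s \<in> {0..T}" using assms(3) by blast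
    thus "?f s \<le> g s" using N(2)[of s] by auto
  qed (use h assms(2) in auto)
  thus ?thesis using integral_unique[OF h] by simp
qed

text \<open>Dropping \<open>G\<close>, Gronwall's inequality bounds \<open>N\<close>. That bound is
  put back into the inequality integrated over the whole interval, which controls the integral of
  \<open>G\<close> even after a multiple of \<open>N\<close> is added.\<close>

lemma abstract_energy:
  fixes N J D G :: "real \<Rightarrow> real"
  assumes T: "0 < T" and K: "0 \<le> K" and J: "integrable (lebesgue_on {0<..<T}) J" and D: "integrable (lebesgue_on {0<..<T}) D"
    and D0: "\<And>t. 0 \<le> D t" and N0: "\<And>t. 0 \<le> N t"
    and NJ: "\<And>t. t \<in> {0..T} \<Longrightarrow> N t = N 0 + integral {0..t} J"
    and ineq: "AE t in lebesgue_on {0<..<T}. J t + G t \<le> D t + K * N t" and G0: "\<And>t. 0 \<le> G t"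
  defines "B \<equiv> N 0 + (LINT t|lebesgue_on {0<..<T}. D t)"
  shows "t \<in> {0..T} \<Longrightarrow> N t \<le> B * exp (K * T)"
    "0 \<le> c \<Longrightarrow> AE t in lebesgue_on {0<..<T}. g t \<le> G t + c * N t \<Longrightarrow>
      (LINT t|lebesgue_on {0<..<T}. g t) \<le> B + (c + K) * T * (B * exp (K * T))"
proof -
  let ?I = "lebesgue_on {0<..<T}"
  note JT = lebesgue_on_open_interval_integral[OF J] and DT = lebesgue_on_open_interval_integral[OF D]
  have sub: "f integrable_on {0..t}" if "f integrable_on {0..T}" "t \<in> {0..T}" for f :: "real \<Rightarrow> real" and t
    by (rule integrable_on_subinterval[OF that(1)]) (use that in auto)
  have "continuous_on {0..T} (\<lambda>t. N 0 + integral {0..t} J)"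
    by (intro continuous_intros indefinite_integral_continuous_1 JT(1))
  hence Nc: "continuous_on {0..T} N" by (rule continuous_on_eq) (rule NJ[symmetric])
  have NT: "N integrable_on {0..T}" by (rule integrable_continuous_interval[OF Nc])
  have B0: "0 \<le> B" unfolding B_def using N0[of 0] D0 by (simp add: Bochner_Integration.integral_nonneg)
  have step1: "N t \<le> B + K * integral {0..t} N" if t: "t \<in> {0..T}" for t
  proof -
    have "integral {0..t} J \<le> integral {0..t} (\<lambda>s. D s + K * N s)"
    proof (rule integral_mono_AE_interval[where T=T])
      show "(\<lambda>s. D s + K * N s) integrable_on {0..t}"
        using has_integral_add[OF integrable_integral[OF sub[OF DT(1) t]]
            has_integral_mult_right[OF integrable_integral[OF sub[OF NT t]], of K]] by (rule has_integral_integrable)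
      show "AE t in ?I. J t \<le> D t + K * N t"
        using ineq
      proof eventually_elim
        case (elim t) thus ?case using G0[of t] by linarith
      qed
    qed (use sub[OF JT(1) t] t in auto)
    also have "\<dots> = integral {0..t} D + K * integral {0..t} N"
      using has_integral_add[OF integrable_integral[OF sub[OF DT(1) t]]
          has_integral_mult_right[OF integrable_integral[OF sub[OF NT t]], of K]] by (rule integral_unique)
    also have "integral {0..t} D \<le> integral {0..T} D"
      using t D0 by (intro integral_subset_le sub[OF DT(1) t] DT(1)) auto
    finally show ?thesis using NJ[OF t] DT(2) by (simp add: B_def)
  qed
  have bound: "N t \<le> B * exp (K * T)" if t: "t \<in> {0..T}" for t
  proof -
    have "N t \<le> B * exp (K * t)" by (rule gronwall[OF Nc K t step1])
    also have "\<dots> \<le> B * exp (K * T)" using t K B0 by (intro mult_left_mono) (auto intro: mult_left_mono)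
    finally show ?thesis .
  qed
  show "t \<in> {0..T} \<Longrightarrow> N t \<le> B * exp (K * T)" by (rule bound)
  assume c: "0 \<le> c" and g: "AE t in ?I. g t \<le> G t + c * N t"
  have Nm: "integrable ?I N"
  proof -
    have "set_integrable lebesgue {0..T} N"
      using absolutely_integrable_continuous_real[OF Nc] .
    hence "set_integrable lebesgue {0<..<T} N" by (rule set_integrable_subset) auto
    thus ?thesis by (simp add: integrable_restrict_space set_integrable_def)
  qed
  let ?H = "\<lambda>t. (c + K) * N t + D t - J t"
  have Hi: "integrable ?I ?H" using Nm D J by simp
  have gH: "AE t in ?I. g t \<le> ?H t" using g ineq
  proof eventually_elim
    case (elim t) thus ?case by (simp add: algebra_simps)
  qed
  \<comment> \<open>Integrability of \<open>g\<close> is not at hand, so the comparison of integrals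
    is made with an integrable majorant that is also nonnegative.\<close>
  have H0: "AE t in ?I. 0 \<le> ?H t" using ineq
  proof eventually_elim
    case (elim t)
    have "0 \<le> c * N t" using c N0 by simp
    thus ?case using elim G0[of t] by (simp add: algebra_simps)
  qed
  have "(LINT t|?I. g t) \<le> (LINT t|?I. ?H t)"
    by (rule Bochner_Integration.integral_mono_AE'[OF Hi gH H0])
  also have "\<dots> = (c + K) * (LINT t|?I. N t) + (LINT t|?I. D t) - (LINT t|?I. J t)" using Nm D J by simp
  also have "(LINT t|?I. J t) = N T - N 0" using NJ[of T] T JT(2) by simp
  finally have le: "(LINT t|?I. g t) \<le> (c + K) * (LINT t|?I. N t) + (LINT t|?I. D t) - (N T - N 0)" .
  have "(LINT t|?I. N t) \<le> T * (B * exp (K * T))"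
  proof -
    have "integral {0..T} N \<le> integral {0..T} (\<lambda>t. B * exp (K * T))"
      by (rule integral_le[OF NT]) (use bound in auto)
    thus ?thesis using lebesgue_on_open_interval_integral(2)[OF Nm] T by (simp add: mult_ac)
  qed
  hence "(c + K) * (LINT t|?I. N t) \<le> (c + K) * (T * (B * exp (K * T)))" using c K by (intro mult_left_mono) auto
  thus "(LINT t|?I. g t) \<le> B + (c + K) * T * (B * exp (K * T))"
    using le N0[of T] unfolding mult.assoc[of "c + K" T] by (simp add: B_def)
qed

section \<open>Explicit constants and the stability estimate\<close>

definition coupling :: "real \<Rightarrow> real \<Rightarrow> real \<Rightarrow> real" where
  "coupling \<alpha> k \<nu> = k * \<alpha>\<^sup>2 / \<nu>"

text \<open>The sum of the two coefficients of the zero-order terms, doubled because the energy is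
  half of the weighted squared norms. A sum is used where the maximum would do.\<close>

definition growth_rate :: "real \<Rightarrow> real \<Rightarrow> real \<Rightarrow> real \<Rightarrow> real \<Rightarrow> real" where
  "growth_rate \<alpha> k \<nu> \<gamma> L = 2 * (1 + coupling \<alpha> k \<nu> * \<gamma> / 2) + 2 * (L + \<gamma>)"

text \<open>The contributions, in order, of the initial values, of the source and of the stationary
  shift. The 9 is the square of the 3 in \<open>laplacian_diff\<close>, and \<open>T\<close> appears
  because the shift does not depend on time.\<close>

definition data_weight :: "real \<Rightarrow> real \<Rightarrow> real \<Rightarrow> real \<Rightarrow> real \<Rightarrow> real" where
  "data_weight T \<alpha> k \<nu> \<gamma> = (1 + coupling \<alpha> k \<nu>) / 2 + (1 / 2 + T * (9 * k\<^sup>2 / 2 + coupling \<alpha> k \<nu> * \<gamma> / 2))"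

definition energy_bound :: "real \<Rightarrow> real \<Rightarrow> real \<Rightarrow> real \<Rightarrow> real \<Rightarrow> real \<Rightarrow> real" where
  "energy_bound T \<alpha> k \<nu> \<gamma> L = data_weight T \<alpha> k \<nu> \<gamma> * exp (growth_rate \<alpha> k \<nu> \<gamma> L * T)"

text \<open>Here \<open>c\<close> is the multiple of the energy that is added to complete a gradient
  to a full \<open>H1_norm\<close>.\<close>

definition dissipation_bound :: "real \<Rightarrow> real \<Rightarrow> real \<Rightarrow> real \<Rightarrow> real \<Rightarrow> real \<Rightarrow> real \<Rightarrow> real" where
  "dissipation_bound T \<alpha> k \<nu> \<gamma> L c = data_weight T \<alpha> k \<nu> \<gamma>
     + (c + growth_rate \<alpha> k \<nu> \<gamma> L) * T * energy_bound T \<alpha> k \<nu> \<gamma> L"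

definition data_distance where
  "data_distance T \<Omega> f1 \<Xi>s1 \<Xi>01 \<phi>01 f2 \<Xi>s2 \<Xi>02 \<phi>02 =
     L2_norm (cyl T \<Omega>) (\<lambda>(t, x). f1 t x - f2 t x) + H2_norm \<Omega> (\<lambda>x. \<Xi>s1 x - \<Xi>s2 x)
       + L2_norm \<Omega> (\<lambda>x. \<Xi>01 x - \<Xi>02 x) + L2_norm \<Omega> (\<lambda>x. \<phi>01 x - \<phi>02 x)"

lemma H2_norm_nonneg [simp]: "0 \<le> H2_norm \<Omega> u"
  using H2_norm_ge(1)[of \<Omega> u] H1_norm_ge(1)[of \<Omega> u] L2_norm_nonneg[of \<Omega> u] by linarith

text \<open>Putting \<open>\<alpha>\<close> in place of \<open>l\<close> leaves the time derivative
  of \<Xi> alone in the first equation. The bounds stay quadratic in the data distance; roots are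
  taken later, separately for each norm.\<close>

lemma stability:
  fixes \<Omega> :: "(real^3) set"
  assumes dom: "bounded_C1_domain \<Omega>" and T: "0 < T"
    and par: "0 < \<alpha>" "0 < k" "0 < \<nu>" "0 < \<gamma>"
    and nl: "admissible_nonlinearities \<Omega> L \<chi>hat \<pi>hat A"
    and data: "admissible_data \<Omega> T f1 \<Xi>s1 \<Xi>01 \<phi>01" "admissible_data \<Omega> T f2 \<Xi>s2 \<Xi>02 \<phi>02"
    and sol1: "solution_P \<Omega> T \<alpha> \<alpha> k \<nu> \<gamma> \<chi>hat \<pi>hat A f1 \<Xi>s1 \<Xi>01 \<phi>01 \<Xi>1 \<phi>1"
    and sol2: "solution_P \<Omega> T \<alpha> \<alpha> k \<nu> \<gamma> \<chi>hat \<pi>hat A f2 \<Xi>s2 \<Xi>02 \<phi>02 \<Xi>2 \<phi>2"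
  defines "R \<equiv> data_distance T \<Omega> f1 \<Xi>s1 \<Xi>01 \<phi>01 f2 \<Xi>s2 \<Xi>02 \<phi>02"
    and "X \<equiv> \<lambda>t x. \<Xi>1 t x - \<Xi>2 t x" and "F \<equiv> \<lambda>t x. \<phi>1 t x - \<phi>2 t x"
  shows "case_prod X \<in> L2 (cyl T \<Omega>)" "case_prod F \<in> L2 (cyl T \<Omega>)"
    "AE t in lebesgue_on {0<..<T}. (L2_norm \<Omega> (X t))\<^sup>2 + coupling \<alpha> k \<nu> * (L2_norm \<Omega> (F t))\<^sup>2
      \<le> 2 * energy_bound T \<alpha> k \<nu> \<gamma> L * R\<^sup>2"
    "(LINT t|lebesgue_on {0<..<T}. k / 2 * (H1_norm \<Omega> (X t))\<^sup>2) \<le> dissipation_bound T \<alpha> k \<nu> \<gamma> L k * R\<^sup>2"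
    "(LINT t|lebesgue_on {0<..<T}. k * \<alpha>\<^sup>2 / 2 * (H1_norm \<Omega> (F t))\<^sup>2) \<le> dissipation_bound T \<alpha> k \<nu> \<gamma> L \<nu> * R\<^sup>2"
proof -
  let ?I = "lebesgue_on {0<..<T}" and ?M = "lebesgue_on \<Omega>"
  have \<Omega>: "open \<Omega>" "bounded \<Omega>" using dom by (auto simp: bounded_C1_domain_def)
  define \<mu> where "\<mu> = coupling \<alpha> k \<nu>"
  define K where "K = growth_rate \<alpha> k \<nu> \<gamma> L"
  have \<mu>: "0 < \<mu>" and \<mu>\<nu>: "\<mu> * \<nu> = k * \<alpha>\<^sup>2" using par by (auto simp: \<mu>_def coupling_def)
  have lip: "\<bar>deriv \<pi>hat a - deriv \<pi>hat b\<bar> \<le> L * \<bar>a - b\<bar>" for a b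
    using nl unfolding admissible_nonlinearities_def lipschitz_on_def dist_real_def by blast
  have L: "0 \<le> L" using nl unfolding admissible_nonlinearities_def lipschitz_on_def by blast
  have K: "0 \<le> K" using L par \<mu> unfolding K_def growth_rate_def \<mu>_def[symmetric] by simp
  have mm: "maximal_monotone \<Omega> A" and \<chi>0: "\<And>r. 0 \<le> \<chi>hat r" using nl by (auto simp: admissible_nonlinearities_def)

  obtain d\<Xi>1 d\<phi>1 \<Delta>\<Xi>1 \<Delta>\<phi>1 \<zeta>1 \<xi>1 where s1:
    "has_time_derivative T \<Omega> \<Xi>1 d\<Xi>1" "has_time_derivative T \<Omega> \<phi>1 d\<phi>1"
    "has_laplacian T \<Omega> \<Xi>1 \<Delta>\<Xi>1" "has_laplacian T \<Omega> \<phi>1 \<Delta>\<phi>1"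
    "AE (t, x) in lebesgue_on (cyl T \<Omega>). d\<Xi>1 t x - k * \<Delta>\<Xi>1 t x + k * \<alpha> * \<Delta>\<phi>1 t x + \<zeta>1 t x = f1 t x - k * laplacian \<Omega> \<Xi>s1 x"
    "AE (t, x) in lebesgue_on (cyl T \<Omega>). d\<phi>1 t x - \<nu> * \<Delta>\<phi>1 t x + \<xi>1 t x + deriv \<pi>hat (\<phi>1 t x) = \<gamma> * (\<Xi>1 t x - \<alpha> * \<phi>1 t x + \<Xi>s1 x)"
    "AE t in ?I. \<zeta>1 t \<in> A (\<Xi>1 t)" "AE (t, x) in lebesgue_on (cyl T \<Omega>). \<xi>1 t x \<in> subdifferential \<chi>hat (\<phi>1 t x)"
    using sol1 unfolding solution_P_def by auto
  obtain d\<Xi>2 d\<phi>2 \<Delta>\<Xi>2 \<Delta>\<phi>2 \<zeta>2 \<xi>2 where s2: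
    "has_time_derivative T \<Omega> \<Xi>2 d\<Xi>2" "has_time_derivative T \<Omega> \<phi>2 d\<phi>2"
    "has_laplacian T \<Omega> \<Xi>2 \<Delta>\<Xi>2" "has_laplacian T \<Omega> \<phi>2 \<Delta>\<phi>2"
    "AE (t, x) in lebesgue_on (cyl T \<Omega>). d\<Xi>2 t x - k * \<Delta>\<Xi>2 t x + k * \<alpha> * \<Delta>\<phi>2 t x + \<zeta>2 t x = f2 t x - k * laplacian \<Omega> \<Xi>s2 x"
    "AE (t, x) in lebesgue_on (cyl T \<Omega>). d\<phi>2 t x - \<nu> * \<Delta>\<phi>2 t x + \<xi>2 t x + deriv \<pi>hat (\<phi>2 t x) = \<gamma> * (\<Xi>2 t x - \<alpha> * \<phi>2 t x + \<Xi>s2 x)"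
    "AE t in ?I. \<zeta>2 t \<in> A (\<Xi>2 t)" "AE (t, x) in lebesgue_on (cyl T \<Omega>). \<xi>2 t x \<in> subdifferential \<chi>hat (\<phi>2 t x)"
    using sol2 unfolding solution_P_def by auto
  have W1: "AE t in ?I. \<Xi>1 t \<in> W \<Omega>" "AE t in ?I. \<phi>1 t \<in> W \<Omega>"
    and iv1: "has_initial_value T \<Omega> \<Xi>1 \<Xi>01" "has_initial_value T \<Omega> \<phi>1 \<phi>01"
    using sol1 unfolding solution_P_def L2_time_def strongly_measurable_def by auto
  have W2: "AE t in ?I. \<Xi>2 t \<in> W \<Omega>" "AE t in ?I. \<phi>2 t \<in> W \<Omega>"
    and iv2: "has_initial_value T \<Omega> \<Xi>2 \<Xi>02" "has_initial_value T \<Omega> \<phi>2 \<phi>02"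
    using sol2 unfolding solution_P_def L2_time_def strongly_measurable_def by auto

  obtain w\<Xi>1 where w\<Xi>1: "h1_path T \<Omega> \<Xi>1 d\<Xi>1 w\<Xi>1" "AE x in ?M. w\<Xi>1 0 x = \<Xi>01 x"
    using h1_path_exists[OF \<Omega> T s1(1) iv1(1)] .
  obtain w\<Xi>2 where w\<Xi>2: "h1_path T \<Omega> \<Xi>2 d\<Xi>2 w\<Xi>2" "AE x in ?M. w\<Xi>2 0 x = \<Xi>02 x"
    using h1_path_exists[OF \<Omega> T s2(1) iv2(1)] .
  obtain w\<phi>1 where w\<phi>1: "h1_path T \<Omega> \<phi>1 d\<phi>1 w\<phi>1" "AE x in ?M. w\<phi>1 0 x = \<phi>01 x"
    using h1_path_exists[OF \<Omega> T s1(2) iv1(2)] .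
  obtain w\<phi>2 where w\<phi>2: "h1_path T \<Omega> \<phi>2 d\<phi>2 w\<phi>2" "AE x in ?M. w\<phi>2 0 x = \<phi>02 x"
    using h1_path_exists[OF \<Omega> T s2(2) iv2(2)] .
  define dX where "dX = (\<lambda>t x. d\<Xi>1 t x - d\<Xi>2 t x)"
  define dF where "dF = (\<lambda>t x. d\<phi>1 t x - d\<phi>2 t x)"
  define wX where "wX = (\<lambda>t x. w\<Xi>1 t x - w\<Xi>2 t x)"
  define wF where "wF = (\<lambda>t x. w\<phi>1 t x - w\<phi>2 t x)"
  have pX: "h1_path T \<Omega> X dX wX" unfolding X_def dX_def wX_def by (rule h1_path_diff[OF \<Omega> w\<Xi>1(1) w\<Xi>2(1)])
  have pF: "h1_path T \<Omega> F dF wF" unfolding F_def dF_def wF_def by (rule h1_path_diff[OF \<Omega> w\<phi>1(1) w\<phi>2(1)])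
  show XL: "case_prod X \<in> L2 (cyl T \<Omega>)" and FL: "case_prod F \<in> L2 (cyl T \<Omega>)"
    using pX pF by (auto simp: h1_path_def)
  have dXL: "case_prod dX \<in> L2 (cyl T \<Omega>)" and dFL: "case_prod dF \<in> L2 (cyl T \<Omega>)"
    and wXL: "\<And>t. t \<in> {0..T} \<Longrightarrow> wX t \<in> L2 \<Omega>" and wFL: "\<And>t. t \<in> {0..T} \<Longrightarrow> wF t \<in> L2 \<Omega>"
    and wX: "AE t in ?I. AE x in ?M. wX t x = X t x" and wF: "AE t in ?I. AE x in ?M. wF t x = F t x"
    using pX pF by (auto simp: h1_path_def)
  \<comment> \<open>The initial values and the energy identity concern the continuous
    representatives \<open>wX\<close> and \<open>wF\<close>, the equations concern \<open>X\<close>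
    and \<open>F\<close>; their norms agree at almost every time.\<close>
  have norm_eq: "AE t in ?I. L2_norm \<Omega> (wX t) = L2_norm \<Omega> (X t) \<and> L2_norm \<Omega> (wF t) = L2_norm \<Omega> (F t)"
    using wX wF cyl_L2_sections(1)[OF \<Omega> XL] cyl_L2_sections(1)[OF \<Omega> FL] AE_space
  proof eventually_elim
    case (elim t)
    have "t \<in> {0..T}" using elim(5) by simp
    thus ?case using elim wXL wFL by (intro conjI L2_norm_cong_AE L2D(1)) auto
  qed

  define f where "f = (\<lambda>t x. f1 t x - f2 t x)"
  define \<sigma> where "\<sigma> = (\<lambda>x. \<Xi>s1 x - \<Xi>s2 x)"
  define Ls where "Ls = (\<lambda>x. laplacian \<Omega> \<Xi>s1 x - laplacian \<Omega> \<Xi>s2 x)"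
  define hs where "hs = H2_norm \<Omega> \<sigma>"
  have s2': "\<Xi>s1 \<in> H2 \<Omega>" "\<Xi>s2 \<in> H2 \<Omega>" using data by (auto simp: admissible_data_def W_def)
  have LsL: "Ls \<in> L2 \<Omega>" unfolding Ls_def by (intro L2_diff laplacian_L2 s2')
  have \<sigma>L: "\<sigma> \<in> L2 \<Omega>" unfolding \<sigma>_def using H2D(1)[OF s2'(1)] H2D(1)[OF s2'(2)] by (intro L2_diff) (auto simp: H1_def)
  have Ls_le: "L2_norm \<Omega> Ls \<le> 3 * hs" unfolding Ls_def hs_def \<sigma>_def by (rule laplacian_diff[OF \<Omega> s2'])
  have \<sigma>_le: "L2_norm \<Omega> \<sigma> \<le> hs" unfolding hs_def using H1_norm_ge(1) H2_norm_ge(1) by (rule order_trans)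
  have fL: "case_prod f \<in> L2 (cyl T \<Omega>)"
    using L2_diff[of "case_prod f1" "cyl T \<Omega>" "case_prod f2"] data by (simp add: f_def admissible_data_def case_prod_unfold)

  define N where "N t = ((L2_norm \<Omega> (wX t))\<^sup>2 + \<mu> * (L2_norm \<Omega> (wF t))\<^sup>2) / 2" for t
  define J where "J t = (LINT x|?M. dX t x * X t x) + \<mu> * (LINT x|?M. dF t x * F t x)" for t
  define D where "D t = (L2_norm \<Omega> (f t))\<^sup>2 / 2 + (9 * k\<^sup>2 / 2 + \<mu> * \<gamma> / 2) * hs\<^sup>2" for t
  define G where "G t = k / 2 * grad_sq \<Omega> (X t) + k * \<alpha>\<^sup>2 / 2 * grad_sq \<Omega> (F t)" for t
  have iX: "integrable ?I (\<lambda>t. LINT x|?M. dX t x * X t x)" and iF: "integrable ?I (\<lambda>t. LINT x|?M. dF t x * F t x)"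
    using cyl_inner_integrable[OF \<Omega>(1) dXL XL] cyl_inner_integrable[OF \<Omega>(1) dFL FL] .
  have Ji: "integrable ?I J" unfolding J_def using iX iF by simp
  have If: "finite_measure ?I" by (rule finite_measure_lebesgue_on) auto
  have Di: "integrable ?I D" unfolding D_def 
    by (intro Bochner_Integration.integrable_add Bochner_Integration.integrable_divide cyl_L2_sections(2)[OF \<Omega> fL]
        finite_measure.integrable_const[OF If])
  have D0: "0 \<le> D t" for t unfolding D_def using \<mu> par by (intro add_nonneg_nonneg mult_nonneg_nonneg) auto
  have N0: "0 \<le> N t" for t unfolding N_def using \<mu> by simp
  have G0: "0 \<le> G t" for t unfolding G_def using par grad_sq_nonneg[of \<Omega>] by (intro add_nonneg_nonneg mult_nonneg_nonneg) auto
  have NJ: "N t = N 0 + integral {0..t} J" if t: "t \<in> {0..T}" for t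
  proof -
    have sub: "h integrable_on {0..t}" if "integrable ?I h" for h :: "real \<Rightarrow> real"
      by (rule integrable_on_subinterval[OF lebesgue_on_open_interval_integral(1)[OF that]]) (use t in auto)
    have "integral {0..t} J = integral {0..t} (\<lambda>t. LINT x|?M. dX t x * X t x) + \<mu> * integral {0..t} (\<lambda>t. LINT x|?M. dF t x * F t x)"
      unfolding J_def using has_integral_add[OF integrable_integral[OF sub[OF iX]]
          has_integral_mult_right[OF integrable_integral[OF sub[OF iF]], of \<mu>]] by (rule integral_unique)
    thus ?thesis unfolding N_def energy_identity[OF \<Omega> pX t] energy_identity[OF \<Omega> pF t] by (simp add: field_simps)
  qed

  have ineq: "AE t in ?I. J t + G t \<le> D t + K * N t"
  proof -
    have oI: "open {0<..<T}" by simp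
    note sec = lebesgue_on_AE_sections[OF oI \<Omega>(1)]
    have E1: "AE t in ?I. AE x in ?M. d\<Xi>1 t x - k * \<Delta>\<Xi>1 t x + k * \<alpha> * \<Delta>\<phi>1 t x + \<zeta>1 t x = f1 t x - k * laplacian \<Omega> \<Xi>s1 x"
      "AE t in ?I. AE x in ?M. d\<Xi>2 t x - k * \<Delta>\<Xi>2 t x + k * \<alpha> * \<Delta>\<phi>2 t x + \<zeta>2 t x = f2 t x - k * laplacian \<Omega> \<Xi>s2 x"
      using sec[OF s1(5)[unfolded cyl_def]] sec[OF s2(5)[unfolded cyl_def]] by simp_all
    have E2: "AE t in ?I. AE x in ?M. d\<phi>1 t x - \<nu> * \<Delta>\<phi>1 t x + \<xi>1 t x + deriv \<pi>hat (\<phi>1 t x) = \<gamma> * (\<Xi>1 t x - \<alpha> * \<phi>1 t x + \<Xi>s1 x)"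
      "AE t in ?I. AE x in ?M. d\<phi>2 t x - \<nu> * \<Delta>\<phi>2 t x + \<xi>2 t x + deriv \<pi>hat (\<phi>2 t x) = \<gamma> * (\<Xi>2 t x - \<alpha> * \<phi>2 t x + \<Xi>s2 x)"
      using sec[OF s1(6)[unfolded cyl_def]] sec[OF s2(6)[unfolded cyl_def]] by simp_all
    have E3: "AE t in ?I. AE x in ?M. \<xi>1 t x \<in> subdifferential \<chi>hat (\<phi>1 t x)" "AE t in ?I. AE x in ?M. \<xi>2 t x \<in> subdifferential \<chi>hat (\<phi>2 t x)"
      using sec[OF s1(8)[unfolded cyl_def]] sec[OF s2(8)[unfolded cyl_def]] by simp_all
    have E4: "AE t in ?I. AE x in ?M. \<Delta>\<Xi>1 t x = laplacian \<Omega> (\<Xi>1 t) x" "AE t in ?I. AE x in ?M. \<Delta>\<phi>1 t x = laplacian \<Omega> (\<phi>1 t) x"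
      "AE t in ?I. AE x in ?M. \<Delta>\<Xi>2 t x = laplacian \<Omega> (\<Xi>2 t) x" "AE t in ?I. AE x in ?M. \<Delta>\<phi>2 t x = laplacian \<Omega> (\<phi>2 t) x"
      using s1(3,4) s2(3,4) by (auto simp: has_laplacian_def)
    show ?thesis
      using E1 E2 E3 E4 W1 W2 s1(7) s2(7) norm_eq cyl_L2_sections(1)[OF \<Omega> dXL] cyl_L2_sections(1)[OF \<Omega> dFL] cyl_L2_sections(1)[OF \<Omega> fL]
    proof eventually_elim
      case (elim t)
      define \<zeta> where "\<zeta> = (\<lambda>x. \<zeta>1 t x - \<zeta>2 t x)"
      have xL: "\<Xi>1 t \<in> L2 \<Omega>" "\<Xi>2 t \<in> L2 \<Omega>" using elim(11,13) by (auto simp: W_def H2_def H1_def)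
      have zL: "\<zeta>1 t \<in> L2 \<Omega>" "\<zeta>2 t \<in> L2 \<Omega>" using mm xL elim(15,16) by (auto simp: maximal_monotone_def)
      have \<zeta>L: "\<zeta> \<in> L2 \<Omega>" unfolding \<zeta>_def using zL by (rule L2_diff)
      have mono: "0 \<le> (LINT x|?M. \<zeta> x * (\<Xi>1 t x - \<Xi>2 t x))"
      proof -
        have "monotone_graph \<Omega> A" using mm by (simp add: maximal_monotone_def)
        hence "0 \<le> L2_inner \<Omega> (\<lambda>z. \<zeta>1 t z - \<zeta>2 t z) (\<lambda>z. \<Xi>1 t z - \<Xi>2 t z)"
          using xL elim(15,16) unfolding monotone_graph_def by blast
        thus ?thesis by (simp add: L2_inner_def \<zeta>_def)
      qed
      have eq1: "AE x in ?M. dX t x - k * (laplacian \<Omega> (\<Xi>1 t) x - laplacian \<Omega> (\<Xi>2 t) x)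
        + k * \<alpha> * (laplacian \<Omega> (\<phi>1 t) x - laplacian \<Omega> (\<phi>2 t) x) + \<zeta> x = f t x - k * Ls x"
        using elim(1,2,7,8,9,10)
        by eventually_elim (simp add: dX_def \<zeta>_def f_def Ls_def algebra_simps)
      have eq2: "AE x in ?M. dF t x * (\<phi>1 t x - \<phi>2 t x) \<le> \<nu> * ((laplacian \<Omega> (\<phi>1 t) x - laplacian \<Omega> (\<phi>2 t) x) * (\<phi>1 t x - \<phi>2 t x))
        + L * (\<phi>1 t x - \<phi>2 t x)\<^sup>2 + \<gamma> * ((\<Xi>1 t x - \<Xi>2 t x) * (\<phi>1 t x - \<phi>2 t x)) + \<gamma> * (\<sigma> x * (\<phi>1 t x - \<phi>2 t x))"
        using elim(3,4,5,6,8,10)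
      proof eventually_elim
        case (elim x)
        let ?d = "\<phi>1 t x - \<phi>2 t x" and ?l = "laplacian \<Omega> (\<phi>1 t) x - laplacian \<Omega> (\<phi>2 t) x"
        let ?\<pi> = "deriv \<pi>hat (\<phi>1 t x) - deriv \<pi>hat (\<phi>2 t x)"
        have e: "dF t x = \<nu> * ?l - (\<xi>1 t x - \<xi>2 t x) - ?\<pi> + \<gamma> * (\<Xi>1 t x - \<Xi>2 t x) - \<gamma> * \<alpha> * ?d + \<gamma> * \<sigma> x"
          using elim by (simp add: dF_def \<sigma>_def algebra_simps)
        have "0 \<le> (\<xi>1 t x - \<xi>2 t x) * ?d" by (rule subdifferential_monotone[OF \<chi>0 elim(3,4)])
        moreover have "- ?\<pi> * ?d \<le> L * ?d\<^sup>2"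
        proof -
          have "- ?\<pi> * ?d \<le> \<bar>?\<pi>\<bar> * \<bar>?d\<bar>" by (metis abs_ge_self abs_minus_cancel abs_mult)
          also have "\<dots> \<le> (L * \<bar>?d\<bar>) * \<bar>?d\<bar>" using lip by (intro mult_right_mono) auto
          also have "\<dots> = L * ?d\<^sup>2" by (simp add: power2_eq_square mult.assoc)
          finally show ?thesis .
        qed
        moreover have "0 \<le> \<gamma> * \<alpha> * ?d\<^sup>2" using par by simp
        moreover have "dF t x * ?d = \<nu> * (?l * ?d) - (\<xi>1 t x - \<xi>2 t x) * ?d + (- ?\<pi> * ?d) + \<gamma> * ((\<Xi>1 t x - \<Xi>2 t x) * ?d)
            - \<gamma> * \<alpha> * ?d\<^sup>2 + \<gamma> * (\<sigma> x * ?d)"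
          unfolding e by (simp add: algebra_simps power2_eq_square)
        ultimately show ?case by linarith
      qed
      have "J t + G t \<le> (L2_norm \<Omega> (f t))\<^sup>2 / 2 + k\<^sup>2 / 2 * (L2_norm \<Omega> Ls)\<^sup>2 + \<mu> * \<gamma> / 2 * (L2_norm \<Omega> \<sigma>)\<^sup>2
        + (1 + \<mu> * \<gamma> / 2) * (L2_norm \<Omega> (X t))\<^sup>2 + \<mu> * (L + \<gamma>) * (L2_norm \<Omega> (F t))\<^sup>2"
        using static_energy[OF dom par L elim(11,13,12,14) elim(18,19,20) LsL \<sigma>L \<zeta>L eq1 mono eq2]
        unfolding J_def G_def \<mu>_def coupling_def X_def F_def by simp
      moreover have "k\<^sup>2 / 2 * (L2_norm \<Omega> Ls)\<^sup>2 \<le> 9 * k\<^sup>2 / 2 * hs\<^sup>2"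
      proof -
        have "(L2_norm \<Omega> Ls)\<^sup>2 \<le> (3 * hs)\<^sup>2" using Ls_le by (intro power_mono) auto
        hence "k\<^sup>2 / 2 * (L2_norm \<Omega> Ls)\<^sup>2 \<le> k\<^sup>2 / 2 * (3 * hs)\<^sup>2" by (intro mult_left_mono) auto
        thus ?thesis by (simp add: power_mult_distrib)
      qed
      moreover have "\<mu> * \<gamma> / 2 * (L2_norm \<Omega> \<sigma>)\<^sup>2 \<le> \<mu> * \<gamma> / 2 * hs\<^sup>2"
        using \<sigma>_le \<mu> par by (intro mult_left_mono power_mono) auto
      moreover have "(1 + \<mu> * \<gamma> / 2) * (L2_norm \<Omega> (X t))\<^sup>2 + \<mu> * (L + \<gamma>) * (L2_norm \<Omega> (F t))\<^sup>2 \<le> K * N t"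
      proof -
        let ?a = "(L2_norm \<Omega> (X t))\<^sup>2" and ?b = "\<mu> * (L2_norm \<Omega> (F t))\<^sup>2"
        \<comment> \<open>The energy \<open>N t\<close> is half of \<open>?a + ?b\<close>, and
          \<open>growth_rate\<close> is twice the sum of the two coefficients; the cross terms are
          nonnegative.\<close>
        have "K * N t = ((1 + \<mu> * \<gamma> / 2) + (L + \<gamma>)) * (?a + ?b)"
          using elim(17) by (simp add: K_def growth_rate_def N_def \<mu>_def field_simps)
        moreover have "0 \<le> (L + \<gamma>) * ?a" "0 \<le> (1 + \<mu> * \<gamma> / 2) * ?b" using L par \<mu> by auto
        ultimately show ?thesis by (simp add: algebra_simps)
      qed
      ultimately show ?case by (simp add: D_def algebra_simps)
    qed
  qed

  define B where "B = N 0 + (LINT t|?I. D t)"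
  define w where "w = data_weight T \<alpha> k \<nu> \<gamma>"
  define c0 where "c0 = 9 * k\<^sup>2 / 2 + \<mu> * \<gamma> / 2"
  have c0: "0 \<le> c0" using \<mu> par by (simp add: c0_def)
  define nf where "nf = L2_norm (cyl T \<Omega>) (case_prod f)"
  define nX where "nX = L2_norm \<Omega> (\<lambda>x. \<Xi>01 x - \<Xi>02 x)"
  define nF where "nF = L2_norm \<Omega> (\<lambda>x. \<phi>01 x - \<phi>02 x)"
  have R: "R = nf + hs + nX + nF"
    by (simp add: R_def data_distance_def nf_def hs_def nX_def nF_def f_def \<sigma>_def case_prod_unfold)
  have nn: "0 \<le> nf" "0 \<le> hs" "0 \<le> nX" "0 \<le> nF" by (auto simp: nf_def hs_def nX_def nF_def)
  have sq_le: "nf\<^sup>2 \<le> R\<^sup>2" "hs\<^sup>2 \<le> R\<^sup>2" "nX\<^sup>2 \<le> R\<^sup>2" "nF\<^sup>2 \<le> R\<^sup>2"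
    using nn by (auto simp: R intro!: power_mono)
  have B_le: "B \<le> w * R\<^sup>2"
  proof -
    have init: "\<Xi>01 \<in> L2 \<Omega>" "\<Xi>02 \<in> L2 \<Omega>" "\<phi>01 \<in> L2 \<Omega>" "\<phi>02 \<in> L2 \<Omega>" using data by (auto simp: admissible_data_def H1_def)
    have "L2_norm \<Omega> (wX 0) = nX" unfolding nX_def
    proof (rule L2_norm_cong_AE)
      show "wX 0 \<in> borel_measurable ?M" using wXL[of 0] T L2D(1) by simp
      show "(\<lambda>x. \<Xi>01 x - \<Xi>02 x) \<in> borel_measurable ?M" by (intro L2D(1) L2_diff init)
      show "AE x in ?M. wX 0 x = \<Xi>01 x - \<Xi>02 x" using w\<Xi>1(2) w\<Xi>2(2) by eventually_elim (simp add: wX_def)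
    qed
    moreover have "L2_norm \<Omega> (wF 0) = nF" unfolding nF_def
    proof (rule L2_norm_cong_AE)
      show "wF 0 \<in> borel_measurable ?M" using wFL[of 0] T L2D(1) by simp
      show "(\<lambda>x. \<phi>01 x - \<phi>02 x) \<in> borel_measurable ?M" by (intro L2D(1) L2_diff init)
      show "AE x in ?M. wF 0 x = \<phi>01 x - \<phi>02 x" using w\<phi>1(2) w\<phi>2(2) by eventually_elim (simp add: wF_def)
    qed
    ultimately have "N 0 = (nX\<^sup>2 + \<mu> * nF\<^sup>2) / 2" by (simp add: N_def)
    also have "\<dots> \<le> (R\<^sup>2 + \<mu> * R\<^sup>2) / 2" using sq_le \<mu> by (intro divide_right_mono add_mono mult_left_mono) auto
    finally have n0: "N 0 \<le> (1 + \<mu>) / 2 * R\<^sup>2" by (simp add: algebra_simps)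
    have "(LINT t|?I. D t) = nf\<^sup>2 / 2 + T * (c0 * hs\<^sup>2)"
    proof -
      have "(LINT t|?I. c0 * hs\<^sup>2) = T * (c0 * hs\<^sup>2)"
      proof (rule trans[OF lebesgue_on_open_interval_integral(2)[OF finite_measure.integrable_const[OF If]]])
        show "integral {0..T} (\<lambda>t. c0 * hs\<^sup>2) = T * (c0 * hs\<^sup>2)" using T by simp
      qed
      thus ?thesis
        unfolding D_def c0_def[symmetric] nf_def cyl_L2_sections(3)[OF \<Omega> fL, symmetric]
        using cyl_L2_sections(2)[OF \<Omega> fL] finite_measure.integrable_const[OF If]
        by (subst Bochner_Integration.integral_add) auto
    qed
    also have "\<dots> \<le> R\<^sup>2 / 2 + T * (c0 * R\<^sup>2)" using sq_le T c0 by (intro add_mono divide_right_mono mult_left_mono) auto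
    finally have "B \<le> (1 + \<mu>) / 2 * R\<^sup>2 + (R\<^sup>2 / 2 + T * (c0 * R\<^sup>2))" using n0 by (simp add: B_def)
    also have "\<dots> = w * R\<^sup>2" by (simp add: w_def data_weight_def c0_def \<mu>_def algebra_simps)
    finally show ?thesis .
  qed
  define E where "E = energy_bound T \<alpha> k \<nu> \<gamma> L"
  have BE: "B * exp (K * T) \<le> E * R\<^sup>2"
    using mult_right_mono[OF B_le, of "exp (K * T)"] by (simp add: E_def energy_bound_def w_def K_def mult_ac)
  note ae = abstract_energy[OF T K Ji Di D0 N0 NJ ineq G0, folded B_def]
  show "AE t in ?I. (L2_norm \<Omega> (X t))\<^sup>2 + coupling \<alpha> k \<nu> * (L2_norm \<Omega> (F t))\<^sup>2 \<le> 2 * energy_bound T \<alpha> k \<nu> \<gamma> L * R\<^sup>2"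
    using norm_eq AE_space
  proof eventually_elim
    case (elim t)
    have "t \<in> {0..T}" using elim(2) by simp
    hence "N t \<le> E * R\<^sup>2" using ae(1) BE by (meson order_trans)
    thus ?case using elim(1) by (simp add: N_def E_def \<mu>_def)
  qed
  have diss: "B + (c + K) * T * (B * exp (K * T)) \<le> dissipation_bound T \<alpha> k \<nu> \<gamma> L c * R\<^sup>2" if "0 \<le> c" for c
  proof -
    have "(c + K) * T * (B * exp (K * T)) \<le> (c + K) * T * (E * R\<^sup>2)" using BE that K T by (intro mult_left_mono) auto
    thus ?thesis using B_le by (simp add: dissipation_bound_def E_def w_def K_def algebra_simps)
  qed
  \<comment> \<open>The multiple \<open>k\<close> of the energy supplies the missing
    \<open>k / 2\<close> times the squared L2 norm of \<open>X t\<close>.\<close>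
  have gX: "AE t in ?I. k / 2 * (H1_norm \<Omega> (X t))\<^sup>2 \<le> G t + k * N t"
    using norm_eq
  proof eventually_elim
    case (elim t)
    have "0 \<le> k * \<alpha>\<^sup>2 / 2 * grad_sq \<Omega> (F t)" "0 \<le> k * (\<mu> * (L2_norm \<Omega> (F t))\<^sup>2) / 2"
      using par \<mu> grad_sq_nonneg[of \<Omega> "F t"] by (auto intro!: mult_nonneg_nonneg divide_nonneg_nonneg)
    moreover have "k * N t = k / 2 * (L2_norm \<Omega> (X t))\<^sup>2 + k * (\<mu> * (L2_norm \<Omega> (F t))\<^sup>2) / 2"
      using elim by (simp add: N_def field_simps)
    ultimately show ?case unfolding H1_norm_sq G_def distrib_left[of "k / 2"] by linarith
  qed
  \<comment> \<open>For the second difference the multiple is \<open>\<nu>\<close>, because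
    \<open>\<nu> * \<mu> / 2 = k * \<alpha>\<^sup>2 / 2\<close> matches the weight of its
    gradient.\<close>
  have gF: "AE t in ?I. k * \<alpha>\<^sup>2 / 2 * (H1_norm \<Omega> (F t))\<^sup>2 \<le> G t + \<nu> * N t"
    using norm_eq
  proof eventually_elim
    case (elim t)
    have "0 \<le> k / 2 * grad_sq \<Omega> (X t)" "0 \<le> \<nu> * (L2_norm \<Omega> (X t))\<^sup>2 / 2"
      using par grad_sq_nonneg[of \<Omega> "X t"] by (auto intro!: mult_nonneg_nonneg divide_nonneg_nonneg)
    moreover have "\<nu> * N t = \<nu> * (L2_norm \<Omega> (X t))\<^sup>2 / 2 + k * \<alpha>\<^sup>2 / 2 * (L2_norm \<Omega> (F t))\<^sup>2"
      using elim unfolding \<mu>\<nu>[symmetric] by (simp add: N_def algebra_simps)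
    ultimately show ?case by (simp add: H1_norm_sq G_def algebra_simps)
  qed
  show "(LINT t|?I. k / 2 * (H1_norm \<Omega> (X t))\<^sup>2) \<le> dissipation_bound T \<alpha> k \<nu> \<gamma> L k * R\<^sup>2"
    by (rule order_trans[OF ae(2)[OF _ _ gX] diss]) (use par in auto)
  show "(LINT t|?I. k * \<alpha>\<^sup>2 / 2 * (H1_norm \<Omega> (F t))\<^sup>2) \<le> dissipation_bound T \<alpha> k \<nu> \<gamma> L \<nu> * R\<^sup>2"
    by (rule order_trans[OF ae(2)[OF _ _ gF] diss]) (use par in auto)
qed

section \<open>From squared bounds to norms, and the conclusion\<close>

lemma sq_le_imp_le_sqrt:
  fixes a c R :: real
  assumes "a\<^sup>2 \<le> c * R\<^sup>2" "0 \<le> a" "0 \<le> R"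
  shows "a \<le> sqrt c * R"
proof -
  have "a = sqrt (a\<^sup>2)" using assms by simp
  also have "\<dots> \<le> sqrt (c * R\<^sup>2)" using assms by (intro real_sqrt_le_mono)
  also have "\<dots> = sqrt c * R" using assms by (simp add: real_sqrt_mult)
  finally show ?thesis .
qed

text \<open>If the norm is not a measurable function of time, the essential supremum is infinite by
  convention and its real value is 0, so the bound holds in that case by
  \<open>0 \<le> c\<close>.\<close>

lemma Linf_time_norm_le:
  assumes "AE t in lebesgue_on {0<..<T}. N (u t) \<le> c" "0 \<le> c"
  shows "Linf_time_norm T N u \<le> c"
proof (cases "(\<lambda>t. ereal (N (u t))) \<in> borel_measurable (lebesgue_on {0<..<T})")
  case True
  have "esssup (lebesgue_on {0<..<T}) (\<lambda>t. ereal (N (u t))) \<le> ereal c"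
    by (rule esssup_I[OF True]) (use assms in simp)
  thus ?thesis unfolding Linf_time_norm_def using assms(2)
    by (cases "esssup (lebesgue_on {0<..<T}) (\<lambda>t. ereal (N (u t)))") auto
next
  case False
  thus ?thesis unfolding Linf_time_norm_def using assms(2) by (simp add: esssup_non_measurable top_ereal_def)
qed

lemma L2_time_norm_le:
  assumes "(LINT t|lebesgue_on {0<..<T}. a * (N (u t))\<^sup>2) \<le> c * R\<^sup>2" "0 < a" "0 \<le> R"
  shows "L2_time_norm T N u \<le> sqrt (c / a) * R"
proof (rule sq_le_imp_le_sqrt)
  have "0 \<le> (LINT t|lebesgue_on {0<..<T}. (N (u t))\<^sup>2)" by (rule Bochner_Integration.integral_nonneg) simp
  thus "(L2_time_norm T N u)\<^sup>2 \<le> c / a * R\<^sup>2" "0 \<le> L2_time_norm T N u"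
    using assms unfolding L2_time_norm_def by (auto simp: field_simps)
qed (rule assms)

text \<open>By Fubini the norm on the cylinder vanishes, and this gives equality almost everywhere
  jointly in time and space.\<close>

lemma L2_cyl_zero_AE:
  fixes \<Omega> :: "'a::euclidean_space set"
  assumes \<Omega>: "open \<Omega>" "bounded \<Omega>" and u: "case_prod u \<in> L2 (cyl T \<Omega>)"
    and z: "AE t in lebesgue_on {0<..<T}. L2_norm \<Omega> (u t) = 0"
  shows "AE (t, x) in lebesgue_on (cyl T \<Omega>). u t x = 0"
proof -
  have "(L2_norm (cyl T \<Omega>) (case_prod u))\<^sup>2 = (LINT t|lebesgue_on {0<..<T}. (L2_norm \<Omega> (u t))\<^sup>2)"
    using cyl_L2_sections(3)[OF \<Omega> u] by simp
  also have "\<dots> = (LINT t|lebesgue_on {0<..<T}. 0)"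
    using z cyl_L2_sections(2)[OF \<Omega> u] by (intro integral_cong_AE) (auto elim: eventually_mono)
  finally have "L2_norm (cyl T \<Omega>) (case_prod u) = 0" by simp
  from L2_norm_0_AE[OF u this] show ?thesis by (simp add: case_prod_unfold)
qed

theorem theorem2p4:
  fixes \<Omega> :: "(real^3) set" and T l \<alpha> k \<nu> \<gamma> L :: real
  assumes "bounded_C1_domain \<Omega>" and "0 < T"
    and "0 < l" and "0 < \<alpha>" and "0 < k" and "0 < \<nu>" and "0 < \<gamma>"
    and "\<alpha> = l"
  shows
    "(\<forall>\<chi>hat \<pi>hat A f \<Xi>s \<Xi>0 \<phi>0 \<Xi> \<phi> \<Xi>' \<phi>'.
        admissible_nonlinearities \<Omega> L \<chi>hat \<pi>hat A \<longrightarrow>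
        admissible_data \<Omega> T f \<Xi>s \<Xi>0 \<phi>0 \<longrightarrow>
        (\<integral>\<^sup>+ x. e2ennreal (\<chi>hat (\<phi>0 x)) \<partial>lebesgue_on \<Omega>) < \<infinity> \<longrightarrow>
        solution_P \<Omega> T l \<alpha> k \<nu> \<gamma> \<chi>hat \<pi>hat A f \<Xi>s \<Xi>0 \<phi>0 \<Xi> \<phi> \<longrightarrow>
        solution_P \<Omega> T l \<alpha> k \<nu> \<gamma> \<chi>hat \<pi>hat A f \<Xi>s \<Xi>0 \<phi>0 \<Xi>' \<phi>' \<longrightarrow>
        (AE (t, x) in lebesgue_on (cyl T \<Omega>). \<Xi> t x = \<Xi>' t x \<and> \<phi> t x = \<phi>' t x))
     \<and>
     (\<exists>C::real. \<forall>\<chi>hat \<pi>hat A f1 \<Xi>s1 \<Xi>01 \<phi>01 \<Xi>1 \<phi>1 f2 \<Xi>s2 \<Xi>02 \<phi>02 \<Xi>2 \<phi>2.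
        admissible_nonlinearities \<Omega> L \<chi>hat \<pi>hat A \<longrightarrow>
        admissible_data \<Omega> T f1 \<Xi>s1 \<Xi>01 \<phi>01 \<longrightarrow>
        admissible_data \<Omega> T f2 \<Xi>s2 \<Xi>02 \<phi>02 \<longrightarrow>
        solution_P \<Omega> T l \<alpha> k \<nu> \<gamma> \<chi>hat \<pi>hat A f1 \<Xi>s1 \<Xi>01 \<phi>01 \<Xi>1 \<phi>1 \<longrightarrow>
        solution_P \<Omega> T l \<alpha> k \<nu> \<gamma> \<chi>hat \<pi>hat A f2 \<Xi>s2 \<Xi>02 \<phi>02 \<Xi>2 \<phi>2 \<longrightarrow>
        LinfH_L2V_norm T \<Omega> (\<lambda>t x. \<Xi>1 t x - \<Xi>2 t x)
          + LinfH_L2V_norm T \<Omega> (\<lambda>t x. \<phi>1 t x - \<phi>2 t x)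
        \<le> C * (L2_norm (cyl T \<Omega>) (\<lambda>(t, x). f1 t x - f2 t x)
                + H2_norm \<Omega> (\<lambda>x. \<Xi>s1 x - \<Xi>s2 x)
                + L2_norm \<Omega> (\<lambda>x. \<Xi>01 x - \<Xi>02 x)
                + L2_norm \<Omega> (\<lambda>x. \<phi>01 x - \<phi>02 x)))"
proof (intro conjI allI impI)
  have \<Omega>: "open \<Omega>" "bounded \<Omega>" using assms(1) by (auto simp: bounded_C1_domain_def)
  have \<mu>: "0 < coupling \<alpha> k \<nu>" using assms by (simp add: coupling_def)
  {
    fix \<chi>hat \<pi>hat A f \<Xi>s \<Xi>0 \<phi>0 \<Xi> \<phi> \<Xi>' \<phi>'
    assume nl: "admissible_nonlinearities \<Omega> L \<chi>hat \<pi>hat A" and d: "admissible_data \<Omega> T f \<Xi>s \<Xi>0 \<phi>0"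
      and s: "solution_P \<Omega> T l \<alpha> k \<nu> \<gamma> \<chi>hat \<pi>hat A f \<Xi>s \<Xi>0 \<phi>0 \<Xi> \<phi>"
        "solution_P \<Omega> T l \<alpha> k \<nu> \<gamma> \<chi>hat \<pi>hat A f \<Xi>s \<Xi>0 \<phi>0 \<Xi>' \<phi>'"
    note st = stability[OF assms(1,2,4-7) nl d d s[folded assms(8)]]
    \<comment> \<open>Identical data have distance 0, so the energy bound of
      \<open>stability\<close> forces both differences to vanish.\<close>
    have z: "data_distance T \<Omega> f \<Xi>s \<Xi>0 \<phi>0 f \<Xi>s \<Xi>0 \<phi>0 = 0"
      by (simp add: data_distance_def H2_norm_zero[OF \<Omega>] L2_norm_def case_prod_unfold)
    have n: "AE t in lebesgue_on {0<..<T}. L2_norm \<Omega> (\<lambda>x. \<Xi> t x - \<Xi>' t x) = 0 \<and> L2_norm \<Omega> (\<lambda>x. \<phi> t x - \<phi>' t x) = 0"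
      using st(3)
    proof eventually_elim
      case (elim t)
      have "0 \<le> coupling \<alpha> k \<nu> * (L2_norm \<Omega> (\<lambda>x. \<phi> t x - \<phi>' t x))\<^sup>2" using \<mu> by simp
      moreover have "(L2_norm \<Omega> (\<lambda>x. \<Xi> t x - \<Xi>' t x))\<^sup>2 + coupling \<alpha> k \<nu> * (L2_norm \<Omega> (\<lambda>x. \<phi> t x - \<phi>' t x))\<^sup>2 \<le> 0"
        using elim unfolding z by simp
      ultimately have "(L2_norm \<Omega> (\<lambda>x. \<Xi> t x - \<Xi>' t x))\<^sup>2 \<le> 0" "coupling \<alpha> k \<nu> * (L2_norm \<Omega> (\<lambda>x. \<phi> t x - \<phi>' t x))\<^sup>2 \<le> 0"
        using zero_le_power2[of "L2_norm \<Omega> (\<lambda>x. \<Xi> t x - \<Xi>' t x)"] by linarith+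
      thus ?case using \<mu> by (simp add: mult_le_0_iff)
    qed
    have "AE (t, x) in lebesgue_on (cyl T \<Omega>). \<Xi> t x - \<Xi>' t x = 0" "AE (t, x) in lebesgue_on (cyl T \<Omega>). \<phi> t x - \<phi>' t x = 0"
      by (intro L2_cyl_zero_AE[OF \<Omega>] st(1) eventually_mono[OF n]; simp) (intro L2_cyl_zero_AE[OF \<Omega>] st(2) eventually_mono[OF n]; simp)
    thus "AE (t, x) in lebesgue_on (cyl T \<Omega>). \<Xi> t x = \<Xi>' t x \<and> \<phi> t x = \<phi>' t x"
      by eventually_elim auto
  }
  \<comment> \<open>One summand for each norm on the left, namely the supremum in H and the L2 norm
    in V of the first difference and then of the second. Each squared bound is divided by the weight
    of its norm in \<open>stability\<close>. The value is fixed before the nonlinearities, the data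
    and the solutions.\<close>
  define C where "C = sqrt (2 * energy_bound T \<alpha> k \<nu> \<gamma> L) + sqrt (dissipation_bound T \<alpha> k \<nu> \<gamma> L k / (k / 2))
    + (sqrt (2 * energy_bound T \<alpha> k \<nu> \<gamma> L / coupling \<alpha> k \<nu>) + sqrt (dissipation_bound T \<alpha> k \<nu> \<gamma> L \<nu> / (k * \<alpha>\<^sup>2 / 2)))"
  show "\<exists>C::real. \<forall>\<chi>hat \<pi>hat A f1 \<Xi>s1 \<Xi>01 \<phi>01 \<Xi>1 \<phi>1 f2 \<Xi>s2 \<Xi>02 \<phi>02 \<Xi>2 \<phi>2.
        admissible_nonlinearities \<Omega> L \<chi>hat \<pi>hat A \<longrightarrow>
        admissible_data \<Omega> T f1 \<Xi>s1 \<Xi>01 \<phi>01 \<longrightarrow>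
        admissible_data \<Omega> T f2 \<Xi>s2 \<Xi>02 \<phi>02 \<longrightarrow>
        solution_P \<Omega> T l \<alpha> k \<nu> \<gamma> \<chi>hat \<pi>hat A f1 \<Xi>s1 \<Xi>01 \<phi>01 \<Xi>1 \<phi>1 \<longrightarrow>
        solution_P \<Omega> T l \<alpha> k \<nu> \<gamma> \<chi>hat \<pi>hat A f2 \<Xi>s2 \<Xi>02 \<phi>02 \<Xi>2 \<phi>2 \<longrightarrow>
        LinfH_L2V_norm T \<Omega> (\<lambda>t x. \<Xi>1 t x - \<Xi>2 t x)
          + LinfH_L2V_norm T \<Omega> (\<lambda>t x. \<phi>1 t x - \<phi>2 t x)
        \<le> C * (L2_norm (cyl T \<Omega>) (\<lambda>(t, x). f1 t x - f2 t x)
                + H2_norm \<Omega> (\<lambda>x. \<Xi>s1 x - \<Xi>s2 x)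
                + L2_norm \<Omega> (\<lambda>x. \<Xi>01 x - \<Xi>02 x)
                + L2_norm \<Omega> (\<lambda>x. \<phi>01 x - \<phi>02 x))"
  proof (intro exI[of _ C] allI impI)
    fix \<chi>hat \<pi>hat A f1 \<Xi>s1 \<Xi>01 \<phi>01 \<Xi>1 \<phi>1 f2 \<Xi>s2 \<Xi>02 \<phi>02 \<Xi>2 \<phi>2
    assume nl: "admissible_nonlinearities \<Omega> L \<chi>hat \<pi>hat A"
      and d: "admissible_data \<Omega> T f1 \<Xi>s1 \<Xi>01 \<phi>01" "admissible_data \<Omega> T f2 \<Xi>s2 \<Xi>02 \<phi>02"
      and s: "solution_P \<Omega> T l \<alpha> k \<nu> \<gamma> \<chi>hat \<pi>hat A f1 \<Xi>s1 \<Xi>01 \<phi>01 \<Xi>1 \<phi>1"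
        "solution_P \<Omega> T l \<alpha> k \<nu> \<gamma> \<chi>hat \<pi>hat A f2 \<Xi>s2 \<Xi>02 \<phi>02 \<Xi>2 \<phi>2"
    note st = stability[OF assms(1,2,4-7) nl d s[folded assms(8)]]
    let ?R = "data_distance T \<Omega> f1 \<Xi>s1 \<Xi>01 \<phi>01 f2 \<Xi>s2 \<Xi>02 \<phi>02"
    let ?E = "energy_bound T \<alpha> k \<nu> \<gamma> L"
    let ?X = "\<lambda>t x. \<Xi>1 t x - \<Xi>2 t x" and ?F = "\<lambda>t x. \<phi>1 t x - \<phi>2 t x"
    have R: "0 \<le> ?R" by (simp add: data_distance_def)
    have L0: "0 \<le> L" using nl unfolding admissible_nonlinearities_def lipschitz_on_def by blast
    have E: "0 \<le> ?E"
      using \<mu> assms by (simp add: energy_bound_def data_weight_def)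
    have "AE t in lebesgue_on {0<..<T}. L2_norm \<Omega> (?X t) \<le> sqrt (2 * ?E) * ?R"
      using st(3)
    proof eventually_elim
      case (elim t)
      have "0 \<le> coupling \<alpha> k \<nu> * (L2_norm \<Omega> (?F t))\<^sup>2" using \<mu> by simp
      thus ?case using elim R by (intro sq_le_imp_le_sqrt) auto
    qed
    hence 1: "Linf_time_norm T (L2_norm \<Omega>) ?X \<le> sqrt (2 * ?E) * ?R"
      by (rule Linf_time_norm_le) (use E R in simp)
    have "AE t in lebesgue_on {0<..<T}. L2_norm \<Omega> (?F t) \<le> sqrt (2 * ?E / coupling \<alpha> k \<nu>) * ?R"
      using st(3)
    proof eventually_elim
      case (elim t)
      have "coupling \<alpha> k \<nu> * (L2_norm \<Omega> (?F t))\<^sup>2 \<le> 2 * ?E * ?R\<^sup>2"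
        using elim zero_le_power2[of "L2_norm \<Omega> (?X t)"] by linarith
      hence "(L2_norm \<Omega> (?F t))\<^sup>2 \<le> 2 * ?E / coupling \<alpha> k \<nu> * ?R\<^sup>2" using \<mu> by (simp add: field_simps)
      thus ?case using R by (intro sq_le_imp_le_sqrt) auto
    qed
    hence 2: "Linf_time_norm T (L2_norm \<Omega>) ?F \<le> sqrt (2 * ?E / coupling \<alpha> k \<nu>) * ?R"
      by (rule Linf_time_norm_le) (use E R \<mu> in simp)
    have 3: "L2_time_norm T (H1_norm \<Omega>) ?X \<le> sqrt (dissipation_bound T \<alpha> k \<nu> \<gamma> L k / (k / 2)) * ?R"
      by (rule L2_time_norm_le[where u="?X", OF st(4) _ R]) (use assms in simp)
    have 4: "L2_time_norm T (H1_norm \<Omega>) ?F \<le> sqrt (dissipation_bound T \<alpha> k \<nu> \<gamma> L \<nu> / (k * \<alpha>\<^sup>2 / 2)) * ?R"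
      by (rule L2_time_norm_le[where u="?F", OF st(5) _ R]) (use assms in simp)
    have "LinfH_L2V_norm T \<Omega> ?X + LinfH_L2V_norm T \<Omega> ?F \<le> C * ?R"
      unfolding LinfH_L2V_norm_def C_def distrib_right by (intro add_mono 1 2 3 4)
    thus "LinfH_L2V_norm T \<Omega> ?X + LinfH_L2V_norm T \<Omega> ?F
        \<le> C * (L2_norm (cyl T \<Omega>) (\<lambda>(t, x). f1 t x - f2 t x)
                + H2_norm \<Omega> (\<lambda>x. \<Xi>s1 x - \<Xi>s2 x)
                + L2_norm \<Omega> (\<lambda>x. \<Xi>01 x - \<Xi>02 x)
                + L2_norm \<Omega> (\<lambda>x. \<phi>01 x - \<phi>02 x))"
      by (simp add: data_distance_def)
  qed
qed

end
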